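(* Let $T\in\mathcal{O}_C'(\mathbb{R})$. Then the following properties are equivalent (where "(uniformly) mean ergodic" may be read in each item either as "mean ergodic" or as "uniformly mean ergodic"): (1) $C_T$ is (uniformly) mean ergodic on $\mathcal{S}(\mathbb{R})$. (1)' $\mathcal{C}_T$ is (uniformly) mean ergodic on $\mathcal{S}'(\mathbb{R})$. (2) $C_T$ is (uniformly) mean ergodic on $\mathcal{O}_C(\mathbb{R})$. (2)' $\mathcal{C}_T$ is (uniformly) mean ergodic on $\mathcal{O}_C'(\mathbb{R})$. (3) The sequence $\{(\star T)_{[n]}\}_{n\in\mathbb{N}}$ is convergent in $\mathcal{O}_C'(\mathbb{R})$.
   Context: All functions are complex-valued. $\mathcal{S}(\mathbb{R})$ is the Schwartz space of $f\in C^\infty(\mathbb{R})$ with $\|f\|_n:=\sup_{x\in\mathbb{R}}\sup_{0\le i\le n}(1+x^2)^n|f^{(i)}(x)|<\infty$ for all $n\in\mathbb{N}_0$, a Fréchet space with these norms; $\mathcal{S}'(\mathbb{R})$ is its strong dual. For $m,n\in\mathbb{N}$ and $f\in C^\infty(\mathbb{R})$ let $|f|_{m,n}:=\sup_{x\in\mathbb{R}}\sup_{0\le i\le m}(1+x^2)^{-n}|f^{(i)}(x)|$. $\mathcal{O}_C(\mathbb{R})$ is the space of $f\in C^\infty(\mathbb{R})$ such that there is $n$ with $|f|_{m,n}<\infty$ for all $m$, with the locally convex inductive limit topology (over $n$) of the Fréchet spaces $\{f\in C^\infty(\mathbb{R})\colon|f|_{m,n}<\infty\ \forall m\}$ normed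 by $|\cdot|_{m,n}$, $m\in\mathbb{N}$. $\mathcal{O}_C'(\mathbb{R})$ is the strong dual of $\mathcal{O}_C(\mathbb{R})$; it is regarded as a subspace of $\mathcal{S}'(\mathbb{R})$ and is the space of convolutors of $\mathcal{S}(\mathbb{R})$. For $T\in\mathcal{O}_C'(\mathbb{R})$ and $f\in\mathcal{S}(\mathbb{R})$ or $f\in\mathcal{O}_C(\mathbb{R})$, $(T\star f)(x)=\langle T_y,f(x-y)\rangle$, $x\in\mathbb{R}$; the map $C_T\colon f\mapsto T\star f$ is continuous from $\mathcal{S}(\mathbb{R})$ into itself and from $\mathcal{O}_C(\mathbb{R})$ into itself. For $S\in\mathcal{S}'(\mathbb{R})$, $T\star S\in\mathcal{S}'(\mathbb{R})$ is defined by $(T\star S)(f)=\langle S,\check T\star f\rangle$, $f\in\mathcal{S}(\mathbb{R})$, where $\langle\check T,\varphi\rangle=\langle T,\check\varphi\rangle$ and $\check\varphi(y)=\varphi(-y)$; if $S\in\mathcal{O}_C'(\mathbb{R})$ then $T\star S\in\mathcal{O}_C'(\mathbb{R})$. The map $\mathcal{C}_T\colon S\mapsto T\star S$ is continuous from $\mathcal{S}'(\mathbb{R})$ into itself and from $\mathcal{O}_C'(\mathbb{R})$ into itself. Set $(\star T)^1=T$, $(\star T)^n=T\star(\star T)^{n-1}\in\mathcal{O}_C'(\mathbb{R})$ for $n\ge2$, and $(\star T)_{[n]}=\frac1n\sum_{m=1}^n(\star T)^m$. For a locally convex Hausdorff space $E$, $\mathcal{L}(E)$ is the space of continuous linear operators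 on $E$; $\mathcal{L}_s(E)$ (resp. $\mathcal{L}_b(E)$) is $\mathcal{L}(E)$ with the topology of uniform convergence on finite (resp. bounded) subsets of $E$. $A\in\mathcal{L}(E)$ is mean ergodic (resp. uniformly mean ergodic) if its Cesàro means $A_{[n]}=\frac1n\sum_{m=1}^nA^m$, $n\in\mathbb{N}$, form a convergent sequence in $\mathcal{L}_s(E)$ (resp. $\mathcal{L}_b(E)$). *)

theory Defs
  imports "HOL-Analysis.Analysis" "HOL-Library.Function_Algebras"
begin

text \<open>
  A topological vector space is represented by a value of type \<^typ>\<open>('x \<Rightarrow> complex) topology\<close>: its
  carrier is the topspace, and its vector space operations are the pointwise ones. The same type
  covers spaces of functions (\<open>'x = real\<close>) and spaces of functionals (\<open>'x = real \<Rightarrow> complex\<close>).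
  Functionals and operators on a space are total functions that vanish outside the carrier.
\<close>

section \<open>Locally convex spaces\<close>

definition seminorm_topology :: "'v set \<Rightarrow> 'i set \<Rightarrow> ('i \<Rightarrow> 'v \<Rightarrow> ennreal) \<Rightarrow> ('v :: minus) topology" where
  "seminorm_topology V I p =
     topology_generated_by {{g \<in> V. p i (g - f) < ennreal e} | i f e. i \<in> I \<and> f \<in> V \<and> e > 0}"

definition lin_subspace :: "('x \<Rightarrow> complex) set \<Rightarrow> bool" where
  "lin_subspace V \<longleftrightarrow> 0 \<in> V \<and> (\<forall>f\<in>V. \<forall>g\<in>V. f + g \<in> V) \<and> (\<forall>c. \<forall>f\<in>V. (\<lambda>x. c * f x) \<in> V)"

definition convex_fun_set :: "('x \<Rightarrow> complex) set \<Rightarrow> bool" where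
  "convex_fun_set C \<longleftrightarrow>
     (\<forall>f\<in>C. \<forall>g\<in>C. \<forall>t::real. 0 \<le> t \<and> t \<le> 1 \<longrightarrow>
        (\<lambda>x. of_real (1 - t) * f x + of_real t * g x) \<in> C)"

definition locally_convex :: "('x \<Rightarrow> complex) topology \<Rightarrow> bool" where
  "locally_convex E \<longleftrightarrow>
     lin_subspace (topspace E) \<and>
     continuous_map (prod_topology E E) E (\<lambda>(f, g). f + g) \<and>
     continuous_map (prod_topology euclidean E) E (\<lambda>(c, f). (\<lambda>x. c * f x)) \<and>
     (\<forall>U. openin E U \<and> 0 \<in> U \<longrightarrow> (\<exists>C. openin E C \<and> 0 \<in> C \<and> C \<subseteq> U \<and> convex_fun_set C))"

text \<open>
  The locally convex inductive limit of an increasing sequence of spaces is the finest locally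
  convex topology on the union that makes all inclusions continuous. It is obtained as the supremum
  of all such topologies; the supremum of locally convex topologies is again locally convex.
\<close>

definition lc_inductive_limit :: "'i set \<Rightarrow> ('i \<Rightarrow> ('x \<Rightarrow> complex) topology) \<Rightarrow> ('x \<Rightarrow> complex) topology" where
  "lc_inductive_limit I E =
     topology_generated_by
       {U. \<exists>F. locally_convex F \<and> topspace F = (\<Union>i\<in>I. topspace (E i)) \<and>
               (\<forall>i\<in>I. continuous_map (E i) F id) \<and> openin F U}"

definition bounded_sets :: "('x \<Rightarrow> complex) topology \<Rightarrow> ('x \<Rightarrow> complex) set set" where
  "bounded_sets E =
     {B. B \<subseteq> topspace E \<and>
         (\<forall>U. openin E U \<and> 0 \<in> U \<longrightarrow>
            (\<exists>r>0. \<forall>t::real. t \<ge> r \<longrightarrow> B \<subseteq> (\<lambda>f x. of_real t * f x) ` U))}"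

definition finite_subsets :: "'v topology \<Rightarrow> 'v set set" where
  "finite_subsets E = {B. finite B \<and> B \<subseteq> topspace E}"

text \<open>
  The topology on a set \<open>H\<close> of maps into a topological vector space \<open>F\<close> of uniform convergence on
  the members of \<open>\<B>\<close>: the sets \<open>{v \<in> H. (v - u) ` B \<subseteq> U}\<close> form a neighbourhood base at \<open>u\<close>.
\<close>

definition uniform_topology ::
    "('a \<Rightarrow> 'b) set \<Rightarrow> 'a set set \<Rightarrow> ('b :: {minus, zero}) topology \<Rightarrow> ('a \<Rightarrow> 'b) topology" where
  "uniform_topology H \<B> F =
     topology (\<lambda>W. W \<subseteq> H \<and>
       (\<forall>u\<in>W. \<exists>B\<in>\<B>. \<exists>U. openin F U \<and> 0 \<in> U \<and> {v \<in> H. \<forall>x\<in>B. v x - u x \<in> U} \<subseteq> W))"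

lemma openin_uniform_topology:
  assumes ne: "\<B> \<noteq> {}"
    and un: "\<And>A B. A \<in> \<B> \<Longrightarrow> B \<in> \<B> \<Longrightarrow> A \<union> B \<in> \<B>" and z: "0 \<in> topspace F"
  shows "openin (uniform_topology H \<B> F) W \<longleftrightarrow>
    W \<subseteq> H \<and> (\<forall>u\<in>W. \<exists>B\<in>\<B>. \<exists>U. openin F U \<and> 0 \<in> U \<and> {v \<in> H. \<forall>x\<in>B. v x - u x \<in> U} \<subseteq> W)"
    (is "_ \<longleftrightarrow> ?P W")
proof -
  have "istopology ?P"
    unfolding istopology_def
  proof (rule conjI; intro allI impI)
    fix S T assume S: "?P S" and T: "?P T"
    show "?P (S \<inter> T)"
    proof (intro conjI ballI)
      show "S \<inter> T \<subseteq> H" using conjunct1[OF S] by (rule le_infI1)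
      fix u assume u: "u \<in> S \<inter> T"
      obtain A U where A: "A \<in> \<B>" "openin F U" "0 \<in> U" "{v \<in> H. \<forall>x\<in>A. v x - u x \<in> U} \<subseteq> S"
        using bspec[OF conjunct2[OF S], OF IntD1[OF u]] by (elim bexE exE conjE)
      obtain B V where B: "B \<in> \<B>" "openin F V" "0 \<in> V" "{v \<in> H. \<forall>x\<in>B. v x - u x \<in> V} \<subseteq> T"
        using bspec[OF conjunct2[OF T], OF IntD2[OF u]] by (elim bexE exE conjE)
      show "\<exists>C\<in>\<B>. \<exists>U. openin F U \<and> 0 \<in> U \<and> {v \<in> H. \<forall>x\<in>C. v x - u x \<in> U} \<subseteq> S \<inter> T"
      proof (rule bexI[of _ "A \<union> B"], rule exI[of _ "U \<inter> V"], intro conjI subsetI IntI)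
        show "openin F (U \<inter> V)" using A(2) B(2) by (rule openin_Int)
        show "0 \<in> U" "0 \<in> V" by (rule A(3), rule B(3))
        show "A \<union> B \<in> \<B>" using A(1) B(1) by (rule un)
        fix v assume v: "v \<in> {v \<in> H. \<forall>x\<in>A \<union> B. v x - u x \<in> U \<inter> V}"
        show "v \<in> S" by (rule subsetD[OF A(4)]) (use v in simp)
        show "v \<in> T" by (rule subsetD[OF B(4)]) (use v in simp)
      qed
    qed
  next
    fix K :: "('a \<Rightarrow> 'b) set set" assume K: "\<forall>S\<in>K. ?P S"
    show "?P (\<Union>K)"
    proof (intro conjI ballI)
      show "\<Union>K \<subseteq> H" by (rule Union_least) (rule conjunct1[OF bspec[OF K]])
      fix u assume "u \<in> \<Union>K"
      then obtain S where S: "S \<in> K" "u \<in> S" by blast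
      then obtain B U where B: "B \<in> \<B>" "openin F U" "0 \<in> U" "{v \<in> H. \<forall>x\<in>B. v x - u x \<in> U} \<subseteq> S"
        using bspec[OF conjunct2[OF bspec[OF K S(1)]] S(2)] by (elim bexE exE conjE)
      show "\<exists>B\<in>\<B>. \<exists>U. openin F U \<and> 0 \<in> U \<and> {v \<in> H. \<forall>x\<in>B. v x - u x \<in> U} \<subseteq> \<Union>K"
      proof (rule bexI[of _ B], rule exI[of _ U], intro conjI)
        show "{v \<in> H. \<forall>x\<in>B. v x - u x \<in> U} \<subseteq> \<Union>K"
          by (rule subset_trans[OF B(4)]) (rule Union_upper[OF S(1)])
      qed (rule B)+
    qed
  qed
  then show ?thesis
    unfolding uniform_topology_def by (rule arg_cong[OF topology_inverse', of _ "\<lambda>P. P W"])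
qed

lemma topspace_uniform_topology:
  assumes ne: "\<B> \<noteq> {}"
    and un: "\<And>A B. A \<in> \<B> \<Longrightarrow> B \<in> \<B> \<Longrightarrow> A \<union> B \<in> \<B>" and z: "0 \<in> topspace F"
  shows "topspace (uniform_topology H \<B> F) = H"
proof
  have *: "openin (uniform_topology H \<B> F) W \<longleftrightarrow> W \<subseteq> H \<and>
      (\<forall>u\<in>W. \<exists>B\<in>\<B>. \<exists>U. openin F U \<and> 0 \<in> U \<and> {v \<in> H. \<forall>x\<in>B. v x - u x \<in> U} \<subseteq> W)" for W
    by (rule openin_uniform_topology) (rule ne, erule (1) un, rule z)
  show "topspace (uniform_topology H \<B> F) \<subseteq> H"
    by (rule conjunct1[OF iffD1[OF * openin_topspace]])
  obtain B where B: "B \<in> \<B>" using ne by blast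
  have "openin (uniform_topology H \<B> F) H"
  proof (rule iffD2[OF *], rule conjI, simp, rule ballI)
    fix u
    show "\<exists>B\<in>\<B>. \<exists>U. openin F U \<and> 0 \<in> U \<and> {v \<in> H. \<forall>x\<in>B. v x - u x \<in> U} \<subseteq> H"
      by (rule bexI[OF _ B], rule exI[of _ "topspace F"]) (simp add: z Collect_restrict)
  qed
  then show "H \<subseteq> topspace (uniform_topology H \<B> F)"
    by (rule openin_subset)
qed

lemma bounded_sets_nonempty: "bounded_sets E \<noteq> {}"
proof -
  have "{} \<in> bounded_sets E"
    unfolding bounded_sets_def using zero_less_one by blast
  then show ?thesis by blast
qed

lemma bounded_sets_Un:
  assumes "A \<in> bounded_sets E" "B \<in> bounded_sets E"
  shows "A \<union> B \<in> bounded_sets E"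
  unfolding bounded_sets_def
proof (intro CollectI conjI allI impI)
  show "A \<union> B \<subseteq> topspace E" using assms by (auto simp: bounded_sets_def)
  fix U assume U: "openin E U \<and> 0 \<in> U"
  obtain r where r: "r > 0" "\<And>t::real. t \<ge> r \<Longrightarrow> A \<subseteq> (\<lambda>f x. of_real t * f x) ` U"
    using assms(1) U by (auto simp: bounded_sets_def)
  obtain s where s: "s > 0" "\<And>t::real. t \<ge> s \<Longrightarrow> B \<subseteq> (\<lambda>f x. of_real t * f x) ` U"
    using assms(2) U by (auto simp: bounded_sets_def)
  have "A \<union> B \<subseteq> (\<lambda>f x. of_real t * f x) ` U" if "t \<ge> max r s" for t :: real
    using r(2)[of t] s(2)[of t] that by simp
  moreover have "max r s > 0" using r(1) by simp
  ultimately show "\<exists>r>0. \<forall>t::real. t \<ge> r \<longrightarrow> A \<union> B \<subseteq> (\<lambda>f x. of_real t * f x) ` U"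
    by blast
qed

definition lin_on :: "('x \<Rightarrow> complex) set \<Rightarrow> (('x \<Rightarrow> complex) \<Rightarrow> ('y \<Rightarrow> complex)) \<Rightarrow> bool" where
  "lin_on V A \<longleftrightarrow>
     (\<forall>f\<in>V. \<forall>g\<in>V. A (f + g) = A f + A g) \<and> (\<forall>c. \<forall>f\<in>V. A (\<lambda>x. c * f x) = (\<lambda>y. c * A f y))"

definition dual :: "('x \<Rightarrow> complex) topology \<Rightarrow> (('x \<Rightarrow> complex) \<Rightarrow> complex) set" where
  "dual E =
     {u. (\<forall>f\<in>topspace E. \<forall>g\<in>topspace E. u (f + g) = u f + u g) \<and>
         (\<forall>c. \<forall>f\<in>topspace E. u (\<lambda>x. c * f x) = c * u f) \<and>
         continuous_map E euclidean u \<and> (\<forall>f. f \<notin> topspace E \<longrightarrow> u f = 0)}"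

definition strong_dual :: "('x \<Rightarrow> complex) topology \<Rightarrow> (('x \<Rightarrow> complex) \<Rightarrow> complex) topology" where
  "strong_dual E = uniform_topology (dual E) (bounded_sets E) euclidean"

lemma topspace_strong_dual: "topspace (strong_dual E) = dual E"
  unfolding strong_dual_def
  by (intro topspace_uniform_topology bounded_sets_nonempty bounded_sets_Un) auto


section \<open>Mean ergodic operators\<close>

definition convergent_in :: "'a topology \<Rightarrow> (nat \<Rightarrow> 'a) \<Rightarrow> bool" where
  "convergent_in E X \<longleftrightarrow> (\<exists>l. limitin E X l sequentially)"

definition operators :: "('x \<Rightarrow> complex) topology \<Rightarrow> (('x \<Rightarrow> complex) \<Rightarrow> ('x \<Rightarrow> complex)) set" where
  "operators E = {A. lin_on (topspace E) A \<and> continuous_map E E A \<and> (\<forall>f. f \<notin> topspace E \<longrightarrow> A f = 0)}"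

definition operators_s ::
    "('x \<Rightarrow> complex) topology \<Rightarrow> (('x \<Rightarrow> complex) \<Rightarrow> ('x \<Rightarrow> complex)) topology" where
  "operators_s E = uniform_topology (operators E) (finite_subsets E) E"

definition operators_b ::
    "('x \<Rightarrow> complex) topology \<Rightarrow> (('x \<Rightarrow> complex) \<Rightarrow> ('x \<Rightarrow> complex)) topology" where
  "operators_b E = uniform_topology (operators E) (bounded_sets E) E"

lemma topspace_operators_s: "0 \<in> topspace E \<Longrightarrow> topspace (operators_s E) = operators E"
  unfolding operators_s_def
  by (rule topspace_uniform_topology) (auto simp: finite_subsets_def)

lemma topspace_operators_b: "0 \<in> topspace E \<Longrightarrow> topspace (operators_b E) = operators E"
  unfolding operators_b_def
  by (intro topspace_uniform_topology bounded_sets_nonempty bounded_sets_Un)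

definition cesaro_mean ::
    "(('x \<Rightarrow> complex) \<Rightarrow> ('x \<Rightarrow> complex)) \<Rightarrow> nat \<Rightarrow> ('x \<Rightarrow> complex) \<Rightarrow> ('x \<Rightarrow> complex)" where
  "cesaro_mean A n = (\<lambda>f x. 1 / of_nat n * (\<Sum>m=1..n. (A ^^ m) f x))"

definition mean_ergodic ::
    "('x \<Rightarrow> complex) topology \<Rightarrow> (('x \<Rightarrow> complex) \<Rightarrow> ('x \<Rightarrow> complex)) \<Rightarrow> bool" where
  "mean_ergodic E A \<longleftrightarrow> A \<in> operators E \<and> convergent_in (operators_s E) (cesaro_mean A)"

definition uniformly_mean_ergodic ::
    "('x \<Rightarrow> complex) topology \<Rightarrow> (('x \<Rightarrow> complex) \<Rightarrow> ('x \<Rightarrow> complex)) \<Rightarrow> bool" where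
  "uniformly_mean_ergodic E A \<longleftrightarrow>
     A \<in> operators E \<and> convergent_in (operators_b E) (cesaro_mean A)"


section \<open>The spaces \<open>\<S>(\<real>)\<close> and \<open>\<O>\<^sub>C(\<real>)\<close>\<close>

definition iter_deriv :: "nat \<Rightarrow> (real \<Rightarrow> complex) \<Rightarrow> real \<Rightarrow> complex" where
  "iter_deriv i f = ((\<lambda>g x. vector_derivative g (at x)) ^^ i) f"

definition smooth :: "(real \<Rightarrow> complex) \<Rightarrow> bool" where
  "smooth f \<longleftrightarrow> (\<forall>i x. iter_deriv i f differentiable (at x))"

definition schwartz_norm :: "nat \<Rightarrow> (real \<Rightarrow> complex) \<Rightarrow> ennreal" where
  "schwartz_norm n f = (SUP x. SUP i\<in>{0..n}. ennreal ((1 + x\<^sup>2) ^ n * cmod (iter_deriv i f x)))"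

definition schwartz_space :: "(real \<Rightarrow> complex) topology" where
  "schwartz_space =
     seminorm_topology {f. smooth f \<and> (\<forall>n. schwartz_norm n f < \<infinity>)} UNIV schwartz_norm"

definition oc_norm :: "nat \<Rightarrow> nat \<Rightarrow> (real \<Rightarrow> complex) \<Rightarrow> ennreal" where
  "oc_norm m n f = (SUP x. SUP i\<in>{0..m}. ennreal (cmod (iter_deriv i f x) / (1 + x\<^sup>2) ^ n))"

definition oc_step :: "nat \<Rightarrow> (real \<Rightarrow> complex) topology" where
  "oc_step n =
     seminorm_topology {f. smooth f \<and> (\<forall>m\<ge>1. oc_norm m n f < \<infinity>)} {1..} (\<lambda>m. oc_norm m n)"

definition oc_space :: "(real \<Rightarrow> complex) topology" where
  "oc_space = lc_inductive_limit {1..} oc_step"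


section \<open>Convolution\<close>

definition convolution :: "((real \<Rightarrow> complex) \<Rightarrow> complex) \<Rightarrow> (real \<Rightarrow> complex) \<Rightarrow> real \<Rightarrow> complex" where
  "convolution T f = (\<lambda>x. T (\<lambda>y. f (x - y)))"

definition reflection :: "((real \<Rightarrow> complex) \<Rightarrow> complex) \<Rightarrow> (real \<Rightarrow> complex) \<Rightarrow> complex" where
  "reflection T = (\<lambda>\<phi>. T (\<lambda>y. \<phi> (- y)))"

text \<open>In the following, \<open>E\<close> is \<^const>\<open>schwartz_space\<close> or \<^const>\<open>oc_space\<close>, and \<open>T \<in> dual oc_space\<close>.\<close>

definition conv_op ::
    "(real \<Rightarrow> complex) topology \<Rightarrow> ((real \<Rightarrow> complex) \<Rightarrow> complex) \<Rightarrow>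
     (real \<Rightarrow> complex) \<Rightarrow> (real \<Rightarrow> complex)" where
  "conv_op E T f = (if f \<in> topspace E then convolution T f else 0)"

text \<open>
  \<open>T \<star> S\<close> for \<open>S \<in> dual E\<close>. For \<open>E = oc_space\<close> this is the element of \<open>dual oc_space\<close> whose restriction
  to \<^const>\<open>schwartz_space\<close> is the convolution of \<open>T\<close> with the tempered distribution induced by \<open>S\<close>; see
  lemma \<open>dual_conv_op_restrict\<close>.
\<close>

definition dual_conv_op ::
    "(real \<Rightarrow> complex) topology \<Rightarrow> ((real \<Rightarrow> complex) \<Rightarrow> complex) \<Rightarrow>
     ((real \<Rightarrow> complex) \<Rightarrow> complex) \<Rightarrow> ((real \<Rightarrow> complex) \<Rightarrow> complex)" where
  "dual_conv_op E T S =
     (if S \<in> dual E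
      then (\<lambda>f. if f \<in> topspace E then S (convolution (reflection T) f) else 0)
      else 0)"

definition restrict_functional ::
    "(real \<Rightarrow> complex) topology \<Rightarrow> ((real \<Rightarrow> complex) \<Rightarrow> complex) \<Rightarrow> (real \<Rightarrow> complex) \<Rightarrow> complex" where
  "restrict_functional E S = (\<lambda>f. if f \<in> topspace E then S f else 0)"

lemma dual_conv_op_restrict:
  assumes "topspace E \<subseteq> topspace F"
    and "\<And>f. f \<in> topspace E \<Longrightarrow> convolution (reflection T) f \<in> topspace E"
    and "S \<in> dual F" and "restrict_functional E S \<in> dual E"
  shows "restrict_functional E (dual_conv_op F T S) = dual_conv_op E T (restrict_functional E S)"
  using assms by (auto simp: restrict_functional_def dual_conv_op_def fun_eq_iff)

text \<open>The powers \<open>(\<star>T)\<^sup>n\<close> are meant for \<open>n \<ge> 1\<close>; the value at \<open>0\<close> is a dummy.\<close>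

fun conv_power :: "((real \<Rightarrow> complex) \<Rightarrow> complex) \<Rightarrow> nat \<Rightarrow> (real \<Rightarrow> complex) \<Rightarrow> complex" where
  "conv_power T 0 = 0"
| "conv_power T (Suc 0) = T"
| "conv_power T (Suc (Suc n)) = dual_conv_op oc_space T (conv_power T (Suc n))"

definition conv_mean :: "((real \<Rightarrow> complex) \<Rightarrow> complex) \<Rightarrow> nat \<Rightarrow> (real \<Rightarrow> complex) \<Rightarrow> complex" where
  "conv_mean T n = (\<lambda>f. 1 / of_nat n * (\<Sum>m=1..n. conv_power T m f))"

end

theory Submission
  imports Defs
begin

text \<open>
  Write \<open>T\<^sub>n\<close> for the means of the powers of \<open>T\<close>. The Cesaro means of the four operators are the convolution operators
  of \<open>T\<^sub>n\<close> and their transposes, so every item follows from, and implies, that \<open>T\<^sub>n f\<close> converges for each \<open>f\<close> in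
  \<open>\<O>\<^sub>C\<close>.

  Given pointwise convergence, uniform boundedness on the steps makes the sequence \<open>T\<^sub>n - L\<close> equicontinuous. For a continuous
  seminorm \<open>R\<close> on \<open>\<O>\<^sub>C\<close>, the seminorm \<open>sup\<^sub>J (1 + J\<^sup>2) R (f - \<kappa>\<^sub>J f)\<close> with cut-off functions \<open>\<kappa>\<^sub>J\<close> is again continuous; hence
  bounded sets are reduced to sets of functions with common compact support, which are totally bounded. This upgrades
  pointwise to uniform convergence without knowing that bounded sets lie in one step.

  Conversely, (weak) convergence on \<open>\<S>\<close> bounds \<open>T\<^sub>n\<close> applied to translates of a test function faster than any power of the
  translation, and a partition of unity turns this into equicontinuity on \<open>\<O>\<^sub>C\<close>. On the duals, \<open>\<delta>\<^sub>0\<close> and weighted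
  \<open>\<ell>\<^sup>1\<close> sums of point evaluations serve as probes.
\<close>

section \<open>Spaces topologised by seminorms\<close>

text \<open>Continuity on the inductive limit is tested one step at a time: \<open>oc_space\<close>
  turns out to carry all seminorms dominated on each \<open>oc_fun k\<close> by a multiple of some
  \<open>ocn m k\<close>, with \<open>m\<close> depending on \<open>k\<close>. Thus a supremum of
  seminorms with common bounds on every step is again continuous, and a Banach-Steinhaus argument on
  each single step replaces barrelledness of the limit. Cutting off at \<open>J\<close> costs one
  step and gains the factor \<open>1 / wt (real J)\<close>; a condition over all steps absorbs the
  loss. Values of functionals suffice because \<open>convolution u f x\<close> is \<open>u\<close>
  applied to a reflected translate of \<open>f\<close>: the norms of
  \<open>convolution (u n) f\<close> are controlled by \<open>u n\<close> on normalised translates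
  of derivatives of \<open>f\<close>, and these form a bounded set. The passage from Schwartz
  functions back to O_C has no equicontinuity to start from, as Schwartz convergence says nothing
  about growing functions. It is replaced by decay of arbitrary order in the translation parameter,
  which beats the growth \<open>wt a ^ k\<close> of the piece near \<open>a\<close> of a function of
  step \<open>k\<close>.\<close>

definition seminorm_on :: "('x \<Rightarrow> complex) set \<Rightarrow> (('x \<Rightarrow> complex) \<Rightarrow> real) \<Rightarrow> bool" where
  "seminorm_on V q \<longleftrightarrow> (\<forall>f\<in>V. 0 \<le> q f) \<and> (\<forall>f\<in>V. \<forall>g\<in>V. q (f + g) \<le> q f + q g) \<and>
     (\<forall>c. \<forall>f\<in>V. q (\<lambda>x. c * f x) = cmod c * q f)"

lemma lin_subspaceD:
  assumes "lin_subspace V"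
  shows "0 \<in> V" "f \<in> V \<Longrightarrow> g \<in> V \<Longrightarrow> f + g \<in> V" "f \<in> V \<Longrightarrow> (\<lambda>x. c * f x) \<in> V"
    "f \<in> V \<Longrightarrow> - f \<in> V" "f \<in> V \<Longrightarrow> g \<in> V \<Longrightarrow> f - g \<in> V"
proof -
  show *: "0 \<in> V" "\<And>f g. f \<in> V \<Longrightarrow> g \<in> V \<Longrightarrow> f + g \<in> V" "\<And>c f. f \<in> V \<Longrightarrow> (\<lambda>x. c * f x) \<in> V"
    using assms by (auto simp: lin_subspace_def)
  show **: "\<And>f. f \<in> V \<Longrightarrow> - f \<in> V"
    using *(3)[of _ "-1"] by (simp add: fun_Compl_def)
  show "f \<in> V \<Longrightarrow> g \<in> V \<Longrightarrow> f - g \<in> V"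
    using *(2)[of f "- g"] **[of g] by simp
qed

lemma lin_subspace_sum:
  assumes "lin_subspace V" "\<And>i. i \<in> I \<Longrightarrow> f i \<in> V"
  shows "(\<Sum>i\<in>I. f i) \<in> V"
  using assms(2) by (induction I rule: infinite_finite_induct) (auto intro: lin_subspaceD[OF assms(1)])

lemma seminorm_onD:
  assumes "seminorm_on V q"
  shows "f \<in> V \<Longrightarrow> 0 \<le> q f" "f \<in> V \<Longrightarrow> g \<in> V \<Longrightarrow> q (f + g) \<le> q f + q g"
    "f \<in> V \<Longrightarrow> q (\<lambda>x. c * f x) = cmod c * q f"
  using assms by (auto simp: seminorm_on_def)

lemma seminorm_on_minus:
  assumes "seminorm_on V q" "f \<in> V"
  shows "q (- f) = q f"
  using seminorm_onD(3)[OF assms, of "-1"] by (simp add: fun_Compl_def)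

lemma seminorm_on_diff_le:
  assumes "seminorm_on V q" "lin_subspace V" "f \<in> V" "g \<in> V"
  shows "q (f - g) \<le> q f + q g"
  using seminorm_onD(2)[OF assms(1,3), of "- g"] seminorm_on_minus[OF assms(1,4)]
    lin_subspaceD(4)[OF assms(2,4)] by simp

lemma seminorm_on_zero:
  assumes "seminorm_on V q" "lin_subspace V"
  shows "q 0 = 0"
  using seminorm_onD(3)[OF assms(1) lin_subspaceD(1)[OF assms(2)], of 0] by (simp add: zero_fun_def)

lemma seminorm_on_diff_commute:
  assumes "seminorm_on V q" "lin_subspace V" "f \<in> V" "g \<in> V"
  shows "q (f - g) = q (g - f)"
  using seminorm_on_minus[OF assms(1), of "f - g"] lin_subspaceD(5)[OF assms(2-4)] by simp

lemma seminorm_on_triangle_diff: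
  assumes "seminorm_on V q" "lin_subspace V" "f \<in> V" "g \<in> V" "h \<in> V"
  shows "q (f - h) \<le> q (f - g) + q (g - h)"
  using seminorm_onD(2)[OF assms(1), of "f - g" "g - h"] lin_subspaceD(5)[OF assms(2)] assms
  by simp

lemma seminorm_on_triangle:
  assumes "seminorm_on V q" "lin_subspace V" "f \<in> V" "g \<in> V"
  shows "q f \<le> q (f - g) + q g"
  using seminorm_onD(2)[OF assms(1), of "f - g" "g"] lin_subspaceD(5)[OF assms(2)] assms
  by simp

lemma seminorm_on_subset: "seminorm_on V q \<Longrightarrow> W \<subseteq> V \<Longrightarrow> seminorm_on W q"
  unfolding seminorm_on_def by blast

lemma seminorm_on_add: "seminorm_on V p \<Longrightarrow> seminorm_on V q \<Longrightarrow> seminorm_on V (\<lambda>f. p f + q f)"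
  unfolding seminorm_on_def by (auto simp: algebra_simps) (metis add.assoc add.commute add_mono)

lemma seminorm_on_scale: "seminorm_on V q \<Longrightarrow> 0 \<le> c \<Longrightarrow> seminorm_on V (\<lambda>f. c * q f)"
  unfolding seminorm_on_def
  by (auto simp: algebra_simps) (metis distrib_left mult_left_mono)

text \<open>Half of homogeneity is enough: applied to \<open>1/c\<close> and \<open>c * f\<close>,
  the inequality gives its own converse. All suprema below are treated this way.\<close>

lemma seminorm_onI:
  assumes V: "lin_subspace V" and "\<And>f. f \<in> V \<Longrightarrow> 0 \<le> q f"
    and "\<And>f g. f \<in> V \<Longrightarrow> g \<in> V \<Longrightarrow> q (f + g) \<le> q f + q g"
    and le: "\<And>c f. f \<in> V \<Longrightarrow> q (\<lambda>x. c * f x) \<le> cmod c * q f"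
  shows "seminorm_on V q"
  unfolding seminorm_on_def
proof (intro conjI ballI allI assms)
  fix c f assume f: "f \<in> V"
  show "q (\<lambda>x. c * f x) = cmod c * q f"
  proof (cases "c = 0")
    case True
    then show ?thesis using le[OF f, of c] assms(2)[OF lin_subspaceD(3)[OF V f, of c]] by simp
  next
    case False
    have "q (\<lambda>x. (1/c) * (c * f x)) \<le> cmod (1/c) * q (\<lambda>x. c * f x)"
      by (rule le[OF lin_subspaceD(3)[OF V f]])
    then have "cmod c * q f \<le> q (\<lambda>x. c * f x)"
      using False by (simp add: norm_divide field_simps)
    with le[OF f, of c] show ?thesis by simp
  qed
qed auto

text \<open>The scaling and directedness conditions let a single unit ball serve as a basic neighbourhood.\<close>

locale seminormed =
  fixes E :: "('x \<Rightarrow> complex) topology" and Q :: "(('x \<Rightarrow> complex) \<Rightarrow> real) set"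
  assumes lin: "lin_subspace (topspace E)"
    and nonempty: "Q \<noteq> {}"
    and seminorm: "q \<in> Q \<Longrightarrow> seminorm_on (topspace E) q"
    and directed: "p \<in> Q \<Longrightarrow> q \<in> Q \<Longrightarrow> \<exists>r\<in>Q. \<forall>f\<in>topspace E. p f \<le> r f \<and> q f \<le> r f"
    and scaled: "q \<in> Q \<Longrightarrow> c > 0 \<Longrightarrow> \<exists>r\<in>Q. \<forall>f\<in>topspace E. c * q f \<le> r f"
    and openin_iff: "openin E U \<longleftrightarrow>
      U \<subseteq> topspace E \<and> (\<forall>f\<in>U. \<exists>q\<in>Q. {g \<in> topspace E. q (g - f) < 1} \<subseteq> U)"
begin

lemmas lin_simps = lin_subspaceD[OF lin]

lemma openin_ball:
  assumes q: "q \<in> Q" and f: "f \<in> topspace E"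
  shows "openin E {g \<in> topspace E. q (g - f) < e}"
  unfolding openin_iff
proof (intro conjI ballI)
  fix h assume "h \<in> {g \<in> topspace E. q (g - f) < e}"
  then have h: "h \<in> topspace E" "q (h - f) < e" by auto
  \<comment> \<open>The radius left at \<open>h\<close>. Scaling \<open>q\<close> by
    \<open>1/d\<close> turns the ball of radius \<open>d\<close> into the unit ball that
    \<open>openin_iff\<close> asks for.\<close>
  define d where "d = e - q (h - f)"
  have d: "d > 0" using h by (simp add: d_def)
  obtain r where r: "r \<in> Q" "\<And>f. f \<in> topspace E \<Longrightarrow> 1 / d * q f \<le> r f"
    using scaled[OF q, of "1/d"] d by auto
  have "q (g - f) < e" if g: "g \<in> topspace E" "r (g - h) < 1" for g
  proof -
    have "q (g - h) < d"
    proof -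
      have "1 / d * q (g - h) < 1" using r(2)[OF lin_simps(5)[OF g(1) h(1)]] g(2) by simp
      then show ?thesis using d by (simp add: field_simps)
    qed
    then show ?thesis
      using seminorm_on_triangle_diff[OF seminorm[OF q] lin g(1) h(1) f] by (simp add: d_def)
  qed
  then show "\<exists>q'\<in>Q. {g \<in> topspace E. q' (g - h) < 1} \<subseteq> {g \<in> topspace E. q (g - f) < e}"
    using r(1) by blast
qed auto

lemma nhd_seminorm:
  assumes "openin E U" "0 \<in> U"
  obtains q where "q \<in> Q" "{g \<in> topspace E. q g < 1} \<subseteq> U"
  using assms unfolding openin_iff by auto

lemma openin_unit_ball: "q \<in> Q \<Longrightarrow> e > 0 \<Longrightarrow> openin E {g \<in> topspace E. q g < e} \<and> 0 \<in> {g \<in> topspace E. q g < e}"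
  using openin_ball[of q 0 e] lin_simps(1) seminorm_on_zero[OF seminorm lin, of q] by simp

lemma bounded_sets_iff:
  "B \<in> bounded_sets E \<longleftrightarrow> B \<subseteq> topspace E \<and> (\<forall>q\<in>Q. \<exists>C. \<forall>f\<in>B. q f \<le> C)"
proof safe
  fix x assume "B \<in> bounded_sets E" "x \<in> B"
  then show "x \<in> topspace E" by (auto simp: bounded_sets_def)
next
  fix q assume B: "B \<in> bounded_sets E" and q: "q \<in> Q"
  obtain r where r: "r > 0" "\<And>t::real. t \<ge> r \<Longrightarrow> B \<subseteq> (\<lambda>f x. of_real t * f x) ` {g \<in> topspace E. q g < 1}"
    using B openin_unit_ball[OF q, of 1] unfolding bounded_sets_def by auto
  have "q f \<le> r" if "f \<in> B" for f
  proof -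
    obtain g where g: "g \<in> topspace E" "q g < 1" "f = (\<lambda>x. of_real r * g x)"
      using r(2)[of r] \<open>f \<in> B\<close> by auto
    then show ?thesis
      using seminorm_onD(3)[OF seminorm[OF q] g(1), of "of_real r"] r(1) by simp
  qed
  then show "\<exists>C. \<forall>f\<in>B. q f \<le> C" by blast
next
  assume B: "B \<subseteq> topspace E" and *: "\<forall>q\<in>Q. \<exists>C. \<forall>f\<in>B. q f \<le> C"
  show "B \<in> bounded_sets E"
    unfolding bounded_sets_def
  proof (intro CollectI conjI allI impI)
    fix U assume U: "openin E U \<and> 0 \<in> U"
    then obtain q where q: "q \<in> Q" "{g \<in> topspace E. q g < 1} \<subseteq> U" by (auto elim: nhd_seminorm)
    obtain C where C: "\<And>f. f \<in> B \<Longrightarrow> q f \<le> C" using * q(1) by blast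
    \<comment> \<open>The summand 1 keeps the factor positive when \<open>C = 0\<close> and the
      rescaled value strictly below 1.\<close>
    have "B \<subseteq> (\<lambda>f x. of_real t * f x) ` U" if t: "t \<ge> \<bar>C\<bar> + 1" for t :: real
    proof
      fix f assume f: "f \<in> B"
      then have fV: "f \<in> topspace E" using B by auto
      define g where "g = (\<lambda>x. of_real (1 / t) * f x)"
      have "q g = 1 / t * q f"
        using seminorm_onD(3)[OF seminorm[OF q(1)] fV, of "of_real (1/t)"] t
        unfolding g_def by (simp add: norm_divide)
      also have "\<dots> < 1" using C[OF f] t by (simp add: field_simps)
      finally have "g \<in> U" using q(2) lin_simps(3)[OF fV] unfolding g_def by blast
      moreover have "f = (\<lambda>x. of_real t * g x)" using t by (auto simp: g_def)
      ultimately show "f \<in> (\<lambda>f x. of_real t * f x) ` U" by blast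
    qed
    then show "\<exists>r>0. \<forall>t\<ge>r. B \<subseteq> (\<lambda>f x. complex_of_real t * f x) ` U"
      by (intro exI[of _ "\<bar>C\<bar> + 1"]) auto
  qed (rule B)
qed

lemma finite_subset_bounded: "B \<in> finite_subsets E \<Longrightarrow> B \<in> bounded_sets E"
  unfolding bounded_sets_iff finite_subsets_def
proof safe
  fix q :: "_ \<Rightarrow> real" assume "finite B"
  then show "\<exists>C. \<forall>f\<in>B. q f \<le> C" by (intro exI[of _ "Max (q ` B)"]) auto
qed

text \<open>Makes a topology given by seminorms a competitor in the supremum that defines
  \<open>lc_inductive_limit\<close>.\<close>

lemma locally_convex: "locally_convex E"
  unfolding locally_convex_def
proof (intro conjI allI impI)
  show "lin_subspace (topspace E)" by (rule lin)
  show "continuous_map (prod_topology E E) E (\<lambda>(f, g). f + g)"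
    unfolding continuous_map openin_prod_topology_alt
  proof (intro conjI allI impI)
    show "(\<lambda>(f, g). f + g) ` topspace (prod_topology E E) \<subseteq> topspace E"
      using lin_simps(2) by auto
  next
    fix U f g assume U: "openin E U"
      and "(f, g) \<in> {x \<in> topspace (prod_topology E E). (case x of (f, g) \<Rightarrow> f + g) \<in> U}"
    then have fg: "f \<in> topspace E" "g \<in> topspace E" "f + g \<in> U" by auto
    then obtain q where q: "q \<in> Q" "{h \<in> topspace E. q (h - (f + g)) < 1} \<subseteq> U"
      using U unfolding openin_iff by blast
    show "\<exists>U' V. openin E U' \<and> openin E V \<and> f \<in> U' \<and> g \<in> V \<and>
      U' \<times> V \<subseteq> {x \<in> topspace (prod_topology E E). (case x of (f, g) \<Rightarrow> f + g) \<in> U}"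
    proof (rule exI[of _ "{h \<in> topspace E. q (h - f) < 1/2}"],
        rule exI[of _ "{h \<in> topspace E. q (h - g) < 1/2}"], intro conjI openin_ball q fg)
      have "h + k \<in> U" if hk: "h \<in> topspace E" "k \<in> topspace E" "q (h - f) < 1/2" "q (k - g) < 1/2" for h k
      proof -
        have "q (h + k - (f + g)) = q ((h - f) + (k - g))" by (simp add: algebra_simps)
        also have "\<dots> \<le> q (h - f) + q (k - g)"
          by (intro seminorm_onD(2)[OF seminorm[OF q(1)]] lin_simps hk fg)
        also have "\<dots> < 1" using hk by simp
        finally show ?thesis using q(2) lin_simps(2)[OF hk(1,2)] by blast
      qed
      then show "{h \<in> topspace E. q (h - f) < 1/2} \<times> {h \<in> topspace E. q (h - g) < 1/2}
        \<subseteq> {x \<in> topspace (prod_topology E E). (case x of (f, g) \<Rightarrow> f + g) \<in> U}" by auto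
    qed (use seminorm_on_zero[OF seminorm[OF q(1)] lin] fg in auto)
  qed
  show "continuous_map (prod_topology euclidean E) E (\<lambda>(c, f). (\<lambda>x. c * f x))"
    unfolding continuous_map openin_prod_topology_alt
  proof (intro conjI allI impI)
    show "(\<lambda>(c, f). (\<lambda>x. c * f x)) ` topspace (prod_topology euclidean E) \<subseteq> topspace E"
      using lin_simps(3) by auto
  next
    fix U and c :: complex and f assume U: "openin E U"
      and "(c, f) \<in> {x \<in> topspace (prod_topology euclidean E). (case x of (c, f) \<Rightarrow> \<lambda>x. c * f x) \<in> U}"
    then have cf: "f \<in> topspace E" "(\<lambda>x. c * f x) \<in> U" by auto
    then obtain q where q: "q \<in> Q" "{h \<in> topspace E. q (h - (\<lambda>x. c * f x)) < 1} \<subseteq> U"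
      using U unfolding openin_iff by blast
    have qf: "q f \<ge> 0" using seminorm_onD(1)[OF seminorm[OF q(1)] cf(1)] .
    \<comment> \<open>From \<open>a * h - c * f = a * (h - f) + (a - c) * f\<close>: the radius
      \<open>e\<close> keeps the second summand at most 1/2, and \<open>d\<close> is then chosen
      against \<open>cmod a \<le> cmod c + e\<close>.\<close>
    define e where "e = 1 / (2 * (q f + 1))"
    define d where "d = 1 / (2 * (cmod c + e + 1))"
    have ed: "e > 0" "d > 0" "e * q f \<le> 1/2"
    proof -
      show "e > 0" "e * q f \<le> 1/2" using qf by (auto simp: e_def field_simps)
      then have "cmod c + e + 1 > 0" by (simp add: add_nonneg_pos)
      then show "d > 0" by (simp add: d_def)
    qed
    show "\<exists>U' V. openin euclidean U' \<and> openin E V \<and> c \<in> U' \<and> f \<in> V \<and>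
      U' \<times> V \<subseteq> {x \<in> topspace (prod_topology euclidean E). (case x of (c, f) \<Rightarrow> \<lambda>x. c * f x) \<in> U}"
    proof (rule exI[of _ "ball c e"],
        rule exI[of _ "{h \<in> topspace E. q (h - f) < d}"], intro conjI openin_ball q cf)
      have "(\<lambda>x. a * h x) \<in> U" if h: "h \<in> topspace E" "q (h - f) < d" "dist c a < e" for a h
      proof -
        have "q ((\<lambda>x. a * h x) - (\<lambda>x. c * f x)) = q ((\<lambda>x. a * (h - f) x) + (\<lambda>x. (a - c) * f x))"
          by (simp add: algebra_simps plus_fun_def fun_diff_def)
        also have "\<dots> \<le> q (\<lambda>x. a * (h - f) x) + q (\<lambda>x. (a - c) * f x)"
          by (intro seminorm_onD(2)[OF seminorm[OF q(1)]] lin_simps h cf)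
        also have "\<dots> = cmod a * q (h - f) + cmod (a - c) * q f"
          using lin_simps(5)[OF h(1) cf(1)] cf(1) by (simp only: seminorm_onD(3)[OF seminorm[OF q(1)]])
        also have "\<dots> < 1"
        proof -
          have "cmod a \<le> cmod c + e" using h(3) norm_triangle_ineq2[of a c] by (simp add: dist_norm norm_minus_commute)
          then have "cmod a * q (h - f) \<le> (cmod c + e) * d"
            using h ed seminorm_onD(1)[OF seminorm[OF q(1)] lin_simps(5)[OF h(1) cf(1)]]
            by (intro mult_mono) auto
          also have "\<dots> < 1/2"
          proof -
            have "cmod c + e + 1 > 0" using ed(1) by (simp add: add_nonneg_pos)
            then show ?thesis using ed(1) by (simp add: d_def field_simps)
          qed
          finally have "cmod a * q (h - f) < 1/2" .
          moreover have "cmod (a - c) * q f \<le> e * q f"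
            using h(3) qf by (intro mult_right_mono) (auto simp: dist_norm norm_minus_commute)
          ultimately show ?thesis using ed(3) by simp
        qed
        finally show ?thesis using q(2) lin_simps(3)[OF h(1)] by blast
      qed
      then show "ball c e \<times> {h \<in> topspace E. q (h - f) < d}
        \<subseteq> {x \<in> topspace (prod_topology euclidean E). (case x of (c, f) \<Rightarrow> \<lambda>x. c * f x) \<in> U}" by auto
    qed (use seminorm_on_zero[OF seminorm[OF q(1)] lin] cf ed in auto)
  qed
next
  fix U assume U: "openin E U \<and> 0 \<in> U"
  then obtain q where q: "q \<in> Q" "{g \<in> topspace E. q g < 1} \<subseteq> U" by (auto elim: nhd_seminorm)
  have "convex_fun_set {g \<in> topspace E. q g < 1}"
    unfolding convex_fun_set_def
  proof safe
    fix f g and t :: real assume fg: "f \<in> topspace E" "g \<in> topspace E" "q f < 1" "q g < 1" "0 \<le> t" "t \<le> 1"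
    let ?a = "\<lambda>x. of_real (1 - t) * f x" and ?b = "\<lambda>x. of_real t * g x"
    have eq: "(\<lambda>x. of_real (1 - t) * f x + of_real t * g x) = ?a + ?b" by (simp add: plus_fun_def)
    show "(\<lambda>x. of_real (1 - t) * f x + of_real t * g x) \<in> topspace E"
      unfolding eq by (intro lin_simps fg)
    have "q (?a + ?b) \<le> q ?a + q ?b"
      by (intro seminorm_onD(2)[OF seminorm[OF q(1)]] lin_simps fg)
    also have "\<dots> = (1 - t) * q f + t * q g"
      using fg by (simp only: seminorm_onD(3)[OF seminorm[OF q(1)]] norm_of_real abs_of_nonneg)
    also have "\<dots> < 1" using fg by (intro convex_bound_lt) auto
    finally show "q (\<lambda>x. of_real (1 - t) * f x + of_real t * g x) < 1" unfolding eq .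
  qed
  then show "\<exists>C. openin E C \<and> 0 \<in> C \<and> C \<subseteq> U \<and> convex_fun_set C"
    using openin_unit_ball[OF q(1), of 1] q(2) by (intro exI[of _ "{g \<in> topspace E. q g < 1}"]) auto
qed

section \<open>Continuous functionals as functionals dominated by a seminorm\<close>

lemma functional_bound:
  assumes u: "\<And>f c. f \<in> topspace E \<Longrightarrow> u (\<lambda>x. c * f x) = c * u f"
    and cont: "continuous_map E euclidean (u :: _ \<Rightarrow> complex)"
  obtains q where "q \<in> Q" "\<And>f. f \<in> topspace E \<Longrightarrow> cmod (u f) \<le> q f"
proof -
  have "openin E {f \<in> topspace E. u f \<in> ball 0 1}"
    using cont by (rule openin_continuous_map_preimage) auto
  moreover have "u 0 = 0" using u[of 0 0] lin_simps(1) by (simp add: zero_fun_def)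
  ultimately obtain q where q: "q \<in> Q" "{g \<in> topspace E. q g < 1} \<subseteq> {f \<in> topspace E. u f \<in> ball 0 1}"
    using nhd_seminorm[of "{f \<in> topspace E. u f \<in> ball 0 1}"] lin_simps(1) by auto
  have "cmod (u f) \<le> q f" if f: "f \<in> topspace E" for f
  \<comment> \<open>\<open>q f\<close> may vanish, so \<open>f\<close> is divided by every
    \<open>s > q f\<close> instead.\<close>
  proof (rule dense_ge)
    fix s assume s: "q f < s"
    then have s0: "s > 0" using seminorm_onD(1)[OF seminorm[OF q(1)] f] by simp
    define g where "g = (\<lambda>x. of_real (1 / s) * f x)"
    have "q g = 1 / s * q f"
      using seminorm_onD(3)[OF seminorm[OF q(1)] f, of "of_real (1/s)"] s0
      unfolding g_def by (simp add: norm_divide)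
    also have "\<dots> < 1" using s s0 by simp
    finally have "g \<in> {f \<in> topspace E. u f \<in> ball 0 1}"
      using q(2) lin_simps(3)[OF f] unfolding g_def by blast
    then have "cmod (u g) < 1" by simp
    then have "cmod (of_real (1/s) * u f) < 1" unfolding g_def using u[OF f] by metis
    then show "cmod (u f) \<le> s" using s0 by (simp add: norm_mult norm_divide)
  qed
  then show ?thesis by (rule that[OF q(1)])
qed

lemma in_dual_iff:
  "u \<in> dual E \<longleftrightarrow>
    (\<forall>f\<in>topspace E. \<forall>g\<in>topspace E. u (f + g) = u f + u g) \<and>
    (\<forall>c. \<forall>f\<in>topspace E. u (\<lambda>x. c * f x) = c * u f) \<and>
    (\<exists>q\<in>Q. \<forall>f\<in>topspace E. cmod (u f) \<le> q f) \<and> (\<forall>f. f \<notin> topspace E \<longrightarrow> u f = 0)"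
    (is "_ \<longleftrightarrow> ?add \<and> ?mul \<and> ?bd \<and> ?out")
proof
  assume u: "u \<in> dual E"
  then have *: ?add ?mul "continuous_map E euclidean u" ?out by (auto simp: dual_def)
  then obtain q where "q \<in> Q" "\<And>f. f \<in> topspace E \<Longrightarrow> cmod (u f) \<le> q f"
    using functional_bound[of u] by metis
  with * show "?add \<and> ?mul \<and> ?bd \<and> ?out" by blast
next
  assume *: "?add \<and> ?mul \<and> ?bd \<and> ?out"
  then obtain q where q: "q \<in> Q" "\<And>f. f \<in> topspace E \<Longrightarrow> cmod (u f) \<le> q f" by blast
  have "continuous_map E euclidean u"
    unfolding continuous_map
  proof (intro conjI allI impI)
    fix W :: "complex set" assume W: "openin euclidean W"
    show "openin E {x \<in> topspace E. u x \<in> W}"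
      unfolding openin_iff
    proof (intro conjI ballI)
      fix f assume "f \<in> {x \<in> topspace E. u x \<in> W}"
      then have f: "f \<in> topspace E" "u f \<in> W" by auto
      obtain e where e: "e > 0" "ball (u f) e \<subseteq> W" using W f(2) by (auto simp: open_contains_ball)
      obtain r where r: "r \<in> Q" "\<And>f. f \<in> topspace E \<Longrightarrow> 1 / e * q f \<le> r f"
        using scaled[OF q(1), of "1/e"] e by auto
      have "u g \<in> W" if g: "g \<in> topspace E" "r (g - f) < 1" for g
      proof -
        have gf: "g - f \<in> topspace E" using lin_simps(5)[OF g(1) f(1)] .
        have "u g = u (g - f) + u f" using * gf f(1) by (metis diff_add_cancel)
        then have "cmod (u g - u f) \<le> q (g - f)" using q(2)[OF gf] by simp
        also have "\<dots> < e"
        proof -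
          have "1 / e * q (g - f) < 1" using r(2)[OF gf] g(2) by simp
          then show ?thesis using e(1) by (simp add: field_simps)
        qed
        finally show ?thesis using e(2) by (auto simp: dist_norm norm_minus_commute)
      qed
      then show "\<exists>q\<in>Q. {g \<in> topspace E. q (g - f) < 1} \<subseteq> {x \<in> topspace E. u x \<in> W}"
        using r(1) by blast
    qed auto
  qed auto
  with * show "u \<in> dual E" unfolding dual_def by blast
qed

lemma in_dualD:
  assumes "u \<in> dual E"
  shows "f \<in> topspace E \<Longrightarrow> g \<in> topspace E \<Longrightarrow> u (f + g) = u f + u g"
    "f \<in> topspace E \<Longrightarrow> u (\<lambda>x. c * f x) = c * u f"
    "f \<notin> topspace E \<Longrightarrow> u f = 0" "u 0 = 0"
    "f \<in> topspace E \<Longrightarrow> g \<in> topspace E \<Longrightarrow> u (f - g) = u f - u g"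
    "\<exists>q\<in>Q. \<forall>f\<in>topspace E. cmod (u f) \<le> q f"
proof -
  show 1: "\<And>f g. f \<in> topspace E \<Longrightarrow> g \<in> topspace E \<Longrightarrow> u (f + g) = u f + u g"
    "\<And>f c. f \<in> topspace E \<Longrightarrow> u (\<lambda>x. c * f x) = c * u f"
    "f \<notin> topspace E \<Longrightarrow> u f = 0" "\<exists>q\<in>Q. \<forall>f\<in>topspace E. cmod (u f) \<le> q f"
    using assms unfolding in_dual_iff by blast+
  show "u 0 = 0" using 1(2)[of 0 0] lin_simps(1) by (simp add: zero_fun_def)
  show "f \<in> topspace E \<Longrightarrow> g \<in> topspace E \<Longrightarrow> u (f - g) = u f - u g"
    using 1(1)[of "f - g" g] lin_simps(5)[of f g] by simp
qed

lemma dual_sum: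
  assumes "u \<in> dual E" "\<And>i. i \<in> I \<Longrightarrow> f i \<in> topspace E"
  shows "u (\<Sum>i\<in>I. f i) = (\<Sum>i\<in>I. u (f i))"
  using assms(2)
proof (induction I rule: infinite_finite_induct)
  case (insert x F)
  have "u (f x + sum f F) = u (f x) + u (sum f F)"
    using insert.prems lin_subspace_sum[OF lin, of F f] by (intro in_dualD(1)[OF assms(1)]) auto
  also have "\<dots> = u (f x) + (\<Sum>i\<in>F. u (f i))" using insert.IH insert.prems by simp
  finally show ?case unfolding sum.insert[OF insert.hyps] .
qed (simp_all add: in_dualD(4)[OF assms(1)])

lemma lin_subspace_dual: "lin_subspace (dual E)"
  unfolding lin_subspace_def
proof (intro conjI ballI allI)
  show "0 \<in> dual E"
  proof -
    obtain q where "q \<in> Q" using nonempty by blast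
    then have "\<exists>q\<in>Q. \<forall>f\<in>topspace E. cmod (0 f) \<le> q f"
      using seminorm_onD(1)[OF seminorm[of q]] by auto
    then show ?thesis
      by (intro in_dual_iff[THEN iffD2] conjI allI ballI impI) simp_all
  qed
next
  fix u v assume uv: "u \<in> dual E" "v \<in> dual E"
  obtain p q where pq: "p \<in> Q" "q \<in> Q" "\<And>f. f \<in> topspace E \<Longrightarrow> cmod (u f) \<le> p f"
    "\<And>f. f \<in> topspace E \<Longrightarrow> cmod (v f) \<le> q f"
    using in_dualD(6)[OF uv(1)] in_dualD(6)[OF uv(2)] by blast
  obtain r where r: "r \<in> Q" "\<And>f. f \<in> topspace E \<Longrightarrow> p f \<le> r f \<and> q f \<le> r f"
    using directed[OF pq(1,2)] by blast
  obtain r' where r': "r' \<in> Q" "\<And>f. f \<in> topspace E \<Longrightarrow> 2 * r f \<le> r' f"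
    using scaled[OF r(1), of 2] by auto
  have "cmod ((u + v) f) \<le> r' f" if f: "f \<in> topspace E" for f
    using pq(3)[OF f] pq(4)[OF f] r(2)[OF f] r'(2)[OF f] norm_triangle_ineq[of "u f" "v f"] by simp
  with r'(1) have "\<exists>q\<in>Q. \<forall>f\<in>topspace E. cmod ((u + v) f) \<le> q f" by blast
  then show "u + v \<in> dual E"
    unfolding in_dual_iff using in_dualD(1-3)[OF uv(1)] in_dualD(1-3)[OF uv(2)]
    by (simp add: algebra_simps)
next
  fix c u assume u: "u \<in> dual E"
  obtain p where p: "p \<in> Q" "\<And>f. f \<in> topspace E \<Longrightarrow> cmod (u f) \<le> p f"
    using in_dualD(6)[OF u] by blast
  \<comment> \<open>\<open>cmod c + 1\<close> instead of \<open>cmod c\<close>, since scaling needs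
    a positive factor even for \<open>c = 0\<close>.\<close>
  obtain r where r: "r \<in> Q" "\<And>f. f \<in> topspace E \<Longrightarrow> (cmod c + 1) * p f \<le> r f"
    using scaled[OF p(1), of "cmod c + 1"] by (auto simp: add_nonneg_pos)
  have "cmod (c * u f) \<le> r f" if f: "f \<in> topspace E" for f
  proof -
    have "cmod (c * u f) \<le> (cmod c + 1) * p f"
      unfolding norm_mult by (intro mult_mono p f) auto
    then show ?thesis using r(2)[OF f] by simp
  qed
  with r(1) have "\<exists>q\<in>Q. \<forall>f\<in>topspace E. cmod (c * u f) \<le> q f" by blast
  then show "(\<lambda>f. c * u f) \<in> dual E"
    unfolding in_dual_iff using in_dualD(1-3)[OF u] by (simp add: algebra_simps)
qed

end

lemma continuous_map_seminormed:
  assumes "seminormed E P" "seminormed F Q"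
    and map: "\<And>f. f \<in> topspace E \<Longrightarrow> A f \<in> topspace F"
    and diff: "\<And>f g. f \<in> topspace E \<Longrightarrow> g \<in> topspace E \<Longrightarrow> A (f - g) = A f - A g"
    and bound: "\<And>q. q \<in> Q \<Longrightarrow> \<exists>p\<in>P. \<forall>f\<in>topspace E. q (A f) \<le> p f"
  shows "continuous_map E F A"
proof -
  interpret E: seminormed E P by fact
  interpret F: seminormed F Q by fact
  show ?thesis
    unfolding continuous_map
  proof (intro conjI allI impI)
    show "A ` topspace E \<subseteq> topspace F" using map by auto
    fix W assume W: "openin F W"
    show "openin E {f \<in> topspace E. A f \<in> W}"
      unfolding E.openin_iff
    proof (intro conjI ballI)
      fix f assume "f \<in> {f \<in> topspace E. A f \<in> W}"
      then have f: "f \<in> topspace E" "A f \<in> W" by auto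
      then obtain q where q: "q \<in> Q" "{g \<in> topspace F. q (g - A f) < 1} \<subseteq> W"
        using W unfolding F.openin_iff by blast
      obtain p where p: "p \<in> P" "\<And>f. f \<in> topspace E \<Longrightarrow> q (A f) \<le> p f" using bound[OF q(1)] by blast
      have "A g \<in> W" if g: "g \<in> topspace E" "p (g - f) < 1" for g
      proof -
        have "q (A g - A f) \<le> p (g - f)"
          using p(2)[of "g - f"] E.lin_simps(5)[OF g(1) f(1)] diff[OF g(1) f(1)] by simp
        then show ?thesis using g q(2) map[OF g(1)] by force
      qed
      then show "\<exists>p\<in>P. {g \<in> topspace E. p (g - f) < 1} \<subseteq> {f \<in> topspace E. A f \<in> W}"
        using p(1) by blast
    qed auto
  qed
qed

lemma lin_on_diff:
  assumes "lin_on V A" "lin_subspace V" "f \<in> V" "g \<in> V"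
  shows "A (f - g) = A f - A g"
proof -
  have "A f = A ((f - g) + g)" by simp
  also have "\<dots> = A (f - g) + A g"
    using assms lin_subspaceD(5)[OF assms(2-4)] unfolding lin_on_def by blast
  finally show ?thesis by simp
qed

lemma lin_on_zero:
  assumes "lin_on V A" "lin_subspace V"
  shows "A 0 = 0"
  using lin_on_diff[OF assms lin_subspaceD(1)[OF assms(2)] lin_subspaceD(1)[OF assms(2)]] by simp

subsection \<open>Strong duals and operator topologies\<close>

text \<open>Inserting \<open>0\<close> keeps the supremum meaningful when \<open>B\<close> is empty.\<close>

definition polar_seminorm :: "('x \<Rightarrow> complex) set \<Rightarrow> (('x \<Rightarrow> complex) \<Rightarrow> complex) \<Rightarrow> real" where
  "polar_seminorm B u = (SUP f\<in>insert 0 B. cmod (u f))"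

context seminormed
begin

lemma dual_bounded_on:
  assumes "u \<in> dual E" "B \<in> bounded_sets E"
  shows "bdd_above ((\<lambda>f. cmod (u f)) ` insert 0 B)"
proof -
  obtain q where q: "q \<in> Q" "\<And>f. f \<in> topspace E \<Longrightarrow> cmod (u f) \<le> q f" using in_dualD(6)[OF assms(1)] by blast
  obtain C where C: "\<And>f. f \<in> B \<Longrightarrow> q f \<le> C" using assms(2) q(1) unfolding bounded_sets_iff by blast
  have "cmod (u f) \<le> max 0 C" if "f \<in> insert 0 B" for f
  proof (cases "f \<in> B")
    case True
    then have "f \<in> topspace E" using assms(2) unfolding bounded_sets_iff by blast
    then show ?thesis using q(2)[of f] C[OF True] by simp
  next
    case False
    then show ?thesis using that in_dualD(4)[OF assms(1)] by simp
  qed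
  then show ?thesis by (intro bdd_aboveI2)
qed

lemma polar_seminorm_upper:
  assumes "u \<in> dual E" "B \<in> bounded_sets E" "f \<in> B"
  shows "cmod (u f) \<le> polar_seminorm B u"
  unfolding polar_seminorm_def by (intro cSUP_upper dual_bounded_on assms) (use assms in auto)

lemma polar_seminorm_le_iff:
  assumes "u \<in> dual E" "B \<in> bounded_sets E" "C \<ge> 0"
  shows "polar_seminorm B u \<le> C \<longleftrightarrow> (\<forall>f\<in>B. cmod (u f) \<le> C)"
  unfolding polar_seminorm_def
  by (subst cSUP_le_iff[OF _ dual_bounded_on[OF assms(1,2)]]) (use assms in_dualD(4)[OF assms(1)] in auto)

lemma polar_seminorm_nonneg:
  assumes "u \<in> dual E" "B \<in> bounded_sets E"
  shows "0 \<le> polar_seminorm B u"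
  unfolding polar_seminorm_def
  using cSUP_upper[OF _ dual_bounded_on[OF assms], of 0] in_dualD(4)[OF assms(1)] by auto

lemma bounded_sets_scale:
  assumes "B \<in> bounded_sets E"
  shows "(\<lambda>f x. c * f x) ` B \<in> bounded_sets E"
  unfolding bounded_sets_iff
proof safe
  fix f assume "f \<in> B" then show "(\<lambda>x. c * f x) \<in> topspace E"
    using assms lin_simps(3) unfolding bounded_sets_iff by auto
next
  fix q assume q: "q \<in> Q"
  then obtain C where C: "\<And>f. f \<in> B \<Longrightarrow> q f \<le> C" using assms unfolding bounded_sets_iff by blast
  have "q (\<lambda>x. c * f x) \<le> cmod c * C" if "f \<in> B" for f
  proof -
    have "f \<in> topspace E" using that assms unfolding bounded_sets_iff by blast
    then show ?thesis
      using seminorm_onD(3)[OF seminorm[OF q], of f c] C[OF that] by (simp add: mult_left_mono)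
  qed
  then show "\<exists>C. \<forall>f\<in>(\<lambda>f x. c * f x) ` B. q f \<le> C" by blast
qed

lemma seminorm_polar:
  assumes B: "B \<in> bounded_sets E"
  shows "seminorm_on (dual E) (polar_seminorm B)"
proof -
  have le: "polar_seminorm B (\<lambda>f. c * u f) \<le> cmod c * polar_seminorm B u" if u: "u \<in> dual E" for c u
    using polar_seminorm_upper[OF u B] polar_seminorm_nonneg[OF u B]
    by (subst polar_seminorm_le_iff[OF lin_subspaceD(3)[OF lin_subspace_dual u] B])
      (auto simp: norm_mult intro!: mult_left_mono)
  show ?thesis
  proof (rule seminorm_onI[OF lin_subspace_dual _ _ le])
    show "0 \<le> polar_seminorm B u" if "u \<in> dual E" for u by (rule polar_seminorm_nonneg[OF that B])
    fix u v assume uv: "u \<in> dual E" "v \<in> dual E"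
    have "cmod ((u + v) f) \<le> polar_seminorm B u + polar_seminorm B v" if "f \<in> B" for f
      using polar_seminorm_upper[OF uv(1) B that] polar_seminorm_upper[OF uv(2) B that]
        norm_triangle_ineq[of "u f" "v f"] by simp
    then show "polar_seminorm B (u + v) \<le> polar_seminorm B u + polar_seminorm B v"
      using uv B polar_seminorm_nonneg
      by (subst polar_seminorm_le_iff[OF lin_subspaceD(2)[OF lin_subspace_dual uv] B]) auto
  qed
qed

text \<open>Scalars move between functional and test function: \<open>c * polar_seminorm B\<close>
  is dominated by the polar of \<open>c B\<close>, so the bounded sets themselves provide all radii,
  and a ball of radius \<open>e\<close> in the complex plane is traded for the set \<open>B\<close>
  divided by \<open>e\<close>.\<close>

lemma seminormed_strong_dual: "seminormed (strong_dual E) (polar_seminorm ` bounded_sets E)"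
proof
  show "lin_subspace (topspace (strong_dual E))"
    unfolding topspace_strong_dual by (rule lin_subspace_dual)
  show "polar_seminorm ` bounded_sets E \<noteq> {}" using bounded_sets_nonempty by blast
  show "\<And>q. q \<in> polar_seminorm ` bounded_sets E \<Longrightarrow> seminorm_on (topspace (strong_dual E)) q"
    unfolding topspace_strong_dual using seminorm_polar by blast
next
  fix p q assume "p \<in> polar_seminorm ` bounded_sets E" "q \<in> polar_seminorm ` bounded_sets E"
  then obtain A B where AB: "A \<in> bounded_sets E" "B \<in> bounded_sets E" "p = polar_seminorm A" "q = polar_seminorm B"
    by blast
  have "p u \<le> polar_seminorm (A \<union> B) u \<and> q u \<le> polar_seminorm (A \<union> B) u" if u: "u \<in> dual E" for u
    unfolding AB using polar_seminorm_upper[OF u bounded_sets_Un[OF AB(1,2)]]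
      polar_seminorm_nonneg[OF u bounded_sets_Un[OF AB(1,2)]]
    by (simp add: polar_seminorm_le_iff[OF u AB(1)] polar_seminorm_le_iff[OF u AB(2)])
  then show "\<exists>r\<in>polar_seminorm ` bounded_sets E. \<forall>f\<in>topspace (strong_dual E). p f \<le> r f \<and> q f \<le> r f"
    unfolding topspace_strong_dual using bounded_sets_Un[OF AB(1,2)] by blast
next
  fix q and c :: real assume "q \<in> polar_seminorm ` bounded_sets E" and c: "c > 0"
  then obtain B where B: "B \<in> bounded_sets E" "q = polar_seminorm B" by blast
  let ?B = "(\<lambda>f x. of_real c * f x) ` B"
  have B': "?B \<in> bounded_sets E" by (rule bounded_sets_scale[OF B(1)])
  have "c * q u \<le> polar_seminorm ?B u" if u: "u \<in> dual E" for u
  proof -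
    have "q u \<le> polar_seminorm ?B u / c"
      unfolding B(2)
    proof (subst polar_seminorm_le_iff[OF u B(1)])
      show "0 \<le> polar_seminorm ?B u / c" using polar_seminorm_nonneg[OF u B'] c by simp
      show "\<forall>f\<in>B. cmod (u f) \<le> polar_seminorm ?B u / c"
      proof
        fix f assume f: "f \<in> B"
        have "cmod (u (\<lambda>x. of_real c * f x)) \<le> polar_seminorm ?B u"
          by (rule polar_seminorm_upper[OF u B']) (use f in blast)
        then show "cmod (u f) \<le> polar_seminorm ?B u / c"
          using in_dualD(2)[OF u, of f "of_real c"] f B(1) c unfolding bounded_sets_iff
          by (auto simp: norm_mult field_simps)
      qed
    qed
    then show ?thesis using c by (simp add: field_simps)
  qed
  then show "\<exists>r\<in>polar_seminorm ` bounded_sets E. \<forall>f\<in>topspace (strong_dual E). c * q f \<le> r f"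
    unfolding topspace_strong_dual using B' by blast
next
  fix W
  have op: "openin (strong_dual E) W \<longleftrightarrow> W \<subseteq> dual E \<and> (\<forall>u\<in>W. \<exists>B\<in>bounded_sets E. \<exists>U. openin euclidean U \<and> 0 \<in> U \<and>
      {v \<in> dual E. \<forall>x\<in>B. v x - u x \<in> U} \<subseteq> W)"
    unfolding strong_dual_def
    by (rule openin_uniform_topology) (auto simp: bounded_sets_nonempty bounded_sets_Un)
  have "(\<exists>B\<in>bounded_sets E. \<exists>U. openin euclidean U \<and> 0 \<in> U \<and> {v \<in> dual E. \<forall>x\<in>B. v x - u x \<in> U} \<subseteq> W) \<longleftrightarrow>
    (\<exists>B\<in>bounded_sets E. {v \<in> dual E. polar_seminorm B (v - u) < 1} \<subseteq> W)" if u: "u \<in> dual E" for u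
  proof safe
    fix B and U :: "complex set" assume B: "B \<in> bounded_sets E" and U: "openin euclidean U" "0 \<in> U"
      and W: "{v \<in> dual E. \<forall>x\<in>B. v x - u x \<in> U} \<subseteq> W"
    obtain e where e: "e > 0" "ball 0 e \<subseteq> U" using U open_contains_ball[of U] by auto
    let ?B = "(\<lambda>f x. of_real (1/e) * f x) ` B"
    have B': "?B \<in> bounded_sets E" by (rule bounded_sets_scale[OF B])
    have "v x - u x \<in> U" if v: "v \<in> dual E" "polar_seminorm ?B (v - u) < 1" "x \<in> B" for v x
    proof -
      have vu: "v - u \<in> dual E" using lin_subspaceD(5)[OF lin_subspace_dual v(1) u] .
      have x: "x \<in> topspace E" using B v(3) unfolding bounded_sets_iff by auto
      have "cmod ((v - u) (\<lambda>y. of_real (1/e) * x y)) < 1"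
        using polar_seminorm_upper[OF vu B', of "\<lambda>y. of_real (1/e) * x y"] v(2,3) by fastforce
      then have "cmod (of_real (1/e) * (v - u) x) < 1"
        using in_dualD(2)[OF vu x, of "of_real (1/e)"] by metis
      then have "cmod (v x - u x) < e" using e(1) by (simp add: norm_mult norm_divide)
      then show ?thesis using e(2) by (auto simp: dist_norm norm_minus_commute)
    qed
    then have "{v \<in> dual E. polar_seminorm ?B (v - u) < 1} \<subseteq> W" using W by blast
    then show "\<exists>B\<in>bounded_sets E. {v \<in> dual E. polar_seminorm B (v - u) < 1} \<subseteq> W" using B' by blast
  next
    fix B assume B: "B \<in> bounded_sets E" and W: "{v \<in> dual E. polar_seminorm B (v - u) < 1} \<subseteq> W"
    \<comment> \<open>Radius 1/2, because a supremum of values below 1 can equal 1.\<close>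
    have "polar_seminorm B (v - u) < 1" if v: "v \<in> dual E" "\<forall>x\<in>B. v x - u x \<in> ball 0 (1/2)" for v
    proof -
      have vu: "v - u \<in> dual E" using lin_subspaceD(5)[OF lin_subspace_dual v(1) u] .
      have "polar_seminorm B (v - u) \<le> 1/2"
        using v(2) by (subst polar_seminorm_le_iff[OF vu B]) (auto intro: less_imp_le)
      then show ?thesis by simp
    qed
    then have "{v \<in> dual E. \<forall>x\<in>B. v x - u x \<in> ball 0 (1/2)} \<subseteq> W" using W by blast
    then show "\<exists>B\<in>bounded_sets E. \<exists>U. openin euclidean U \<and> 0 \<in> U \<and> {v \<in> dual E. \<forall>x\<in>B. v x - u x \<in> U} \<subseteq> W"
      using B by (intro bexI[of _ B] exI[of _ "ball 0 (1/2)"]) auto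
  qed
  then show "openin (strong_dual E) W \<longleftrightarrow> W \<subseteq> topspace (strong_dual E) \<and>
    (\<forall>f\<in>W. \<exists>q\<in>polar_seminorm ` bounded_sets E. {g \<in> topspace (strong_dual E). q (g - f) < 1} \<subseteq> W)"
    unfolding op topspace_strong_dual bex_simps by blast
qed

section \<open>Limits and mean ergodicity expressed by seminorms\<close>

lemma operatorsD:
  assumes "A \<in> operators E"
  shows "f \<in> topspace E \<Longrightarrow> A f \<in> topspace E" "lin_on (topspace E) A" "f \<notin> topspace E \<Longrightarrow> A f = 0"
  using assms unfolding operators_def continuous_map by auto

lemma limitin_iff_seminorm:
  "limitin E X l F \<longleftrightarrow> l \<in> topspace E \<and>
     (\<forall>q\<in>Q. \<forall>e>0. \<forall>\<^sub>F n in F. X n \<in> topspace E \<and> q (X n - l) < e)"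
proof safe
  assume lim: "limitin E X l F"
  then show l: "l \<in> topspace E" by (simp add: limitin_def)
  fix q and e :: real assume "q \<in> Q" "e > 0"
  then show "\<forall>\<^sub>F n in F. X n \<in> topspace E \<and> q (X n - l) < e"
    using limitinD[OF lim openin_ball[OF _ l]] l seminorm_on_zero[OF seminorm lin]
    by (fastforce elim: eventually_mono)
next
  assume l: "l \<in> topspace E" and *: "\<forall>q\<in>Q. \<forall>e>0. \<forall>\<^sub>F n in F. X n \<in> topspace E \<and> q (X n - l) < e"
  show "limitin E X l F"
    unfolding limitin_def
  proof (intro conjI allI impI l)
    fix U assume "openin E U \<and> l \<in> U"
    then obtain q where q: "q \<in> Q" "{g \<in> topspace E. q (g - l) < 1} \<subseteq> U" unfolding openin_iff by blast
    show "\<forall>\<^sub>F n in F. X n \<in> U"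
      using *[rule_format, OF q(1), of 1] q(2) by (auto elim: eventually_mono)
  qed
qed

text \<open>Evaluation at \<open>f\<close> is continuous as soon as the family contains the
  singleton of \<open>f\<close>; this serves finite and bounded subsets alike.\<close>

lemma limitin_uniform_topology_pointwise:
  assumes H: "H \<subseteq> operators E" and f: "f \<in> topspace E" "{f} \<in> \<B>" and un: "\<And>A B. A \<in> \<B> \<Longrightarrow> B \<in> \<B> \<Longrightarrow> A \<union> B \<in> \<B>"
    and lim: "limitin (uniform_topology H \<B> E) X l F"
  shows "limitin E (\<lambda>n. X n f) (l f) F"
proof -
  have op: "openin (uniform_topology H \<B> E) W \<longleftrightarrow>
      W \<subseteq> H \<and> (\<forall>u\<in>W. \<exists>B\<in>\<B>. \<exists>U. openin E U \<and> 0 \<in> U \<and> {v \<in> H. \<forall>x\<in>B. v x - u x \<in> U} \<subseteq> W)" for W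
    by (rule openin_uniform_topology) (use f un lin_simps in auto)
  have ts: "topspace (uniform_topology H \<B> E) = H"
    by (rule topspace_uniform_topology) (use f un lin_simps in auto)
  have l: "l \<in> H" using lim ts by (simp add: limitin_def)
  have HV: "v f \<in> topspace E" if "v \<in> H" for v using H that operatorsD(1) f by blast
  show ?thesis
    unfolding limitin_def
  proof (intro conjI allI impI HV l)
    fix U assume U: "openin E U \<and> l f \<in> U"
    have "openin (uniform_topology H \<B> E) {v \<in> H. v f \<in> U}"
      unfolding op
    proof (intro conjI ballI)
      fix u assume "u \<in> {v \<in> H. v f \<in> U}"
      then have u: "u \<in> H" "u f \<in> U" by auto
      then obtain q where q: "q \<in> Q" "{g \<in> topspace E. q (g - u f) < 1} \<subseteq> U"
        using U unfolding openin_iff by blast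
      have "{v \<in> H. \<forall>x\<in>{f}. v x - u x \<in> {g \<in> topspace E. q g < 1}} \<subseteq> {v \<in> H. v f \<in> U}"
        using q(2) HV by auto
      then show "\<exists>B\<in>\<B>. \<exists>U'. openin E U' \<and> 0 \<in> U' \<and> {v \<in> H. \<forall>x\<in>B. v x - u x \<in> U'} \<subseteq> {v \<in> H. v f \<in> U}"
        using openin_unit_ball[OF q(1), of 1] f(2)
        by (intro bexI[of _ "{f}"] exI[of _ "{g \<in> topspace E. q g < 1}"]) auto
    qed auto
    then show "\<forall>\<^sub>F n in F. X n f \<in> U"
      using limitinD[OF lim, of "{v \<in> H. v f \<in> U}"] U l by (auto elim: eventually_mono)
  qed
qed

text \<open>All that the implications from ergodicity use, in either reading: orbitwise convergence
  of the means.\<close>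

lemma mean_ergodic_pointwise:
  assumes "mean_ergodic E A \<or> uniformly_mean_ergodic E A" "f \<in> topspace E"
  shows "\<exists>l. limitin E (\<lambda>n. cesaro_mean A n f) l sequentially"
proof -
  have "{f} \<in> finite_subsets E" using assms(2) by (simp add: finite_subsets_def)
  then have "{f} \<in> bounded_sets E" "{f} \<in> finite_subsets E" by (auto intro: finite_subset_bounded)
  then show ?thesis
    using assms limitin_uniform_topology_pointwise[of "operators E" f "bounded_sets E"]
      limitin_uniform_topology_pointwise[of "operators E" f "finite_subsets E"]
    unfolding mean_ergodic_def uniformly_mean_ergodic_def convergent_in_def operators_b_def operators_s_def
    by (fastforce simp: finite_subsets_def bounded_sets_Un)
qed

text \<open>Finite sets are bounded, so one uniform estimate yields both readings at once.\<close>

lemma uniformly_mean_ergodicI: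
  assumes A: "A \<in> operators E" and P: "P \<in> operators E"
    and X: "\<forall>\<^sub>F n in sequentially. cesaro_mean A n \<in> operators E"
    and lim: "\<And>B q e. B \<in> bounded_sets E \<Longrightarrow> q \<in> Q \<Longrightarrow> e > 0 \<Longrightarrow>
        \<forall>\<^sub>F n in sequentially. \<forall>f\<in>B. q (cesaro_mean A n f - P f) < e"
  shows "mean_ergodic E A \<and> uniformly_mean_ergodic E A"
proof -
  have *: "limitin (uniform_topology (operators E) \<B> E) (cesaro_mean A) P sequentially"
    if ne: "\<B> \<noteq> {}" and un: "\<And>A B. A \<in> \<B> \<Longrightarrow> B \<in> \<B> \<Longrightarrow> A \<union> B \<in> \<B>" and bd: "\<B> \<subseteq> bounded_sets E" for \<B>
  proof -
    have op: "openin (uniform_topology (operators E) \<B> E) W \<longleftrightarrow>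
      W \<subseteq> operators E \<and> (\<forall>u\<in>W. \<exists>B\<in>\<B>. \<exists>U. openin E U \<and> 0 \<in> U \<and> {v \<in> operators E. \<forall>x\<in>B. v x - u x \<in> U} \<subseteq> W)" for W
      by (rule openin_uniform_topology) (use ne un lin_simps in auto)
    have ts: "topspace (uniform_topology (operators E) \<B> E) = operators E"
      by (rule topspace_uniform_topology) (use ne un lin_simps in auto)
    show ?thesis
      unfolding limitin_def ts
    proof (intro conjI allI impI P)
      fix W assume "openin (uniform_topology (operators E) \<B> E) W \<and> P \<in> W"
      then obtain B U where BU: "B \<in> \<B>" "openin E U" "0 \<in> U" "{v \<in> operators E. \<forall>x\<in>B. v x - P x \<in> U} \<subseteq> W"
        unfolding op by blast
      obtain q where q: "q \<in> Q" "{g \<in> topspace E. q g < 1} \<subseteq> U" using nhd_seminorm[OF BU(2,3)] by blast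
      have B: "B \<in> bounded_sets E" using bd BU(1) by blast
      show "\<forall>\<^sub>F n in sequentially. cesaro_mean A n \<in> W"
        using X lim[OF B q(1) zero_less_one]
      proof eventually_elim
        case (elim n)
        have "cesaro_mean A n f - P f \<in> U" if f: "f \<in> B" for f
          using elim(2) f q(2) lin_simps(5)[OF operatorsD(1)[OF elim(1)] operatorsD(1)[OF P]] B
          unfolding bounded_sets_iff by blast
        then show ?case using BU(4) elim(1) by blast
      qed
    qed
  qed
  have "limitin (operators_s E) (cesaro_mean A) P sequentially"
    unfolding operators_s_def
    by (rule *) (auto simp: finite_subsets_def intro!: finite_subset_bounded)
  moreover have "limitin (operators_b E) (cesaro_mean A) P sequentially"
    unfolding operators_b_def by (rule *) (auto simp: bounded_sets_nonempty bounded_sets_Un)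
  ultimately show ?thesis
    unfolding mean_ergodic_def uniformly_mean_ergodic_def convergent_in_def using A by blast
qed

end

section \<open>Smooth functions\<close>

lemma iter_deriv_0 [simp]: "iter_deriv 0 f = f"
  by (simp add: iter_deriv_def)

lemma iter_deriv_Suc: "iter_deriv (Suc i) f = (\<lambda>x. vector_derivative (iter_deriv i f) (at x))"
  by (simp add: iter_deriv_def)

lemma smoothD:
  assumes "smooth f"
  shows "(iter_deriv i f has_vector_derivative iter_deriv (Suc i) f x) (at x)"
  using assms unfolding iter_deriv_Suc smooth_def by (simp add: vector_derivative_works)

text \<open>Exhibiting the whole sequence of derivatives at once proves smoothness and identifies
  \<open>iter_deriv\<close>; most calculus rules below are instances.\<close>

lemma
  assumes "\<And>i x. (g i has_vector_derivative g (Suc i) x) (at x)"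
  shows smooth_chain: "smooth (g 0)"
    and iter_deriv_chain: "iter_deriv i (g 0) = g i"
proof -
  show *: "iter_deriv i (g 0) = g i" for i
  proof (induction i)
    case (Suc i)
    then show ?case unfolding iter_deriv_Suc by (auto intro!: vector_derivative_at assms)
  qed simp
  show "smooth (g 0)"
    unfolding smooth_def * using assms differentiableI_vector by blast
qed

lemma
  assumes "\<And>i x. (g i has_vector_derivative g (Suc i) x) (at x)" "f = g 0"
  shows smooth_chainI: "smooth f"
    and iter_deriv_chainI: "iter_deriv i f = g i"
  using smooth_chain[of g, OF assms(1)] iter_deriv_chain[of g, OF assms(1)] assms(2) by auto

lemma continuous_iter_deriv: "smooth f \<Longrightarrow> continuous_on A (iter_deriv i f)"
  by (meson smoothD continuous_at_imp_continuous_on has_vector_derivative_continuous)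

lemma
  assumes f: "smooth f" and g: "smooth g"
  shows smooth_add: "smooth (f + g)"
    and iter_deriv_add: "iter_deriv i (f + g) = iter_deriv i f + iter_deriv i g"
proof -
  have "((iter_deriv i f + iter_deriv i g) has_vector_derivative (iter_deriv (Suc i) f + iter_deriv (Suc i) g) x) (at x)" for i x
    using smoothD[OF f, of i x] smoothD[OF g, of i x] unfolding plus_fun_def
    by (rule has_vector_derivative_add)
  note * = smooth_chainI[of "\<lambda>i. iter_deriv i f + iter_deriv i g", OF this]
    iter_deriv_chainI[of "\<lambda>i. iter_deriv i f + iter_deriv i g", OF this]
  show "smooth (f + g)" "iter_deriv i (f + g) = iter_deriv i f + iter_deriv i g"
    using * by simp_all
qed

lemma
  assumes f: "smooth f"
  shows smooth_cmult: "smooth (\<lambda>x. c * f x)"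
    and iter_deriv_cmult: "iter_deriv i (\<lambda>x. c * f x) = (\<lambda>x. c * iter_deriv i f x)"
proof -
  have "((\<lambda>x. c * iter_deriv i f x) has_vector_derivative c * iter_deriv (Suc i) f x) (at x)" for i x
    using smoothD[OF f, of i x] by (rule has_vector_derivative_mult_right)
  note * = smooth_chainI[of "\<lambda>i x. c * iter_deriv i f x", OF this]
    iter_deriv_chainI[of "\<lambda>i x. c * iter_deriv i f x", OF this]
  show "smooth (\<lambda>x. c * f x)" "iter_deriv i (\<lambda>x. c * f x) = (\<lambda>x. c * iter_deriv i f x)"
    using * by simp_all
qed

lemma smooth_zero: "smooth 0" and iter_deriv_zero: "iter_deriv i 0 = 0"
proof -
  have *: "((0 :: real \<Rightarrow> complex) has_vector_derivative 0) (at x)" for x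
    unfolding zero_fun_def by (rule has_vector_derivative_const)
  show "smooth 0" "iter_deriv i 0 = 0"
    using smooth_chainI[of "\<lambda>i. 0" 0] iter_deriv_chainI[of "\<lambda>i. 0" 0 i] * by simp_all
qed

lemma
  assumes f: "smooth f" and g: "smooth g"
  shows smooth_diff: "smooth (f - g)"
    and iter_deriv_diff: "iter_deriv i (f - g) = iter_deriv i f - iter_deriv i g"
proof -
  have eq: "f - g = f + (\<lambda>x. (-1) * g x)" by (auto simp: fun_eq_iff)
  show "smooth (f - g)" unfolding eq by (intro smooth_add smooth_cmult f g)
  show "iter_deriv i (f - g) = iter_deriv i f - iter_deriv i g"
    unfolding eq iter_deriv_add[OF f smooth_cmult[OF g]] iter_deriv_cmult[OF g]
    by (auto simp: fun_eq_iff)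
qed

lemma
  assumes f: "smooth f"
  shows smooth_affine: "smooth (\<lambda>x. f (a + s * x))"
    and iter_deriv_affine: "iter_deriv i (\<lambda>x. f (a + s * x)) = (\<lambda>x. of_real s ^ i * iter_deriv i f (a + s * x))"
proof -
  have "((\<lambda>x. of_real s ^ i * iter_deriv i f (a + s * x)) has_vector_derivative
      of_real s ^ Suc i * iter_deriv (Suc i) f (a + s * x)) (at x)" for i x
  proof -
    have "((\<lambda>x. a + s * x) has_vector_derivative s) (at x)"
      by (auto intro!: derivative_eq_intros)
    then have "((iter_deriv i f \<circ> (\<lambda>x. a + s * x)) has_vector_derivative s *\<^sub>R iter_deriv (Suc i) f (a + s * x)) (at x)"
      by (rule vector_diff_chain_at[OF _ smoothD[OF f]])
    from has_vector_derivative_mult_right[OF this, of "of_real s ^ i"]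
    show ?thesis by (simp add: o_def scaleR_conv_of_real algebra_simps)
  qed
  note * = smooth_chainI[of "\<lambda>i x. of_real s ^ i * iter_deriv i f (a + s * x)", OF this]
    iter_deriv_chainI[of "\<lambda>i x. of_real s ^ i * iter_deriv i f (a + s * x)", OF this]
  show "smooth (\<lambda>x. f (a + s * x))" "iter_deriv i (\<lambda>x. f (a + s * x)) = (\<lambda>x. of_real s ^ i * iter_deriv i f (a + s * x))"
    using * by simp_all
qed

lemma
  assumes "smooth f"
  shows smooth_reflect: "smooth (\<lambda>y. f (x - y))"
    and cmod_iter_deriv_reflect: "cmod (iter_deriv i (\<lambda>y. f (x - y)) y) = cmod (iter_deriv i f (x - y))"
    and iter_deriv_reflect: "iter_deriv i (\<lambda>y. f (x - y)) y = (- 1) ^ i * iter_deriv i f (x - y)"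
  using smooth_affine[OF assms, of x "-1"] iter_deriv_affine[OF assms, of i x "-1"]
  by (simp_all add: norm_mult norm_power)

lemma
  assumes "smooth f"
  shows smooth_translate: "smooth (\<lambda>y. f (x + y))"
    and iter_deriv_translate: "iter_deriv i (\<lambda>y. f (x + y)) y = iter_deriv i f (x + y)"
  using smooth_affine[OF assms, of x 1] iter_deriv_affine[OF assms, of i x 1] by simp_all

lemma
  assumes "smooth f"
  shows smooth_iter_deriv: "smooth (iter_deriv k f)"
    and iter_deriv_iter_deriv: "iter_deriv i (iter_deriv k f) = iter_deriv (k + i) f"
proof -
  have "(iter_deriv (k + i) f has_vector_derivative iter_deriv (k + Suc i) f x) (at x)" for i x
    using smoothD[OF assms, of "k + i" x] by simp
  note * = smooth_chainI[of "\<lambda>i. iter_deriv (k + i) f", OF this]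
    iter_deriv_chainI[of "\<lambda>i. iter_deriv (k + i) f", OF this]
  show "smooth (iter_deriv k f)" "iter_deriv i (iter_deriv k f) = iter_deriv (k + i) f"
    by (rule *, simp)+
qed

text \<open>The recursion is the product rule applied inside each factor, so no binomial coefficients occur.\<close>

fun leibniz :: "nat \<Rightarrow> (nat \<Rightarrow> real \<Rightarrow> complex) \<Rightarrow> (nat \<Rightarrow> real \<Rightarrow> complex) \<Rightarrow> real \<Rightarrow> complex" where
  "leibniz 0 F G = (\<lambda>x. F 0 x * G 0 x)"
| "leibniz (Suc i) F G = (\<lambda>x. leibniz i (\<lambda>a. F (Suc a)) G x + leibniz i F (\<lambda>a. G (Suc a)) x)"

lemma leibniz_derivative:
  assumes "\<And>i x. (F i has_vector_derivative F (Suc i) x) (at x)"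
    and "\<And>i x. (G i has_vector_derivative G (Suc i) x) (at x)"
  shows "(leibniz i F G has_vector_derivative leibniz (Suc i) F G x) (at x)"
  using assms
proof (induction i arbitrary: F G)
  case 0
  show ?case
    using has_vector_derivative_mult[OF 0(1)[of 0 x] 0(2)[of 0 x]] by (simp add: add.commute)
next
  case (Suc i)
  have "(leibniz i (\<lambda>a. F (Suc a)) G has_vector_derivative leibniz (Suc i) (\<lambda>a. F (Suc a)) G x) (at x)"
    "(leibniz i F (\<lambda>a. G (Suc a)) has_vector_derivative leibniz (Suc i) F (\<lambda>a. G (Suc a)) x) (at x)"
    by (rule Suc.IH, rule Suc.prems(1), rule Suc.prems(2))+
  from has_vector_derivative_add[OF this] show ?case by simp
qed

text \<open>Each unfolding doubles the number of products, so there are \<open>2 ^ i\<close> of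
  them, each at most \<open>A * B\<close>.\<close>

lemma leibniz_bound:
  assumes "\<And>a. a \<le> i \<Longrightarrow> cmod (F a x) \<le> A" "\<And>a. a \<le> i \<Longrightarrow> cmod (G a x) \<le> B"
  shows "cmod (leibniz i F G x) \<le> 2 ^ i * (A * B)"
  using assms
proof (induction i arbitrary: F G)
  case 0
  have "A \<ge> 0" using 0(1)[of 0] norm_ge_zero order_trans by blast
  then show ?case using 0 by (auto simp: norm_mult intro!: mult_mono)
next
  case (Suc i)
  have "cmod (leibniz i (\<lambda>a. F (Suc a)) G x) \<le> 2 ^ i * (A * B)"
    "cmod (leibniz i F (\<lambda>a. G (Suc a)) x) \<le> 2 ^ i * (A * B)"
    by (rule Suc.IH; use Suc.prems in simp)+
  then show ?case
    using norm_triangle_ineq[of "leibniz i (\<lambda>a. F (Suc a)) G x" "leibniz i F (\<lambda>a. G (Suc a)) x"]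
    by simp
qed

lemma
  assumes f: "smooth f" and g: "smooth g"
  shows smooth_mult: "smooth (\<lambda>x. f x * g x)"
    and iter_deriv_mult: "iter_deriv i (\<lambda>x. f x * g x) = leibniz i (\<lambda>a. iter_deriv a f) (\<lambda>a. iter_deriv a g)"
proof -
  note * = leibniz_derivative[of "\<lambda>a. iter_deriv a f" "\<lambda>a. iter_deriv a g", OF smoothD[OF f] smoothD[OF g]]
  show "smooth (\<lambda>x. f x * g x)"
    by (rule smooth_chainI[of "\<lambda>i. leibniz i (\<lambda>a. iter_deriv a f) (\<lambda>a. iter_deriv a g)", OF *]) simp
  show "iter_deriv i (\<lambda>x. f x * g x) = leibniz i (\<lambda>a. iter_deriv a f) (\<lambda>a. iter_deriv a g)"
    by (rule iter_deriv_chainI[of "\<lambda>i. leibniz i (\<lambda>a. iter_deriv a f) (\<lambda>a. iter_deriv a g)", OF *]) simp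
qed

lemma cmod_iter_deriv_mult_le:
  assumes "smooth f" "smooth g"
    and "\<And>a. a \<le> i \<Longrightarrow> cmod (iter_deriv a f x) \<le> A" "\<And>a. a \<le> i \<Longrightarrow> cmod (iter_deriv a g x) \<le> B"
  shows "cmod (iter_deriv i (\<lambda>x. f x * g x) x) \<le> 2 ^ i * (A * B)"
  unfolding iter_deriv_mult[OF assms(1,2)] using assms(3,4) by (rule leibniz_bound)

lemma iter_deriv_eq_on_open:
  assumes "open U" "\<And>x. x \<in> U \<Longrightarrow> f x = g x" "x \<in> U"
  shows "iter_deriv i f x = iter_deriv i g x"
  using assms(3)
proof (induction i arbitrary: x)
  case (Suc i)
  have "\<forall>\<^sub>F y in nhds x. iter_deriv i f y = iter_deriv i g y"
    using Suc assms(1) unfolding eventually_nhds by blast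
  then show ?case
    unfolding iter_deriv_Suc using Suc.IH[OF Suc.prems] by (intro vector_derivative_cong_eq) (auto simp: eventually_at_filter elim: eventually_mono)
qed (use assms in simp)

section \<open>Weighted supremum norms\<close>

definition wt :: "real \<Rightarrow> real" where
  "wt x = 1 + x\<^sup>2"

lemma wt_ge_1: "1 \<le> wt x" and wt_pos: "0 < wt x" and wt_0 [simp]: "wt 0 = 1" and wt_minus [simp]: "wt (- x) = wt x"
  by (auto simp: wt_def add_pos_nonneg)

lemma wt_power_ge_1: "1 \<le> wt x ^ k" and wt_power_pos: "0 < wt x ^ k"
  using wt_ge_1[of x] wt_pos[of x] by auto

lemma wt_power_mono: "k \<le> l \<Longrightarrow> wt x ^ k \<le> wt x ^ l"
  using wt_ge_1 by (intro power_increasing)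

text \<open>Peetre's inequality. The right side minus the left side is
  \<open>(x - y)\<^sup>2 + 2 * x\<^sup>2 * y\<^sup>2 + 1\<close>. Every estimate for translates and
  convolutions rests on it.\<close>

lemma wt_add_le: "wt (x + y) \<le> 2 * wt x * wt y"
proof -
  have "0 \<le> (x - y)\<^sup>2 + 2 * x\<^sup>2 * y\<^sup>2 + 1" by simp
  then show ?thesis unfolding wt_def by (simp add: power2_eq_square algebra_simps)
qed

lemma wt_add_power_le: "wt (x + y) ^ k \<le> 2 ^ k * wt x ^ k * wt y ^ k"
  using power_mono[OF wt_add_le[of x y], of k] wt_pos[of "x + y"] by (simp add: power_mult_distrib)

lemma wt_diff_power_le: "wt (x - y) ^ k \<le> 2 ^ k * wt x ^ k * wt y ^ k"
  using wt_add_power_le[of x "- y"] by simp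

text \<open>The common shape of \<open>schwartz_norm\<close> and \<open>oc_norm\<close>, so that
  both are handled by one set of lemmas.\<close>

definition wnorm :: "(real \<Rightarrow> real) \<Rightarrow> nat \<Rightarrow> (real \<Rightarrow> complex) \<Rightarrow> ennreal" where
  "wnorm W m f = (SUP x. SUP i\<in>{0..m}. ennreal (W x * cmod (iter_deriv i f x)))"

lemma schwartz_norm_eq_wnorm: "schwartz_norm n f = wnorm (\<lambda>x. wt x ^ n) n f"
  by (simp add: schwartz_norm_def wnorm_def wt_def)

lemma oc_norm_eq_wnorm: "oc_norm m n f = wnorm (\<lambda>x. 1 / wt x ^ n) m f"
  by (simp add: oc_norm_def wnorm_def wt_def)

lemma wnorm_le_iff:
  assumes "0 \<le> c"
  shows "wnorm W m f \<le> ennreal c \<longleftrightarrow> (\<forall>x. \<forall>i\<le>m. W x * cmod (iter_deriv i f x) \<le> c)"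
  using assms by (auto simp: wnorm_def SUP_le_iff ennreal_le_iff)

lemma wnorm_finite_iff:
  "wnorm W m f < \<infinity> \<longleftrightarrow> (\<exists>c. \<forall>x. \<forall>i\<le>m. W x * cmod (iter_deriv i f x) \<le> c)"
proof
  assume "wnorm W m f < \<infinity>"
  then obtain c where "0 \<le> c" "wnorm W m f = ennreal c" by (cases "wnorm W m f") auto
  then show "\<exists>c. \<forall>x. \<forall>i\<le>m. W x * cmod (iter_deriv i f x) \<le> c"
    using wnorm_le_iff[of c W m f] by (intro exI[of _ c]) simp
next
  assume "\<exists>c. \<forall>x. \<forall>i\<le>m. W x * cmod (iter_deriv i f x) \<le> c"
  then obtain c where c: "\<forall>x. \<forall>i\<le>m. W x * cmod (iter_deriv i f x) \<le> c" by blast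
  then have "\<forall>x. \<forall>i\<le>m. W x * cmod (iter_deriv i f x) \<le> max 0 c" by (auto simp: le_max_iff_disj)
  then have "wnorm W m f \<le> ennreal (max 0 c)" by (subst wnorm_le_iff) auto
  also have "\<dots> < \<infinity>" by simp
  finally show "wnorm W m f < \<infinity>" .
qed

text \<open>An infinite norm is sent to 0, so this is a norm value only where \<open>wnorm\<close>
  is finite; hence the finiteness assumption in \<open>rnorm_upper\<close>.\<close>

definition rnorm :: "(real \<Rightarrow> real) \<Rightarrow> nat \<Rightarrow> (real \<Rightarrow> complex) \<Rightarrow> real" where
  "rnorm W m f = enn2real (wnorm W m f)"

lemma rnorm_nonneg: "0 \<le> rnorm W m f"
  by (simp add: rnorm_def)

lemma wnorm_eq_rnorm: "wnorm W m f < \<infinity> \<Longrightarrow> wnorm W m f = ennreal (rnorm W m f)"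
  by (simp add: rnorm_def ennreal_enn2real)

lemma rnorm_upper:
  assumes "wnorm W m f < \<infinity>" "i \<le> m"
  shows "W x * cmod (iter_deriv i f x) \<le> rnorm W m f"
  using wnorm_le_iff[of "rnorm W m f" W m f] wnorm_eq_rnorm[OF assms(1)] assms(2) rnorm_nonneg
  by auto

lemma rnorm_leI:
  assumes "\<And>x i. i \<le> m \<Longrightarrow> W x * cmod (iter_deriv i f x) \<le> c" "0 \<le> c"
  shows "rnorm W m f \<le> c"
proof -
  have "wnorm W m f \<le> ennreal c" using assms by (subst wnorm_le_iff) auto
  then show ?thesis unfolding rnorm_def using enn2real_mono[of _ "ennreal c"] assms(2) by force
qed

lemma seminorm_on_rnorm:
  assumes W: "\<And>x. 0 \<le> W x"
    and V: "\<And>f. f \<in> V \<Longrightarrow> smooth f \<and> wnorm W m f < \<infinity>" "lin_subspace V"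
  shows "seminorm_on V (rnorm W m)"
proof -
  have le: "rnorm W m (\<lambda>x. c * f x) \<le> cmod c * rnorm W m f" if f: "f \<in> V" for c f
  proof (rule rnorm_leI)
    fix x i assume "i \<le> m"
    then have "cmod c * (W x * cmod (iter_deriv i f x)) \<le> cmod c * rnorm W m f"
      using rnorm_upper V(1)[OF f] by (intro mult_left_mono) auto
    then show "W x * cmod (iter_deriv i (\<lambda>x. c * f x) x) \<le> cmod c * rnorm W m f"
      using V(1)[OF f] by (simp add: iter_deriv_cmult norm_mult algebra_simps)
  qed (simp add: rnorm_nonneg)
  show ?thesis
  proof (rule seminorm_onI[OF V(2) rnorm_nonneg _ le])
    fix f g assume fg: "f \<in> V" "g \<in> V"
    show "rnorm W m (f + g) \<le> rnorm W m f + rnorm W m g"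
    proof (rule rnorm_leI)
      fix x i assume i: "i \<le> m"
      have "W x * cmod (iter_deriv i (f + g) x) \<le> W x * (cmod (iter_deriv i f x) + cmod (iter_deriv i g x))"
        using V(1) fg W by (intro mult_left_mono) (auto simp: iter_deriv_add norm_triangle_ineq)
      also have "\<dots> \<le> rnorm W m f + rnorm W m g"
        using rnorm_upper[of W m f i x] rnorm_upper[of W m g i x] V(1) fg i by (simp add: distrib_left add_mono)
      finally show "W x * cmod (iter_deriv i (f + g) x) \<le> rnorm W m f + rnorm W m g" .
    qed (simp add: rnorm_nonneg)
  qed
qed

lemma lin_subspace_wnorm:
  assumes W: "\<And>m x. 0 \<le> W m x"
  shows "lin_subspace {f. smooth f \<and> (\<forall>m\<in>I. wnorm (W m) (M m) f < \<infinity>)}"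
  unfolding lin_subspace_def
proof (safe, goal_cases)
  case (2 m)
  show ?case unfolding wnorm_finite_iff by (intro exI[of _ 0]) (simp add: iter_deriv_zero)
next
  case (4 f g m)
  then have "wnorm (W m) (M m) f < \<infinity>" "wnorm (W m) (M m) g < \<infinity>" by auto
  then obtain c d where cd: "\<forall>x. \<forall>i\<le>M m. W m x * cmod (iter_deriv i f x) \<le> c" "\<forall>x. \<forall>i\<le>M m. W m x * cmod (iter_deriv i g x) \<le> d"
    unfolding wnorm_finite_iff by auto
  have "W m x * cmod (iter_deriv i (f + g) x) \<le> c + d" if "i \<le> M m" for x i
  proof -
    have "W m x * cmod (iter_deriv i (f + g) x) \<le> W m x * (cmod (iter_deriv i f x) + cmod (iter_deriv i g x))"
      using 4 W by (intro mult_left_mono) (auto simp: iter_deriv_add norm_triangle_ineq)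
    also have "\<dots> \<le> c + d" using cd that by (simp add: distrib_left add_mono)
    finally show ?thesis .
  qed
  then show ?case unfolding wnorm_finite_iff by blast
next
  case (6 c f m)
  then have "wnorm (W m) (M m) f < \<infinity>" by auto
  then obtain d where d: "\<forall>x. \<forall>i\<le>M m. W m x * cmod (iter_deriv i f x) \<le> d"
    unfolding wnorm_finite_iff by auto
  have "W m x * cmod (iter_deriv i (\<lambda>x. c * f x) x) \<le> cmod c * d" if "i \<le> M m" for x i
  proof -
    have "cmod c * (W m x * cmod (iter_deriv i f x)) \<le> cmod c * d"
      using d that by (intro mult_left_mono) auto
    then show ?thesis using 6 by (simp add: iter_deriv_cmult norm_mult algebra_simps)
  qed
  then show ?case unfolding wnorm_finite_iff by blast
qed (auto intro: smooth_zero smooth_add smooth_cmult)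

text \<open>The generating sets are balls about all centres and of all radii. Monotonicity in the
  index turns finitely many of them into one, and the positive multiples of the norms encode the
  radii.\<close>

lemma
  fixes p :: "nat \<Rightarrow> ('x \<Rightarrow> complex) \<Rightarrow> ennreal"
  assumes V: "lin_subspace V" and I: "I \<noteq> {}" "\<And>i j. i \<in> I \<Longrightarrow> j \<in> I \<Longrightarrow> max i j \<in> I"
    and fin: "\<And>i f. i \<in> I \<Longrightarrow> f \<in> V \<Longrightarrow> p i f < \<infinity>"
    and semi: "\<And>i. i \<in> I \<Longrightarrow> seminorm_on V (\<lambda>f. enn2real (p i f))"
    and mono: "\<And>i j f. i \<le> j \<Longrightarrow> f \<in> V \<Longrightarrow> p i f \<le> p j f"
  shows topspace_seminorm_topology: "topspace (seminorm_topology V I p) = V"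
    and seminormed_seminorm_topology:
      "seminormed (seminorm_topology V I p) {\<lambda>f. c * enn2real (p i f) | c i. c > 0 \<and> i \<in> I}"
proof -
  let ?G = "{{g \<in> V. p i (g - f) < ennreal e} | i f e. i \<in> I \<and> f \<in> V \<and> e > 0}"
  define Q where "Q = {\<lambda>f. c * enn2real (p i f) | c i. c > 0 \<and> i \<in> I}"
  have QI: "(\<lambda>f. c * enn2real (p i f)) \<in> Q" if "c > 0" "i \<in> I" for c i
    unfolding Q_def using that by (intro CollectI exI[of _ c] exI[of _ i]) auto
  have QE: thesis if "q \<in> Q" "\<And>c i. c > 0 \<Longrightarrow> i \<in> I \<Longrightarrow> q = (\<lambda>f. c * enn2real (p i f)) \<Longrightarrow> thesis" for q thesis
    using that(1) unfolding Q_def by (elim CollectE exE conjE) (rule that(2))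
  have less_iff: "p i h < ennreal e \<longleftrightarrow> enn2real (p i h) < e" if "i \<in> I" "h \<in> V" "e > 0" for i h e
    using fin[OF that(1,2)] that(3) by (cases "p i h") (auto simp: ennreal_less_iff)
  have zero: "p i 0 = 0" if "i \<in> I" for i
    using seminorm_on_zero[OF semi[OF that] V] fin[OF that lin_subspaceD(1)[OF V]]
    by (cases "p i 0") (auto simp: enn2real_eq_0_iff)
  have "\<Union>?G = V"
  proof safe
    fix f assume "f \<in> V"
    obtain i where "i \<in> I" using I(1) by blast
    then have "f \<in> {g \<in> V. p i (g - f) < ennreal 1}" using zero \<open>f \<in> V\<close> by simp
    then show "f \<in> \<Union>?G" using \<open>f \<in> V\<close> \<open>i \<in> I\<close> zero_less_one by blast
  qed
  then show ts: "topspace (seminorm_topology V I p) = V"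
    unfolding seminorm_topology_def topology_generated_by_topspace .
  have dir: "\<exists>r\<in>Q. \<forall>f\<in>V. q f \<le> r f \<and> q' f \<le> r f" if q: "q \<in> Q" "q' \<in> Q" for q q'
  proof -
    obtain c i c' i' where ci: "c > 0" "i \<in> I" "q = (\<lambda>f. c * enn2real (p i f))"
      "c' > 0" "i' \<in> I" "q' = (\<lambda>f. c' * enn2real (p i' f))" using QE[OF q(1)] QE[OF q(2)] by metis
    have "q f \<le> (c + c') * enn2real (p (max i i') f) \<and> q' f \<le> (c + c') * enn2real (p (max i i') f)"
      if f: "f \<in> V" for f
      unfolding ci using ci fin[OF I(2)[OF ci(2,5)] f]
      by (auto intro!: mult_mono enn2real_mono mono f)
    moreover have "(\<lambda>f. (c + c') * enn2real (p (max i i') f)) \<in> Q"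
      using ci I(2)[OF ci(2,5)] by (intro QI) auto
    ultimately show ?thesis by (intro bexI[of _ "\<lambda>f. (c + c') * enn2real (p (max i i') f)"]) auto
  qed
  have sq: "seminorm_on V q" if q: "q \<in> Q" for q
  proof -
    obtain c i where "c > 0" "i \<in> I" "q = (\<lambda>f. c * enn2real (p i f))" using QE[OF q] by metis
    then show ?thesis using seminorm_on_scale[OF semi[of i], of c] by simp
  qed
  have "seminormed (seminorm_topology V I p) Q"
  proof
    show "lin_subspace (topspace (seminorm_topology V I p))" unfolding ts by (rule V)
    show "Q \<noteq> {}" using I(1) QI[OF zero_less_one] by blast
    show "seminorm_on (topspace (seminorm_topology V I p)) q" if "q \<in> Q" for q
      unfolding ts using sq that .
    show "\<exists>r\<in>Q. \<forall>f\<in>topspace (seminorm_topology V I p). q f \<le> r f \<and> q' f \<le> r f"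
      if "q \<in> Q" "q' \<in> Q" for q q'
      unfolding ts using dir[OF that] .
    show "\<exists>r\<in>Q. \<forall>f\<in>topspace (seminorm_topology V I p). c * q f \<le> r f" if "q \<in> Q" "c > 0" for q c
    proof -
      obtain c' i where ci: "c' > 0" "i \<in> I" "q = (\<lambda>f. c' * enn2real (p i f))"
        using QE[OF \<open>q \<in> Q\<close>] by metis
      then have "(\<lambda>f. c * q f) \<in> Q" using \<open>c > 0\<close> QI[of "c * c'" i] by (simp add: mult.assoc)
      then show ?thesis by (intro bexI[of _ "\<lambda>f. c * q f"]) auto
    qed
    show "openin (seminorm_topology V I p) U \<longleftrightarrow> U \<subseteq> topspace (seminorm_topology V I p) \<and>
      (\<forall>f\<in>U. \<exists>q\<in>Q. {g \<in> topspace (seminorm_topology V I p). q (g - f) < 1} \<subseteq> U)" for U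
      unfolding ts
    proof safe
      fix f assume "openin (seminorm_topology V I p) U" "f \<in> U"
      then show "f \<in> V" using openin_subset ts by blast
    next
      fix f assume "openin (seminorm_topology V I p) U" and f: "f \<in> U"
      then have *: "generate_topology_on ?G U"
        unfolding seminorm_topology_def openin_topology_generated_by_iff by simp
      from * f show "\<exists>q\<in>Q. {g \<in> V. q (g - f) < 1} \<subseteq> U"
      proof (induction U)
        case (Int a b)
        then obtain q q' where q: "q \<in> Q" "{g \<in> V. q (g - f) < 1} \<subseteq> a" "q' \<in> Q" "{g \<in> V. q' (g - f) < 1} \<subseteq> b"
          by blast
        obtain r where r: "r \<in> Q" "\<And>f. f \<in> V \<Longrightarrow> q f \<le> r f \<and> q' f \<le> r f" using dir[OF q(1,3)] by blast
        have fV: "f \<in> V"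
          using openin_subset[of "topology_generated_by ?G" a] Int.hyps(1) Int.prems \<open>\<Union>?G = V\<close>
          unfolding openin_topology_generated_by_iff topology_generated_by_topspace by blast
        have "g \<in> a \<inter> b" if g: "g \<in> V" "r (g - f) < 1" for g
          using r(2)[OF lin_subspaceD(5)[OF V g(1) fV]] q(2,4) g by force
        then show ?case using r(1) by blast
      next
        case (UN K)
        then obtain k where k: "k \<in> K" "f \<in> k" by blast
        with UN.IH[OF this] show ?case by blast
      next
        case (Basis s)
        then obtain i h e where s: "s = {g \<in> V. p i (g - h) < ennreal e}" "i \<in> I" "h \<in> V" "e > 0" by blast
        have f: "f \<in> V" "p i (f - h) < ennreal e" using Basis s by auto
        \<comment> \<open>The generating ball is centred at \<open>h\<close> rather than at
          \<open>f\<close>; \<open>d\<close> is the radius that remains about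
          \<open>f\<close>.\<close>
        define d where "d = e - enn2real (p i (f - h))"
        have d: "d > 0" using less_iff[OF s(2) lin_subspaceD(5)[OF V f(1) s(3)] s(4)] f by (simp add: d_def)
        have "g \<in> s" if g: "g \<in> V" "1 / d * enn2real (p i (g - f)) < 1" for g
        proof -
          have "enn2real (p i (g - f)) < d" using g(2) d by (simp add: field_simps)
          then have "enn2real (p i (g - h)) < e"
            using seminorm_on_triangle_diff[OF semi[OF s(2)] V g(1) f(1) s(3)] by (simp add: d_def)
          then show ?thesis
            using less_iff[OF s(2) lin_subspaceD(5)[OF V g(1) s(3)] s(4)] g(1) s(1) by simp
        qed
        moreover have "(\<lambda>f. 1 / d * enn2real (p i f)) \<in> Q" using d s(2) by (intro QI) auto
        ultimately show ?case
          by (intro bexI[of _ "\<lambda>f. 1 / d * enn2real (p i f)"]) (rule subsetI, blast, assumption)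
      qed auto
    next
      assume UV: "U \<subseteq> V" and *: "\<forall>f\<in>U. \<exists>q\<in>Q. {g \<in> V. q (g - f) < 1} \<subseteq> U"
      have "\<exists>s. openin (seminorm_topology V I p) s \<and> f \<in> s \<and> s \<subseteq> U" if f: "f \<in> U" for f
      proof -
        obtain q where q: "q \<in> Q" "{g \<in> V. q (g - f) < 1} \<subseteq> U" using bspec[OF * f] by blast
        obtain c i where c: "c > 0" "i \<in> I" "q = (\<lambda>f. c * enn2real (p i f))"
          using QE[OF q(1)] by metis
        then have ci: "c > 0" "i \<in> I" "{g \<in> V. c * enn2real (p i (g - f)) < 1} \<subseteq> U"
          using q(2) by simp_all
        have fV: "f \<in> V" using UV f by blast
        let ?s = "{g \<in> V. p i (g - f) < ennreal (1 / c)}"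
        have "?s \<in> ?G" using ci fV by (intro CollectI exI[of _ i] exI[of _ f] exI[of _ "1/c"]) auto
        then have "openin (seminorm_topology V I p) ?s"
          unfolding seminorm_topology_def by (rule topology_generated_by_Basis)
        moreover have "f \<in> ?s" using fV zero[OF ci(2)] ci(1) by simp
        moreover have "?s \<subseteq> U"
        proof
          fix g assume g: "g \<in> ?s"
          then have "enn2real (p i (g - f)) < 1 / c"
            using less_iff[OF ci(2), of "g - f" "1/c"] ci(1) lin_subspaceD(5)[OF V _ fV] by auto
          then show "g \<in> U" using g ci by (auto simp: field_simps)
        qed
        ultimately show ?thesis by blast
      qed
      then show "openin (seminorm_topology V I p) U"
        by (subst openin_subopen) blast
    qed
  qed
  then show "seminormed (seminorm_topology V I p) {\<lambda>f. c * enn2real (p i f) | c i. c > 0 \<and> i \<in> I}"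
    unfolding Q_def .
qed

section \<open>The spaces of test functions\<close>

definition ocn :: "nat \<Rightarrow> nat \<Rightarrow> (real \<Rightarrow> complex) \<Rightarrow> real" where
  "ocn m k = rnorm (\<lambda>x. 1 / wt x ^ k) m"

definition sn :: "nat \<Rightarrow> (real \<Rightarrow> complex) \<Rightarrow> real" where
  "sn n = rnorm (\<lambda>x. wt x ^ n) n"

definition oc_fun :: "nat \<Rightarrow> (real \<Rightarrow> complex) set" where
  "oc_fun k = {f. smooth f \<and> (\<forall>m\<in>{1..}. oc_norm m k f < \<infinity>)}"

definition schwartz_fun :: "(real \<Rightarrow> complex) set" where
  "schwartz_fun = {f. smooth f \<and> (\<forall>n\<in>UNIV. schwartz_norm n f < \<infinity>)}"

lemma wt_div_le_iff: "1 / wt x ^ k * a \<le> c \<longleftrightarrow> a \<le> c * wt x ^ k"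
  using wt_power_pos[of x k] by (simp add: field_simps)

lemma oc_norm_finite_iff: "oc_norm m k f < \<infinity> \<longleftrightarrow> (\<exists>c. \<forall>x. \<forall>i\<le>m. cmod (iter_deriv i f x) \<le> c * wt x ^ k)"
  unfolding oc_norm_eq_wnorm wnorm_finite_iff wt_div_le_iff by (rule refl)

text \<open>The steps only ask for orders \<open>m\<close> from 1 on; order 0 is read off from order
  1.\<close>

lemma oc_norm_finite: "f \<in> oc_fun k \<Longrightarrow> oc_norm m k f < \<infinity>"
proof (cases m)
  case 0
  assume "f \<in> oc_fun k"
  then have "oc_norm 1 k f < \<infinity>" by (auto simp: oc_fun_def)
  then obtain c where "\<forall>x. \<forall>i\<le>1. cmod (iter_deriv i f x) \<le> c * wt x ^ k"
    unfolding oc_norm_finite_iff by blast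
  from this[rule_format, of 0] show ?thesis using 0 unfolding oc_norm_finite_iff by (intro exI[of _ c]) simp
qed (auto simp: oc_fun_def)

lemma oc_fun_smooth: "f \<in> oc_fun k \<Longrightarrow> smooth f"
  by (simp add: oc_fun_def)

lemma schwartz_fun_smooth: "f \<in> schwartz_fun \<Longrightarrow> smooth f"
  by (simp add: schwartz_fun_def)

lemma finite_bounds:
  fixes a :: "nat \<Rightarrow> 'b \<Rightarrow> real"
  assumes "\<And>i. \<exists>c. \<forall>x. a i x \<le> c * b x" "\<And>x. b x \<ge> 0"
  shows "\<exists>c. \<forall>x. \<forall>i\<le>m. a i x \<le> c * b x"
proof -
  obtain c where c: "\<And>i x. a i x \<le> c i * b x" using assms(1) by metis
  have "a i x \<le> (\<Sum>i\<le>m. \<bar>c i\<bar>) * b x" if "i \<le> m" for i x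
  proof -
    have "c i \<le> \<bar>c i\<bar>" by simp
    also have "\<dots> \<le> (\<Sum>i\<le>m. \<bar>c i\<bar>)" using that by (intro member_le_sum) auto
    finally show ?thesis using c[of i x] assms(2)[of x] by (meson mult_right_mono order_trans)
  qed
  then show ?thesis by blast
qed

lemma oc_funI:
  assumes "smooth f" "\<And>i. \<exists>c. \<forall>x. cmod (iter_deriv i f x) \<le> c * wt x ^ k"
  shows "f \<in> oc_fun k"
  unfolding oc_fun_def oc_norm_finite_iff
  using assms(1) finite_bounds[of "\<lambda>i x. cmod (iter_deriv i f x)" "\<lambda>x. wt x ^ k", OF assms(2)] wt_power_pos
  by (auto simp: less_imp_le)

lemma schwartz_funI:
  assumes "smooth f" "\<And>n i. \<exists>c. \<forall>x. wt x ^ n * cmod (iter_deriv i f x) \<le> c"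
  shows "f \<in> schwartz_fun"
  unfolding schwartz_fun_def schwartz_norm_eq_wnorm wnorm_finite_iff
proof (intro CollectI conjI ballI assms(1))
  fix n
  show "\<exists>c. \<forall>x. \<forall>i\<le>n. wt x ^ n * cmod (iter_deriv i f x) \<le> c"
    using finite_bounds[of "\<lambda>i x. wt x ^ n * cmod (iter_deriv i f x)" "\<lambda>x. 1" n] assms(2)[of n] by simp
qed

lemma ocn_nonneg: "0 \<le> ocn m k f" and sn_nonneg: "0 \<le> sn n f"
  by (simp_all add: ocn_def sn_def rnorm_nonneg)

lemma ocn_upper: "f \<in> oc_fun k \<Longrightarrow> i \<le> m \<Longrightarrow> cmod (iter_deriv i f x) \<le> ocn m k f * wt x ^ k"
  using rnorm_upper[of "\<lambda>x. 1 / wt x ^ k" m f i x] oc_norm_finite[of f k m]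
  unfolding oc_norm_eq_wnorm ocn_def wt_div_le_iff by simp

lemma ocn_leI:
  assumes "\<And>x i. i \<le> m \<Longrightarrow> cmod (iter_deriv i f x) \<le> c * wt x ^ k" "0 \<le> c"
  shows "ocn m k f \<le> c"
  unfolding ocn_def by (rule rnorm_leI) (use assms wt_div_le_iff in auto)

lemma sn_upper:
  assumes "f \<in> schwartz_fun" "i \<le> n"
  shows "wt x ^ n * cmod (iter_deriv i f x) \<le> sn n f"
  using assms rnorm_upper[of "\<lambda>x. wt x ^ n" n f i x]
  unfolding sn_def schwartz_fun_def schwartz_norm_eq_wnorm by simp

lemma sn_leI:
  assumes "\<And>x i. i \<le> n \<Longrightarrow> wt x ^ n * cmod (iter_deriv i f x) \<le> c" "0 \<le> c"
  shows "sn n f \<le> c"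
  unfolding sn_def by (rule rnorm_leI) (use assms in auto)

lemma lin_subspace_oc_fun: "lin_subspace (oc_fun k)"
  unfolding oc_fun_def oc_norm_eq_wnorm
  using lin_subspace_wnorm[of "\<lambda>m x. 1 / wt x ^ k" "{1..}" "\<lambda>m. m"] wt_power_pos by (simp add: less_imp_le)

lemma lin_subspace_schwartz_fun: "lin_subspace schwartz_fun"
  unfolding schwartz_fun_def schwartz_norm_eq_wnorm
  using lin_subspace_wnorm[of "\<lambda>n x. wt x ^ n" UNIV "\<lambda>n. n"] wt_power_pos by (simp add: less_imp_le)

lemma seminorm_ocn: "seminorm_on (oc_fun k) (ocn m k)"
  unfolding ocn_def
  by (rule seminorm_on_rnorm[OF _ _ lin_subspace_oc_fun])
    (use oc_norm_finite oc_fun_smooth wt_power_pos in \<open>auto simp: oc_norm_eq_wnorm less_imp_le\<close>)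

lemma seminorm_sn: "seminorm_on schwartz_fun (sn n)"
  unfolding sn_def
  by (rule seminorm_on_rnorm[OF _ _ lin_subspace_schwartz_fun])
    (use wt_power_pos in \<open>auto simp: schwartz_fun_def schwartz_norm_eq_wnorm less_imp_le\<close>)

lemma ocn_mono: "f \<in> oc_fun k \<Longrightarrow> m \<le> m' \<Longrightarrow> ocn m k f \<le> ocn m' k f"
  by (rule ocn_leI) (auto intro: ocn_upper ocn_nonneg)

lemma oc_fun_mono: "k \<le> l \<Longrightarrow> oc_fun k \<subseteq> oc_fun l"
proof
  fix f assume kl: "k \<le> l" and f: "f \<in> oc_fun k"
  show "f \<in> oc_fun l"
  proof (rule oc_funI[OF oc_fun_smooth[OF f]])
    fix i
    have "cmod (iter_deriv i f x) \<le> ocn i k f * wt x ^ l" for x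
      using ocn_upper[OF f order.refl, of i x] mult_left_mono[OF wt_power_mono[OF kl, of x] ocn_nonneg[of i k f]] by simp
    then show "\<exists>c. \<forall>x. cmod (iter_deriv i f x) \<le> c * wt x ^ l" by blast
  qed
qed

lemma sn_mono:
  assumes "f \<in> schwartz_fun" "n \<le> n'"
  shows "sn n f \<le> sn n' f"
proof (rule sn_leI)
  fix x i assume "i \<le> n"
  have "wt x ^ n * cmod (iter_deriv i f x) \<le> wt x ^ n' * cmod (iter_deriv i f x)"
    by (intro mult_right_mono wt_power_mono assms) auto
  also have "\<dots> \<le> sn n' f" using \<open>i \<le> n\<close> assms by (intro sn_upper) auto
  finally show "wt x ^ n * cmod (iter_deriv i f x) \<le> sn n' f" .
qed (rule sn_nonneg)

lemma schwartz_fun_decay: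
  assumes "f \<in> schwartz_fun" "i \<le> n'" "n \<le> n'"
  shows "wt x ^ n * cmod (iter_deriv i f x) \<le> sn n' f"
proof -
  have "wt x ^ n * cmod (iter_deriv i f x) \<le> wt x ^ n' * cmod (iter_deriv i f x)"
    by (intro mult_right_mono wt_power_mono assms) auto
  also have "\<dots> \<le> sn n' f" using assms by (intro sn_upper) auto
  finally show ?thesis .
qed

lemma topspace_oc_step: "topspace (oc_step k) = oc_fun k"
  and seminormed_oc_step: "seminormed (oc_step k) {\<lambda>f. c * ocn m k f | c m. c > 0 \<and> m \<in> {1..}}"
proof -
  have 1: "i \<le> j \<Longrightarrow> oc_norm i k f \<le> oc_norm j k f" for i j f
    unfolding oc_norm_def by (intro SUP_mono' SUP_subset_mono) auto
  have o: "oc_step k = seminorm_topology (oc_fun k) {1..} (\<lambda>m. oc_norm m k)"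
    unfolding oc_step_def oc_fun_def by (simp add: Ball_def)
  have s: "seminorm_on (oc_fun k) (\<lambda>f. enn2real (oc_norm i k f))" for i
    using seminorm_ocn[of k i] unfolding ocn_def rnorm_def oc_norm_eq_wnorm by simp
  show "topspace (oc_step k) = oc_fun k"
    unfolding o by (rule topspace_seminorm_topology[OF lin_subspace_oc_fun]) (auto simp: oc_norm_finite[simplified] s 1)
  have "seminormed (oc_step k) {\<lambda>f. c * enn2real (oc_norm m k f) | c m. c > 0 \<and> m \<in> {1..}}"
    unfolding o by (rule seminormed_seminorm_topology[OF lin_subspace_oc_fun]) (auto simp: oc_norm_finite[simplified] s 1)
  then show "seminormed (oc_step k) {\<lambda>f. c * ocn m k f | c m. c > 0 \<and> m \<in> {1..}}"
    unfolding ocn_def rnorm_def oc_norm_eq_wnorm .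
qed

text \<open>Positive multiples are included to meet the scaling condition of
  \<open>seminormed\<close>.\<close>

definition schwartz_seminorms :: "((real \<Rightarrow> complex) \<Rightarrow> real) set" where
  "schwartz_seminorms = {\<lambda>f. c * sn n f | c n. c > 0}"

lemma topspace_schwartz_space: "topspace schwartz_space = schwartz_fun"
  and seminormed_schwartz_space: "seminormed schwartz_space schwartz_seminorms"
proof -
  have fin: "schwartz_norm n f < \<infinity>" if "f \<in> schwartz_fun" for n f using that by (simp add: schwartz_fun_def)
  have 1: "schwartz_norm i f \<le> schwartz_norm j f" if "i \<le> j" for i j f
    unfolding schwartz_norm_def
  proof (intro SUP_mono' SUP_mono)
    fix x a assume "a \<in> {0..i}"
    then show "\<exists>b\<in>{0..j}. ennreal ((1 + x\<^sup>2) ^ i * cmod (iter_deriv a f x)) \<le> ennreal ((1 + x\<^sup>2) ^ j * cmod (iter_deriv b f x))"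
      using that wt_power_mono[OF that, of x] unfolding wt_def
      by (intro bexI[of _ a] ennreal_leI mult_right_mono) auto
  qed
  have o: "schwartz_space = seminorm_topology schwartz_fun UNIV schwartz_norm"
    unfolding schwartz_space_def schwartz_fun_def by simp
  have s: "seminorm_on schwartz_fun (\<lambda>f. enn2real (schwartz_norm i f))" for i
    using seminorm_sn[of i] unfolding sn_def rnorm_def schwartz_norm_eq_wnorm by simp
  show "topspace schwartz_space = schwartz_fun"
    unfolding o by (rule topspace_seminorm_topology[OF lin_subspace_schwartz_fun]) (auto simp: fin[simplified] s 1)
  have "seminormed schwartz_space {\<lambda>f. c * enn2real (schwartz_norm n f) | c n. c > 0 \<and> n \<in> UNIV}"
    unfolding o by (rule seminormed_seminorm_topology[OF lin_subspace_schwartz_fun]) (auto simp: fin[simplified] s 1)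
  then show "seminormed schwartz_space schwartz_seminorms"
    unfolding schwartz_seminorms_def sn_def rnorm_def schwartz_norm_eq_wnorm by simp
qed

definition oc_all :: "(real \<Rightarrow> complex) set" where
  "oc_all = (\<Union>k\<in>{1..}. oc_fun k)"

lemma oc_fun_subset: "1 \<le> k \<Longrightarrow> oc_fun k \<subseteq> oc_all"
  by (auto simp: oc_all_def)

lemma oc_allE:
  assumes "f \<in> oc_all" obtains k where "1 \<le> k" "f \<in> oc_fun k"
  using assms by (auto simp: oc_all_def)

lemma oc_allE2:
  assumes "f \<in> oc_all" "g \<in> oc_all" obtains k where "1 \<le> k" "f \<in> oc_fun k" "g \<in> oc_fun k"
proof -
  obtain k l where kl: "1 \<le> k" "f \<in> oc_fun k" "1 \<le> l" "g \<in> oc_fun l"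
    using assms by (auto elim!: oc_allE)
  then have "f \<in> oc_fun (max k l)" "g \<in> oc_fun (max k l)"
    using oc_fun_mono[of k "max k l"] oc_fun_mono[of l "max k l"] by auto
  with kl(1) show ?thesis by (intro that[of "max k l"]) auto
qed

lemma oc_all_smooth: "f \<in> oc_all \<Longrightarrow> smooth f"
  by (auto elim!: oc_allE intro: oc_fun_smooth)

lemma lin_subspace_oc_all: "lin_subspace oc_all"
  unfolding lin_subspace_def
proof (intro conjI ballI allI)
  show "0 \<in> oc_all" using lin_subspaceD(1)[OF lin_subspace_oc_fun, of 1] oc_fun_subset by blast
next
  fix f g assume "f \<in> oc_all" "g \<in> oc_all"
  then show "f + g \<in> oc_all"
    by (rule oc_allE2) (use lin_subspaceD(2)[OF lin_subspace_oc_fun] oc_fun_subset in blast)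
next
  fix c f assume "f \<in> oc_all"
  then show "(\<lambda>x. c * f x) \<in> oc_all"
    by (rule oc_allE) (use lin_subspaceD(3)[OF lin_subspace_oc_fun] oc_fun_subset in blast)
qed

lemma schwartz_fun_subset: "schwartz_fun \<subseteq> oc_fun k"
proof
  fix f assume f: "f \<in> schwartz_fun"
  show "f \<in> oc_fun k"
  proof (rule oc_funI[OF schwartz_fun_smooth[OF f]])
    fix i
    have "cmod (iter_deriv i f x) \<le> sn i f * wt x ^ k" for x
      using schwartz_fun_decay[OF f, of i i 0 x] mult_left_mono[OF wt_power_ge_1[of x k] sn_nonneg[of i f]] by simp
    then show "\<exists>c. \<forall>x. cmod (iter_deriv i f x) \<le> c * wt x ^ k" by blast
  qed
qed

lemma schwartz_fun_oc_all: "schwartz_fun \<subseteq> oc_all"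
  using schwartz_fun_subset[of 1] oc_fun_subset[of 1] by auto

section \<open>The inductive limit topology\<close>

text \<open>\<open>locally_convex\<close> supplies convex neighbourhoods that need not be balanced,
  so the gauge is that of the balanced core of \<open>C\<close>. The last conclusion bounds the
  gauge from above and later yields its continuity on the steps.\<close>

lemma minkowski_seminorm:
  assumes V: "lin_subspace V" and C: "convex_fun_set C"
    and absorb: "\<And>g. g \<in> V \<Longrightarrow> \<exists>t::real>0. \<forall>l. cmod l \<le> 1 \<longrightarrow> (\<lambda>x. l / of_real t * g x) \<in> C"
  obtains q where "seminorm_on V q" "{g \<in> V. q g < 1} \<subseteq> C"
    "\<forall>g\<in>V. \<forall>t>0. (\<forall>l. cmod l \<le> 1 \<longrightarrow> (\<lambda>x. l / of_real t * g x) \<in> C) \<longrightarrow> q g \<le> t"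
proof -
  \<comment> \<open>Asking for all \<open>l\<close> in the unit disc makes the admissible
    \<open>t\<close> insensitive to the argument of a complex scalar, which gives absolute
    homogeneity.\<close>
  define S where "S g = {t::real. t > 0 \<and> (\<forall>l. cmod l \<le> 1 \<longrightarrow> (\<lambda>x. l / of_real t * g x) \<in> C)}" for g
  define q where "q g = Inf (S g)" for g
  have ne: "S g \<noteq> {}" if "g \<in> V" for g using absorb[OF that] by (auto simp: S_def)
  have bb: "bdd_below (S g)" for g by (rule bdd_belowI[of _ 0]) (auto simp: S_def)
  have le: "q g \<le> t" if "t \<in> S g" for g t unfolding q_def using that bb by (rule cInf_lower)
  have semi: "seminorm_on V q"
  proof (rule seminorm_onI[OF V])
    fix f assume f: "f \<in> V"
    show "0 \<le> q f" unfolding q_def by (rule cInf_greatest[OF ne[OF f]]) (auto simp: S_def)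
  next
    fix f g assume fg: "f \<in> V" "g \<in> V"
    have "s + t \<in> S (f + g)" if st: "s \<in> S f" "t \<in> S g" for s t
    proof -
      have pos: "s > 0" "t > 0" using st by (auto simp: S_def)
      \<comment> \<open>A convex combination of \<open>l f / s\<close> and \<open>l g / t\<close>
        with weights \<open>s / (s + t)\<close> and \<open>t / (s + t)\<close>.\<close>
      have "(\<lambda>x. l / of_real (s + t) * (f + g) x) \<in> C" if l: "cmod l \<le> 1" for l
      proof -
        have "(\<lambda>x. of_real (1 - t / (s + t)) * (l / of_real s * f x) + of_real (t / (s + t)) * (l / of_real t * g x)) \<in> C"
          using C[unfolded convex_fun_set_def, rule_format, of "\<lambda>x. l / of_real s * f x" "\<lambda>x. l / of_real t * g x" "t / (s + t)"]
            st l pos by (auto simp: S_def)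
        moreover have "1 - t / (s + t) = s / (s + t)" using pos by (simp add: field_simps)
        moreover have "of_real (s / (s + t)) * (l / of_real s * f x) + of_real (t / (s + t)) * (l / of_real t * g x)
          = l / of_real (s + t) * (f + g) x" for x
        proof -
          have "of_real (s / (s + t)) * (l / of_real s * f x) = l / of_real (s + t) * f x"
            using pos by (simp del: of_real_add)
          moreover have "of_real (t / (s + t)) * (l / of_real t * g x) = l / of_real (s + t) * g x"
            using pos by (simp del: of_real_add)
          ultimately show ?thesis by (simp add: distrib_left del: of_real_add)
        qed
        ultimately show ?thesis by simp
      qed
      then show ?thesis using pos by (simp add: S_def)
    qed
    then have *: "q (f + g) \<le> s + t" if "s \<in> S f" "t \<in> S g" for s t using le that by blast
    have "q (f + g) - t \<le> q f" if "t \<in> S g" for t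
      unfolding q_def[of f] by (rule cInf_greatest[OF ne[OF fg(1)]]) (use *[OF _ that] in force)
    then have "q (f + g) - q f \<le> q g"
      unfolding q_def[of g] by (intro cInf_greatest[OF ne[OF fg(2)]]) force
    then show "q (f + g) \<le> q f + q g" by simp
  next
    fix c f assume f: "f \<in> V"
    \<comment> \<open>The scalar 0 is treated apart, as the argument for other scalars divides by
      \<open>cmod c\<close>.\<close>
    have zero: "q (\<lambda>x. 0) \<le> 0"
    proof (rule field_le_epsilon)
      fix e :: real assume e: "e > 0"
      obtain t where "t > 0" "\<And>l. cmod l \<le> 1 \<Longrightarrow> (\<lambda>x. l / of_real t * 0 x) \<in> C"
        using absorb[OF lin_subspaceD(1)[OF V]] by auto
      from this(2)[of 0] have "(\<lambda>x. 0) \<in> C" by simp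
      then have "e \<in> S (\<lambda>x. 0)" using e by (simp add: S_def)
      then show "q (\<lambda>x. 0) \<le> 0 + e" using le by simp
    qed
    show "q (\<lambda>x. c * f x) \<le> cmod c * q f"
    proof (cases "c = 0")
      case False
      have "q (\<lambda>x. c * f x) / cmod c \<le> t" if t: "t \<in> S f" for t
      proof -
        have "cmod c * t \<in> S (\<lambda>x. c * f x)"
          unfolding S_def
        proof (intro CollectI conjI allI impI)
          show "0 < cmod c * t" using t False by (simp add: S_def)
          fix l assume "cmod l \<le> 1"
          then have "cmod (l * c / of_real (cmod c)) \<le> 1" using False by (simp add: norm_mult norm_divide)
          then have "(\<lambda>x. (l * c / of_real (cmod c)) / of_real t * f x) \<in> C"
            using t unfolding S_def by blast
          then show "(\<lambda>x. l / of_real (cmod c * t) * (c * f x)) \<in> C"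
            by (simp add: field_simps)
        qed
        then show ?thesis using le False by (simp add: field_simps)
      qed
      then have "q (\<lambda>x. c * f x) / cmod c \<le> q f"
        unfolding q_def[of f] by (intro cInf_greatest[OF ne[OF f]])
      then show ?thesis using False by (simp add: field_simps)
    qed (simp add: zero)
  qed
  have "g \<in> C" if g: "g \<in> V" "q g < 1" for g
  proof -
    obtain t where t: "t \<in> S g" "t < 1"
      using g(2) cInf_lessD[OF ne[OF g(1)]] unfolding q_def by blast
    then have t0: "t > 0" by (simp add: S_def)
    have "cmod (of_real t) \<le> 1" using t0 t(2) by simp
    with t(1) have "(\<lambda>x. of_real t / of_real t * g x) \<in> C" unfolding S_def by blast
    then show ?thesis using t0 by simp
  qed
  then have sub: "{g \<in> V. q g < 1} \<subseteq> C" by blast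
  show ?thesis by (rule that[OF semi sub]) (auto intro!: le simp: S_def)
qed

text \<open>These will be the continuous seminorms of \<open>oc_space\<close>: order and constant
  may change with the step, and no uniformity over the steps is required.\<close>

definition oc_seminorm :: "((real \<Rightarrow> complex) \<Rightarrow> real) \<Rightarrow> bool" where
  "oc_seminorm q \<longleftrightarrow> seminorm_on oc_all q \<and> (\<forall>k\<ge>1. \<exists>m c. \<forall>f\<in>oc_fun k. q f \<le> c * ocn m k f)"

lemma oc_seminormE:
  assumes "oc_seminorm q" "1 \<le> k"
  obtains m c where "1 \<le> m" "0 < c" "\<And>f. f \<in> oc_fun k \<Longrightarrow> q f \<le> c * ocn m k f"
proof -
  obtain m c where mc: "\<forall>f\<in>oc_fun k. q f \<le> c * ocn m k f" using assms unfolding oc_seminorm_def by blast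
  have "q f \<le> (\<bar>c\<bar> + 1) * ocn (max m 1) k f" if f: "f \<in> oc_fun k" for f
  proof -
    have "q f \<le> c * ocn m k f" using mc f by blast
    also have "\<dots> \<le> (\<bar>c\<bar> + 1) * ocn (max m 1) k f"
      by (intro mult_mono ocn_mono[OF f]) (auto simp: ocn_nonneg)
    finally show ?thesis .
  qed
  then show ?thesis by (intro that[of "max m 1" "\<bar>c\<bar> + 1"]) auto
qed

lemma oc_seminorm_nonneg: "oc_seminorm q \<Longrightarrow> f \<in> oc_all \<Longrightarrow> 0 \<le> q f"
  unfolding oc_seminorm_def using seminorm_onD(1) by blast

lemma oc_seminorm_scale: "oc_seminorm q \<Longrightarrow> 0 \<le> d \<Longrightarrow> oc_seminorm (\<lambda>f. d * q f)"
  unfolding oc_seminorm_def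
proof (intro conjI allI impI seminorm_on_scale)
  fix k :: nat
  assume q: "seminorm_on oc_all q \<and> (\<forall>k\<ge>1. \<exists>m c. \<forall>f\<in>oc_fun k. q f \<le> c * ocn m k f)" and d: "0 \<le> d" and k: "1 \<le> k"
  then obtain m c where "\<forall>f\<in>oc_fun k. q f \<le> c * ocn m k f" by blast
  then have "\<forall>f\<in>oc_fun k. d * q f \<le> (d * c) * ocn m k f"
    using d by (auto simp: mult.assoc intro: mult_left_mono)
  then show "\<exists>m c. \<forall>f\<in>oc_fun k. d * q f \<le> c * ocn m k f" by blast
qed auto

lemma oc_seminorm_add:
  assumes "oc_seminorm p" "oc_seminorm q"
  shows "oc_seminorm (\<lambda>f. p f + q f)"
  unfolding oc_seminorm_def
proof (intro conjI allI impI seminorm_on_add)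
  show "seminorm_on oc_all p" "seminorm_on oc_all q" using assms by (auto simp: oc_seminorm_def)
  fix k :: nat assume k: "1 \<le> k"
  obtain m c where p: "0 < c" "\<And>f. f \<in> oc_fun k \<Longrightarrow> p f \<le> c * ocn m k f"
    using oc_seminormE[OF assms(1) k] by metis
  obtain m' c' where q: "0 < c'" "\<And>f. f \<in> oc_fun k \<Longrightarrow> q f \<le> c' * ocn m' k f"
    using oc_seminormE[OF assms(2) k] by metis
  have "p f + q f \<le> (c + c') * ocn (max m m') k f" if f: "f \<in> oc_fun k" for f
  proof -
    have "p f \<le> c * ocn (max m m') k f"
      by (rule order_trans[OF p(2)[OF f]]) (use p(1) ocn_mono[OF f] in \<open>auto intro!: mult_left_mono\<close>)
    moreover have "q f \<le> c' * ocn (max m m') k f"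
      by (rule order_trans[OF q(2)[OF f]]) (use q(1) ocn_mono[OF f] in \<open>auto intro!: mult_left_mono\<close>)
    ultimately show ?thesis by (simp add: distrib_right)
  qed
  then show "\<exists>m c. \<forall>f\<in>oc_fun k. p f + q f \<le> c * ocn m k f" by blast
qed

text \<open>The topology \<open>G\<close> of all such seminorms is locally convex with continuous
  inclusions, so it is one of the topologies whose supremum is taken. Conversely, an open set of any
  competitor contains about each of its points a translated convex neighbourhood of 0, and the gauge
  of that neighbourhood is bounded on every step, hence belongs to \<open>G\<close>.\<close>

lemma topspace_oc_space: "topspace oc_space = oc_all"
  and seminormed_oc_space: "seminormed oc_space (Collect oc_seminorm)"
proof -
  define P where "P U \<longleftrightarrow> U \<subseteq> oc_all \<and> (\<forall>f\<in>U. \<exists>q. oc_seminorm q \<and> {g \<in> oc_all. q (g - f) < 1} \<subseteq> U)" for U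
  define G where "G = topology P"
  have sum_le: "q f \<le> p f + q f" "p f \<le> p f + q f" if "oc_seminorm p" "oc_seminorm q" "f \<in> oc_all" for p q f
    using oc_seminorm_nonneg[OF that(1,3)] oc_seminorm_nonneg[OF that(2,3)] by auto
  have "istopology P"
    unfolding istopology_def
  proof (intro conjI allI impI)
    fix S T assume ST: "P S" "P T"
    show "P (S \<inter> T)"
      unfolding P_def
    proof (intro conjI ballI)
      show "S \<inter> T \<subseteq> oc_all" using ST by (auto simp: P_def)
      fix f assume f: "f \<in> S \<inter> T"
      then obtain p where p: "oc_seminorm p" "{g \<in> oc_all. p (g - f) < 1} \<subseteq> S" using ST unfolding P_def by blast
      obtain q where q: "oc_seminorm q" "{g \<in> oc_all. q (g - f) < 1} \<subseteq> T" using ST f unfolding P_def by blast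
      have fo: "f \<in> oc_all" using f ST by (auto simp: P_def)
      have "g \<in> S \<inter> T" if g: "g \<in> oc_all" "p (g - f) + q (g - f) < 1" for g
        using sum_le[OF p(1) q(1) lin_subspaceD(5)[OF lin_subspace_oc_all g(1) fo]] g p(2) q(2) by force
      then show "\<exists>q. oc_seminorm q \<and> {g \<in> oc_all. q (g - f) < 1} \<subseteq> S \<inter> T"
        using oc_seminorm_add[OF p(1) q(1)] by (intro exI[of _ "\<lambda>f. p f + q f"]) blast
    qed
  next
    fix K assume K: "\<forall>S\<in>K. P S"
    show "P (\<Union>K)"
      unfolding P_def
    proof (intro conjI ballI)
      show "\<Union>K \<subseteq> oc_all" using K by (auto simp: P_def)
      fix f assume "f \<in> \<Union>K"
      then obtain S where "S \<in> K" "f \<in> S" by blast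
      moreover from this K obtain q where "oc_seminorm q" "{g \<in> oc_all. q (g - f) < 1} \<subseteq> S"
        unfolding P_def by blast
      ultimately show "\<exists>q. oc_seminorm q \<and> {g \<in> oc_all. q (g - f) < 1} \<subseteq> \<Union>K" by blast
    qed
  qed
  then have openG: "openin G U \<longleftrightarrow> P U" for U by (simp add: G_def)
  have zero_semi: "oc_seminorm (\<lambda>f. 0)"
    unfolding oc_seminorm_def seminorm_on_def by (auto intro!: exI[of _ 0])
  have tsG: "topspace G = oc_all"
  proof
    show "topspace G \<subseteq> oc_all" using openG[of "topspace G"] by (simp add: P_def)
    have "P oc_all" unfolding P_def using zero_semi by auto
    then show "oc_all \<subseteq> topspace G" using openG openin_subset by blast
  qed
  have semiG: "seminormed G (Collect oc_seminorm)"
  proof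
    show "lin_subspace (topspace G)" unfolding tsG by (rule lin_subspace_oc_all)
    show "Collect oc_seminorm \<noteq> {}" using zero_semi by blast
    show "seminorm_on (topspace G) q" if "q \<in> Collect oc_seminorm" for q
      using that unfolding tsG oc_seminorm_def by simp
    show "\<exists>r\<in>Collect oc_seminorm. \<forall>f\<in>topspace G. p f \<le> r f \<and> q f \<le> r f"
      if "p \<in> Collect oc_seminorm" "q \<in> Collect oc_seminorm" for p q
      using that oc_seminorm_add[of p q] sum_le[of p q] unfolding tsG
      by (intro bexI[of _ "\<lambda>f. p f + q f"]) auto
    show "\<exists>r\<in>Collect oc_seminorm. \<forall>f\<in>topspace G. c * q f \<le> r f"
      if "q \<in> Collect oc_seminorm" "c > 0" for q c
      using that oc_seminorm_scale[of q c] by (intro bexI[of _ "\<lambda>f. c * q f"]) auto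
    show "openin G U \<longleftrightarrow> U \<subseteq> topspace G \<and> (\<forall>f\<in>U. \<exists>q\<in>Collect oc_seminorm. {g \<in> topspace G. q (g - f) < 1} \<subseteq> U)" for U
      unfolding openG P_def tsG by simp
  qed
  have contG: "continuous_map (oc_step k) G id" if k: "1 \<le> k" for k
  proof (rule continuous_map_seminormed[OF seminormed_oc_step semiG])
    show "id f \<in> topspace G" if "f \<in> topspace (oc_step k)" for f
      using that k oc_fun_subset unfolding topspace_oc_step tsG by auto
    fix q assume "q \<in> Collect oc_seminorm"
    then obtain m c where "1 \<le> m" "0 < c" "\<And>f. f \<in> oc_fun k \<Longrightarrow> q f \<le> c * ocn m k f"
      using k oc_seminormE[of q k] by (metis mem_Collect_eq)
    then show "\<exists>p\<in>{\<lambda>f. c * ocn m k f |c m. c > 0 \<and> m \<in> {1..}}. \<forall>f\<in>topspace (oc_step k). q (id f) \<le> p f"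
      unfolding topspace_oc_step
      by (intro bexI[of _ "\<lambda>f. c * ocn m k f"] CollectI exI[of _ c] exI[of _ m]) auto
  qed auto
  let ?G = "{U. \<exists>F. locally_convex F \<and> topspace F = (\<Union>i\<in>{1..}. topspace (oc_step i)) \<and>
               (\<forall>i\<in>{1..}. continuous_map (oc_step i) F id) \<and> openin F U}"
  have tsU: "(\<Union>i\<in>{1..}. topspace (oc_step i)) = oc_all"
    unfolding topspace_oc_step oc_all_def by (rule refl)
  have "openin oc_space U" if "openin G U" for U
    unfolding oc_space_def lc_inductive_limit_def
  proof (rule topology_generated_by_Basis, intro CollectI exI[of _ G] conjI ballI that)
    show "locally_convex G" by (rule seminormed.locally_convex[OF semiG])
    show "topspace G = (\<Union>i\<in>{1..}. topspace (oc_step i))" unfolding tsU by (rule tsG)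
    show "continuous_map (oc_step i) G id" if "i \<in> {1..}" for i using contG that by simp
  qed
  moreover have "openin G U" if "openin oc_space U" for U
  proof -
    have "generate_topology_on ?G U"
      using that unfolding oc_space_def lc_inductive_limit_def openin_topology_generated_by_iff .
    then show ?thesis
    proof (induction U rule: generate_topology_on.induct)
      case (Basis U)
      then obtain F where F: "locally_convex F" "topspace F = oc_all"
        "\<And>k. 1 \<le> k \<Longrightarrow> continuous_map (oc_step k) F id" "openin F U"
        unfolding tsU by auto
      show ?case
        unfolding openG P_def
      proof (intro conjI ballI)
        show "U \<subseteq> oc_all" using openin_subset[OF F(4)] F(2) by simp
        fix f assume f: "f \<in> U"
        then have fo: "f \<in> oc_all" using openin_subset[OF F(4)] F(2) by blast
        \<comment> \<open>Translation by \<open>f\<close> moves the question to the origin, where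
          convex neighbourhoods are available.\<close>
        have "continuous_map F F ((\<lambda>(f, g). f + g) \<circ> (\<lambda>g. (f, g)))"
          using F(1,2) fo unfolding locally_convex_def
          by (intro continuous_map_compose[of F "prod_topology F F"]) (auto intro!: continuous_map_pairedI)
        then have "openin F {g \<in> topspace F. ((\<lambda>(f, g). f + g) \<circ> (\<lambda>g. (f, g))) g \<in> U}"
          using F(4) by (rule openin_continuous_map_preimage)
        then have "openin F {g \<in> oc_all. f + g \<in> U} \<and> 0 \<in> {g \<in> oc_all. f + g \<in> U}"
          using F(2) f lin_subspaceD(1)[OF lin_subspace_oc_all] by simp
        then obtain C where C: "openin F C" "0 \<in> C" "C \<subseteq> {g \<in> oc_all. f + g \<in> U}" "convex_fun_set C"
          using F(1) unfolding locally_convex_def by meson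
        \<comment> \<open>Continuity of the inclusion of step \<open>k\<close>: the convex set
          contains a ball of one norm of that step.\<close>
        have ball: "\<exists>m c. c > 0 \<and> (\<forall>g\<in>oc_fun k. c * ocn m k g < 1 \<longrightarrow> g \<in> C)" if k: "1 \<le> k" for k
        proof -
          interpret s: seminormed "oc_step k" "{\<lambda>f. c * ocn m k f | c m. c > 0 \<and> m \<in> {1..}}"
            by (rule seminormed_oc_step)
          have "openin (oc_step k) {g \<in> topspace (oc_step k). id g \<in> C}"
            by (rule openin_continuous_map_preimage[OF F(3)[OF k] C(1)])
          moreover have "0 \<in> {g \<in> topspace (oc_step k). id g \<in> C}" using C(2) s.lin_simps(1) by simp
          ultimately obtain q where q: "q \<in> {\<lambda>f. c * ocn m k f | c m. c > 0 \<and> m \<in> {1..}}"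
            "{g \<in> topspace (oc_step k). q g < 1} \<subseteq> {g \<in> topspace (oc_step k). id g \<in> C}"
            by (rule s.nhd_seminorm)
          obtain c m where cm: "c > 0" "q = (\<lambda>f. c * ocn m k f)" using q(1) by blast
          then show ?thesis using q(2) unfolding topspace_oc_step cm(2) by (intro exI[of _ m] exI[of _ c]) auto
        qed
        have scaled_in: "(\<lambda>x. l / of_real t * g x) \<in> C"
          if "c > 0" "\<forall>g\<in>oc_fun k. c * ocn m k g < 1 \<longrightarrow> g \<in> C" "g \<in> oc_fun k" "c * ocn m k g < t" "cmod l \<le> 1"
          for c m k g t l
        proof -
          have t: "t > 0" using that ocn_nonneg[of m k g] by (meson less_le_trans mult_nonneg_nonneg not_less order.strict_implies_order)
          have "ocn m k (\<lambda>x. l / of_real t * g x) = cmod l / t * ocn m k g"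
            using seminorm_onD(3)[OF seminorm_ocn that(3), of m "l / of_real t"] t by (simp add: norm_divide)
          then have "c * ocn m k (\<lambda>x. l / of_real t * g x) = cmod l * (c * ocn m k g / t)" by simp
          also have "\<dots> \<le> 1 * (c * ocn m k g / t)"
            using that t ocn_nonneg[of m k g] by (intro mult_right_mono) auto
          also have "\<dots> < 1" using that t by simp
          finally show ?thesis using that(2) lin_subspaceD(3)[OF lin_subspace_oc_fun that(3)] by blast
        qed
        obtain q where q: "seminorm_on oc_all q" "{g \<in> oc_all. q g < 1} \<subseteq> C"
          "\<forall>g\<in>oc_all. \<forall>t>0. (\<forall>l. cmod l \<le> 1 \<longrightarrow> (\<lambda>x. l / of_real t * g x) \<in> C) \<longrightarrow> q g \<le> t"
        proof (rule minkowski_seminorm[OF lin_subspace_oc_all C(4)])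
          fix g assume "g \<in> oc_all"
          then obtain k where k: "1 \<le> k" "g \<in> oc_fun k" by (rule oc_allE)
          obtain m c where mc: "c > 0" "\<forall>g\<in>oc_fun k. c * ocn m k g < 1 \<longrightarrow> g \<in> C" using ball[OF k(1)] by blast
          show "\<exists>t::real>0. \<forall>l. cmod l \<le> 1 \<longrightarrow> (\<lambda>x. l / of_real t * g x) \<in> C"
            using scaled_in[OF mc k(2), of "c * ocn m k g + 1"] mc(1) ocn_nonneg[of m k g]
            by (intro exI[of _ "c * ocn m k g + 1"]) (auto simp: add_nonneg_pos)
        qed
        have "oc_seminorm q"
          unfolding oc_seminorm_def
        proof (intro conjI allI impI q(1))
          fix k :: nat assume k: "1 \<le> k"
          obtain m c where mc: "c > 0" "\<forall>g\<in>oc_fun k. c * ocn m k g < 1 \<longrightarrow> g \<in> C" using ball[OF k] by blast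
          have "q g \<le> c * ocn m k g" if g: "g \<in> oc_fun k" for g
          \<comment> \<open>The norm may vanish at \<open>g\<close>, so all larger \<open>t\<close>
            are used.\<close>
          proof (rule dense_ge)
            fix t assume t: "c * ocn m k g < t"
            moreover have "0 \<le> c * ocn m k g" using mc(1) ocn_nonneg by simp
            ultimately show "q g \<le> t"
              using scaled_in[OF mc g t] oc_fun_subset[OF k] g by (intro q(3)[rule_format]) auto
          qed
          then show "\<exists>m c. \<forall>f\<in>oc_fun k. q f \<le> c * ocn m k f" by blast
        qed
        moreover have "g \<in> U" if g: "g \<in> oc_all" "q (g - f) < 1" for g
        proof -
          have "g - f \<in> C" using q(2) g lin_subspaceD(5)[OF lin_subspace_oc_all g(1) fo] by blast
          then have "f + (g - f) \<in> U" using C(3) by blast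
          then show ?thesis by simp
        qed
        ultimately show "\<exists>q. oc_seminorm q \<and> {g \<in> oc_all. q (g - f) < 1} \<subseteq> U" by blast
      qed
    qed (auto intro: openin_Int openin_Union)
  qed
  ultimately have "oc_space = G" by (auto simp: topology_eq)
  with tsG semiG show "topspace oc_space = oc_all" "seminormed oc_space (Collect oc_seminorm)" by simp_all
qed

interpretation oc: seminormed oc_space "Collect oc_seminorm"
  by (rule seminormed_oc_space)

interpretation sw: seminormed schwartz_space schwartz_seminorms
  by (rule seminormed_schwartz_space)

text \<open>The modulus of a linear functional is itself a seminorm, so bounds found separately on
  each step already give a dominating member of \<open>Collect oc_seminorm\<close>.\<close>

lemma dual_oc_iff:
  "u \<in> dual oc_space \<longleftrightarrow>
    (\<forall>f\<in>oc_all. \<forall>g\<in>oc_all. u (f + g) = u f + u g) \<and> (\<forall>c. \<forall>f\<in>oc_all. u (\<lambda>x. c * f x) = c * u f) \<and>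
    (\<forall>k\<ge>1. \<exists>m c. \<forall>f\<in>oc_fun k. cmod (u f) \<le> c * ocn m k f) \<and> (\<forall>f. f \<notin> oc_all \<longrightarrow> u f = 0)"
    (is "_ \<longleftrightarrow> ?add \<and> ?mul \<and> ?bd \<and> ?out")
proof
  assume u: "u \<in> dual oc_space"
  obtain q where q: "q \<in> Collect oc_seminorm" "\<forall>f\<in>topspace oc_space. cmod (u f) \<le> q f"
    using oc.in_dualD(6)[OF u] by blast
  have ?bd
  proof (intro allI impI)
    fix k :: nat assume k: "1 \<le> k"
    obtain m c where mc: "\<And>f. f \<in> oc_fun k \<Longrightarrow> q f \<le> c * ocn m k f"
      using q(1) oc_seminormE[OF _ k, of q] by (metis mem_Collect_eq)
    have "cmod (u f) \<le> c * ocn m k f" if f: "f \<in> oc_fun k" for f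
      using q(2) mc[OF f] oc_fun_subset[OF k] f unfolding topspace_oc_space by force
    then show "\<exists>m c. \<forall>f\<in>oc_fun k. cmod (u f) \<le> c * ocn m k f" by blast
  qed
  then show "?add \<and> ?mul \<and> ?bd \<and> ?out"
    using oc.in_dualD(1-3)[OF u] unfolding topspace_oc_space by simp
next
  assume *: "?add \<and> ?mul \<and> ?bd \<and> ?out"
  have "oc_seminorm (\<lambda>f. cmod (u f))"
    unfolding oc_seminorm_def seminorm_on_def using * by (auto simp: norm_mult norm_triangle_ineq)
  then have "\<exists>q\<in>Collect oc_seminorm. \<forall>f\<in>topspace oc_space. cmod (u f) \<le> q f"
    by (intro bexI[of _ "\<lambda>f. cmod (u f)"]) auto
  with * show "u \<in> dual oc_space"
    unfolding oc.in_dual_iff topspace_oc_space by simp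
qed

lemma dual_oc_bound:
  assumes "u \<in> dual oc_space" "1 \<le> k"
  obtains m c where "0 < c" "\<And>f. f \<in> oc_fun k \<Longrightarrow> cmod (u f) \<le> c * ocn m k f"
proof -
  have "oc_seminorm (\<lambda>f. cmod (u f))"
    using assms(1) unfolding dual_oc_iff oc_seminorm_def seminorm_on_def
    by (auto simp: norm_mult norm_triangle_ineq)
  then show ?thesis using oc_seminormE[OF _ assms(2)] that by metis
qed

section \<open>Convolution operators\<close>

lemma vector_derivative_norm_bound:
  fixes F :: "real \<Rightarrow> complex"
  assumes "\<And>z. (F has_vector_derivative F' z) (at z)"
    and "\<And>z. z \<in> closed_segment a b \<Longrightarrow> cmod (F' z) \<le> B"
  shows "cmod (F b - F a) \<le> B * \<bar>b - a\<bar>"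
proof -
  have "norm (F b - F a) \<le> B * norm (b - a)"
  proof (rule differentiable_bound[where S = "closed_segment a b" and f' = "\<lambda>z h. h *\<^sub>R F' z"])
    show "(F has_derivative (\<lambda>h. h *\<^sub>R F' z)) (at z within closed_segment a b)" for z
      using assms(1)[of z] unfolding has_vector_derivative_def by (rule has_derivative_at_withinI)
    show "onorm (\<lambda>h. h *\<^sub>R F' z) \<le> B" if "z \<in> closed_segment a b" for z
      by (rule onorm_le) (use assms(2)[OF that] in \<open>auto simp: mult.commute[of B] intro: mult_left_mono\<close>)
  qed auto
  then show ?thesis by simp
qed

text \<open>The mean value inequality twice: for \<open>F'\<close>, and then for
  \<open>F z - z * F' a\<close>, whose derivative is \<open>F' z - F' a\<close>.\<close>

lemma taylor_bound:
  fixes F :: "real \<Rightarrow> complex"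
  assumes F: "\<And>z. (F has_vector_derivative F' z) (at z)"
    and F': "\<And>z. (F' has_vector_derivative F'' z) (at z)"
    and B: "\<And>t. \<bar>t\<bar> \<le> \<bar>h\<bar> \<Longrightarrow> cmod (F'' (a + t)) \<le> B"
  shows "cmod (F (a + h) - F a - of_real h * F' a) \<le> B * h\<^sup>2"
proof -
  have seg: "\<bar>z - a\<bar> \<le> \<bar>h\<bar>" if "z \<in> closed_segment a (a + h)" for z
    using that by (auto simp: closed_segment_eq_real_ivl split: if_splits)
  have B0: "0 \<le> B" using B[of 0] norm_ge_zero order_trans by (metis abs_ge_zero abs_zero)
  have 1: "cmod (F' z - F' a) \<le> B * \<bar>h\<bar>" if z: "z \<in> closed_segment a (a + h)" for z
  proof -
    have "cmod (F' z - F' a) \<le> B * \<bar>z - a\<bar>"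
    proof (rule vector_derivative_norm_bound[OF F'])
      fix y assume "y \<in> closed_segment a z"
      then have "y \<in> closed_segment a (a + h)" using z by (meson ends_in_segment(1) subset_closed_segment subsetD)
      then show "cmod (F'' y) \<le> B" using B[of "y - a"] seg by simp
    qed
    also have "\<dots> \<le> B * \<bar>h\<bar>" using seg[OF z] B0 by (rule mult_left_mono)
    finally show ?thesis .
  qed
  have D: "((\<lambda>z. F z - of_real z * F' a) has_vector_derivative F' z - F' a) (at z)" for z
  proof -
    have "((\<lambda>z. z *\<^sub>R F' a) has_vector_derivative F' a) (at z)"
      using has_vector_derivative_scaleR[OF DERIV_ident has_vector_derivative_const[of "F' a" "at z"]] by simp
    from has_vector_derivative_diff[OF F[of z] this] show ?thesis by (simp add: scaleR_conv_of_real)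
  qed
  have "cmod ((F (a + h) - of_real (a + h) * F' a) - (F a - of_real a * F' a)) \<le> (B * \<bar>h\<bar>) * \<bar>a + h - a\<bar>"
    by (rule vector_derivative_norm_bound[OF D 1])
  then show ?thesis by (simp add: algebra_simps power2_eq_square abs_mult_self_eq)
qed

text \<open>A quadratic remainder leaves difference quotients of order \<open>h\<close>. The
  criterion serves to differentiate through a functional, to differentiate a series termwise, and at
  the flat point of \<open>exp (- 1 / x)\<close>.\<close>

lemma has_vector_derivative_quadratic:
  fixes F :: "real \<Rightarrow> complex"
  assumes "\<And>h. \<bar>h\<bar> \<le> 1 \<Longrightarrow> cmod (F (x + h) - F x - of_real h * D) \<le> C * h\<^sup>2"
  shows "(F has_vector_derivative D) (at x)"
  unfolding has_vector_derivative_def has_derivative_iff_norm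
proof
  show "bounded_linear (\<lambda>h. h *\<^sub>R D)" by (rule bounded_linear_scaleR_left)
  show "((\<lambda>y. norm (F y - F x - (y - x) *\<^sub>R D) / norm (y - x)) \<longlongrightarrow> 0) (at x)"
  proof (rule Lim_null_comparison)
    have "\<bar>norm (F y - F x - (y - x) *\<^sub>R D) / norm (y - x)\<bar> \<le> C * \<bar>y - x\<bar>" if "y \<noteq> x" "\<bar>y - x\<bar> \<le> 1" for y
    proof -
      have "norm (F y - F x - (y - x) *\<^sub>R D) \<le> C * (y - x)\<^sup>2"
        using assms[OF that(2)] by (simp add: scaleR_conv_of_real)
      also have "\<dots> = C * \<bar>y - x\<bar> * \<bar>y - x\<bar>" by (simp add: power2_eq_square)
      finally show ?thesis using that(1) by (simp add: divide_le_eq)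
    qed
    then show "\<forall>\<^sub>F y in at x. norm (norm (F y - F x - (y - x) *\<^sub>R D) / norm (y - x)) \<le> C * \<bar>y - x\<bar>"
      unfolding eventually_at by (intro exI[of _ 1]) (auto simp: dist_real_def)
    have "((\<lambda>y. C * \<bar>y - x\<bar>) \<longlongrightarrow> C * \<bar>x - x\<bar>) (at x)" by (intro tendsto_intros)
    then show "((\<lambda>y. C * \<bar>y - x\<bar>) \<longlongrightarrow> 0) (at x)" by simp
  qed
qed

text \<open>Peetre's inequality moves the growth into the factor \<open>wt x ^ k\<close>: reflected
  translates stay in the same step, and that factor becomes the growth of the convolution.\<close>

lemma
  assumes f: "f \<in> oc_fun k"
  shows reflect_oc_fun: "(\<lambda>y. f (x - y)) \<in> oc_fun k"
    and ocn_reflect: "ocn m k (\<lambda>y. f (x - y)) \<le> 2 ^ k * wt x ^ k * ocn m k f"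
proof -
  have *: "cmod (iter_deriv i (\<lambda>y. f (x - y)) y) \<le> (2 ^ k * wt x ^ k * ocn m k f) * wt y ^ k" if "i \<le> m" for i m y
  proof -
    have "cmod (iter_deriv i f (x - y)) \<le> ocn m k f * wt (x - y) ^ k" by (rule ocn_upper[OF f that])
    also have "\<dots> \<le> ocn m k f * (2 ^ k * wt x ^ k * wt y ^ k)"
      by (intro mult_left_mono wt_diff_power_le ocn_nonneg)
    finally show ?thesis using cmod_iter_deriv_reflect[OF oc_fun_smooth[OF f]] by (simp add: algebra_simps)
  qed
  show "(\<lambda>y. f (x - y)) \<in> oc_fun k"
    by (rule oc_funI[OF smooth_reflect[OF oc_fun_smooth[OF f]]]) (use * in blast)
  show "ocn m k (\<lambda>y. f (x - y)) \<le> 2 ^ k * wt x ^ k * ocn m k f"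
    by (rule ocn_leI[OF *]) (simp_all add: ocn_nonneg wt_pos less_imp_le)
qed

lemma reflect_oc_all: "f \<in> oc_all \<Longrightarrow> (\<lambda>y. f (x - y)) \<in> oc_all"
  using reflect_oc_fun oc_fun_subset by (blast elim: oc_allE)

lemma
  assumes f: "f \<in> oc_fun k"
  shows iter_deriv_oc_fun: "iter_deriv j f \<in> oc_fun k"
    and ocn_iter_deriv: "ocn m k (iter_deriv j f) \<le> ocn (j + m) k f"
proof -
  note s = oc_fun_smooth[OF f]
  have *: "cmod (iter_deriv i (iter_deriv j f) y) \<le> ocn (j + m) k f * wt y ^ k" if "i \<le> m" for i m y
    unfolding iter_deriv_iter_deriv[OF s] by (rule ocn_upper[OF f]) (use that in simp)
  show "iter_deriv j f \<in> oc_fun k"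
    by (rule oc_funI[OF smooth_iter_deriv[OF s]]) (use * in blast)
  show "ocn m k (iter_deriv j f) \<le> ocn (j + m) k f"
    by (rule ocn_leI[OF *]) (simp_all add: ocn_nonneg)
qed

lemma dual_ocD:
  assumes "u \<in> dual oc_space"
  shows "f \<in> oc_all \<Longrightarrow> g \<in> oc_all \<Longrightarrow> u (f + g) = u f + u g"
    "f \<in> oc_all \<Longrightarrow> u (\<lambda>x. c * f x) = c * u f"
    "f \<notin> oc_all \<Longrightarrow> u f = 0" "u 0 = 0"
    "f \<in> oc_all \<Longrightarrow> g \<in> oc_all \<Longrightarrow> u (f - g) = u f - u g"
  using oc.in_dualD(1-5)[OF assms] unfolding topspace_oc_space by blast+

text \<open>The Taylor remainder of the reflected translates is quadratic in \<open>h\<close> not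
  just pointwise but in the norm \<open>ocn m k\<close> that dominates \<open>u\<close>.\<close>

lemma convolution_derivative:
  assumes u: "u \<in> dual oc_space" and f: "f \<in> oc_all"
  shows "(convolution u f has_vector_derivative convolution u (iter_deriv 1 f) x) (at x)"
proof -
  obtain k where k: "1 \<le> k" "f \<in> oc_fun k" using f by (rule oc_allE)
  note s = oc_fun_smooth[OF k(2)]
  obtain m c where mc: "0 < c" "\<And>f. f \<in> oc_fun k \<Longrightarrow> cmod (u f) \<le> c * ocn m k f"
    using dual_oc_bound[OF u k(1)] by metis
  \<comment> \<open>\<open>m\<close> derivatives are measured by the norm, and the remainder uses
    two more.\<close>
  define N where "N = ocn (m + 2) k f"
  show ?thesis
  proof (rule has_vector_derivative_quadratic)
    fix h :: real assume h: "\<bar>h\<bar> \<le> 1"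
    let ?a = "\<lambda>y. f (x + h - y)" and ?b = "\<lambda>y. f (x - y)" and ?d = "\<lambda>y. iter_deriv 1 f (x - y)"
    have d: "?d \<in> oc_fun k" by (intro reflect_oc_fun iter_deriv_oc_fun k)
    have hd: "(\<lambda>y. of_real h * ?d y) \<in> oc_fun k" by (rule lin_subspaceD(3)[OF lin_subspace_oc_fun d])
    have ab: "?a \<in> oc_fun k" "?b \<in> oc_fun k" by (intro reflect_oc_fun k)+
    define R where "R = ?a - ?b - (\<lambda>y. of_real h * ?d y)"
    have "?a - ?b \<in> oc_fun k" by (rule lin_subspaceD(5)[OF lin_subspace_oc_fun ab])
    then have R: "R \<in> oc_fun k" unfolding R_def by (rule lin_subspaceD(5)[OF lin_subspace_oc_fun _ hd])
    have sub: "oc_fun k \<subseteq> oc_all" by (rule oc_fun_subset[OF k(1)])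
    have uR: "u R = convolution u f (x + h) - convolution u f x - of_real h * convolution u (iter_deriv 1 f) x"
      unfolding R_def convolution_def
      using dual_ocD(5)[OF u subsetD[OF sub \<open>?a - ?b \<in> oc_fun k\<close>] subsetD[OF sub hd]]
        dual_ocD(5)[OF u subsetD[OF sub ab(1)] subsetD[OF sub ab(2)]]
        dual_ocD(2)[OF u subsetD[OF sub d], of "of_real h"] by simp
    have "ocn m k R \<le> N * 8 ^ k * wt x ^ k * h\<^sup>2"
    proof (rule ocn_leI)
      fix y i assume i: "i \<le> m"
      have "iter_deriv i R y = (-1) ^ i * (iter_deriv i f (x - y + h) - iter_deriv i f (x - y) - of_real h * iter_deriv (Suc i) f (x - y))"
        unfolding R_def
        by (simp add: iter_deriv_diff iter_deriv_cmult smooth_diff smooth_cmult smooth_reflect s smooth_iter_deriv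
            iter_deriv_reflect iter_deriv_iter_deriv)
          (simp add: algebra_simps)
      then have "cmod (iter_deriv i R y) = cmod (iter_deriv i f (x - y + h) - iter_deriv i f (x - y) - of_real h * iter_deriv (Suc i) f (x - y))"
        by (simp add: norm_mult norm_power)
      also have "\<dots> \<le> N * (8 ^ k * wt x ^ k * wt y ^ k) * h\<^sup>2"
      proof (rule taylor_bound[OF smoothD[OF s] smoothD[OF s]])
        fix t :: real assume t: "\<bar>t\<bar> \<le> \<bar>h\<bar>"
        have "cmod (iter_deriv (Suc (Suc i)) f (x - y + t)) \<le> N * wt (x - y + t) ^ k"
          unfolding N_def by (rule ocn_upper[OF k(2)]) (use i in simp)
        also have "wt (x - y + t) ^ k \<le> (8 * wt x * wt y) ^ k"
        \<comment> \<open>8 is 2 from \<open>wt t\<close>, as \<open>t\<close> lies in the unit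
          interval about 0, times 2 from Peetre for the sum of \<open>x - y\<close> and
          \<open>t\<close>, times 2 for \<open>x - y\<close> itself.\<close>
        proof (rule power_mono)
          have "wt t \<le> 2" using t h unfolding wt_def by (simp add: abs_square_le_1)
          then have "wt (x - y + t) \<le> 2 * wt (x - y) * 2"
            by (intro order_trans[OF wt_add_le[of "x - y" t]] mult_left_mono) (auto simp: wt_pos less_imp_le)
          also have "\<dots> \<le> 2 * (2 * wt x * wt (- y)) * 2" using wt_add_le[of x "- y"] by simp
          finally show "wt (x - y + t) \<le> 8 * wt x * wt y" by simp
        qed (simp add: wt_pos less_imp_le)
        finally show "cmod (iter_deriv (Suc (Suc i)) f (x - y + t)) \<le> N * (8 ^ k * wt x ^ k * wt y ^ k)"
          using ocn_nonneg[of "m + 2" k f] unfolding N_def[symmetric]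
          by (simp add: power_mult_distrib mult_left_mono)
      qed
      finally show "cmod (iter_deriv i R y) \<le> N * 8 ^ k * wt x ^ k * h\<^sup>2 * wt y ^ k"
        by (simp add: algebra_simps)
    qed (simp add: N_def ocn_nonneg wt_pos less_imp_le)
    then have "c * ocn m k R \<le> c * (N * 8 ^ k * wt x ^ k * h\<^sup>2)" using mc(1) by simp
    with mc(2)[OF R] show "cmod (convolution u f (x + h) - convolution u f x - of_real h * convolution u (iter_deriv 1 f) x)
        \<le> (c * (N * 8 ^ k * wt x ^ k)) * h\<^sup>2"
      unfolding uR by (simp add: algebra_simps)
  qed
qed

lemma iter_deriv_oc_all: "f \<in> oc_all \<Longrightarrow> iter_deriv j f \<in> oc_all"
  using iter_deriv_oc_fun oc_fun_subset by (blast elim: oc_allE)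

lemma
  assumes u: "u \<in> dual oc_space" and f: "f \<in> oc_all"
  shows smooth_convolution: "smooth (convolution u f)"
    and iter_deriv_convolution: "iter_deriv i (convolution u f) = convolution u (iter_deriv i f)"
proof -
  have "(convolution u (iter_deriv i f) has_vector_derivative convolution u (iter_deriv (Suc i) f) x) (at x)" for i x
    using convolution_derivative[OF u iter_deriv_oc_all[OF f], of i x]
    by (simp add: iter_deriv_iter_deriv oc_all_smooth[OF f])
  note * = smooth_chainI[of "\<lambda>i. convolution u (iter_deriv i f)", OF this]
    iter_deriv_chainI[of "\<lambda>i. convolution u (iter_deriv i f)", OF this]
  show "smooth (convolution u f)" "iter_deriv i (convolution u f) = convolution u (iter_deriv i f)"
    by (rule *, simp)+
qed

text \<open>Convolution loses \<open>m\<close> derivatives but no growth. The functional enters only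
  through \<open>c\<close> and \<open>m\<close>, so an equicontinuous family gets common
  estimates.\<close>

lemma
  assumes u: "u \<in> dual oc_space" and k: "1 \<le> k" and c: "0 \<le> c"
    and bd: "\<And>f. f \<in> oc_fun k \<Longrightarrow> cmod (u f) \<le> c * ocn m k f" and f: "f \<in> oc_fun k"
  shows convolution_oc_fun: "convolution u f \<in> oc_fun k"
    and ocn_convolution: "ocn j k (convolution u f) \<le> 2 ^ k * c * ocn (j + m) k f"
proof -
  have fo: "f \<in> oc_all" using f oc_fun_subset[OF k] by blast
  have *: "cmod (iter_deriv i (convolution u f) x) \<le> (2 ^ k * c * ocn (j + m) k f) * wt x ^ k" if "i \<le> j" for i j x
  proof -
    have "cmod (iter_deriv i (convolution u f) x) \<le> c * ocn m k (\<lambda>y. iter_deriv i f (x - y))"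
      unfolding iter_deriv_convolution[OF u fo] unfolding convolution_def
      by (intro bd reflect_oc_fun iter_deriv_oc_fun f)
    also have "\<dots> \<le> c * (2 ^ k * wt x ^ k * ocn (j + m) k f)"
    proof (intro mult_left_mono c)
      have "ocn m k (\<lambda>y. iter_deriv i f (x - y)) \<le> 2 ^ k * wt x ^ k * ocn m k (iter_deriv i f)"
        by (intro ocn_reflect iter_deriv_oc_fun f)
      also have "\<dots> \<le> 2 ^ k * wt x ^ k * ocn (j + m) k f"
        using order_trans[OF ocn_iter_deriv[OF f, of m i] ocn_mono[OF f, of "i + m" "j + m"]] that wt_pos[of x]
        by (intro mult_left_mono) auto
      finally show "ocn m k (\<lambda>y. iter_deriv i f (x - y)) \<le> 2 ^ k * wt x ^ k * ocn (j + m) k f" .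
    qed
    finally show ?thesis by (simp add: algebra_simps)
  qed
  show "convolution u f \<in> oc_fun k"
    by (rule oc_funI[OF smooth_convolution[OF u fo]]) (use * in blast)
  show "ocn j k (convolution u f) \<le> 2 ^ k * c * ocn (j + m) k f"
    by (rule ocn_leI[OF *]) (simp_all add: c ocn_nonneg)
qed

text \<open>Peetre splits the weight at \<open>x\<close> between \<open>x - y\<close>, where the
  decay of \<open>f\<close> pays for it, and \<open>y\<close>, where functions of step
  \<open>n\<close> may grow.\<close>

lemma ocn_reflect_schwartz:
  assumes f: "f \<in> schwartz_fun"
  shows "wt x ^ n * ocn m n (\<lambda>y. iter_deriv i f (x - y)) \<le> 2 ^ n * sn (n + i + m) f"
proof -
  note s = schwartz_fun_smooth[OF f]
  have "ocn m n (\<lambda>y. iter_deriv i f (x - y)) \<le> 2 ^ n * sn (n + i + m) f / wt x ^ n"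
  proof (rule ocn_leI)
    fix y a assume a: "a \<le> m"
    have "wt x ^ n * cmod (iter_deriv (i + a) f (x - y)) \<le> (2 ^ n * wt (x - y) ^ n * wt y ^ n) * cmod (iter_deriv (i + a) f (x - y))"
      using wt_add_power_le[of "x - y" y n] by (intro mult_right_mono) auto
    also have "\<dots> = 2 ^ n * wt y ^ n * (wt (x - y) ^ n * cmod (iter_deriv (i + a) f (x - y)))" by simp
    also have "\<dots> \<le> 2 ^ n * wt y ^ n * sn (n + i + m) f"
      using a wt_pos[of y] by (intro mult_left_mono schwartz_fun_decay[OF f]) auto
    finally have "wt x ^ n * cmod (iter_deriv (i + a) f (x - y)) \<le> 2 ^ n * wt y ^ n * sn (n + i + m) f" .
    then show "cmod (iter_deriv a (\<lambda>y. iter_deriv i f (x - y)) y) \<le> 2 ^ n * sn (n + i + m) f / wt x ^ n * wt y ^ n"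
      using wt_power_pos[of x n]
      by (simp add: cmod_iter_deriv_reflect smooth_iter_deriv s iter_deriv_iter_deriv field_simps)
  qed (simp add: sn_nonneg wt_pos less_imp_le)
  then show ?thesis using wt_power_pos[of x n] by (simp add: field_simps)
qed

lemma convolution_decay:
  assumes u: "u \<in> dual oc_space" and n: "1 \<le> n" and c: "0 \<le> c"
    and bd: "\<And>f. f \<in> oc_fun n \<Longrightarrow> cmod (u f) \<le> c * ocn m n f" and f: "f \<in> schwartz_fun"
  shows "wt x ^ n * cmod (iter_deriv i (convolution u f) x) \<le> 2 ^ n * c * sn (n + i + m) f"
proof -
  have fn: "f \<in> oc_fun n" using f schwartz_fun_subset by blast
  have fo: "f \<in> oc_all" using f schwartz_fun_oc_all by blast
  have "wt x ^ n * cmod (iter_deriv i (convolution u f) x) \<le> wt x ^ n * (c * ocn m n (\<lambda>y. iter_deriv i f (x - y)))"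
    unfolding iter_deriv_convolution[OF u fo] unfolding convolution_def
    by (intro mult_left_mono bd reflect_oc_fun iter_deriv_oc_fun fn) (simp add: wt_pos less_imp_le)
  also have "\<dots> = c * (wt x ^ n * ocn m n (\<lambda>y. iter_deriv i f (x - y)))" by simp
  also have "\<dots> \<le> c * (2 ^ n * sn (n + i + m) f)"
    by (intro mult_left_mono ocn_reflect_schwartz f c)
  finally show ?thesis by (simp only: mult_ac)
qed

lemma convolution_schwartz_fun:
  assumes u: "u \<in> dual oc_space" and f: "f \<in> schwartz_fun"
  shows "convolution u f \<in> schwartz_fun"
proof (rule schwartz_funI)
  show "smooth (convolution u f)"
    using smooth_convolution[OF u] f schwartz_fun_oc_all by blast
  fix n i
  \<comment> \<open>\<open>Suc n\<close>, because bounds for \<open>u\<close> exist only on steps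
    from 1 on.\<close>
  obtain m c where mc: "0 < c" "\<And>f. f \<in> oc_fun (Suc n) \<Longrightarrow> cmod (u f) \<le> c * ocn m (Suc n) f"
    using dual_oc_bound[OF u, of "Suc n"] by (metis Suc_eq_plus1_left le_add1)
  have "wt x ^ n * cmod (iter_deriv i (convolution u f) x) \<le> 2 ^ Suc n * c * sn (Suc n + i + m) f" for x
  proof -
    have "wt x ^ n * cmod (iter_deriv i (convolution u f) x) \<le> wt x ^ Suc n * cmod (iter_deriv i (convolution u f) x)"
      by (intro mult_right_mono wt_power_mono) auto
    also have "\<dots> \<le> 2 ^ Suc n * c * sn (Suc n + i + m) f"
      by (rule convolution_decay[OF u]) (use mc f in auto)
    finally show ?thesis .
  qed
  then show "\<exists>c. \<forall>x. wt x ^ n * cmod (iter_deriv i (convolution u f) x) \<le> c" by blast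
qed

lemma sn_convolution:
  assumes u: "u \<in> dual oc_space" and n: "1 \<le> n" and c: "0 \<le> c"
    and bd: "\<And>f. f \<in> oc_fun n \<Longrightarrow> cmod (u f) \<le> c * ocn m n f" and f: "f \<in> schwartz_fun"
  shows "sn n (convolution u f) \<le> 2 ^ n * c * sn (n + n + m) f"
proof (rule sn_leI)
  fix x i assume "i \<le> n"
  then have "2 ^ n * c * sn (n + i + m) f \<le> 2 ^ n * c * sn (n + n + m) f"
    using c by (intro mult_left_mono sn_mono f) auto
  with convolution_decay[OF u n c bd f, of x i]
  show "wt x ^ n * cmod (iter_deriv i (convolution u f) x) \<le> 2 ^ n * c * sn (n + n + m) f" by (rule order_trans)
qed (simp add: c sn_nonneg)

lemma convolution_oc_all: "u \<in> dual oc_space \<Longrightarrow> f \<in> oc_all \<Longrightarrow> convolution u f \<in> oc_all"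
proof -
  assume u: "u \<in> dual oc_space" and "f \<in> oc_all"
  then obtain k where k: "1 \<le> k" "f \<in> oc_fun k" by (auto elim: oc_allE)
  obtain m c where mc: "0 < c" "\<And>f. f \<in> oc_fun k \<Longrightarrow> cmod (u f) \<le> c * ocn m k f"
    using dual_oc_bound[OF u k(1)] by metis
  have "convolution u f \<in> oc_fun k"
    by (rule convolution_oc_fun[OF u k(1) _ mc(2) k(2)]) (use mc(1) in auto)
  then show ?thesis using oc_fun_subset[OF k(1)] by blast
qed

lemma convolution_add:
  assumes u: "u \<in> dual oc_space" and fg: "f \<in> oc_all" "g \<in> oc_all"
  shows "convolution u (f + g) = convolution u f + convolution u g"
proof
  fix x
  have "(\<lambda>y. (f + g) (x - y)) = (\<lambda>y. f (x - y)) + (\<lambda>y. g (x - y))" by (simp add: plus_fun_def)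
  then show "convolution u (f + g) x = (convolution u f + convolution u g) x"
    unfolding convolution_def using dual_ocD(1)[OF u reflect_oc_all[OF fg(1)] reflect_oc_all[OF fg(2)]] by simp
qed

lemma convolution_cmult:
  assumes u: "u \<in> dual oc_space" and f: "f \<in> oc_all"
  shows "convolution u (\<lambda>x. c * f x) = (\<lambda>x. c * convolution u f x)"
  unfolding convolution_def using dual_ocD(2)[OF u reflect_oc_all[OF f]] by simp

lemma convolution_diff:
  assumes u: "u \<in> dual oc_space" and fg: "f \<in> oc_all" "g \<in> oc_all"
  shows "convolution u (f - g) = convolution u f - convolution u g"
  using convolution_add[OF u, of "f - g" g] fg lin_subspaceD(5)[OF lin_subspace_oc_all fg] by simp

section \<open>Continuity of convolution on both spaces of test functions\<close>

lemma oc_seminorm_convolution: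
  assumes u: "u \<in> dual oc_space" and q: "oc_seminorm q"
  shows "oc_seminorm (\<lambda>f. q (convolution u f))"
  unfolding oc_seminorm_def seminorm_on_def
proof (intro conjI ballI allI impI)
  note qs = conjunct1[OF q[unfolded oc_seminorm_def]]
  show "0 \<le> q (convolution u f)" if "f \<in> oc_all" for f
    using seminorm_onD(1)[OF qs convolution_oc_all[OF u that]] .
  show "q (convolution u (f + g)) \<le> q (convolution u f) + q (convolution u g)" if "f \<in> oc_all" "g \<in> oc_all" for f g
    unfolding convolution_add[OF u that] by (intro seminorm_onD(2)[OF qs] convolution_oc_all u that)
  show "q (convolution u (\<lambda>x. c * f x)) = cmod c * q (convolution u f)" if "f \<in> oc_all" for f c
    unfolding convolution_cmult[OF u that] by (intro seminorm_onD(3)[OF qs] convolution_oc_all u that)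
  fix k :: nat assume k: "1 \<le> k"
  obtain m c where mc: "0 < c" "\<And>f. f \<in> oc_fun k \<Longrightarrow> cmod (u f) \<le> c * ocn m k f"
    using dual_oc_bound[OF u k] by metis
  obtain j d where jd: "0 < d" "\<And>f. f \<in> oc_fun k \<Longrightarrow> q f \<le> d * ocn j k f"
    using oc_seminormE[OF q k] by metis
  have "q (convolution u f) \<le> d * (2 ^ k * c) * ocn (j + m) k f" if f: "f \<in> oc_fun k" for f
  proof -
    have c: "0 \<le> c" using mc(1) by simp
    have "q (convolution u f) \<le> d * ocn j k (convolution u f)"
      by (intro jd convolution_oc_fun[OF u k c mc(2) f])
    also have "\<dots> \<le> d * (2 ^ k * c * ocn (j + m) k f)"
      using jd(1) by (intro mult_left_mono ocn_convolution[OF u k c mc(2) f]) auto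
    finally show ?thesis by (simp add: mult.assoc)
  qed
  then show "\<exists>m c. \<forall>f\<in>oc_fun k. q (convolution u f) \<le> c * ocn m k f" by blast
qed

lemma conv_op_oc_operators:
  assumes u: "u \<in> dual oc_space"
  shows "conv_op oc_space u \<in> operators oc_space"
proof -
  have "continuous_map oc_space oc_space (conv_op oc_space u)"
  proof (rule continuous_map_seminormed[OF seminormed_oc_space seminormed_oc_space])
    fix q assume "q \<in> Collect oc_seminorm"
    then show "\<exists>p\<in>Collect oc_seminorm. \<forall>f\<in>topspace oc_space. q (conv_op oc_space u f) \<le> p f"
      using oc_seminorm_convolution[OF u, of q]
      by (intro bexI[of _ "\<lambda>f. q (convolution u f)"]) (auto simp: conv_op_def)
  qed (use u in \<open>auto simp: conv_op_def topspace_oc_space convolution_oc_all convolution_diff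
      lin_subspaceD(5)[OF lin_subspace_oc_all]\<close>)
  then show ?thesis
    unfolding operators_def lin_on_def
    using u by (auto simp: conv_op_def topspace_oc_space convolution_add convolution_cmult
        lin_subspaceD(2,3)[OF lin_subspace_oc_all])
qed

lemma conv_op_schwartz_operators:
  assumes u: "u \<in> dual oc_space"
  shows "conv_op schwartz_space u \<in> operators schwartz_space"
proof -
  have sub: "f \<in> oc_all" if "f \<in> schwartz_fun" for f using that schwartz_fun_oc_all by blast
  have "continuous_map schwartz_space schwartz_space (conv_op schwartz_space u)"
  proof (rule continuous_map_seminormed[OF seminormed_schwartz_space seminormed_schwartz_space])
    fix q assume "q \<in> schwartz_seminorms"
    then obtain d n where d: "d > 0" "q = (\<lambda>f. d * sn n f)" by (auto simp: schwartz_seminorms_def)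
    obtain m c where mc: "0 < c" "\<And>f. f \<in> oc_fun (Suc n) \<Longrightarrow> cmod (u f) \<le> c * ocn m (Suc n) f"
      using dual_oc_bound[OF u, of "Suc n"] by (metis Suc_eq_plus1_left le_add1)
    have "d * sn n (convolution u f) \<le> (d * (2 ^ Suc n * c)) * sn (Suc n + Suc n + m) f" if f: "f \<in> schwartz_fun" for f
    proof -
      have "sn n (convolution u f) \<le> sn (Suc n) (convolution u f)"
        by (intro sn_mono convolution_schwartz_fun u f) simp
      also have "\<dots> \<le> 2 ^ Suc n * c * sn (Suc n + Suc n + m) f"
        by (rule sn_convolution[OF u _ _ mc(2) f]) (use mc(1) in auto)
      finally show ?thesis using d(1) by (simp add: mult.assoc)
    qed
    moreover have "(\<lambda>f. (d * (2 ^ Suc n * c)) * sn (Suc n + Suc n + m) f) \<in> schwartz_seminorms"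
      unfolding schwartz_seminorms_def using d(1) mc(1)
      by (intro CollectI exI[of _ "d * (2 ^ Suc n * c)"] exI[of _ "Suc n + Suc n + m"]) simp
    ultimately show "\<exists>p\<in>schwartz_seminorms. \<forall>f\<in>topspace schwartz_space. q (conv_op schwartz_space u f) \<le> p f"
      unfolding d(2) topspace_schwartz_space
      by (intro bexI[of _ "\<lambda>f. (d * (2 ^ Suc n * c)) * sn (Suc n + Suc n + m) f"]) (auto simp: conv_op_def topspace_schwartz_space)
  qed (use u in \<open>auto simp: conv_op_def topspace_schwartz_space convolution_schwartz_fun convolution_diff sub
      lin_subspaceD(5)[OF lin_subspace_schwartz_fun]\<close>)
  then show ?thesis
    unfolding operators_def lin_on_def
    using u by (auto simp: conv_op_def topspace_schwartz_space convolution_add convolution_cmult sub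
        lin_subspaceD(2,3)[OF lin_subspace_schwartz_fun])
qed

lemma convolution_reflection: "convolution (reflection u) f x = u (\<lambda>y. f (x + y))"
  by (simp add: convolution_def reflection_def)

lemma reflection_dual:
  assumes u: "u \<in> dual oc_space"
  shows "reflection u \<in> dual oc_space"
  unfolding dual_oc_iff
proof (intro conjI ballI allI impI)
  have r: "(\<lambda>y. f (- y)) \<in> oc_all" if "f \<in> oc_all" for f
    using reflect_oc_all[OF that, of 0] by simp
  show "reflection u (f + g) = reflection u f + reflection u g" if "f \<in> oc_all" "g \<in> oc_all" for f g
    using dual_ocD(1)[OF u r[OF that(1)] r[OF that(2)]] by (simp add: reflection_def plus_fun_def)
  show "reflection u (\<lambda>x. c * f x) = c * reflection u f" if "f \<in> oc_all" for f c
    using dual_ocD(2)[OF u r[OF that]] by (simp add: reflection_def)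
  show "reflection u f = 0" if "f \<notin> oc_all" for f
    unfolding reflection_def by (rule dual_ocD(3)[OF u]) (use that r[of "\<lambda>y. f (- y)"] in auto)
  fix k :: nat assume k: "1 \<le> k"
  obtain m c where mc: "0 < c" "\<And>f. f \<in> oc_fun k \<Longrightarrow> cmod (u f) \<le> c * ocn m k f"
    using dual_oc_bound[OF u k] by metis
  have "cmod (reflection u f) \<le> (c * 2 ^ k) * ocn m k f" if f: "f \<in> oc_fun k" for f
  proof -
    have "cmod (reflection u f) \<le> c * ocn m k (\<lambda>y. f (0 - y))"
      using mc(2)[OF reflect_oc_fun[OF f, of 0]] by (simp add: reflection_def)
    also have "\<dots> \<le> c * (2 ^ k * wt 0 ^ k * ocn m k f)"
      using mc(1) by (intro mult_left_mono ocn_reflect f) auto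
    finally show ?thesis by (simp add: mult.assoc)
  qed
  then show "\<exists>m c. \<forall>f\<in>oc_fun k. cmod (reflection u f) \<le> c * ocn m k f" by blast
qed

section \<open>Continuous operators and their transposes on strong duals\<close>

context seminormed
begin

lemma operators_bound:
  assumes A: "A \<in> operators E" and q: "q \<in> Q"
  obtains p where "p \<in> Q" "\<And>f. f \<in> topspace E \<Longrightarrow> q (A f) \<le> p f"
proof -
  have "openin E {f \<in> topspace E. A f \<in> {g \<in> topspace E. q g < 1}}"
    using A openin_unit_ball[OF q, of 1] unfolding operators_def
    by (intro openin_continuous_map_preimage[of E E]) auto
  moreover have A0: "A 0 = 0" by (rule lin_on_zero[OF operatorsD(2)[OF A] lin])
  ultimately obtain p where p: "p \<in> Q" "{g \<in> topspace E. p g < 1} \<subseteq> {f \<in> topspace E. A f \<in> {g \<in> topspace E. q g < 1}}"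
    using nhd_seminorm[of "{f \<in> topspace E. A f \<in> {g \<in> topspace E. q g < 1}}"] lin_simps(1)
      seminorm_on_zero[OF seminorm[OF q] lin] by auto
  have "q (A f) \<le> p f" if f: "f \<in> topspace E" for f
  proof (rule dense_ge)
    fix s assume s: "p f < s"
    then have s0: "s > 0" using seminorm_onD(1)[OF seminorm[OF p(1)] f] by simp
    have "p (\<lambda>x. of_real (1 / s) * f x) = 1 / s * p f"
      using seminorm_onD(3)[OF seminorm[OF p(1)] f, of "of_real (1/s)"] s0 by (simp add: norm_divide)
    also have "\<dots> < 1" using s s0 by simp
    finally have "q (A (\<lambda>x. of_real (1 / s) * f x)) < 1"
      using p(2) lin_simps(3)[OF f] by blast
    moreover have "A (\<lambda>x. of_real (1 / s) * f x) = (\<lambda>x. of_real (1 / s) * A f x)"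
      using operatorsD(2)[OF A] f unfolding lin_on_def by blast
    ultimately have "cmod (of_real (1 / s)) * q (A f) < 1"
      using seminorm_onD(3)[OF seminorm[OF q] operatorsD(1)[OF A f], of "of_real (1/s)"] by simp
    then show "q (A f) \<le> s" using s0 by (simp add: norm_divide)
  qed
  then show ?thesis by (rule that[OF p(1)])
qed

lemma operators_image_bounded:
  assumes A: "A \<in> operators E" and B: "B \<in> bounded_sets E"
  shows "A ` B \<in> bounded_sets E"
  unfolding bounded_sets_iff
proof (intro conjI ballI)
  show "A ` B \<subseteq> topspace E" using B operatorsD(1)[OF A] unfolding bounded_sets_iff by blast
  fix q assume "q \<in> Q"
  then obtain p where p: "p \<in> Q" "\<And>f. f \<in> topspace E \<Longrightarrow> q (A f) \<le> p f" using operators_bound[OF A] by metis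
  obtain C where "\<And>f. f \<in> B \<Longrightarrow> p f \<le> C" using B p(1) unfolding bounded_sets_iff by blast
  then have "\<forall>f\<in>A ` B. q f \<le> C" using p(2) B unfolding bounded_sets_iff by force
  then show "\<exists>C. \<forall>f\<in>A ` B. q f \<le> C" by blast
qed

text \<open>Zero outside the dual and outside the carrier, matching the conventions of
  \<open>operators\<close> and \<open>dual\<close>.\<close>

definition transp :: "(('x \<Rightarrow> complex) \<Rightarrow> ('x \<Rightarrow> complex)) \<Rightarrow> (('x \<Rightarrow> complex) \<Rightarrow> complex) \<Rightarrow> (('x \<Rightarrow> complex) \<Rightarrow> complex)" where
  "transp A S = (if S \<in> dual E then (\<lambda>f. if f \<in> topspace E then S (A f) else 0) else 0)"

lemma transp_dual:
  assumes A: "A \<in> operators E" and S: "S \<in> dual E"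
  shows "transp A S \<in> dual E"
proof -
  have AL: "A (f + g) = A f + A g" "A (\<lambda>x. c * f x) = (\<lambda>x. c * A f x)" if "f \<in> topspace E" "g \<in> topspace E" for f g c
    using operatorsD(2)[OF A] that unfolding lin_on_def by auto
  obtain q where q: "q \<in> Q" "\<And>f. f \<in> topspace E \<Longrightarrow> cmod (S f) \<le> q f" using in_dualD(6)[OF S] by blast
  obtain p where p: "p \<in> Q" "\<And>f. f \<in> topspace E \<Longrightarrow> q (A f) \<le> p f" using operators_bound[OF A q(1)] by metis
  have "\<exists>p\<in>Q. \<forall>f\<in>topspace E. cmod (transp A S f) \<le> p f"
    using p q(2) operatorsD(1)[OF A] S unfolding transp_def by (auto intro!: bexI[of _ p] intro: order_trans)
  then show ?thesis
    unfolding in_dual_iff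
    using S operatorsD(1)[OF A] by (simp add: transp_def AL in_dualD(1,2)[OF S] lin_simps(2,3))
qed

text \<open>Continuous operators preserve bounded sets, and the polar of \<open>B\<close> after the
  transpose is dominated by the polar of the image of \<open>B\<close>.\<close>

lemma transp_operators:
  assumes A: "A \<in> operators E"
  shows "transp A \<in> operators (strong_dual E)"
proof -
  have lin_d: "S + R \<in> dual E" "S - R \<in> dual E" "(\<lambda>f. c * S f) \<in> dual E" if "S \<in> dual E" "R \<in> dual E" for S R c
    using that lin_subspaceD[OF lin_subspace_dual] by auto
  have "continuous_map (strong_dual E) (strong_dual E) (transp A)"
  proof (rule continuous_map_seminormed[OF seminormed_strong_dual seminormed_strong_dual])
    show "transp A S \<in> topspace (strong_dual E)" if "S \<in> topspace (strong_dual E)" for S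
      using transp_dual[OF A] that unfolding topspace_strong_dual .
    show "transp A (S - R) = transp A S - transp A R"
      if "S \<in> topspace (strong_dual E)" "R \<in> topspace (strong_dual E)" for S R
      using that lin_d(2)[of S R] unfolding topspace_strong_dual by (auto simp: transp_def fun_eq_iff)
    fix q assume "q \<in> polar_seminorm ` bounded_sets E"
    then obtain B where B: "B \<in> bounded_sets E" "q = polar_seminorm B" by blast
    have AB: "A ` B \<in> bounded_sets E" by (rule operators_image_bounded[OF A B(1)])
    have "q (transp A S) \<le> polar_seminorm (A ` B) S" if S: "S \<in> dual E" for S
      unfolding B(2)
    proof (subst polar_seminorm_le_iff[OF transp_dual[OF A S] B(1) polar_seminorm_nonneg[OF S AB]], rule ballI)
      fix f assume f: "f \<in> B"
      then have "f \<in> topspace E" using B(1) unfolding bounded_sets_iff by blast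
      then show "cmod (transp A S f) \<le> polar_seminorm (A ` B) S"
        using polar_seminorm_upper[OF S AB, of "A f"] f S by (simp add: transp_def)
    qed
    then show "\<exists>p\<in>polar_seminorm ` bounded_sets E. \<forall>S\<in>topspace (strong_dual E). q (transp A S) \<le> p S"
      unfolding topspace_strong_dual using AB by blast
  qed
  then show ?thesis
    unfolding operators_def lin_on_def topspace_strong_dual using lin_d
    by (auto simp: transp_def fun_eq_iff)
qed

end

lemma dual_conv_op_transp:
  assumes "seminormed E Q"
  shows "dual_conv_op E u = seminormed.transp E (conv_op E (reflection u))"
  by (rule ext) (simp add: dual_conv_op_def seminormed.transp_def[OF assms] conv_op_def fun_eq_iff)

section \<open>Powers and means\<close>

text \<open>Reflected translation intertwines convolution by \<open>u\<close> with convolution by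
  its reflection. This carries powers defined by transposition over to powers of the
  operator.\<close>

lemma convolution_reflection_reflect:
  "convolution (reflection u) (\<lambda>y. g (x - y)) = (\<lambda>y. convolution u g (x - y))"
  unfolding convolution_reflection by (simp add: convolution_def diff_diff_eq)

lemma convolution_reflection_translate:
  "convolution (reflection u) (\<lambda>y. g (x + y)) = (\<lambda>y. convolution (reflection u) g (x + y))"
  unfolding convolution_reflection by (simp add: add.assoc)

lemma funpow_convolution_reflect:
  "(convolution (reflection u) ^^ m) (\<lambda>y. g (x - y)) = (\<lambda>y. (convolution u ^^ m) g (x - y))"
  by (induction m) (simp_all add: convolution_reflection_reflect)

lemma funpow_convolution_translate:
  "(convolution (reflection u) ^^ m) (\<lambda>y. g (x + y)) = (\<lambda>y. (convolution (reflection u) ^^ m) g (x + y))"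
  by (induction m) (simp_all add: convolution_reflection_translate)

lemma dual_conv_op_dual:
  assumes u: "u \<in> dual oc_space"
  shows "S \<in> dual oc_space \<Longrightarrow> dual_conv_op oc_space u S \<in> dual oc_space"
    and "R \<in> dual schwartz_space \<Longrightarrow> dual_conv_op schwartz_space u R \<in> dual schwartz_space"
  using oc.transp_dual[OF conv_op_oc_operators[OF reflection_dual[OF u]]]
    sw.transp_dual[OF conv_op_schwartz_operators[OF reflection_dual[OF u]]]
  unfolding dual_conv_op_transp[OF seminormed_oc_space] dual_conv_op_transp[OF seminormed_schwartz_space]
  by blast+

lemma dual_conv_op_operators:
  assumes u: "u \<in> dual oc_space"
  shows "dual_conv_op oc_space u \<in> operators (strong_dual oc_space)"
    and "dual_conv_op schwartz_space u \<in> operators (strong_dual schwartz_space)"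
  using oc.transp_operators[OF conv_op_oc_operators[OF reflection_dual[OF u]]]
    sw.transp_operators[OF conv_op_schwartz_operators[OF reflection_dual[OF u]]]
  unfolding dual_conv_op_transp[OF seminormed_oc_space] dual_conv_op_transp[OF seminormed_schwartz_space]
  by blast+

text \<open>Unfolding the transposed definition moves all factors but one onto the test function;
  the remaining one is \<open>T\<close> itself, hence exponent \<open>m\<close> against power
  \<open>Suc m\<close>.\<close>

lemma
  assumes T: "T \<in> dual oc_space"
  shows conv_power_dual: "conv_power T m \<in> dual oc_space"
    and conv_power_Suc_apply: "f \<in> oc_all \<Longrightarrow> conv_power T (Suc m) f = T ((convolution (reflection T) ^^ m) f)"
proof -
  have *: "conv_power T (Suc m) \<in> dual oc_space \<and>
    (\<forall>f\<in>oc_all. conv_power T (Suc m) f = T ((convolution (reflection T) ^^ m) f))" for m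
  proof (induction m)
    case (Suc m)
    have "conv_power T (Suc (Suc m)) f = T ((convolution (reflection T) ^^ Suc m) f)" if f: "f \<in> oc_all" for f
    proof -
      have "conv_power T (Suc (Suc m)) f = conv_power T (Suc m) (convolution (reflection T) f)"
        using Suc f by (simp add: dual_conv_op_def topspace_oc_space)
      also have "\<dots> = T ((convolution (reflection T) ^^ m) (convolution (reflection T) f))"
        using Suc convolution_oc_all[OF reflection_dual[OF T] f] by blast
      finally show ?thesis by (simp add: funpow_swap1)
    qed
    with Suc show ?case using dual_conv_op_dual(1)[OF T] by simp
  qed (simp add: T)
  then show "f \<in> oc_all \<Longrightarrow> conv_power T (Suc m) f = T ((convolution (reflection T) ^^ m) f)" by blast
  show "conv_power T m \<in> dual oc_space"
    using * lin_subspaceD(1)[OF oc.lin_subspace_dual] by (cases m) (simp_all del: conv_power.simps(2,3))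
qed

text \<open>Applies the previous formula to (reflected) translates of \<open>f\<close>; exponent 0
  is excluded because \<open>conv_power T 0\<close> is a dummy, not the unit.\<close>

lemma convolution_conv_power:
  assumes T: "T \<in> dual oc_space" and f: "f \<in> oc_all" and m: "1 \<le> m"
  shows "convolution (conv_power T m) f = (convolution T ^^ m) f"
    and "convolution (reflection (conv_power T m)) f = (convolution (reflection T) ^^ m) f"
proof -
  obtain l where l: "m = Suc l" using m by (cases m) auto
  have tr: "(\<lambda>y. f (x + y)) \<in> oc_all" for x
    using reflect_oc_all[OF reflect_oc_all[OF f, of 0], of "- x"] by (simp add: algebra_simps)
  show "convolution (conv_power T m) f = (convolution T ^^ m) f"
    unfolding l convolution_def[of "conv_power T (Suc l)"] conv_power_Suc_apply[OF T reflect_oc_all[OF f]]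
      funpow_convolution_reflect by (simp add: convolution_def[of T])
  show "convolution (reflection (conv_power T m)) f = (convolution (reflection T) ^^ m) f"
    unfolding l fun_eq_iff convolution_reflection[of "conv_power T (Suc l)"] conv_power_Suc_apply[OF T tr]
      funpow_convolution_translate by (simp add: convolution_reflection[of T])
qed

lemma sum_apply: "(\<Sum>i\<in>I. F i) x = (\<Sum>i\<in>I. F i x)" for F :: "'i \<Rightarrow> 'a \<Rightarrow> complex"
  by (induction I rule: infinite_finite_induct) auto

lemma conv_mean_dual:
  assumes T: "T \<in> dual oc_space"
  shows "conv_mean T n \<in> dual oc_space"
proof -
  have "(\<lambda>f. 1 / of_nat n * (\<Sum>m=1..n. conv_power T m) f) \<in> dual oc_space"
    by (intro lin_subspaceD(3)[OF oc.lin_subspace_dual] lin_subspace_sum[OF oc.lin_subspace_dual] conv_power_dual T)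
  then show ?thesis by (simp add: conv_mean_def sum_apply)
qed

lemma convolution_conv_mean:
  assumes T: "T \<in> dual oc_space" and f: "f \<in> oc_all"
  shows "convolution (conv_mean T n) f = (\<lambda>x. 1 / of_nat n * (\<Sum>m=1..n. (convolution T ^^ m) f x))"
    and "convolution (reflection (conv_mean T n)) f = (\<lambda>x. 1 / of_nat n * (\<Sum>m=1..n. (convolution (reflection T) ^^ m) f x))"
proof -
  have "(\<Sum>m=1..n. (convolution T ^^ m) f x) = (\<Sum>m=1..n. conv_power T m (\<lambda>y. f (x - y)))"
    "(\<Sum>m=1..n. (convolution (reflection T) ^^ m) f x) = (\<Sum>m=1..n. conv_power T m (\<lambda>y. f (x + y)))" for x
    by (rule sum.cong; simp add: convolution_conv_power[OF T f, symmetric] convolution_def[of "conv_power T _"]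
        convolution_reflection[of "conv_power T _"])+
  then show "convolution (conv_mean T n) f = (\<lambda>x. 1 / of_nat n * (\<Sum>m=1..n. (convolution T ^^ m) f x))"
    "convolution (reflection (conv_mean T n)) f = (\<lambda>x. 1 / of_nat n * (\<Sum>m=1..n. (convolution (reflection T) ^^ m) f x))"
    unfolding fun_eq_iff convolution_def[of "conv_mean T n"] convolution_reflection[of "conv_mean T n"]
    by (simp_all only: conv_mean_def simp_thms)
qed

text \<open>Ergodicity of the operator thus concerns the convolution operators of the means of
  \<open>T\<close>. The equality holds for total functions, including the values outside the
  carrier.\<close>

lemma cesaro_mean_conv_op:
  assumes T: "T \<in> dual oc_space" and E: "lin_subspace (topspace E)" "topspace E \<subseteq> oc_all"
    and inv: "\<And>f. f \<in> topspace E \<Longrightarrow> convolution T f \<in> topspace E"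
  shows "cesaro_mean (conv_op E T) n = conv_op E (conv_mean T n)"
proof
  fix f
  show "cesaro_mean (conv_op E T) n f = conv_op E (conv_mean T n) f"
  proof (cases "f \<in> topspace E")
    case True
    have "(conv_op E T ^^ m) f = (convolution T ^^ m) f \<and> (convolution T ^^ m) f \<in> topspace E" for m
      by (induction m) (auto simp: True conv_op_def inv)
    then show ?thesis
      using True E(2) by (auto simp: cesaro_mean_def conv_op_def convolution_conv_mean[OF T])
  next
    case False
    \<comment> \<open>Outside the carrier every power with positive exponent vanishes; the identity,
      as power 0, would not, but the means start at \<open>m = 1\<close>.\<close>
    have "conv_op E T 0 = 0"
      using lin_subspaceD(1)[OF E(1)] dual_ocD(4)[OF T]
      by (simp add: conv_op_def convolution_def zero_fun_def)
    then have "(conv_op E T ^^ Suc m) f = 0" for m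
      using False by (induction m) (auto simp: conv_op_def)
    then have "(conv_op E T ^^ m) f = 0" if "m \<in> {1..n}" for m using that by (cases m) auto
    then show ?thesis using False by (auto simp: cesaro_mean_def conv_op_def zero_fun_def)
  qed
qed

lemma cesaro_mean_dual_conv_op:
  assumes T: "T \<in> dual oc_space" and E: "seminormed E Q" "topspace E \<subseteq> oc_all"
    and inv: "\<And>f. f \<in> topspace E \<Longrightarrow> convolution (reflection T) f \<in> topspace E"
    and dual: "\<And>S. S \<in> dual E \<Longrightarrow> dual_conv_op E T S \<in> dual E"
  shows "cesaro_mean (dual_conv_op E T) n = dual_conv_op E (conv_mean T n)"
proof
  interpret seminormed E Q by fact
  fix S
  show "cesaro_mean (dual_conv_op E T) n S = dual_conv_op E (conv_mean T n) S"
  proof (cases "S \<in> dual E")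
    case True
    have d: "(dual_conv_op E T ^^ m) S \<in> dual E" for m
      by (induction m) (auto simp: True dual)
    have K: "(convolution (reflection T) ^^ m) f \<in> topspace E" if "f \<in> topspace E" for f m
      using that by (induction m) (auto simp: inv)
    have pow: "\<forall>f\<in>topspace E. (dual_conv_op E T ^^ m) S f = S ((convolution (reflection T) ^^ m) f)" for m
    proof (induction m)
      case (Suc m)
      have "(dual_conv_op E T ^^ Suc m) S f = S ((convolution (reflection T) ^^ Suc m) f)" if "f \<in> topspace E" for f
      proof -
        have "(dual_conv_op E T ^^ Suc m) S f = (dual_conv_op E T ^^ m) S (convolution (reflection T) f)"
          using d that by (simp add: dual_conv_op_def)
        also have "\<dots> = S ((convolution (reflection T) ^^ m) (convolution (reflection T) f))"
          using Suc inv[OF that] by blast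
        finally show ?thesis by (simp add: funpow_swap1)
      qed
      then show ?case by blast
    qed simp
    show ?thesis
    proof
      fix f
      show "cesaro_mean (dual_conv_op E T) n S f = dual_conv_op E (conv_mean T n) S f"
      proof (cases "f \<in> topspace E")
        case f: True
        have "S (\<lambda>x. 1 / of_nat n * (\<Sum>m=1..n. (convolution (reflection T) ^^ m) f) x)
            = 1 / of_nat n * (\<Sum>m=1..n. S ((convolution (reflection T) ^^ m) f))"
          using in_dualD(2)[OF True lin_subspace_sum[OF lin, of "{1..n}" "\<lambda>m. (convolution (reflection T) ^^ m) f", OF K[OF f]],
              of "1 / of_nat n"]
            dual_sum[OF True, of "{1..n}" "\<lambda>m. (convolution (reflection T) ^^ m) f", OF K[OF f]]
          by (simp only:)
        then show ?thesis
          using True f pow E(2) by (auto simp: cesaro_mean_def dual_conv_op_def convolution_conv_mean[OF T] sum_apply)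
      next
        case f: False
        then have "(dual_conv_op E T ^^ m) S f = 0" for m using in_dualD(3)[OF d] by blast
        then show ?thesis using f by (simp add: cesaro_mean_def dual_conv_op_def)
      qed
    qed
  next
    case False
    have "dual_conv_op E T 0 = 0" by (auto simp: dual_conv_op_def fun_eq_iff)
    then have "(dual_conv_op E T ^^ Suc m) S = 0" for m
      using False by (induction m) (auto simp: dual_conv_op_def)
    then have "(dual_conv_op E T ^^ m) S = 0" if "m \<in> {1..n}" for m using that by (cases m) auto
    then show ?thesis using False by (auto simp: cesaro_mean_def dual_conv_op_def zero_fun_def)
  qed
qed

section \<open>Uniform boundedness\<close>

text \<open>A gliding hump: \<open>x\<close> is moved by \<open>\<plusminus>y\<close> with \<open>y\<close> tiny for the \<open>p m\<close> but large for some \<open>q i\<close>; one of the two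
  signs makes \<open>q i\<close> large, and later moves are too small to undo this.\<close>

lemma uniform_boundedness:
  fixes V :: "('x \<Rightarrow> complex) set" and p :: "nat \<Rightarrow> ('x \<Rightarrow> complex) \<Rightarrow> real" and q :: "'i \<Rightarrow> ('x \<Rightarrow> complex) \<Rightarrow> real"
  assumes V: "lin_subspace V" and p: "\<And>m. seminorm_on V (p m)"
    and p_mono: "\<And>f m m'. f \<in> V \<Longrightarrow> m \<le> m' \<Longrightarrow> p m f \<le> p m' f"
    and q: "\<And>i. i \<in> I \<Longrightarrow> seminorm_on V (q i)"
    and cont: "\<And>i. i \<in> I \<Longrightarrow> \<exists>m c. \<forall>f\<in>V. q i f \<le> c * p m f"
    and bounded: "\<And>f. f \<in> V \<Longrightarrow> \<exists>C. \<forall>i\<in>I. q i f \<le> C"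
    and complete: "\<And>g. (\<And>i. g i \<in> V) \<Longrightarrow> (\<And>i. p i (g i) \<le> (1/2) ^ i) \<Longrightarrow>
      \<exists>s\<in>V. \<forall>m. (\<lambda>n. p m (s - (\<Sum>i<n. g i))) \<longlonglongrightarrow> 0"
  shows "\<exists>m c. \<forall>i\<in>I. \<forall>f\<in>V. q i f \<le> c * p m f"
proof (rule ccontr)
  assume "\<not> ?thesis"
  then have neg: "\<exists>i\<in>I. \<exists>f\<in>V. c * p m f < q i f" for m c by (meson not_less)
  \<comment> \<open>A state \<open>(x, K, M)\<close>: the current point, and a constant and an order
    for which \<open>K * p M\<close> dominates every \<open>q i\<close> chosen so far. The next move
    must be at most \<open>(1/2) ^ n\<close> for the current \<open>K\<close> and for an order of at
    least \<open>M\<close> and \<open>n\<close>.\<close>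
  define P where "P n s \<longleftrightarrow> fst s \<in> V \<and> 1 \<le> fst (snd s) \<and> (n = 0 \<longrightarrow> fst s = 0)"
    for n :: nat and s :: "('x \<Rightarrow> complex) \<times> real \<times> nat"
  define R where "R n s t \<longleftrightarrow> fst (snd s) * p (max (snd (snd s)) n) (fst t - fst s) \<le> (1/2) ^ n \<and>
      (\<exists>i\<in>I. real n \<le> q i (fst t) \<and> (\<forall>f\<in>V. q i f \<le> fst (snd t) * p (snd (snd t)) f)) \<and>
      fst (snd s) \<le> fst (snd t) \<and> snd (snd s) \<le> snd (snd t)"
    for n :: nat and s t :: "('x \<Rightarrow> complex) \<times> real \<times> nat"
  have "\<exists>F. \<forall>n. P n (F n) \<and> R n (F n) (F (Suc n))"
  proof (rule dependent_nat_choice)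
    show "\<exists>x. P 0 x" by (rule exI[of _ "(0, 1, 0)"]) (simp add: P_def lin_subspaceD(1)[OF V])
    fix s n assume "P n s"
    then obtain x K M where s: "s = (x, K, M)" "x \<in> V" "1 \<le> K" by (cases s) (auto simp: P_def)
    let ?M = "max M n"
    \<comment> \<open>The constant is such that rescaling \<open>f\<close> to \<open>q i\<close>
      value \<open>n + 1\<close> leaves \<open>K * p ?M\<close> at most
      \<open>(1/2) ^ n\<close>.\<close>
    obtain i f where f: "i \<in> I" "f \<in> V" "(K * 2 ^ n * (real n + 1)) * p ?M f < q i f" using neg by blast
    have "0 \<le> (K * 2 ^ n * (real n + 1)) * p ?M f" using seminorm_onD(1)[OF p f(2)] s(3) by simp
    with f(3) have qf: "0 < q i f" by linarith
    define t where "t = (real n + 1) / q i f"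
    have t: "0 < t" using qf by (simp add: t_def)
    define y where "y = (\<lambda>z. of_real t * f z)"
    have y: "y \<in> V" unfolding y_def by (rule lin_subspaceD(3)[OF V f(2)])
    have qy: "q i y = real n + 1"
    proof -
      have "q i y = t * q i f"
        using seminorm_onD(3)[OF q[OF f(1)] f(2), of "of_real t"] t unfolding y_def by simp
      then show ?thesis using qf by (simp add: t_def)
    qed
    have "K * p ?M y = K * (real n + 1) * p ?M f / q i f"
    proof -
      have "p ?M y = t * p ?M f"
        using seminorm_onD(3)[OF p f(2), of ?M "of_real t"] t unfolding y_def by simp
      then show ?thesis by (simp add: t_def)
    qed
    also have "\<dots> \<le> (1/2) ^ n"
      using f(3) qf by (simp add: field_simps)
    finally have py: "K * p ?M y \<le> (1/2) ^ n" .
    \<comment> \<open>Since \<open>2 * y\<close> is the difference of \<open>x + y\<close> and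
      \<open>x - y\<close>, the two values of \<open>q i\<close> sum to at least
      \<open>2 * (n + 1)\<close>.\<close>
    have "2 * q i y = q i (\<lambda>z. 2 * y z)" using seminorm_onD(3)[OF q[OF f(1)] y, of 2] by simp
    also have "(\<lambda>z. 2 * y z) = (x + y) - (x - y)" by (simp add: fun_eq_iff)
    also have "q i \<dots> \<le> q i (x + y) + q i (x - y)"
      by (intro seminorm_on_diff_le[OF q[OF f(1)] V] lin_subspaceD(2,5)[OF V] s(2) y)
    finally have "\<exists>x'\<in>{x + y, x - y}. real n \<le> q i x'" unfolding qy by auto
    then obtain x' where x': "x' \<in> {x + y, x - y}" "real n \<le> q i x'" by blast
    have x'V: "x' \<in> V" using x'(1) lin_subspaceD(2,5)[OF V s(2) y] by auto
    have px': "p ?M (x' - x) = p ?M y" using x'(1) seminorm_on_minus[OF p y, of ?M] by auto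
    obtain m c where mc: "\<forall>f\<in>V. q i f \<le> c * p m f" using cont[OF f(1)] by blast
    have "q i f \<le> max K \<bar>c\<bar> * p (max M m) f" if "f \<in> V" for f
    proof -
      have "q i f \<le> c * p m f" using mc that by blast
      also have "\<dots> \<le> max K \<bar>c\<bar> * p (max M m) f"
        using s(3) by (intro mult_mono p_mono that seminorm_onD(1)[OF p that]) auto
      finally show ?thesis .
    qed
    then have "R n s (x', max K \<bar>c\<bar>, max M m)"
      unfolding R_def s(1) using py px' x'(2) f(1) by auto
    moreover have "P (Suc n) (x', max K \<bar>c\<bar>, max M m)" unfolding P_def using x'V s(3) by simp
    ultimately show "\<exists>y. P (Suc n) y \<and> R n s y" by blast
  qed
  then obtain F where F: "\<And>n. P n (F n)" "\<And>n. R n (F n) (F (Suc n))" by blast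
  define X K M where "X n = fst (F n)" and "K n = fst (snd (F n))" and "M n = snd (snd (F n))" for n
  have X: "X n \<in> V" "1 \<le> K n" "X 0 = 0" for n using F(1)[of n] F(1)[of 0] by (auto simp: P_def X_def K_def)
  have step: "K n * p (max (M n) n) (X (Suc n) - X n) \<le> (1/2) ^ n"
    "\<exists>i\<in>I. real n \<le> q i (X (Suc n)) \<and> (\<forall>f\<in>V. q i f \<le> K (Suc n) * p (M (Suc n)) f)"
    "K n \<le> K (Suc n)" "M n \<le> M (Suc n)" for n
    using F(2)[of n] unfolding R_def X_def K_def M_def by blast+
  have mono: "K n \<le> K l" "M n \<le> M l" if "n \<le> l" for n l
    using lift_Suc_mono_le[of K, OF step(3) that] lift_Suc_mono_le[of M, OF step(4) that] by auto
  define g where "g n = X (Suc n) - X n" for n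
  have g: "g n \<in> V" for n unfolding g_def by (rule lin_subspaceD(5)[OF V X(1) X(1)])
  have "p n (g n) \<le> (1/2) ^ n" for n
  proof -
    have "p n (g n) \<le> p (max (M n) n) (g n)" by (intro p_mono g) simp
    also have "\<dots> \<le> K n * p (max (M n) n) (g n)"
      using mult_right_mono[OF X(2)[of n] seminorm_onD(1)[OF p g], of "max (M n) n" n] by simp
    finally show ?thesis using step(1)[of n] by (simp add: g_def)
  qed
  then obtain s where s: "s \<in> V" "\<And>m. (\<lambda>n. p m (s - (\<Sum>i<n. g i))) \<longlonglongrightarrow> 0" using complete[of g, OF g] by blast
  have sumX: "(\<Sum>i<n. g i) = X n" for n
    unfolding g_def using sum_lessThan_telescope[of X n] X(3) by simp
  obtain C where C: "\<And>i. i \<in> I \<Longrightarrow> q i s \<le> C" using bounded[OF s(1)] by blast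
  \<comment> \<open>All later moves together change this \<open>q i\<close> by at most the sum of
    the geometric series, which is 2; domination by \<open>K * p M\<close> lets the estimate pass to
    the limit \<open>s\<close>.\<close>
  have "real n - 2 \<le> C" for n
  proof -
    obtain i where i: "i \<in> I" "real n \<le> q i (X (Suc n))" "\<And>f. f \<in> V \<Longrightarrow> q i f \<le> K (Suc n) * p (M (Suc n)) f"
      using step(2)[of n] by blast
    have qg: "q i (g l) \<le> (1/2) ^ l" if l: "Suc n \<le> l" for l
    proof -
      have "q i (g l) \<le> K (Suc n) * p (M (Suc n)) (g l)" by (rule i(3)[OF g])
      also have "\<dots> \<le> K l * p (max (M l) l) (g l)"
        using mono[OF l] X(2)[of l] by (intro mult_mono p_mono g seminorm_onD(1)[OF p g]) auto
      finally show ?thesis using step(1)[of l] by (simp add: g_def)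
    qed
    have low: "real n - (\<Sum>l<N. (1/2) ^ l) \<le> q i (X N)" if "Suc n \<le> N" for N
      using that
    proof (induction N rule: dec_induct)
      case base
      have "(0::real) \<le> (\<Sum>l<Suc n. (1/2) ^ l)" by (intro sum_nonneg) simp
      with i(2) show ?case by linarith
    next
      case (step N)
      have "q i (X N) \<le> q i (X N - X (Suc N)) + q i (X (Suc N))"
        by (intro seminorm_on_triangle[OF q[OF i(1)] V] X)
      moreover have "q i (X N - X (Suc N)) = q i (g N)"
        unfolding g_def by (intro seminorm_on_diff_commute[OF q[OF i(1)] V] X)
      ultimately show ?case using qg[OF step(1)] step.IH by simp
    qed
    have geo: "(\<Sum>l<N. (1/2::real) ^ l) \<le> 2" for N by (simp add: sum_gp_strict)
    have "real n - 2 - q i s \<le> K (Suc n) * p (M (Suc n)) (s - X N)" if N: "Suc n \<le> N" for N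
    proof -
      have "q i (X N) \<le> q i (X N - s) + q i s" by (intro seminorm_on_triangle[OF q[OF i(1)] V] X s)
      moreover have "q i (X N - s) = q i (s - X N)" by (intro seminorm_on_diff_commute[OF q[OF i(1)] V] X s)
      moreover have "q i (s - X N) \<le> K (Suc n) * p (M (Suc n)) (s - X N)" by (intro i(3) lin_subspaceD(5)[OF V] s X)
      ultimately show ?thesis using low[OF N] geo[of N] by linarith
    qed
    moreover have "(\<lambda>N. K (Suc n) * p (M (Suc n)) (s - X N)) \<longlonglongrightarrow> K (Suc n) * 0"
      using s(2)[of "M (Suc n)"] unfolding sumX by (intro tendsto_mult_left)
    ultimately have "real n - 2 - q i s \<le> K (Suc n) * 0"
      by (intro LIMSEQ_le_const[of _ _ "real n - 2 - q i s"]) auto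
    then show ?thesis using C[OF i(1)] by simp
  qed
  then show False using reals_Archimedean2[of "C + 2"] by (meson less_le_not_le diff_le_eq order_trans not_less)
qed

text \<open>Completeness in the form required by the gliding hump. The pointwise formula for the sum
  is kept so that zeros common to all terms survive.\<close>

lemma oc_fun_complete:
  assumes g: "\<And>i. g i \<in> oc_fun k" and small: "\<And>i. ocn i k (g i) \<le> (1/2) ^ i"
  shows "\<exists>s\<in>oc_fun k. (\<forall>x. s x = (\<Sum>i. g i x)) \<and> (\<forall>m. (\<lambda>n. ocn m k (s - (\<Sum>i<n. g i))) \<longlonglongrightarrow> 0)"
proof -
  have small': "ocn j k (g (i + n)) \<le> (1/2) ^ (i + n)" if "j \<le> n" for i j n
    using ocn_mono[OF g, of j "i + n" "i + n"] small[of "i + n"] that by simp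
  have sum_ocn: "summable (\<lambda>i. ocn j k (g (i + n)))" for j n
  proof -
    have "summable (\<lambda>i. ocn j k (g (i + j)))"
    proof (rule summable_comparison_test[OF exI[of _ 0]])
      show "\<forall>i\<ge>0. norm (ocn j k (g (i + j))) \<le> (1/2) ^ (i + j)" using small'[of j j] by (simp add: ocn_nonneg)
      show "summable (\<lambda>i. (1/2::real) ^ (i + j))" unfolding power_add by (intro summable_mult2 summable_geometric) simp
    qed
    then have "summable (\<lambda>i. ocn j k (g i))" by (rule summable_iff_shift[THEN iffD1])
    then show ?thesis by (subst summable_iff_shift)
  qed
  have le: "cmod (iter_deriv j (g i) x) \<le> ocn j k (g i) * wt x ^ k" for i j x by (rule ocn_upper[OF g order.refl])
  have sum_cmod: "summable (\<lambda>i. cmod (iter_deriv j (g (i + n)) x))" for j n x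
    by (rule summable_comparison_test[OF exI[of _ 0] summable_mult2[OF sum_ocn, of j n "wt x ^ k"]]) (use le in simp)
  have sum0: "summable (\<lambda>i. iter_deriv j (g i) x)" for j x
    using summable_norm_cancel[of "\<lambda>i. iter_deriv j (g i) x"] sum_cmod[of j 0 x] by simp
  define S where "S j x = (\<Sum>i. iter_deriv j (g i) x)" for j x
  have "(S j has_vector_derivative S (Suc j) x) (at x)" for j x
  proof (rule has_vector_derivative_quadratic)
    fix h :: real assume h: "\<bar>h\<bar> \<le> 1"
    let ?d = "\<lambda>i. iter_deriv j (g i) (x + h) - iter_deriv j (g i) x - of_real h * iter_deriv (Suc j) (g i) x"
    \<comment> \<open>4 is 2 from Peetre times the bound 2 for \<open>wt t\<close>. The quadratic
      remainders are summable, so the series is differentiated termwise.\<close>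
    have d: "cmod (?d i) \<le> ocn (Suc (Suc j)) k (g i) * (4 ^ k * wt x ^ k) * h\<^sup>2" for i
    proof (rule taylor_bound[OF smoothD smoothD])
      fix t :: real assume t: "\<bar>t\<bar> \<le> \<bar>h\<bar>"
      have "wt t \<le> 2" using t h unfolding wt_def by (simp add: abs_square_le_1)
      then have "wt (x + t) \<le> 2 * wt x * 2"
        by (intro order_trans[OF wt_add_le] mult_left_mono) (auto simp: wt_pos less_imp_le)
      then have "wt (x + t) ^ k \<le> (4 * wt x) ^ k" by (intro power_mono) (auto simp: wt_pos less_imp_le)
      then have "ocn (Suc (Suc j)) k (g i) * wt (x + t) ^ k \<le> ocn (Suc (Suc j)) k (g i) * (4 ^ k * wt x ^ k)"
        by (intro mult_left_mono) (auto simp: power_mult_distrib ocn_nonneg)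
      with le[of "Suc (Suc j)" i "x + t"]
      show "cmod (iter_deriv (Suc (Suc j)) (g i) (x + t)) \<le> ocn (Suc (Suc j)) k (g i) * (4 ^ k * wt x ^ k)"
        by (rule order_trans)
    qed (rule oc_fun_smooth[OF g])+
    have sd: "summable (\<lambda>i. ocn (Suc (Suc j)) k (g i) * (4 ^ k * wt x ^ k) * h\<^sup>2)"
      using sum_ocn[of "Suc (Suc j)" 0] by (intro summable_mult2) simp
    have "?d sums (S j (x + h) - S j x - of_real h * S (Suc j) x)"
      unfolding S_def by (intro sums_diff sums_mult summable_sums sum0)
    then have "(\<Sum>i. ?d i) = S j (x + h) - S j x - of_real h * S (Suc j) x"
      by (rule sums_unique[symmetric])
    moreover have "cmod (\<Sum>i. ?d i) \<le> (\<Sum>i. ocn (Suc (Suc j)) k (g i) * (4 ^ k * wt x ^ k) * h\<^sup>2)"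
      by (rule norm_suminf_le[OF d sd])
    moreover have "(\<Sum>i. ocn (Suc (Suc j)) k (g i) * (4 ^ k * wt x ^ k) * h\<^sup>2)
        = (\<Sum>i. ocn (Suc (Suc j)) k (g i) * (4 ^ k * wt x ^ k)) * h\<^sup>2"
      using sum_ocn[of "Suc (Suc j)" 0] by (intro suminf_mult2[symmetric] summable_mult2) simp
    ultimately show "cmod (S j (x + h) - S j x - of_real h * S (Suc j) x)
        \<le> (\<Sum>i. ocn (Suc (Suc j)) k (g i) * (4 ^ k * wt x ^ k)) * h\<^sup>2" by simp
  qed
  note chain = smooth_chain[of S, OF this] iter_deriv_chain[of S, OF this]
  have iter_sum: "iter_deriv j (\<Sum>i<n. g i) = (\<Sum>i<n. iter_deriv j (g i)) \<and> smooth (\<Sum>i<n. g i)" for j n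
  proof (induction n)
    case 0
    show ?case by (simp only: lessThan_0 sum.empty iter_deriv_zero smooth_zero simp_thms)
  next
    case (Suc n)
    then show ?case
      by (simp only: sum.lessThan_Suc iter_deriv_add smooth_add oc_fun_smooth[OF g] simp_thms)
  qed
  have S: "S 0 \<in> oc_fun k"
  proof (rule oc_funI[OF chain(1)])
    fix j
    have "cmod (S j x) \<le> (\<Sum>i. ocn j k (g i)) * wt x ^ k" for x
    proof -
      have "cmod (S j x) \<le> (\<Sum>i. ocn j k (g i) * wt x ^ k)"
        unfolding S_def using sum_ocn[of j 0] by (intro norm_suminf_le le summable_mult2) simp
      also have "\<dots> = (\<Sum>i. ocn j k (g i)) * wt x ^ k"
        using sum_ocn[of j 0] by (intro suminf_mult2[symmetric]) simp
      finally show ?thesis .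
    qed
    then show "\<exists>c. \<forall>x. cmod (iter_deriv j (S 0) x) \<le> c * wt x ^ k" unfolding chain(2) by blast
  qed
  have tail: "ocn m k (S 0 - (\<Sum>i<n. g i)) \<le> 2 * (1/2) ^ n" if mn: "m \<le> n" for m n
  proof (rule ocn_leI)
    fix x j assume j: "j \<le> m"
    have geo: "(\<lambda>i. (1/2::real) ^ (i + n)) sums (2 * (1/2) ^ n)"
      using sums_mult2[OF geometric_sums[of "1/2::real"], of "(1/2) ^ n"] by (simp add: power_add)
    have "iter_deriv j (S 0 - (\<Sum>i<n. g i)) x = S j x - (\<Sum>i<n. iter_deriv j (g i) x)"
      using iter_sum by (simp add: iter_deriv_diff chain sum_apply)
    also have "\<dots> = (\<Sum>i. iter_deriv j (g (i + n)) x)"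
      unfolding S_def using suminf_minus_initial_segment[OF sum0[of j x], of n] by simp
    finally have "cmod (iter_deriv j (S 0 - (\<Sum>i<n. g i)) x) \<le> (\<Sum>i. (1/2) ^ (i + n) * wt x ^ k)"
    proof (elim ssubst, intro norm_suminf_le)
      fix i
      show "cmod (iter_deriv j (g (i + n)) x) \<le> (1/2) ^ (i + n) * wt x ^ k"
        by (rule order_trans[OF le]) (intro mult_right_mono small', use j mn wt_pos[of x] in auto)
    qed (intro summable_mult2 sums_summable[OF geo])
    also have "\<dots> = 2 * (1/2) ^ n * wt x ^ k"
      using suminf_mult2[OF sums_summable[OF geo], of "wt x ^ k"] sums_unique[OF geo] by simp
    finally show "cmod (iter_deriv j (S 0 - (\<Sum>i<n. g i)) x) \<le> 2 * (1/2) ^ n * wt x ^ k" .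
  qed simp
  have "(\<lambda>n. ocn m k (S 0 - (\<Sum>i<n. g i))) \<longlonglongrightarrow> 0" for m
  proof (rule Lim_null_comparison)
    show "\<forall>\<^sub>F n in sequentially. norm (ocn m k (S 0 - (\<Sum>i<n. g i))) \<le> 2 * (1/2) ^ n"
      using tail by (intro eventually_sequentiallyI[of m]) (simp add: ocn_nonneg)
    show "(\<lambda>n. 2 * (1/2::real) ^ n) \<longlonglongrightarrow> 0"
      using tendsto_mult_left[OF LIMSEQ_power_zero[of "1/2::real"], of 2] by simp
  qed
  moreover have "S 0 x = (\<Sum>i. g i x)" for x by (simp add: S_def)
  ultimately show ?thesis using S by blast
qed

text \<open>Prescribed zeros define a closed subspace. Empty \<open>Z\<close> gives a whole step;
  the complement of \<open>[-1, 1]\<close> gives the test functions used for localisation.\<close>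

lemma oc_uniform_boundedness:
  fixes q :: "'i \<Rightarrow> (real \<Rightarrow> complex) \<Rightarrow> real"
  defines "V \<equiv> \<lambda>k Z. {f \<in> oc_fun k. \<forall>x\<in>Z. f x = 0}"
  assumes q: "\<And>i. i \<in> I \<Longrightarrow> seminorm_on (V k Z) (q i)"
    and cont: "\<And>i. i \<in> I \<Longrightarrow> \<exists>m c. \<forall>f\<in>V k Z. q i f \<le> c * ocn m k f"
    and bounded: "\<And>f. f \<in> V k Z \<Longrightarrow> \<exists>C. \<forall>i\<in>I. q i f \<le> C"
  shows "\<exists>m c. \<forall>i\<in>I. \<forall>f\<in>V k Z. q i f \<le> c * ocn m k f"
proof (rule uniform_boundedness[OF _ _ _ q cont bounded])
  show "lin_subspace (V k Z)"
    using lin_subspace_oc_fun[of k] unfolding lin_subspace_def V_def by simp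
  show "seminorm_on (V k Z) (\<lambda>f. ocn m k f)" for m
    by (rule seminorm_on_subset[OF seminorm_ocn]) (auto simp: V_def)
  show "ocn m k f \<le> ocn m' k f" if "f \<in> V k Z" "m \<le> m'" for f m m'
    using that ocn_mono by (auto simp: V_def)
  fix g assume g: "\<And>i. g i \<in> V k Z" "\<And>i. ocn i k (g i) \<le> (1/2) ^ i"
  then obtain s where s: "s \<in> oc_fun k" "\<And>x. s x = (\<Sum>i. g i x)" "\<forall>m. (\<lambda>n. ocn m k (s - (\<Sum>i<n. g i))) \<longlonglongrightarrow> 0"
    using oc_fun_complete[of g k] by (auto simp: V_def)
  have "s x = 0" if "x \<in> Z" for x unfolding s(2) using g(1) that by (simp add: V_def)
  with s show "\<exists>s\<in>V k Z. \<forall>m. (\<lambda>n. ocn m k (s - (\<Sum>i<n. g i))) \<longlonglongrightarrow> 0" by (auto simp: V_def)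
qed

lemma dual_oc_equicontinuous:
  assumes U: "U \<subseteq> dual oc_space" and bounded: "\<And>f. f \<in> oc_all \<Longrightarrow> \<exists>C. \<forall>u\<in>U. cmod (u f) \<le> C" and k: "1 \<le> k"
  shows "\<exists>m c. \<forall>u\<in>U. \<forall>f\<in>oc_fun k. cmod (u f) \<le> c * ocn m k f"
proof -
  have "\<exists>m c. \<forall>u\<in>U. \<forall>f\<in>{f \<in> oc_fun k. \<forall>x\<in>{}. f x = 0}. cmod (u f) \<le> c * ocn m k f"
  proof (rule oc_uniform_boundedness)
    fix u assume "u \<in> U"
    then have u: "u \<in> dual oc_space" using U by blast
    then have "seminorm_on oc_all (\<lambda>f. cmod (u f))"
      unfolding dual_oc_iff seminorm_on_def by (auto simp: norm_mult norm_triangle_ineq)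
    then show "seminorm_on {f \<in> oc_fun k. \<forall>x\<in>{}. f x = 0} (\<lambda>f. cmod (u f))"
      by (rule seminorm_on_subset) (use oc_fun_subset[OF k] in auto)
    show "\<exists>m c. \<forall>f\<in>{f \<in> oc_fun k. \<forall>x\<in>{}. f x = 0}. cmod (u f) \<le> c * ocn m k f"
      using u k unfolding dual_oc_iff by auto
  next
    fix f assume "f \<in> {f \<in> oc_fun k. \<forall>x\<in>{}. f x = 0}"
    then show "\<exists>C. \<forall>u\<in>U. cmod (u f) \<le> C" using bounded oc_fun_subset[OF k] by auto
  qed
  then show ?thesis by simp
qed

section \<open>A smooth step function\<close>

lemma power_le_fact_exp: "0 \<le> (y::real) \<Longrightarrow> y ^ n \<le> fact n * exp y"
proof -
  assume y: "0 \<le> y"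
  have "(\<Sum>k\<in>{n}. y ^ k /\<^sub>R fact k) \<le> (\<Sum>k. y ^ k /\<^sub>R fact k)"
    by (rule sum_le_suminf[OF summable_exp_generic]) (use y in auto)
  then have "y ^ n / fact n \<le> exp y" by (simp add: exp_def divide_inverse mult.commute)
  then show ?thesis by (simp add: field_simps)
qed

lemma poly_le_exp:
  fixes p :: "real poly"
  shows "\<exists>C. \<forall>y\<ge>0. \<bar>poly p y\<bar> \<le> C * exp y"
proof (intro exI allI impI)
  fix y :: real assume y: "0 \<le> y"
  have "\<bar>poly p y\<bar> \<le> (\<Sum>i\<le>degree p. \<bar>coeff p i * y ^ i\<bar>)" unfolding poly_altdef by (rule sum_abs)
  also have "\<dots> \<le> (\<Sum>i\<le>degree p. \<bar>coeff p i\<bar> * fact i * exp y)"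
    using power_le_fact_exp[OF y] y by (intro sum_mono) (auto simp: abs_mult mult.assoc intro!: mult_left_mono)
  finally show "\<bar>poly p y\<bar> \<le> (\<Sum>i\<le>degree p. \<bar>coeff p i\<bar> * fact i) * exp y" by (simp add: sum_distrib_right)
qed

text \<open>Polynomials in \<open>1 / x\<close> times \<open>exp (- 1 / x)\<close> form a class
  closed under differentiation; \<open>flat 1\<close> is the classical flat function.\<close>

definition flat :: "real poly \<Rightarrow> real \<Rightarrow> real" where
  "flat p x = (if 0 < x then poly p (1 / x) * exp (- 1 / x) else 0)"

lemma flat_derivative:
  "((\<lambda>x. complex_of_real (flat p x)) has_vector_derivative of_real (flat ([:0, 0, 1:] * (p - pderiv p)) x)) (at x)"
proof -
  consider "x < 0" | "x = 0" | "0 < x" by linarith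
  then show ?thesis
  proof cases
    case 1
    have "((\<lambda>x. 0) has_vector_derivative (0::complex)) (at x)" by (rule has_vector_derivative_const)
    then have "((\<lambda>x. complex_of_real (flat p x)) has_vector_derivative 0) (at x)"
      by (rule has_vector_derivative_transform_within_open[of _ _ _ "{..<0}"]) (use 1 in \<open>auto simp: flat_def\<close>)
    then show ?thesis using 1 by (simp add: flat_def)
  next
    case 2
    \<comment> \<open>With \<open>y = 1 / h\<close>, bounding \<open>y\<^sup>2 * p y\<close> rather
      than \<open>p y\<close> by the exponential leaves the factor \<open>h\<^sup>2\<close> of the
      quadratic criterion.\<close>
    obtain C where C: "\<And>y. 0 \<le> y \<Longrightarrow> \<bar>poly ([:0, 0, 1:] * p) y\<bar> \<le> C * exp y" using poly_le_exp by metis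
    have C0: "0 \<le> C" using C[of 0] by simp
    show ?thesis unfolding 2
    proof (rule has_vector_derivative_quadratic)
      fix h :: real
      have "\<bar>flat p h\<bar> \<le> C * h\<^sup>2"
      proof (cases "0 < h")
        case True
        have "\<bar>(1 / h)\<^sup>2 * poly p (1 / h)\<bar> \<le> C * exp (1 / h)"
          using C[of "1 / h"] True by (simp add: power2_eq_square algebra_simps)
        then have "\<bar>(1 / h)\<^sup>2 * poly p (1 / h)\<bar> * (h\<^sup>2 * exp (- 1 / h)) \<le> C * exp (1 / h) * (h\<^sup>2 * exp (- 1 / h))"
          by (intro mult_right_mono) auto
        also have "\<bar>(1 / h)\<^sup>2 * poly p (1 / h)\<bar> * (h\<^sup>2 * exp (- 1 / h)) = \<bar>flat p h\<bar>"
          using True by (simp add: flat_def abs_mult power_divide)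
        also have "C * exp (1 / h) * (h\<^sup>2 * exp (- 1 / h)) = C * h\<^sup>2 * (exp (1 / h) * exp (- (1 / h)))" by simp
        also have "\<dots> = C * h\<^sup>2" by (simp only: exp_minus_inverse mult_1_right)
        finally show ?thesis .
      qed (use C0 in \<open>simp add: flat_def\<close>)
      moreover have "flat q 0 = 0" for q by (simp add: flat_def)
      ultimately show "cmod (complex_of_real (flat p (0 + h)) - complex_of_real (flat p 0)
          - complex_of_real h * complex_of_real (flat ([:0, 0, 1:] * (p - pderiv p)) 0)) \<le> C * h\<^sup>2"
        by simp
    qed
  next
    case 3
    have "((\<lambda>x. poly p (1 / x) * exp (- 1 / x)) has_field_derivative
        poly p (1 / x) * (1 / x\<^sup>2 * exp (- 1 / x)) + (poly (pderiv p) (1 / x) * (- 1 / x\<^sup>2)) * exp (- 1 / x)) (at x)"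
    proof (rule DERIV_mult')
      have i: "((\<lambda>x. 1 / x) has_field_derivative - 1 / x\<^sup>2) (at x)"
        using 3 by (auto intro!: derivative_eq_intros simp: power2_eq_square)
      have "((\<lambda>x. - 1 / x) has_field_derivative 1 / x\<^sup>2) (at x)"
        using 3 by (auto intro!: derivative_eq_intros simp: power2_eq_square)
      from DERIV_fun_exp[OF this] show "((\<lambda>x. exp (- 1 / x)) has_field_derivative 1 / x\<^sup>2 * exp (- 1 / x)) (at x)"
        by (simp add: mult.commute)
      from DERIV_chain2[OF poly_DERIV i]
      show "((\<lambda>x. poly p (1 / x)) has_field_derivative poly (pderiv p) (1 / x) * (- 1 / x\<^sup>2)) (at x)" .
    qed
    from has_vector_derivative_of_real[OF this]
    have "((\<lambda>x. complex_of_real (flat p x)) has_vector_derivative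
        of_real (poly p (1 / x) * (1 / x\<^sup>2 * exp (- 1 / x)) + (poly (pderiv p) (1 / x) * (- 1 / x\<^sup>2)) * exp (- 1 / x))) (at x)"
      by (rule has_vector_derivative_transform_within_open[of _ _ _ "{0<..}"]) (use 3 in \<open>auto simp: flat_def\<close>)
    moreover have "poly p (1 / x) * (1 / x\<^sup>2 * exp (- 1 / x)) + (poly (pderiv p) (1 / x) * (- 1 / x\<^sup>2)) * exp (- 1 / x)
        = flat ([:0, 0, 1:] * (p - pderiv p)) x"
      using 3 by (simp add: flat_def power2_eq_square field_simps)
    ultimately show ?thesis by (simp only:)
  qed
qed

lemma smooth_flat: "smooth (\<lambda>x. complex_of_real (flat 1 x))"
proof -
  define P where "P = rec_nat (1 :: real poly) (\<lambda>_ p. [:0, 0, 1:] * (p - pderiv p))"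
  have P: "P 0 = 1" "P (Suc n) = [:0, 0, 1:] * (P n - pderiv (P n))" for n by (simp_all add: P_def)
  have "((\<lambda>x. complex_of_real (flat (P i) x)) has_vector_derivative of_real (flat (P (Suc i)) x)) (at x)" for i x
    unfolding P(2) by (rule flat_derivative)
  from smooth_chain[of "\<lambda>i x. complex_of_real (flat (P i) x)", OF this] show ?thesis by (simp add: P(1))
qed

text \<open>The normalised antiderivative of the bump \<open>flat 1 x * flat 1 (1 - x)\<close>. Its
  derivatives are bounded on \<open>[0, 1]\<close> by compactness and vanish, from order 1 on,
  outside.\<close>

lemma smooth_step_exists:
  "\<exists>s. smooth s \<and> (\<forall>x\<le>0. s x = 0) \<and> (\<forall>x\<ge>1. s x = 1) \<and> (\<forall>i. \<exists>C. \<forall>x. cmod (iter_deriv i s x) \<le> C)"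
proof -
  define b where "b x = flat 1 x * flat 1 (1 - x)" for x
  define B where "B x = complex_of_real (b x)" for x
  have smB: "smooth B"
    unfolding B_def b_def of_real_mult using smooth_mult[OF smooth_flat smooth_reflect[OF smooth_flat]] by simp
  have b0: "b x = 0" if "x \<le> 0 \<or> 1 \<le> x" for x using that by (auto simp: b_def flat_def)
  have bpos: "0 < b x" if "0 < x" "x < 1" for x using that by (simp add: b_def flat_def)
  have "continuous_on UNIV B" using continuous_iter_deriv[OF smB, of UNIV 0] by simp
  then have "continuous_on UNIV (\<lambda>x. Re (B x))" by (intro continuous_intros)
  then have "isCont b x" for x by (simp add: B_def continuous_on_eq_continuous_at)
  then obtain F where "\<And>x. (F has_vector_derivative b x) (at x)"
    using einterval_antiderivative[of "-\<infinity>" "\<infinity>" b] by auto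
  then have F: "DERIV F x :> b x" for x by (simp add: has_real_derivative_iff_has_vector_derivative)
  obtain z where z: "0 < z" "z < 1" "F 1 - F 0 = (1 - 0) * b z" using MVT2[of 0 1 F b] F by auto
  then have F01: "0 < F 1 - F 0" using bpos[of z] by simp
  have Fl: "F x = F 0" if le: "x \<le> 0" for x
  proof (cases "x = 0")
    case False
    then obtain z where "x < z" "z < 0" "F 0 - F x = (0 - x) * b z" using MVT2[of x 0 F b] F le False by auto
    then show ?thesis using b0[of z] by simp
  qed simp
  have Fr: "F x = F 1" if le: "1 \<le> x" for x
  proof (cases "x = 1")
    case False
    then obtain z where "1 < z" "z < x" "F x - F 1 = (x - 1) * b z" using MVT2[of 1 x F b] F le False by auto
    then show ?thesis using b0[of z] by simp
  qed simp
  define c where "c = 1 / (F 1 - F 0)"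
  define s where "s x = complex_of_real (c * (F x - F 0))" for x
  \<comment> \<open>From order 1 on the derivatives are multiples of derivatives of the bump, whose
    smoothness is known.\<close>
  define g where "g i = (case i of 0 \<Rightarrow> s | Suc j \<Rightarrow> (\<lambda>x. of_real c * iter_deriv j B x))" for i
  have "(g i has_vector_derivative g (Suc i) x) (at x)" for i x
  proof (cases i)
    case 0
    have "((\<lambda>x. c * (F x - F 0)) has_field_derivative c * b x) (at x)"
      using F[of x] by (auto intro!: derivative_eq_intros)
    from has_vector_derivative_of_real[OF this] show ?thesis
      unfolding 0 g_def s_def by (simp add: B_def)
  next
    case (Suc j)
    show ?thesis
      using has_vector_derivative_mult_right[OF smoothD[OF smB, of j x], of "of_real c"] by (simp add: Suc g_def)
  qed
  note chain = smooth_chain[of g, OF this] iter_deriv_chain[of g, OF this]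
  have s: "smooth s" "\<And>i. iter_deriv i s = g i" using chain by (simp_all add: g_def)
  have s0: "s x = 0" if "x \<le> 0" for x using Fl[OF that] by (simp add: s_def)
  have s1: "s x = 1" if "1 \<le> x" for x using Fr[OF that] F01 by (simp add: s_def c_def)
  have "\<exists>C. \<forall>x. cmod (iter_deriv i s x) \<le> C" for i
  proof -
    have "compact (iter_deriv i s ` {0..1})"
      by (intro compact_continuous_image continuous_iter_deriv s) auto
    then have "bounded (iter_deriv i s ` {0..1})" by (rule compact_imp_bounded)
    then obtain C where C: "\<And>x. x \<in> {0..1} \<Longrightarrow> cmod (iter_deriv i s x) \<le> C"
      unfolding bounded_iff by blast
    have "cmod (iter_deriv i s x) \<le> max C 1" for x
    proof (cases "x \<in> {0..1}")
      case False
      show ?thesis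
      proof (cases i)
        case 0
        then show ?thesis using False s0[of x] s1[of x] by (cases "x \<le> 0") auto
      next
        case (Suc j)
        have "iter_deriv j B x = iter_deriv j 0 x"
          by (rule iter_deriv_eq_on_open[of "- {0..1}"]) (use False b0 in \<open>auto simp: B_def\<close>)
        then show ?thesis unfolding s(2) Suc by (simp add: g_def iter_deriv_zero)
      qed
    qed (use C in \<open>auto simp: le_max_iff_disj\<close>)
    then show ?thesis by blast
  qed
  then show ?thesis using s(1) s0 s1 by blast
qed

section \<open>A fixed step and the plateaus built from it\<close>

definition smooth_step :: "real \<Rightarrow> complex" where
  "smooth_step = (SOME s. smooth s \<and> (\<forall>x\<le>0. s x = 0) \<and> (\<forall>x\<ge>1. s x = 1) \<and> (\<forall>i. \<exists>C. \<forall>x. cmod (iter_deriv i s x) \<le> C))"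

lemma smooth_smooth_step: "smooth smooth_step"
  and smooth_step_0: "x \<le> 0 \<Longrightarrow> smooth_step x = 0"
  and smooth_step_1: "1 \<le> x \<Longrightarrow> smooth_step x = 1"
  and smooth_step_bounded: "\<exists>C. \<forall>x. cmod (iter_deriv i smooth_step x) \<le> C"
  using someI_ex[OF smooth_step_exists] unfolding smooth_step_def[symmetric] by blast+

text \<open>As a difference of shifted steps it has derivative bounds independent of
  \<open>a\<close> and \<open>b\<close>, and adjacent plateaus telescope; this is the source of the
  partition of unity.\<close>

definition plateau :: "real \<Rightarrow> real \<Rightarrow> real \<Rightarrow> complex" where
  "plateau a b x = smooth_step (1 - a + x) - smooth_step (- b + x)"

lemma smooth_plateau: "smooth (plateau a b)"
proof -
  have *: "plateau a b = (\<lambda>x. smooth_step (1 - a + x)) - (\<lambda>x. smooth_step (- b + x))"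
    by (simp add: plateau_def fun_eq_iff)
  show ?thesis
    unfolding * by (rule smooth_diff[OF smooth_translate[OF smooth_smooth_step] smooth_translate[OF smooth_smooth_step]])
qed

lemma plateau_bounded: "\<exists>C. \<forall>a b x. \<forall>i\<le>m. cmod (iter_deriv i (plateau a b) x) \<le> C"
proof -
  obtain C where C: "\<And>i x. cmod (iter_deriv i smooth_step x) \<le> C i" using smooth_step_bounded by metis
  have C0: "0 \<le> C i" for i using C[of i 0] norm_ge_zero order_trans by blast
  have "cmod (iter_deriv i (plateau a b) x) \<le> 2 * (\<Sum>i\<le>m. C i)" if "i \<le> m" for i a b x
  proof -
    have p: "plateau a b = (\<lambda>x. smooth_step (1 - a + x)) - (\<lambda>x. smooth_step (- b + x))"
      by (simp add: plateau_def fun_eq_iff)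
    have "iter_deriv i (plateau a b) x = iter_deriv i smooth_step (1 - a + x) - iter_deriv i smooth_step (- b + x)"
      unfolding p iter_deriv_diff[OF smooth_translate[OF smooth_smooth_step] smooth_translate[OF smooth_smooth_step]]
      by (simp only: minus_apply iter_deriv_translate[OF smooth_smooth_step])
    also have "cmod \<dots> \<le> C i + C i" using norm_triangle_ineq4 C by (meson add_mono order_trans)
    also have "C i \<le> (\<Sum>i\<le>m. C i)" using that C0 by (intro member_le_sum) auto
    finally show ?thesis by simp
  qed
  then show ?thesis by blast
qed

lemma plateau_1: "a \<le> x \<Longrightarrow> x \<le> b \<Longrightarrow> plateau a b x = 1"
  by (simp add: plateau_def smooth_step_0 smooth_step_1)

lemma plateau_0: "a \<le> b \<Longrightarrow> x \<le> a - 1 \<or> b + 1 \<le> x \<Longrightarrow> plateau a b x = 0"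
  by (auto simp: plateau_def smooth_step_0 smooth_step_1)

section \<open>Cutting off test functions\<close>

definition cutoff :: "nat \<Rightarrow> (real \<Rightarrow> complex) \<Rightarrow> real \<Rightarrow> complex" where
  "cutoff J f = (\<lambda>x. plateau (- real J) (real J) x * f x)"

lemma iter_deriv_zero_on:
  assumes "open U" "\<And>x. x \<in> U \<Longrightarrow> f x = 0" "x \<in> U"
  shows "iter_deriv i f x = 0"
  using iter_deriv_eq_on_open[of U f 0 x i] assms by (simp add: iter_deriv_zero)

lemma cutoff_bound:
  "\<exists>D\<ge>0. \<forall>k f J. f \<in> oc_fun k \<longrightarrow> cutoff J f \<in> oc_fun k \<and> ocn m k (cutoff J f) \<le> D * ocn m k f"
proof -
  have *: "\<exists>D\<ge>0. \<forall>k f J x. \<forall>i\<le>m. f \<in> oc_fun k \<longrightarrow> cmod (iter_deriv i (cutoff J f) x) \<le> D * ocn m k f * wt x ^ k" for m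
  proof -
    obtain C where C: "\<forall>a b x. \<forall>i\<le>m. cmod (iter_deriv i (plateau a b) x) \<le> C" using plateau_bounded by blast
    have C0: "0 \<le> C" using C norm_ge_zero order_trans by blast
    have "cmod (iter_deriv i (cutoff J f) x) \<le> 2 ^ m * C * ocn m k f * wt x ^ k" if f: "f \<in> oc_fun k" and i: "i \<le> m" for k f J x i
    proof -
      have "cmod (iter_deriv i (cutoff J f) x) \<le> 2 ^ i * (C * (ocn m k f * wt x ^ k))"
        unfolding cutoff_def
        by (rule cmod_iter_deriv_mult_le[OF smooth_plateau oc_fun_smooth[OF f]]) (use C i ocn_upper[OF f] in auto)
      also have "\<dots> \<le> 2 ^ m * (C * (ocn m k f * wt x ^ k))"
        using i C0 ocn_nonneg[of m k f] wt_pos[of x] by (intro mult_right_mono) auto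
      finally show ?thesis by (simp add: mult.assoc)
    qed
    then show ?thesis using C0 by (intro exI[of _ "2 ^ m * C"]) auto
  qed
  have mem: "cutoff J f \<in> oc_fun k" if f: "f \<in> oc_fun k" for J f k
  proof (rule oc_funI)
    show "smooth (cutoff J f)" unfolding cutoff_def by (rule smooth_mult[OF smooth_plateau oc_fun_smooth[OF f]])
    show "\<exists>c. \<forall>x. cmod (iter_deriv i (cutoff J f) x) \<le> c * wt x ^ k" for i
      using *[of i] f by blast
  qed
  obtain D where D: "0 \<le> D" "\<forall>k f J x. \<forall>i\<le>m. f \<in> oc_fun k \<longrightarrow> cmod (iter_deriv i (cutoff J f) x) \<le> D * ocn m k f * wt x ^ k"
    using *[of m] by blast
  have "ocn m k (cutoff J f) \<le> D * ocn m k f" if "f \<in> oc_fun k" for k f J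
    by (rule ocn_leI) (use D that ocn_nonneg in auto)
  with D(1) mem show ?thesis by blast
qed

lemma cutoff_oc_fun: "f \<in> oc_fun k \<Longrightarrow> cutoff J f \<in> oc_fun k"
  using cutoff_bound[of 0] by blast

lemma cutoff_oc_all: "f \<in> oc_all \<Longrightarrow> cutoff J f \<in> oc_all"
  using cutoff_oc_fun oc_fun_subset by (blast elim: oc_allE)

lemma cutoff_support: "real J + 1 \<le> \<bar>x\<bar> \<Longrightarrow> cutoff J f x = 0"
  using plateau_0[of "- real J" "real J" x] by (auto simp: cutoff_def abs_if split: if_splits)

text \<open>The tail lives where \<open>\<bar>x\<bar> \<ge> J\<close>. There
  \<open>wt x / wt (real J)\<close> is at least 1, so the extra weight of step \<open>Suc k\<close>
  buys the factor \<open>1 / wt (real J)\<close>.\<close>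

lemma cutoff_tail:
  "\<exists>D\<ge>0. \<forall>k f J. f \<in> oc_fun k \<longrightarrow> ocn m (Suc k) (f - cutoff J f) \<le> D * ocn m k f / wt (real J)"
proof -
  obtain D where D: "0 \<le> D" "\<forall>k f J. f \<in> oc_fun k \<longrightarrow> cutoff J f \<in> oc_fun k \<and> ocn m k (cutoff J f) \<le> D * ocn m k f"
    using cutoff_bound by blast
  have "ocn m (Suc k) (f - cutoff J f) \<le> (1 + D) * ocn m k f / wt (real J)" if f: "f \<in> oc_fun k" for k f J
  proof (rule ocn_leI)
    fix x i assume i: "i \<le> m"
    note c = D(2)[rule_format, OF f, of J]
    show "cmod (iter_deriv i (f - cutoff J f) x) \<le> (1 + D) * ocn m k f / wt (real J) * wt x ^ Suc k"
    proof (cases "\<bar>x\<bar> < real J")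
      case True
      have "iter_deriv i (f - cutoff J f) x = 0"
        by (rule iter_deriv_zero_on[of "{- real J<..<real J}"]) (use True in \<open>auto simp: cutoff_def plateau_1\<close>)
      then show ?thesis using D(1) ocn_nonneg[of m k f] wt_pos by (simp add: less_imp_le)
    next
      case False
      have "cmod (iter_deriv i (f - cutoff J f) x) \<le> cmod (iter_deriv i f x) + cmod (iter_deriv i (cutoff J f) x)"
        using iter_deriv_diff[OF oc_fun_smooth[OF f] oc_fun_smooth[OF conjunct1[OF c]]] by (simp add: norm_triangle_ineq4)
      also have "\<dots> \<le> ocn m k f * wt x ^ k + ocn m k (cutoff J f) * wt x ^ k"
        by (intro add_mono ocn_upper f c[THEN conjunct1] i)
      also have "\<dots> \<le> ocn m k f * wt x ^ k + D * ocn m k f * wt x ^ k"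
        using c wt_pos[of x] by (intro add_left_mono mult_right_mono) auto
      also have "\<dots> = (1 + D) * ocn m k f * wt x ^ k" by (simp add: algebra_simps)
      also have "\<dots> \<le> (1 + D) * ocn m k f * wt x ^ k * (wt x / wt (real J))"
      proof -
        have "(real J)\<^sup>2 \<le> x\<^sup>2" using False by (simp add: abs_le_square_iff[symmetric])
        then have "1 \<le> wt x / wt (real J)" using wt_pos[of "real J"] by (simp add: wt_def)
        moreover have "0 \<le> (1 + D) * ocn m k f * wt x ^ k" using D(1) ocn_nonneg[of m k f] wt_pos[of x] by simp
        ultimately show ?thesis using mult_left_mono[of 1 "wt x / wt (real J)"] by simp
      qed
      finally show ?thesis by (simp add: mult_ac)
    qed
  qed (use D(1) ocn_nonneg wt_pos in \<open>simp add: less_imp_le\<close>)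
  then show ?thesis using D(1) by (intro exI[of _ "1 + D"]) auto
qed

lemma cutoff_add: "cutoff J (f + g) = cutoff J f + cutoff J g"
  and cutoff_cmult: "cutoff J (\<lambda>x. c * f x) = (\<lambda>x. c * cutoff J f x)"
  by (simp_all add: cutoff_def fun_eq_iff algebra_simps)

lemma open_abs_greater: "open {x::real. A < \<bar>x\<bar>}"
proof -
  have "{x. A < \<bar>x\<bar>} = - {-A..A}" by auto
  then show ?thesis by (simp add: open_Compl)
qed

lemma compact_support_schwartz:
  assumes f: "f \<in> oc_fun k" and supp: "\<And>x. A < \<bar>x\<bar> \<Longrightarrow> f x = 0"
  shows "f \<in> schwartz_fun"
proof (rule schwartz_funI)
  show "smooth f" by (rule oc_fun_smooth[OF f])
  fix n i
  have "wt x ^ n * cmod (iter_deriv i f x) \<le> ocn i k f * wt A ^ (n + k)" for x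
  proof (cases "A < \<bar>x\<bar>")
    case True
    have o: "open {x. A < \<bar>x\<bar>}" by (rule open_abs_greater)
    have "iter_deriv i f x = 0" by (rule iter_deriv_zero_on[OF o]) (simp_all only: mem_Collect_eq supp True)
    then show ?thesis by (simp add: ocn_nonneg wt_pos less_imp_le)
  next
    case False
    then have "\<bar>x\<bar> \<le> \<bar>A\<bar>" by linarith
    then have "wt x \<le> wt A" unfolding wt_def abs_le_square_iff by simp
    then have w: "wt x ^ (n + k) \<le> wt A ^ (n + k)" by (intro power_mono) (simp_all add: wt_pos less_imp_le)
    have "wt x ^ n * cmod (iter_deriv i f x) \<le> wt x ^ n * (ocn i k f * wt x ^ k)"
      using wt_pos[of x] by (intro mult_left_mono ocn_upper[OF f]) auto
    also have "\<dots> = ocn i k f * wt x ^ (n + k)" by (simp add: power_add)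
    also have "\<dots> \<le> ocn i k f * wt A ^ (n + k)" by (intro mult_left_mono w ocn_nonneg)
    finally show ?thesis .
  qed
  then show "\<exists>c. \<forall>x. wt x ^ n * cmod (iter_deriv i f x) \<le> c" by blast
qed

section \<open>Bounded sets are precompact\<close>

text \<open>Each value is rounded to a finite net of the disc. Only finitely many rounding patterns
  occur, and one representative per pattern gives a net inside \<open>G\<close>.\<close>

lemma finite_net:
  fixes \<phi> :: "'i \<Rightarrow> 'a \<Rightarrow> complex"
  assumes I: "finite I" and bd: "\<And>i g. i \<in> I \<Longrightarrow> g \<in> G \<Longrightarrow> cmod (\<phi> i g) \<le> M" and e: "0 < e"
  obtains F where "finite F" "F \<subseteq> G" "\<And>g. g \<in> G \<Longrightarrow> \<exists>h\<in>F. \<forall>i\<in>I. cmod (\<phi> i g - \<phi> i h) < e"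
proof -
  have op: "open (ball z (e/2))" if "z \<in> cball (0::complex) M" for z by simp
  have cov: "cball (0::complex) M \<subseteq> (\<Union>z\<in>cball 0 M. ball z (e/2))"
    by (rule subsetI, rule UN_I, assumption) (use e in simp)
  from compactE_image[OF compact_cball op cov] obtain N
    where "N \<subseteq> cball 0 M" and N: "finite N" "cball (0::complex) M \<subseteq> (\<Union>z\<in>N. ball z (e/2))" .
  define code where "code g = (\<lambda>i\<in>I. SOME z. z \<in> N \<and> dist z (\<phi> i g) < e/2)" for g
  have code: "code g i \<in> N \<and> dist (code g i) (\<phi> i g) < e/2" if "i \<in> I" "g \<in> G" for i g
  proof -
    have "\<phi> i g \<in> cball 0 M" using bd[OF that] by simp
    then have "\<phi> i g \<in> (\<Union>z\<in>N. ball z (e/2))" using N(2) by blast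
    then have "\<exists>z. z \<in> N \<and> dist z (\<phi> i g) < e/2" unfolding UN_iff mem_ball by blast
    from someI_ex[OF this] show ?thesis using that by (simp add: code_def)
  qed
  have "code ` G \<subseteq> PiE I (\<lambda>_. N)" using code by (auto simp: code_def)
  then have fin: "finite (code ` G)" by (rule finite_subset) (rule finite_PiE[OF I N(1)])
  define r where "r c = (SOME g. g \<in> G \<and> code g = c)" for c
  have r: "r (code g) \<in> G \<and> code (r (code g)) = code g" if "g \<in> G" for g
    unfolding r_def by (rule someI[of _ g]) (use that in auto)
  show ?thesis
  proof (rule that[of "r ` code ` G"])
    show "finite (r ` code ` G)" using fin by simp
    show "r ` code ` G \<subseteq> G" using r by auto
    fix g assume g: "g \<in> G"
    have "cmod (\<phi> i g - \<phi> i (r (code g))) < e" if i: "i \<in> I" for i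
    proof -
      have "dist (code g i) (\<phi> i g) < e/2" "dist (code g i) (\<phi> i (r (code g))) < e/2"
        using code[OF i g] code[OF i, of "r (code g)"] r[OF g] by auto
      then have "dist (\<phi> i g) (\<phi> i (r (code g))) < e" by (rule dist_triangle_half_r)
      then show ?thesis by (simp add: dist_norm)
    qed
    then show "\<exists>h\<in>r ` code ` G. \<forall>i\<in>I. cmod (\<phi> i g - \<phi> i h) < e" using g by blast
  qed
qed

text \<open>The Arzela-Ascoli argument in quantitative form: bounds on order \<open>Suc m\<close>
  make all derivatives up to order \<open>m\<close> uniformly Lipschitz, so their values on a finite
  grid determine the functions up to \<open>d\<close>.\<close>

lemma test_functions_net:
  assumes sm: "\<And>g. g \<in> G \<Longrightarrow> smooth g" and bd: "\<And>i. \<exists>M. \<forall>g\<in>G. \<forall>x. cmod (iter_deriv i g x) \<le> M"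
    and supp: "\<And>g x. g \<in> G \<Longrightarrow> A < \<bar>x\<bar> \<Longrightarrow> g x = 0" and d: "0 < d"
  obtains F where "finite F" "F \<subseteq> G" "\<And>g. g \<in> G \<Longrightarrow> \<exists>h\<in>F. ocn m 1 (g - h) \<le> d"
proof -
  obtain b where b: "\<And>i g x. g \<in> G \<Longrightarrow> cmod (iter_deriv i g x) \<le> b i" using bd by metis
  define M where "M = (\<Sum>i\<le>Suc m. \<bar>b i\<bar>)"
  have M0: "0 \<le> M" unfolding M_def by (intro sum_nonneg) simp
  have M: "cmod (iter_deriv i g x) \<le> M" if "g \<in> G" "i \<le> Suc m" for i g x
  proof -
    have "b i \<le> \<bar>b i\<bar>" by simp
    also have "\<dots> \<le> M" unfolding M_def using that by (intro member_le_sum) auto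
    finally show ?thesis using b[OF that(1), of i x] by simp
  qed
  \<comment> \<open>Two Lipschitz errors of \<open>M * n\<close> each stay below
    \<open>d / 2\<close>; the values at the grid point contribute the other \<open>d / 2\<close>.
    The 1 avoids division by 0.\<close>
  define n where "n = d / (4 * (M + 1))"
  have n: "0 < n" "2 * M * n \<le> d / 2"
    using d M0 by (auto simp: n_def field_simps)
  have op: "open (ball p n)" if "p \<in> {-A..A}" for p by simp
  have cov: "{-A..A} \<subseteq> (\<Union>p\<in>{-A..A}. ball p n)"
    by (rule subsetI, rule UN_I, assumption) (use n(1) in simp)
  from compactE_image[OF compact_Icc op cov] obtain P
    where "P \<subseteq> {-A..A}" and P: "finite P" "{-A..A} \<subseteq> (\<Union>p\<in>P. ball p n)" .
  obtain F where F: "finite F" "F \<subseteq> G"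
    "\<And>g. g \<in> G \<Longrightarrow> \<exists>h\<in>F. \<forall>j\<in>{..m} \<times> P. cmod (iter_deriv (fst j) g (snd j) - iter_deriv (fst j) h (snd j)) < d/2"
    by (rule finite_net[of "{..m} \<times> P" G "\<lambda>j g. iter_deriv (fst j) g (snd j)" M "d/2"]) (use P(1) M d in auto)
  show ?thesis
  proof (rule that[OF F(1,2)])
    fix g assume g: "g \<in> G"
    obtain h where h: "h \<in> F" "\<forall>j\<in>{..m} \<times> P. cmod (iter_deriv (fst j) g (snd j) - iter_deriv (fst j) h (snd j)) < d/2"
      using F(3)[OF g] by blast
    have hG: "h \<in> G" using h(1) F(2) by blast
    have "ocn m 1 (g - h) \<le> d"
    proof (rule ocn_leI)
      fix x i assume i: "i \<le> m"
      have e: "iter_deriv i (g - h) x = iter_deriv i g x - iter_deriv i h x"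
        by (simp add: iter_deriv_diff sm g hG)
      have "cmod (iter_deriv i g x - iter_deriv i h x) \<le> d"
      proof (cases "A < \<bar>x\<bar>")
        case True
        have o: "open {x. A < \<bar>x\<bar>}" by (rule open_abs_greater)
        have "iter_deriv i g x = 0" "iter_deriv i h x = 0"
          by (rule iter_deriv_zero_on[OF o]; simp only: mem_Collect_eq supp True g hG)+
        then show ?thesis using d by simp
      next
        case False
        then have "x \<in> {-A..A}" by auto
        then obtain p where p: "p \<in> P" "\<bar>x - p\<bar> < n" using P(2) by (auto simp: dist_real_def)
        have lip: "cmod (iter_deriv i f x - iter_deriv i f p) \<le> M * n" if f: "f \<in> G" for f
        proof -
          have "cmod (iter_deriv i f x - iter_deriv i f p) \<le> M * \<bar>x - p\<bar>"
            by (rule vector_derivative_norm_bound[OF smoothD[OF sm[OF f]]]) (use M f i in auto)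
          also have "\<dots> \<le> M * n" using p(2) M0 by (intro mult_left_mono) auto
          finally show ?thesis .
        qed
        have "cmod (iter_deriv i g p - iter_deriv i h p) < d/2" using h(2) i p(1) by auto
        moreover have "cmod (iter_deriv i g x - iter_deriv i h x) \<le> cmod (iter_deriv i g x - iter_deriv i g p)
            + cmod (iter_deriv i g p - iter_deriv i h p) + cmod (iter_deriv i h x - iter_deriv i h p)"
        proof -
          let ?a = "iter_deriv i g x - iter_deriv i g p" and ?b = "iter_deriv i g p - iter_deriv i h p"
            and ?c = "iter_deriv i h x - iter_deriv i h p"
          have "iter_deriv i g x - iter_deriv i h x = ?a + ?b - ?c" by simp
          then show ?thesis
            using norm_triangle_ineq4[of "?a + ?b" ?c] norm_triangle_ineq[of ?a ?b] by simp
        qed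
        ultimately show ?thesis using lip[OF g] lip[OF hG] n(2) by linarith
      qed
      moreover have "d * 1 \<le> d * wt x ^ 1" using d by (intro mult_left_mono wt_power_ge_1) auto
      ultimately show "cmod (iter_deriv i (g - h) x) \<le> d * wt x ^ 1" unfolding e by simp
    qed (use d in simp)
    then show "\<exists>h\<in>F. ocn m 1 (g - h) \<le> d" using h(1) by blast
  qed
qed

text \<open>The bound for \<open>R\<close> on step \<open>Suc k\<close> is spent on step
  \<open>k\<close>: it exists because \<open>R\<close> is bounded on every step.\<close>

lemma ocn_cutoff_tail_seminorm:
  assumes R: "oc_seminorm R" and k: "1 \<le> k"
  shows "\<exists>m D. \<forall>f\<in>oc_fun k. \<forall>J. wt (real J) * R (f - cutoff J f) \<le> D * ocn m k f"
proof -
  obtain m c where mc: "0 < c" "\<And>f. f \<in> oc_fun (Suc k) \<Longrightarrow> R f \<le> c * ocn m (Suc k) f"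
    using oc_seminormE[OF R, of "Suc k"] by (metis le_SucI k)
  obtain D where D: "0 \<le> D" "\<forall>k f J. f \<in> oc_fun k \<longrightarrow> ocn m (Suc k) (f - cutoff J f) \<le> D * ocn m k f / wt (real J)"
    using cutoff_tail by blast
  have "wt (real J) * R (f - cutoff J f) \<le> c * D * ocn m k f" if f: "f \<in> oc_fun k" for f J
  proof -
    have "f - cutoff J f \<in> oc_fun (Suc k)"
      using lin_subspaceD(5)[OF lin_subspace_oc_fun f cutoff_oc_fun[OF f]] oc_fun_mono[of k "Suc k"] by auto
    then have "R (f - cutoff J f) \<le> c * ocn m (Suc k) (f - cutoff J f)" by (rule mc)
    also have "\<dots> \<le> c * (D * ocn m k f / wt (real J))"
      using mc(1) D(2) f by (intro mult_left_mono) auto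
    finally show ?thesis using wt_pos[of "real J"] by (simp add: field_simps)
  qed
  then show ?thesis by blast
qed

text \<open>The seminorm \<open>sup\<^sub>J wt J * R (f - cutoff J f)\<close> is again continuous, so \<open>R (f - cutoff J f)\<close> tends to \<open>0\<close>
  uniformly on bounded sets, although bounded sets are not known to lie in a single step.\<close>

lemma oc_seminorm_tail:
  assumes R: "oc_seminorm R"
  shows "oc_seminorm (\<lambda>f. SUP J. wt (real J) * R (f - cutoff J f))" (is "oc_seminorm ?S")
    and "f \<in> oc_all \<Longrightarrow> wt (real J) * R (f - cutoff J f) \<le> (SUP J. wt (real J) * R (f - cutoff J f))"
proof -
  note semi = conjunct1[OF R[unfolded oc_seminorm_def]]
  have bdd: "bdd_above (range (\<lambda>J. wt (real J) * R (f - cutoff J f)))" if f: "f \<in> oc_all" for f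
  proof -
    obtain k where k: "1 \<le> k" "f \<in> oc_fun k" using f by (rule oc_allE)
    obtain m D where "\<forall>f\<in>oc_fun k. \<forall>J. wt (real J) * R (f - cutoff J f) \<le> D * ocn m k f"
      using ocn_cutoff_tail_seminorm[OF R k(1)] by blast
    then show ?thesis using k(2) by (intro bdd_aboveI2[of _ _ "D * ocn m k f"]) auto
  qed
  show up: "f \<in> oc_all \<Longrightarrow> wt (real J) * R (f - cutoff J f) \<le> ?S f" for f J
    by (rule cSUP_upper[OF _ bdd]) auto
  have t: "f - cutoff J f \<in> oc_all" if "f \<in> oc_all" for f J
    by (intro lin_subspaceD(5)[OF lin_subspace_oc_all] cutoff_oc_all that)
  show "oc_seminorm ?S"
    unfolding oc_seminorm_def
  proof (intro conjI allI impI)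
    show "seminorm_on oc_all ?S"
    proof (rule seminorm_onI[OF lin_subspace_oc_all])
      fix f assume f: "f \<in> oc_all"
      show "0 \<le> ?S f"
        using up[OF f, of 0] seminorm_onD(1)[OF semi t[OF f, of 0]] by simp
      show "?S (\<lambda>x. c * f x) \<le> cmod c * ?S f" for c
      proof (rule cSUP_least)
        fix J
        have "(\<lambda>x. c * f x) - cutoff J (\<lambda>x. c * f x) = (\<lambda>x. c * (f - cutoff J f) x)"
          by (simp add: cutoff_cmult fun_eq_iff algebra_simps)
        then have "wt (real J) * R ((\<lambda>x. c * f x) - cutoff J (\<lambda>x. c * f x)) = cmod c * (wt (real J) * R (f - cutoff J f))"
          using seminorm_onD(3)[OF semi t[OF f], of c J] by simp
        also have "\<dots> \<le> cmod c * ?S f" by (intro mult_left_mono up f) simp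
        finally show "wt (real J) * R ((\<lambda>x. c * f x) - cutoff J (\<lambda>x. c * f x)) \<le> cmod c * ?S f" .
      qed simp
    next
      fix f g assume fg: "f \<in> oc_all" "g \<in> oc_all"
      show "?S (f + g) \<le> ?S f + ?S g"
      proof (rule cSUP_least)
        fix J
        have eq: "f + g - cutoff J (f + g) = (f - cutoff J f) + (g - cutoff J g)"
          unfolding cutoff_add by (simp add: algebra_simps)
        have "wt (real J) * R (f + g - cutoff J (f + g)) \<le> wt (real J) * (R (f - cutoff J f) + R (g - cutoff J g))"
          unfolding eq by (intro mult_left_mono seminorm_onD(2)[OF semi] t fg) (simp add: wt_pos less_imp_le)
        also have "\<dots> \<le> ?S f + ?S g" unfolding distrib_left by (intro add_mono up fg)
        finally show "wt (real J) * R (f + g - cutoff J (f + g)) \<le> ?S f + ?S g" .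
      qed simp
    qed
    fix k :: nat assume k: "1 \<le> k"
    obtain m D where mD: "\<forall>f\<in>oc_fun k. \<forall>J. wt (real J) * R (f - cutoff J f) \<le> D * ocn m k f"
      using ocn_cutoff_tail_seminorm[OF R k] by blast
    then have "\<forall>f\<in>oc_fun k. ?S f \<le> D * ocn m k f" by (auto intro!: cSUP_least)
    then show "\<exists>m c. \<forall>f\<in>oc_fun k. ?S f \<le> c * ocn m k f" by blast
  qed
qed

text \<open>The maximum of derivatives over a fixed window is dominated on every step, since the
  weight is bounded there. It is therefore a continuous seminorm, hence bounded on
  \<open>B\<close>.\<close>

lemma cutoff_derivatives_bounded:
  assumes B: "B \<in> bounded_sets oc_space"
  shows "\<exists>M. \<forall>f\<in>B. \<forall>x. cmod (iter_deriv i (cutoff J f) x) \<le> M"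
proof -
  obtain C where C: "\<forall>a b x. \<forall>j\<le>i. cmod (iter_deriv j (plateau a b) x) \<le> C" using plateau_bounded by blast
  have C0: "0 \<le> C" using C norm_ge_zero order_trans by blast
  \<comment> \<open>The window that contains the support of the cut-off.\<close>
  let ?X = "{x. \<bar>x\<bar> \<le> real J + 1}"
  define q where "q f = (SUP x\<in>?X. \<Sum>j\<le>i. cmod (iter_deriv j f x))" for f
  have ne: "?X \<noteq> {}" by (auto intro: exI[of _ 0])
  have le: "(\<Sum>j\<le>i. cmod (iter_deriv j f x)) \<le> (Suc i * wt (real J + 1) ^ k) * ocn i k f" if f: "f \<in> oc_fun k" and x: "x \<in> ?X" for f k x
  proof -
    have "wt x \<le> wt (real J + 1)" using x by (simp add: wt_def abs_le_square_iff[symmetric])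
    then have w: "wt x ^ k \<le> wt (real J + 1) ^ k" by (intro power_mono) (simp_all add: wt_pos less_imp_le)
    have "(\<Sum>j\<le>i. cmod (iter_deriv j f x)) \<le> (\<Sum>j\<le>i. ocn i k f * wt (real J + 1) ^ k)"
      by (intro sum_mono order_trans[OF ocn_upper[OF f] mult_left_mono[OF w ocn_nonneg]]) auto
    then show ?thesis by (simp add: algebra_simps)
  qed
  have bdd: "bdd_above ((\<lambda>x. \<Sum>j\<le>i. cmod (iter_deriv j f x)) ` ?X)" if "f \<in> oc_all" for f
    using that by (rule oc_allE) (use le in \<open>auto intro!: bdd_aboveI2\<close>)
  have up: "(\<Sum>j\<le>i. cmod (iter_deriv j f x)) \<le> q f" if "f \<in> oc_all" "x \<in> ?X" for f x
    unfolding q_def by (rule cSUP_upper[OF that(2) bdd[OF that(1)]])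
  have "oc_seminorm q"
    unfolding oc_seminorm_def
  proof (intro conjI allI impI)
    show "seminorm_on oc_all q"
    proof (rule seminorm_onI[OF lin_subspace_oc_all])
      fix f assume f: "f \<in> oc_all"
      have "0 \<le> (\<Sum>j\<le>i. cmod (iter_deriv j f 0))" by (intro sum_nonneg) simp
      also have "\<dots> \<le> q f" by (intro up f) simp
      finally show "0 \<le> q f" .
      show "q (\<lambda>x. c * f x) \<le> cmod c * q f" for c
        unfolding q_def[of "\<lambda>x. c * f x"]
      proof (rule cSUP_least[OF ne])
        fix x assume x: "x \<in> ?X"
        have "(\<Sum>j\<le>i. cmod (iter_deriv j (\<lambda>x. c * f x) x)) = cmod c * (\<Sum>j\<le>i. cmod (iter_deriv j f x))"
          by (simp add: iter_deriv_cmult oc_all_smooth[OF f] norm_mult sum_distrib_left)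
        also have "\<dots> \<le> cmod c * q f" by (intro mult_left_mono up f x) simp
        finally show "(\<Sum>j\<le>i. cmod (iter_deriv j (\<lambda>x. c * f x) x)) \<le> cmod c * q f" .
      qed
    next
      fix f g assume fg: "f \<in> oc_all" "g \<in> oc_all"
      show "q (f + g) \<le> q f + q g"
        unfolding q_def[of "f + g"]
      proof (rule cSUP_least[OF ne])
        fix x assume x: "x \<in> ?X"
        have "(\<Sum>j\<le>i. cmod (iter_deriv j (f + g) x)) \<le> (\<Sum>j\<le>i. cmod (iter_deriv j f x)) + (\<Sum>j\<le>i. cmod (iter_deriv j g x))"
          unfolding sum.distrib[symmetric]
          by (intro sum_mono) (simp add: iter_deriv_add oc_all_smooth fg norm_triangle_ineq)
        also have "\<dots> \<le> q f + q g" by (intro add_mono up fg x)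
        finally show "(\<Sum>j\<le>i. cmod (iter_deriv j (f + g) x)) \<le> q f + q g" .
      qed
    qed
    fix k :: nat
    have "q f \<le> (Suc i * wt (real J + 1) ^ k) * ocn i k f" if "f \<in> oc_fun k" for f
      unfolding q_def by (rule cSUP_least[OF ne le[OF that]])
    then show "\<exists>m c. \<forall>f\<in>oc_fun k. q f \<le> c * ocn m k f" by blast
  qed
  then obtain N where N: "\<And>f. f \<in> B \<Longrightarrow> q f \<le> N" using B unfolding oc.bounded_sets_iff by blast
  have "cmod (iter_deriv i (cutoff J f) x) \<le> 2 ^ i * (C * max 0 N)" if f: "f \<in> B" for f x
  proof (cases "x \<in> ?X")
    case True
    have fo: "f \<in> oc_all" using f B unfolding oc.bounded_sets_iff topspace_oc_space by blast
    have "cmod (iter_deriv j f x) \<le> max 0 N" if "j \<le> i" for j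
    proof -
      have "cmod (iter_deriv j f x) \<le> (\<Sum>j\<le>i. cmod (iter_deriv j f x))" using that by (intro member_le_sum) auto
      then show ?thesis using up[OF fo True] N[OF f] by simp
    qed
    then show ?thesis
      unfolding cutoff_def using C by (intro cmod_iter_deriv_mult_le smooth_plateau oc_all_smooth fo) auto
  next
    case False
    have o: "open {x. real J + 1 < \<bar>x\<bar>}" by (rule open_abs_greater)
    have "iter_deriv i (cutoff J f) x = 0"
      by (rule iter_deriv_zero_on[OF o]) (use False in \<open>auto intro: cutoff_support\<close>)
    then show ?thesis using C0 by simp
  qed
  then show ?thesis by blast
qed

text \<open>Three parts of size \<open>e / 3\<close>: the tail and the distance of the cut-off to a
  finite net are controlled by \<open>R\<close> for all \<open>n\<close> at once, and only the
  finitely many net points need the pointwise limit.\<close>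

lemma uniform_null_on_bounded:
  assumes Q: "\<And>n. seminorm_on oc_all (Q n)" and R: "oc_seminorm R"
    and le: "\<And>n f. f \<in> oc_all \<Longrightarrow> Q n f \<le> R f"
    and null: "\<And>f. f \<in> oc_all \<Longrightarrow> (\<lambda>n. Q n f) \<longlonglongrightarrow> 0"
    and B: "B \<in> bounded_sets oc_space" and e: "0 < e"
  shows "\<forall>\<^sub>F n in sequentially. \<forall>f\<in>B. Q n f < e"
proof -
  have Bo: "B \<subseteq> oc_all" using B unfolding oc.bounded_sets_iff topspace_oc_space by blast
  have "\<exists>C. \<forall>f\<in>B. (SUP J. wt (real J) * R (f - cutoff J f)) \<le> C"
    by (rule bspec[OF conjunct2[OF B[unfolded oc.bounded_sets_iff]] CollectI[of oc_seminorm, OF oc_seminorm_tail(1)[OF R]]])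
  then obtain C where C: "\<And>f. f \<in> B \<Longrightarrow> (SUP J. wt (real J) * R (f - cutoff J f)) \<le> C" by blast
  \<comment> \<open>Enough because \<open>wt (real J)\<close> is at least
    \<open>real J\<close>.\<close>
  obtain J where J: "3 * C / e < real J" using reals_Archimedean2 by blast
  have tail: "R (f - cutoff J f) < e / 3" if f: "f \<in> B" for f
  proof -
    have "wt (real J) * R (f - cutoff J f) \<le> C"
      using oc_seminorm_tail(2)[OF R, of f J] f Bo C[OF f] by auto
    also have "C < real J * e / 3" using J e by (simp add: field_simps)
    also have "\<dots> \<le> wt (real J) * (e / 3)"
    proof -
      have "real J \<le> real J * real J" using mult_left_mono[of 1 "real J" "real J"] by (cases "J = 0") auto
      then show ?thesis using e by (simp add: wt_def power2_eq_square field_simps) (simp add: add_increasing)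
    qed
    finally show ?thesis using wt_pos[of "real J"] by simp
  qed
  obtain m c where mc: "0 < c" "\<And>f. f \<in> oc_fun 1 \<Longrightarrow> R f \<le> c * ocn m 1 f"
    using oc_seminormE[OF R, of 1] by (metis order.refl)
  \<comment> \<open>Half of \<open>e / (3 * c)\<close>, since the net gives a non-strict
    estimate.\<close>
  have d: "0 < e / (6 * c)" using e mc(1) by simp
  have sm: "smooth (cutoff J f)" if "f \<in> B" for f
    using that Bo oc_all_smooth cutoff_oc_all by blast
  have oc1: "g \<in> oc_fun 1" if g: "g \<in> cutoff J ` B" for g
  proof -
    obtain f where f: "f \<in> B" "g = cutoff J f" using g by blast
    then obtain k where "f \<in> oc_fun k" using Bo by (auto elim: oc_allE)
    then have "cutoff J f \<in> schwartz_fun"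
      using compact_support_schwartz[OF cutoff_oc_fun, of f k "real J + 1" J] cutoff_support by auto
    then show ?thesis using f(2) schwartz_fun_subset by blast
  qed
  obtain F where F: "finite F" "F \<subseteq> cutoff J ` B" "\<And>g. g \<in> cutoff J ` B \<Longrightarrow> \<exists>h\<in>F. ocn m 1 (g - h) \<le> e / (6 * c)"
    by (rule test_functions_net[of "cutoff J ` B" "real J + 1" "e / (6 * c)" m])
      (use sm cutoff_derivatives_bounded[OF B] cutoff_support d in auto)
  have Fo: "h \<in> oc_all" if "h \<in> F" for h using that F(2) Bo cutoff_oc_all by blast
  have "\<forall>h\<in>F. \<forall>\<^sub>F n in sequentially. Q n h < e / 3"
    using null Fo e by (auto intro!: order_tendstoD(2))
  then have "\<forall>\<^sub>F n in sequentially. \<forall>h\<in>F. Q n h < e / 3"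
    using F(1) by (simp add: eventually_ball_finite)
  then show ?thesis
  proof eventually_elim
    case (elim n)
    show ?case
    proof
      fix f assume f: "f \<in> B"
      have fo: "f \<in> oc_all" using f Bo by blast
      obtain h where h: "h \<in> F" "ocn m 1 (cutoff J f - h) \<le> e / (6 * c)" using F(3) f by blast
      have "cutoff J f - h \<in> oc_fun 1"
        using oc1 f h(1) F(2) by (intro lin_subspaceD(5)[OF lin_subspace_oc_fun]) auto
      then have "R (cutoff J f - h) \<le> c * ocn m 1 (cutoff J f - h)" by (rule mc)
      also have "\<dots> \<le> c * (e / (6 * c))" using h(2) mc(1) by (intro mult_left_mono) auto
      also have "\<dots> < e / 3" using mc(1) e by simp
      finally have R2: "R (cutoff J f - h) < e / 3" .
      have co: "cutoff J f \<in> oc_all" by (rule cutoff_oc_all[OF fo])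
      have "Q n f \<le> Q n (f - cutoff J f) + Q n (cutoff J f)"
        by (rule seminorm_on_triangle[OF Q lin_subspace_oc_all fo co])
      moreover have "Q n (cutoff J f) \<le> Q n (cutoff J f - h) + Q n h"
        by (rule seminorm_on_triangle[OF Q lin_subspace_oc_all co Fo[OF h(1)]])
      moreover have "Q n (f - cutoff J f) \<le> R (f - cutoff J f)" "Q n (cutoff J f - h) \<le> R (cutoff J f - h)"
        by (intro le lin_subspaceD(5)[OF lin_subspace_oc_all] fo co Fo h)+
      moreover have "Q n h < e / 3" using elim h(1) by blast
      ultimately show "Q n f < e" using tail[OF f] R2 by linarith
    qed
  qed
qed

section \<open>Equicontinuity from local bounds\<close>

text \<open>A translation is the composition of two reflections, each contributing a factor
  \<open>2 ^ k\<close>.\<close>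

lemma
  assumes f: "f \<in> oc_fun k"
  shows translate_oc_fun: "(\<lambda>y. f (y - a)) \<in> oc_fun k"
    and ocn_translate: "ocn m k (\<lambda>y. f (y - a)) \<le> 4 ^ k * wt a ^ k * ocn m k f"
proof -
  let ?g = "\<lambda>z. f (0 - z)"
  have eq: "(\<lambda>y. f (y - a)) = (\<lambda>y. ?g (a - y))" by simp
  have g: "?g \<in> oc_fun k" by (rule reflect_oc_fun[OF f])
  show "(\<lambda>y. f (y - a)) \<in> oc_fun k" unfolding eq by (rule reflect_oc_fun[OF g])
  have "ocn m k (\<lambda>y. ?g (a - y)) \<le> 2 ^ k * wt a ^ k * ocn m k ?g" by (rule ocn_reflect[OF g])
  also have "\<dots> \<le> 2 ^ k * wt a ^ k * (2 ^ k * wt 0 ^ k * ocn m k f)"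
    by (intro mult_left_mono ocn_reflect f) (simp add: wt_pos less_imp_le)
  also have "\<dots> = 4 ^ k * wt a ^ k * ocn m k f"
    using power_mult_distrib[of 2 "2::real" k] by simp
  finally show "ocn m k (\<lambda>y. f (y - a)) \<le> 4 ^ k * wt a ^ k * ocn m k f" unfolding eq .
qed

lemma tendsto_div_wt: "(\<lambda>J. X / wt (real J)) \<longlonglongrightarrow> 0"
proof (rule Lim_null_comparison)
  show "\<forall>\<^sub>F J in sequentially. norm (X / wt (real J)) \<le> \<bar>X\<bar> * inverse (real J)"
  proof (rule eventually_sequentiallyI[of 1])
    fix J :: nat assume J: "1 \<le> J"
    then have "real J \<le> real J * real J" using mult_left_mono[of 1 "real J" "real J"] by simp
    then have "real J \<le> wt (real J)" by (simp add: wt_def power2_eq_square)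
    then show "norm (X / wt (real J)) \<le> \<bar>X\<bar> * inverse (real J)"
      using J wt_pos[of "real J"] by (simp add: divide_inverse abs_mult) (intro mult_left_mono le_imp_inverse_le, auto)
  qed
  show "(\<lambda>J. \<bar>X\<bar> * inverse (real J)) \<longlonglongrightarrow> 0"
    using tendsto_mult_left[OF lim_inverse_n, of "\<bar>X\<bar>"] by simp
qed

text \<open>Smooth functions supported in \<open>[-1, 1]\<close>. Compact support puts them into
  every step, and step 1 supplies complete norms for uniform boundedness.\<close>

definition test_fun :: "(real \<Rightarrow> complex) set" where
  "test_fun = {f \<in> oc_fun 1. \<forall>x\<in>{x. 1 < \<bar>x\<bar>}. f x = 0}"

text \<open>The piece of \<open>g\<close> near \<open>a\<close> is moved to the origin. On its
  support \<open>wt y\<close> is at most 2, so Peetre leaves only the growth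
  \<open>wt a ^ k\<close>, uniformly in \<open>a\<close>.\<close>

lemma localised_bound:
  "\<exists>E\<ge>0. \<forall>g\<in>oc_fun k. \<forall>a y. \<forall>i\<le>m. cmod (iter_deriv i (\<lambda>y. plateau 0 0 y * g (a + y)) y) \<le> E * ocn m k g * wt a ^ k"
proof -
  obtain C where C: "\<forall>a b x. \<forall>i\<le>m. cmod (iter_deriv i (plateau a b) x) \<le> C" using plateau_bounded by blast
  have C0: "0 \<le> C" using C norm_ge_zero order_trans by blast
  have "cmod (iter_deriv i (\<lambda>y. plateau 0 0 y * g (a + y)) y) \<le> (2 ^ m * C * 4 ^ k) * ocn m k g * wt a ^ k"
    if g: "g \<in> oc_fun k" and i: "i \<le> m" for g a y i
  proof (cases "1 < \<bar>y\<bar>")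
    case True
    have "iter_deriv i (\<lambda>y. plateau 0 0 y * g (a + y)) y = 0"
      by (rule iter_deriv_zero_on[OF open_abs_greater[of 1]]) (use True in \<open>auto intro!: plateau_0\<close>)
    then show ?thesis using C0 by (simp add: ocn_nonneg wt_pos less_imp_le)
  next
    case False
    then have "wt y \<le> 2" by (simp add: wt_def abs_square_le_1)
    then have "wt y ^ k \<le> 2 ^ k" by (intro power_mono) (simp_all add: wt_pos less_imp_le)
    then have w: "wt (a + y) ^ k \<le> 4 ^ k * wt a ^ k"
    proof -
      assume y: "wt y ^ k \<le> 2 ^ k"
      have "wt (a + y) ^ k \<le> 2 ^ k * wt a ^ k * wt y ^ k" by (rule wt_add_power_le)
      also have "\<dots> \<le> 2 ^ k * wt a ^ k * 2 ^ k" using y wt_pos[of a] by (intro mult_left_mono) auto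
      finally show ?thesis using power_mult_distrib[of 2 "2::real" k] by (simp add: mult_ac)
    qed
    have "cmod (iter_deriv i (\<lambda>y. plateau 0 0 y * g (a + y)) y) \<le> 2 ^ i * (C * (ocn m k g * (4 ^ k * wt a ^ k)))"
    proof (rule cmod_iter_deriv_mult_le[OF smooth_plateau smooth_translate[OF oc_fun_smooth[OF g]]])
      show "cmod (iter_deriv b (plateau 0 0) y) \<le> C" if "b \<le> i" for b using C that i by simp
      show "cmod (iter_deriv b (\<lambda>y. g (a + y)) y) \<le> ocn m k g * (4 ^ k * wt a ^ k)" if "b \<le> i" for b
        unfolding iter_deriv_translate[OF oc_fun_smooth[OF g]]
        by (rule order_trans[OF ocn_upper[OF g] mult_left_mono[OF w ocn_nonneg]]) (use that i in simp)
    qed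
    also have "\<dots> \<le> 2 ^ m * (C * (ocn m k g * (4 ^ k * wt a ^ k)))"
      using i C0 ocn_nonneg[of m k g] wt_pos[of a] by (intro mult_right_mono power_increasing) auto
    finally show ?thesis by (simp add: mult_ac)
  qed
  then show ?thesis using C0 by (intro exI[of _ "2 ^ m * C * 4 ^ k"]) auto
qed

lemma localised_test_fun:
  assumes g: "g \<in> oc_fun k"
  shows "(\<lambda>y. plateau 0 0 y * g (a + y)) \<in> test_fun"
proof -
  have "(\<lambda>y. plateau 0 0 y * g (a + y)) \<in> oc_fun 1"
  proof (rule oc_funI)
    show "smooth (\<lambda>y. plateau 0 0 y * g (a + y))"
      by (rule smooth_mult[OF smooth_plateau smooth_translate[OF oc_fun_smooth[OF g]]])
    fix i
    obtain E where E: "0 \<le> E" "\<forall>g\<in>oc_fun k. \<forall>a y. \<forall>j\<le>i. cmod (iter_deriv j (\<lambda>y. plateau 0 0 y * g (a + y)) y) \<le> E * ocn i k g * wt a ^ k"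
      using localised_bound by blast
    have "cmod (iter_deriv i (\<lambda>y. plateau 0 0 y * g (a + y)) y) \<le> (E * ocn i k g * wt a ^ k) * wt y ^ 1" for y
    proof -
      have "0 \<le> E * ocn i k g * wt a ^ k" using E(1) by (simp add: ocn_nonneg wt_pos less_imp_le)
      from mult_left_mono[OF wt_power_ge_1[of y 1] this] E(2)[rule_format, OF g order.refl, of a y]
      show ?thesis by simp
    qed
    then show "\<exists>c. \<forall>y. cmod (iter_deriv i (\<lambda>y. plateau 0 0 y * g (a + y)) y) \<le> c * wt y ^ 1" by blast
  qed
  moreover have "plateau 0 0 y = 0" if "1 < \<bar>y\<bar>" for y
  proof (rule plateau_0)
    show "y \<le> 0 - 1 \<or> 0 + 1 \<le> y" using that by linarith
  qed simp
  ultimately show ?thesis by (simp add: test_fun_def)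
qed

text \<open>A test function is a sum of translates of functions supported in \<open>[-1, 1]\<close>; uniform boundedness over
  all translates gives a bound decaying faster than the growth of the pieces.\<close>

lemma dual_oc_equicontinuous_local:
  assumes U: "U \<subseteq> dual oc_space"
    and loc: "\<And>f l. f \<in> test_fun \<Longrightarrow> \<exists>C. \<forall>u\<in>U. \<forall>a. wt a ^ l * cmod (u (\<lambda>y. f (y - a))) \<le> C" and k: "1 \<le> k"
  shows "\<exists>m c. \<forall>u\<in>U. \<forall>f\<in>oc_fun k. cmod (u f) \<le> c * ocn m k f"
proof -
  have t_oc: "f \<in> oc_fun 1" if "f \<in> test_fun" for f using that by (simp add: test_fun_def)
  have tr: "(\<lambda>y. f (y - a)) \<in> oc_all" if "f \<in> test_fun" for f a
    using translate_oc_fun[OF t_oc[OF that], of a] oc_fun_subset[of 1] by auto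
  \<comment> \<open>Exponent \<open>Suc k\<close>: one power more than the growth of the pieces,
    leaving \<open>1 / wt a\<close>, which is summable over integer positions.\<close>
  have "\<exists>m c. \<forall>p\<in>U \<times> UNIV. \<forall>f\<in>{f \<in> oc_fun 1. \<forall>x\<in>{x. 1 < \<bar>x\<bar>}. f x = 0}.
      wt (snd p) ^ Suc k * cmod (fst p (\<lambda>y. f (y - snd p))) \<le> c * ocn m 1 f"
  proof (rule oc_uniform_boundedness; unfold test_fun_def[symmetric])
    fix p :: "((real \<Rightarrow> complex) \<Rightarrow> complex) \<times> real" assume "p \<in> U \<times> UNIV"
    then obtain u a where p: "p = (u, a)" and u: "u \<in> dual oc_space" using U by (cases p) auto
    have "wt a ^ Suc k * cmod (u ((\<lambda>y. f (y - a)) + (\<lambda>y. g (y - a)))) \<le>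
        wt a ^ Suc k * cmod (u (\<lambda>y. f (y - a))) + wt a ^ Suc k * cmod (u (\<lambda>y. g (y - a)))"
      if "f \<in> test_fun" "g \<in> test_fun" for f g
      unfolding dual_ocD(1)[OF u tr[OF that(1)] tr[OF that(2)]] distrib_left[symmetric]
      by (intro mult_left_mono norm_triangle_ineq) (simp add: wt_pos less_imp_le)
    then show "seminorm_on test_fun (\<lambda>f. wt (snd p) ^ Suc k * cmod (fst p (\<lambda>y. f (y - snd p))))"
      unfolding seminorm_on_def p using dual_ocD(2)[OF u tr] wt_power_pos[of a "Suc k"]
      by (auto simp: norm_mult plus_fun_def less_imp_le simp del: power_Suc)
    obtain m c where mc: "0 < c" "\<And>f. f \<in> oc_fun 1 \<Longrightarrow> cmod (u f) \<le> c * ocn m 1 f"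
      using dual_oc_bound[OF u order.refl] by metis
    have "wt a ^ Suc k * cmod (u (\<lambda>y. f (y - a))) \<le> (wt a ^ Suc k * (c * (4 ^ 1 * wt a ^ 1))) * ocn m 1 f" if f: "f \<in> test_fun" for f
    proof -
      have "cmod (u (\<lambda>y. f (y - a))) \<le> c * ocn m 1 (\<lambda>y. f (y - a))" by (intro mc translate_oc_fun t_oc f)
      also have "\<dots> \<le> c * (4 ^ 1 * wt a ^ 1 * ocn m 1 f)" using mc(1) by (intro mult_left_mono ocn_translate t_oc f) auto
      finally have "wt a ^ Suc k * cmod (u (\<lambda>y. f (y - a))) \<le> wt a ^ Suc k * (c * (4 ^ 1 * wt a ^ 1 * ocn m 1 f))"
        by (rule mult_left_mono) (simp add: wt_pos less_imp_le)
      then show ?thesis by (simp only: mult.assoc)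
    qed
    then show "\<exists>m c. \<forall>f\<in>test_fun. wt (snd p) ^ Suc k * cmod (fst p (\<lambda>y. f (y - snd p))) \<le> c * ocn m 1 f"
      unfolding p fst_conv snd_conv by blast
  next
    fix f assume f: "f \<in> test_fun"
    obtain C where "\<forall>u\<in>U. \<forall>a. wt a ^ Suc k * cmod (u (\<lambda>y. f (y - a))) \<le> C" using loc[OF f] by blast
    then show "\<exists>C. \<forall>p\<in>U \<times> UNIV. wt (snd p) ^ Suc k * cmod (fst p (\<lambda>y. f (y - snd p))) \<le> C"
      by (intro exI[of _ C]) auto
  qed
  then obtain m c where mc: "\<And>u a f. u \<in> U \<Longrightarrow> f \<in> test_fun \<Longrightarrow> wt a ^ Suc k * cmod (u (\<lambda>y. f (y - a))) \<le> c * ocn m 1 f"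
    unfolding test_fun_def[symmetric] by fastforce
  obtain E where E: "0 \<le> E" "\<forall>g\<in>oc_fun k. \<forall>a y. \<forall>i\<le>m. cmod (iter_deriv i (\<lambda>y. plateau 0 0 y * g (a + y)) y) \<le> E * ocn m k g * wt a ^ k"
    using localised_bound by blast
  have "cmod (u g) \<le> (10 * (\<bar>c\<bar> * E)) * ocn m k g" if u: "u \<in> U" and g: "g \<in> oc_fun k" for u g
  proof -
    have ud: "u \<in> dual oc_space" using u U by blast
    define K where "K = \<bar>c\<bar> * E * ocn m k g"
    have K0: "0 \<le> K" using E(1) by (simp add: K_def ocn_nonneg)
    define h where "h a = (\<lambda>y. plateau a a y * g y)" for a
    have h_eq: "h a = (\<lambda>y. (\<lambda>y. plateau 0 0 y * g (a + y)) (y - a))" for a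
      by (simp add: h_def fun_eq_iff plateau_def algebra_simps)
    have h_oc: "h a \<in> oc_all" for a unfolding h_eq by (rule tr[OF localised_test_fun[OF g]])
    have uh: "cmod (u (h a)) \<le> K / wt a" for a
    proof -
      let ?f = "\<lambda>y. plateau 0 0 y * g (a + y)"
      have "ocn m 1 ?f \<le> E * ocn m k g * wt a ^ k"
      proof (rule ocn_leI)
        fix y i assume i: "i \<le> m"
        have "0 \<le> E * ocn m k g * wt a ^ k" using E(1) by (simp add: ocn_nonneg wt_pos less_imp_le)
        from mult_left_mono[OF wt_power_ge_1[of y 1] this] E(2)[rule_format, OF g i, of a y]
        show "cmod (iter_deriv i ?f y) \<le> E * ocn m k g * wt a ^ k * wt y ^ 1" by simp
      qed (use E(1) in \<open>simp add: ocn_nonneg wt_pos less_imp_le\<close>)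
      then have "\<bar>c\<bar> * ocn m 1 ?f \<le> K * wt a ^ k"
        unfolding K_def by (simp only: mult.assoc) (intro mult_left_mono, auto)
      moreover have "c * ocn m 1 ?f \<le> \<bar>c\<bar> * ocn m 1 ?f" by (intro mult_right_mono ocn_nonneg) simp
      moreover have "wt a ^ Suc k * cmod (u (h a)) \<le> c * ocn m 1 ?f"
        unfolding h_eq by (rule mc[OF u localised_test_fun[OF g]])
      ultimately have "(wt a * cmod (u (h a))) * wt a ^ k \<le> K * wt a ^ k" by (simp add: mult_ac)
      then have "wt a * cmod (u (h a)) \<le> K" using wt_power_pos[of a k] by simp
      then show ?thesis using wt_pos[of a] by (simp add: field_simps)
    qed
    have cut_oc: "cutoff J g \<in> oc_all" for J using cutoff_oc_fun[OF g] oc_fun_subset[OF k] by blast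
    \<comment> \<open>Enlarging the cut-off adds one piece on each side, together at most
      \<open>2 * K / wt (real J + 1)\<close>. This is dominated by the telescoping increment
      \<open>4 / (J + 1) - 4 / (J + 2)\<close>, and 10 leaves room for the start at
      \<open>J = 0\<close>.\<close>
    have cut: "cmod (u (cutoff J g)) \<le> K * (10 - 4 / (real J + 1))" for J
    proof (induction J)
      case 0
      have "cutoff 0 g = h 0" by (simp add: cutoff_def h_def)
      then show ?case using uh[of 0] K0 by simp
    next
      case (Suc J)
      have "cutoff (Suc J) g = cutoff J g + (h (real J + 1) + h (- real J - 1))"
        by (simp add: cutoff_def h_def plateau_def fun_eq_iff algebra_simps)
      then have "u (cutoff (Suc J) g) = u (cutoff J g) + (u (h (real J + 1)) + u (h (- real J - 1)))"
        using dual_ocD(1)[OF ud cut_oc lin_subspaceD(2)[OF lin_subspace_oc_all h_oc h_oc]] dual_ocD(1)[OF ud h_oc h_oc] by simp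
      then have "cmod (u (cutoff (Suc J) g)) \<le> cmod (u (cutoff J g)) + (cmod (u (h (real J + 1))) + cmod (u (h (- real J - 1))))"
        by (metis norm_triangle_mono order.refl norm_triangle_ineq)
      also have "\<dots> \<le> K * (10 - 4 / (real J + 1)) + (K / wt (real J + 1) + K / wt (- real J - 1))"
        by (intro add_mono Suc uh)
      also have "wt (- real J - 1) = wt (real J + 1)" using wt_minus[of "real J + 1"]
          by (simp only: minus_add_distrib diff_conv_add_uminus)
      also have "K * (10 - 4 / (real J + 1)) + (K / wt (real J + 1) + K / wt (real J + 1))
          = K * (10 - 4 / (real J + 1) + 2 / wt (real J + 1))" by (simp add: algebra_simps)
      also have "\<dots> \<le> K * (10 - 4 / (real (Suc J) + 1))"
      proof (intro mult_left_mono K0)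
        have *: "2 / w \<le> 4 / p" if "0 < p" "0 < w" "2 * p \<le> 4 * w" for p w :: real
          using that by (simp add: field_simps)
        have "2 * ((real J + 1) * (real J + 2)) \<le> 4 * wt (real J + 1)"
          unfolding wt_def by (simp add: power2_eq_square algebra_simps)
        then have "2 / wt (real J + 1) \<le> 4 / ((real J + 1) * (real J + 2))"
          by (intro * wt_pos) simp_all
        also have "\<dots> = 4 / (real J + 1) - 4 / (real J + 2)" by (simp add: field_simps)
        finally have "2 / wt (real J + 1) \<le> 4 / (real J + 1) - 4 / (real J + 2)" .
        moreover have "real (Suc J) + 1 = real J + 2" by simp
        ultimately show "10 - 4 / (real J + 1) + 2 / wt (real J + 1) \<le> 10 - 4 / (real (Suc J) + 1)"
          by (simp only:)
      qed
      finally show ?case .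
    qed
    \<comment> \<open>These constants belong to the single \<open>u\<close>. They only make the tail
      vanish as \<open>J\<close> grows and do not enter the final bound.\<close>
    obtain m' c' where mc': "0 < c'" "\<And>f. f \<in> oc_fun (Suc k) \<Longrightarrow> cmod (u f) \<le> c' * ocn m' (Suc k) f"
      using dual_oc_bound[OF ud, of "Suc k"] by (metis le_SucI k)
    obtain D where D: "0 \<le> D" "\<forall>k f J. f \<in> oc_fun k \<longrightarrow> ocn m' (Suc k) (f - cutoff J f) \<le> D * ocn m' k f / wt (real J)"
      using cutoff_tail by blast
    have "cmod (u g) - 10 * K \<le> (c' * (D * ocn m' k g)) / wt (real J)" for J
    proof -
      have gc: "g - cutoff J g \<in> oc_fun (Suc k)"
        using lin_subspaceD(5)[OF lin_subspace_oc_fun g cutoff_oc_fun[OF g]] oc_fun_mono[of k "Suc k"] by auto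
      have "g \<in> oc_all" using g oc_fun_subset[OF k] by blast
      then have "u g = u (g - cutoff J g) + u (cutoff J g)" using dual_ocD(5)[OF ud _ cut_oc] by simp
      then have "cmod (u g) \<le> cmod (u (g - cutoff J g)) + cmod (u (cutoff J g))" by (metis norm_triangle_ineq)
      also have "cmod (u (g - cutoff J g)) \<le> c' * ocn m' (Suc k) (g - cutoff J g)" by (rule mc'(2)[OF gc])
      also have "\<dots> \<le> c' * (D * ocn m' k g / wt (real J))" using mc'(1) D(2) g by (intro mult_left_mono) auto
      also have "cmod (u (cutoff J g)) \<le> K * (10 - 4 / (real J + 1))" by (rule cut)
      also have "\<dots> \<le> K * 10" by (intro mult_left_mono K0) simp
      finally show ?thesis by simp
    qed
    then have "cmod (u g) - 10 * K \<le> 0"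
      by (intro LIMSEQ_le_const[OF tendsto_div_wt[of "c' * (D * ocn m' k g)"]]) auto
    then show ?thesis by (simp add: K_def mult.assoc)
  qed
  then show ?thesis by blast
qed

text \<open>Cut-offs are Schwartz functions, where convergence is given; equicontinuity on the next
  step makes the tails small for all \<open>n\<close> at once, so the values form a Cauchy
  sequence.\<close>

lemma convergent_from_schwartz:
  assumes u: "\<And>n. u n \<in> dual oc_space"
    and equi: "\<And>k. 1 \<le> k \<Longrightarrow> \<exists>m c. \<forall>v\<in>range u. \<forall>f\<in>oc_fun k. cmod (v f) \<le> c * ocn m k f"
    and conv: "\<And>f. f \<in> schwartz_fun \<Longrightarrow> convergent (\<lambda>n. u n f)" and f: "f \<in> oc_all"
  shows "convergent (\<lambda>n. u n f)"
proof (rule Cauchy_convergent, rule metric_CauchyI)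
  fix e :: real assume e: "0 < e"
  obtain k where k: "1 \<le> k" "f \<in> oc_fun k" using f by (rule oc_allE)
  have "1 \<le> Suc k" by simp
  from equi[OF this] obtain m c where mc: "\<And>n f. f \<in> oc_fun (Suc k) \<Longrightarrow> cmod (u n f) \<le> c * ocn m (Suc k) f" by blast
  obtain D where D: "0 \<le> D" "\<forall>k f J. f \<in> oc_fun k \<longrightarrow> ocn m (Suc k) (f - cutoff J f) \<le> D * ocn m k f / wt (real J)"
    using cutoff_tail by blast
  have "\<forall>\<^sub>F J in sequentially. (\<bar>c\<bar> * (D * ocn m k f)) / wt (real J) < e / 3"
    by (rule order_tendstoD(2)[OF tendsto_div_wt]) (use e in simp)
  then obtain J where J: "(\<bar>c\<bar> * (D * ocn m k f)) / wt (real J) < e / 3"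
    by (auto simp: eventually_sequentially)
  have tail: "cmod (u n (f - cutoff J f)) < e / 3" for n
  proof -
    have fc: "f - cutoff J f \<in> oc_fun (Suc k)"
      using lin_subspaceD(5)[OF lin_subspace_oc_fun k(2) cutoff_oc_fun[OF k(2)]] oc_fun_mono[of k "Suc k"] by auto
    have "cmod (u n (f - cutoff J f)) \<le> c * ocn m (Suc k) (f - cutoff J f)" by (rule mc[OF fc])
    also have "\<dots> \<le> \<bar>c\<bar> * (D * ocn m k f / wt (real J))"
      using D(2) k(2) by (intro mult_mono) (auto simp: ocn_nonneg)
    finally show ?thesis using J by (simp only: times_divide_eq_right)
  qed
  have "cutoff J f \<in> schwartz_fun"
    by (rule compact_support_schwartz[OF cutoff_oc_fun[OF k(2)], of "real J + 1"]) (simp add: cutoff_support)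
  then have "Cauchy (\<lambda>n. u n (cutoff J f))" using conv convergent_Cauchy by blast
  then obtain M where M: "\<forall>p\<ge>M. \<forall>n\<ge>M. dist (u p (cutoff J f)) (u n (cutoff J f)) < e / 3"
    using metric_CauchyD[of "\<lambda>n. u n (cutoff J f)" "e / 3"] e by auto
  have split: "u n f = u n (f - cutoff J f) + u n (cutoff J f)" for n
    using dual_ocD(5)[OF u f cutoff_oc_all[OF f]] by simp
  have "dist (u p f) (u n f) < e" if "p \<ge> M" "n \<ge> M" for p n
  proof -
    have "u p f - u n f = (u p (f - cutoff J f) - u n (f - cutoff J f)) + (u p (cutoff J f) - u n (cutoff J f))"
      using split[of p] split[of n] by simp
    then have "cmod (u p f - u n f) \<le> cmod (u p (f - cutoff J f) - u n (f - cutoff J f)) + cmod (u p (cutoff J f) - u n (cutoff J f))"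
      by (simp only: norm_triangle_ineq)
    moreover have "cmod (u p (f - cutoff J f) - u n (f - cutoff J f)) \<le> cmod (u p (f - cutoff J f)) + cmod (u n (f - cutoff J f))"
      by (rule norm_triangle_ineq4)
    moreover have "cmod (u p (cutoff J f) - u n (cutoff J f)) < e / 3" using M that by (simp add: dist_norm)
    ultimately show ?thesis using tail[of p] tail[of n] unfolding dist_norm by linarith
  qed
  then show "\<exists>M. \<forall>m\<ge>M. \<forall>n\<ge>M. dist (u m f) (u n f) < e" by blast
qed

section \<open>Weakly bounded sequences of Schwartz functions\<close>

text \<open>The Banach space case of the gliding hump: the same norm is taken for every
  index.\<close>

lemma l1_uniform_boundedness:
  fixes q :: "'i \<Rightarrow> (nat \<Rightarrow> complex) \<Rightarrow> real"
  defines "V \<equiv> {c. summable (\<lambda>i. cmod (c i))}"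
  assumes q: "\<And>i. i \<in> I \<Longrightarrow> seminorm_on V (q i)"
    and cont: "\<And>i. i \<in> I \<Longrightarrow> \<exists>c. \<forall>f\<in>V. q i f \<le> c * (\<Sum>j. cmod (f j))"
    and bounded: "\<And>f. f \<in> V \<Longrightarrow> \<exists>C. \<forall>i\<in>I. q i f \<le> C"
  shows "\<exists>c. \<forall>i\<in>I. \<forall>f\<in>V. q i f \<le> c * (\<Sum>j. cmod (f j))"
proof -
  have V: "lin_subspace V"
    unfolding lin_subspace_def
  proof (intro conjI ballI allI)
    show "0 \<in> V" by (simp add: V_def)
    fix f g assume "f \<in> V" "g \<in> V"
    then have "summable (\<lambda>i. cmod (f i) + cmod (g i))" unfolding V_def by (intro summable_add) simp_all
    then have "summable (\<lambda>i. cmod ((f + g) i))"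
      by (rule summable_comparison_test[rotated]) (simp add: norm_triangle_ineq)
    then show "f + g \<in> V" by (simp only: V_def mem_Collect_eq)
  next
    fix c f assume "f \<in> V"
    then show "(\<lambda>x. c * f x) \<in> V" by (simp add: V_def norm_mult summable_mult)
  qed
  have "\<exists>(m::nat) c. \<forall>i\<in>I. \<forall>f\<in>V. q i f \<le> c * (\<Sum>j. cmod (f j))"
  proof (rule uniform_boundedness[OF V _ _ q _ bounded, where p = "\<lambda>m f. \<Sum>j. cmod (f j)"])
    show "seminorm_on V (\<lambda>f. \<Sum>j. cmod (f j))"
      unfolding seminorm_on_def
    proof (intro conjI ballI allI)
      fix f g assume fg: "f \<in> V" "g \<in> V"
      show "0 \<le> (\<Sum>j. cmod (f j))" using fg by (intro suminf_nonneg) (auto simp: V_def)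
      have s: "summable (\<lambda>j. cmod (f j) + cmod (g j))" using fg by (intro summable_add) (auto simp: V_def)
      have "(\<Sum>j. cmod ((f + g) j)) \<le> (\<Sum>j. cmod (f j) + cmod (g j))"
        using lin_subspaceD(2)[OF V fg] by (intro suminf_le s) (auto simp: V_def norm_triangle_ineq)
      also have "\<dots> = (\<Sum>j. cmod (f j)) + (\<Sum>j. cmod (g j))"
        using fg by (intro suminf_add[symmetric]) (auto simp: V_def)
      finally show "(\<Sum>j. cmod ((f + g) j)) \<le> (\<Sum>j. cmod (f j)) + (\<Sum>j. cmod (g j))" .
    next
      fix c f assume "f \<in> V"
      then show "(\<Sum>j. cmod (c * f j)) = cmod c * (\<Sum>j. cmod (f j))"
        unfolding norm_mult by (intro suminf_mult) (simp add: V_def)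
    qed
    show "\<exists>(m::nat) c. \<forall>f\<in>V. q i f \<le> c * (\<Sum>j. cmod (f j))" if "i \<in> I" for i using cont[OF that] by simp
    fix g assume g: "\<And>i. g i \<in> V" and small: "\<And>i. (\<Sum>j. cmod (g i j)) \<le> (1/2) ^ i"
    have sg: "summable (\<lambda>j. cmod (g i j))" for i using g by (simp add: V_def)
    have partial: "(\<Sum>j<J. cmod (g i j)) \<le> (1/2) ^ i" for i J
      using sum_le_suminf[OF sg, of "{..<J}" i] small[of i] by simp
    have point: "cmod (g i j) \<le> (1/2) ^ i" for i j
      using partial[of i "Suc j"] sum_nonneg[of "{..<j}" "\<lambda>j. cmod (g i j)"] by simp
    have geo: "(\<lambda>i. (1/2::real) ^ (i + n)) sums (2 * (1/2) ^ n)" for n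
      using sums_mult2[OF geometric_sums[of "1/2::real"], of "(1/2) ^ n"] by (simp add: power_add)
    have sc: "summable (\<lambda>i. cmod (g (i + n) j))" for n j
      by (rule summable_comparison_test[OF exI[of _ 0] sums_summable[OF geo[of n]]]) (use point in simp)
    define s where "s j = (\<Sum>i. g i j)" for j
    have sg': "summable (\<lambda>i. g i j)" for j using summable_norm_cancel[of "\<lambda>i. g i j"] sc[of 0 j] by simp
    have tail: "(s - (\<Sum>i<n. g i)) j = (\<Sum>i. g (i + n) j)" for n j
      unfolding s_def using suminf_minus_initial_segment[OF sg'[of j], of n] by (simp add: sum_apply)
    \<comment> \<open>Finite sums over \<open>j\<close> commute with the series over
      \<open>i\<close>; a bound independent of \<open>J\<close> then yields both summability and the
      norm estimate.\<close>
    have tail_partial: "(\<Sum>j<J. cmod ((s - (\<Sum>i<n. g i)) j)) \<le> 2 * (1/2) ^ n" for n J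
    proof -
      have "(\<Sum>j<J. cmod ((s - (\<Sum>i<n. g i)) j)) \<le> (\<Sum>j<J. \<Sum>i. cmod (g (i + n) j))"
        unfolding tail by (intro sum_mono summable_norm sc)
      also have "\<dots> = (\<Sum>i. \<Sum>j<J. cmod (g (i + n) j))" by (rule suminf_sum[OF sc, symmetric])
      also have "\<dots> \<le> (\<Sum>i. (1/2) ^ (i + n))"
        by (intro suminf_le partial summable_sum sc sums_summable[OF geo])
      also have "\<dots> = 2 * (1/2) ^ n" by (rule sums_unique[OF geo, symmetric])
      finally show ?thesis .
    qed
    have tail_summable: "summable (\<lambda>j. cmod ((s - (\<Sum>i<n. g i)) j))" for n
      by (rule summableI_nonneg_bounded[of _ "2 * (1/2) ^ n"]) (use tail_partial in auto)
    have "s \<in> V" using tail_summable[of 0] by (simp add: V_def)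
    moreover have "(\<lambda>n. \<Sum>j. cmod ((s - (\<Sum>i<n. g i)) j)) \<longlonglongrightarrow> 0"
    proof (rule Lim_null_comparison)
      show "\<forall>\<^sub>F n in sequentially. norm (\<Sum>j. cmod ((s - (\<Sum>i<n. g i)) j)) \<le> 2 * (1/2) ^ n"
      proof (intro always_eventually allI)
        fix n
        have "0 \<le> (\<Sum>j. cmod ((s - (\<Sum>i<n. g i)) j))" by (intro suminf_nonneg tail_summable norm_ge_zero)
        moreover have "(\<Sum>j. cmod ((s - (\<Sum>i<n. g i)) j)) \<le> 2 * (1/2) ^ n"
          by (rule suminf_le_const[OF tail_summable tail_partial])
        ultimately show "norm (\<Sum>j. cmod ((s - (\<Sum>i<n. g i)) j)) \<le> 2 * (1/2) ^ n" by simp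
      qed
      show "(\<lambda>n. 2 * (1/2::real) ^ n) \<longlonglongrightarrow> 0"
        using tendsto_mult_left[OF LIMSEQ_power_zero[of "1/2::real"], of 2] by simp
    qed
    ultimately show "\<exists>s\<in>V. \<forall>m. (\<lambda>n. \<Sum>j. cmod ((s - (\<Sum>i<n. g i)) j)) \<longlonglongrightarrow> 0" by blast
  qed simp
  then show ?thesis by blast
qed

text \<open>The functionals \<open>\<Sum>\<^sub>j c\<^sub>j wt (a\<^sub>j)\<^sup>l \<delta>\<^sub>a\<^sub>j\<close> with summable \<open>c\<close> detect unboundedness along any sequence \<open>a\<close>.\<close>

lemma weakly_bounded_decay:
  fixes X :: "nat \<Rightarrow> real \<Rightarrow> complex"
  assumes X: "\<And>n. X n \<in> schwartz_fun"
    and weak: "\<And>S. S \<in> dual schwartz_space \<Longrightarrow> \<exists>C. \<forall>n. cmod (S (X n)) \<le> C"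
  shows "\<exists>C. \<forall>n a. wt a ^ l * cmod (X n a) \<le> C"
proof (rule ccontr)
  assume "\<not> ?thesis"
  then have "\<forall>i::nat. \<exists>n a. real i < wt a ^ l * cmod (X n a)" by (meson not_less)
  then obtain N a where Na: "\<And>i::nat. real i < wt (a i) ^ l * cmod (X (N i) (a i))" by metis
  let ?V = "{c. summable (\<lambda>i::nat. cmod (c i))}"
  define t where "t c f j = c j * (of_real (wt (a j) ^ l) * f (a j))" for c :: "nat \<Rightarrow> complex" and f :: "real \<Rightarrow> complex" and j
  have t_le: "cmod (t c f j) \<le> cmod (c j) * sn l f" if "f \<in> schwartz_fun" for c f j
  proof -
    have "wt (a j) ^ l * cmod (f (a j)) \<le> sn l f" using sn_upper[OF that, of 0 l "a j"] by simp
    then have "cmod (c j) * (wt (a j) ^ l * cmod (f (a j))) \<le> cmod (c j) * sn l f" by (rule mult_left_mono) simp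
    then show ?thesis by (simp add: t_def norm_mult norm_power wt_pos less_imp_le)
  qed
  have t_sum: "summable (\<lambda>j. cmod (t c f j))" if "c \<in> ?V" "f \<in> schwartz_fun" for c f
    by (rule summable_comparison_test[OF exI[of _ 0] summable_mult2[of "\<lambda>j. cmod (c j)" "sn l f"]])
      (use that t_le in auto)
  have t_sum': "summable (t c f)" if "c \<in> ?V" "f \<in> schwartz_fun" for c f
    by (rule summable_norm_cancel[OF t_sum[OF that]])
  have t_bound: "cmod (\<Sum>j. t c f j) \<le> (\<Sum>j. cmod (c j)) * sn l f" if c: "c \<in> ?V" and f: "f \<in> schwartz_fun" for c f
  proof -
    have s: "summable (\<lambda>j. cmod (c j) * sn l f)" using c by (intro summable_mult2) simp
    have "cmod (\<Sum>j. t c f j) \<le> (\<Sum>j. cmod (c j) * sn l f)" by (rule norm_suminf_le[OF _ s]) (rule t_le[OF f])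
    also have "\<dots> = (\<Sum>j. cmod (c j)) * sn l f" using c by (intro suminf_mult2[symmetric]) simp
    finally show ?thesis .
  qed
  have "\<exists>c. \<forall>n\<in>UNIV. \<forall>f\<in>?V. cmod (\<Sum>j. t f (X n) j) \<le> c * (\<Sum>j. cmod (f j))"
  proof (rule l1_uniform_boundedness)
    fix n :: nat
    show "seminorm_on ?V (\<lambda>c. cmod (\<Sum>j. t c (X n) j))"
      unfolding seminorm_on_def
    proof (intro conjI ballI allI)
      fix c d assume cd: "c \<in> ?V" "d \<in> ?V"
      have "t (c + d) (X n) = (\<lambda>j. t c (X n) j + t d (X n) j)" by (simp add: t_def fun_eq_iff algebra_simps)
      then have "(\<Sum>j. t (c + d) (X n) j) = (\<Sum>j. t c (X n) j) + (\<Sum>j. t d (X n) j)"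
        by (simp only: suminf_add[OF t_sum'[OF cd(1) X[of n]] t_sum'[OF cd(2) X[of n]]])
      then show "cmod (\<Sum>j. t (c + d) (X n) j) \<le> cmod (\<Sum>j. t c (X n) j) + cmod (\<Sum>j. t d (X n) j)"
        by (simp add: norm_triangle_ineq)
    next
      fix z c assume c: "c \<in> ?V"
      have "t (\<lambda>x. z * c x) (X n) = (\<lambda>j. z * t c (X n) j)" by (simp add: t_def fun_eq_iff mult.assoc)
      then have "(\<Sum>j. t (\<lambda>x. z * c x) (X n) j) = z * (\<Sum>j. t c (X n) j)"
        by (simp only: suminf_mult[OF t_sum'[OF c X[of n]]])
      then show "cmod (\<Sum>j. t (\<lambda>x. z * c x) (X n) j) = cmod z * cmod (\<Sum>j. t c (X n) j)"
        by (simp add: norm_mult)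
    qed simp
    show "\<exists>c. \<forall>f\<in>?V. cmod (\<Sum>j. t f (X n) j) \<le> c * (\<Sum>j. cmod (f j))"
      using t_bound[OF _ X[of n]] by (intro exI[of _ "sn l (X n)"]) (simp add: mult.commute)
  next
    fix c assume c: "c \<in> ?V"
    define S where "S f = (if f \<in> schwartz_fun then (\<Sum>j. t c f j) else 0)" for f
    have "S \<in> dual schwartz_space"
      unfolding sw.in_dual_iff topspace_schwartz_space
    proof (intro conjI ballI allI impI)
      fix f g assume fg: "f \<in> schwartz_fun" "g \<in> schwartz_fun"
      have "t c (f + g) = (\<lambda>j. t c f j + t c g j)" by (simp add: t_def fun_eq_iff algebra_simps)
      then have "(\<Sum>j. t c (f + g) j) = (\<Sum>j. t c f j) + (\<Sum>j. t c g j)"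
        by (simp only: suminf_add[OF t_sum'[OF c fg(1)] t_sum'[OF c fg(2)]])
      then show "S (f + g) = S f + S g"
        using fg lin_subspaceD(2)[OF lin_subspace_schwartz_fun fg] by (simp only: S_def if_True)
    next
      fix z f assume f: "f \<in> schwartz_fun"
      have "t c (\<lambda>x. z * f x) = (\<lambda>j. z * t c f j)" by (simp add: t_def fun_eq_iff mult_ac)
      then have "(\<Sum>j. t c (\<lambda>x. z * f x) j) = z * (\<Sum>j. t c f j)"
        by (simp only: suminf_mult[OF t_sum'[OF c f]])
      then show "S (\<lambda>x. z * f x) = z * S f"
        using f lin_subspaceD(3)[OF lin_subspace_schwartz_fun f] by (simp only: S_def if_True)
    next
      have c0: "0 \<le> (\<Sum>j. cmod (c j))" using c by (intro suminf_nonneg) auto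
      have "(\<lambda>f. ((\<Sum>j. cmod (c j)) + 1) * sn l f) \<in> schwartz_seminorms"
        unfolding schwartz_seminorms_def using c0
        by (intro CollectI exI[of _ "(\<Sum>j. cmod (c j)) + 1"] exI[of _ l]) auto
      moreover have "cmod (S f) \<le> ((\<Sum>j. cmod (c j)) + 1) * sn l f" if "f \<in> schwartz_fun" for f
        using t_bound[OF c that] that sn_nonneg[of l f] by (simp add: S_def distrib_right)
      ultimately show "\<exists>q\<in>schwartz_seminorms. \<forall>f\<in>schwartz_fun. cmod (S f) \<le> q f"
        by - (rule bexI[of _ "\<lambda>f. ((\<Sum>j. cmod (c j)) + 1) * sn l f"], rule ballI, assumption+)
    qed (simp add: S_def)
    from weak[OF this] show "\<exists>C. \<forall>n\<in>UNIV. cmod (\<Sum>j. t c (X n) j) \<le> C" using X by (simp add: S_def)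
  qed
  then obtain C where C: "\<And>n f. f \<in> ?V \<Longrightarrow> cmod (\<Sum>j. t f (X n) j) \<le> C * (\<Sum>j. cmod (f j))" by blast
  have "real i < C" for i
  proof -
    \<comment> \<open>A unit vector returns the single value at \<open>a i\<close>, so the uniform
      bound contradicts the choice of \<open>a\<close>.\<close>
    define d where "d = (\<lambda>j. if j = i then 1 else 0 :: complex)"
    have nd: "cmod (d j) = (if j = i then 1 else 0)" for j by (simp add: d_def)
    have d1: "(\<lambda>j. cmod (d j)) sums 1" unfolding nd using sums_single[of i "\<lambda>_. 1::real"] .
    have "(\<lambda>j. t d (X n) j) = (\<lambda>j. if j = i then of_real (wt (a i) ^ l) * X n (a i) else 0)" for n
      by (auto simp: t_def d_def fun_eq_iff)
    then have "(\<Sum>j. t d (X n) j) = of_real (wt (a i) ^ l) * X n (a i)" for n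
      using sums_unique[OF sums_single[of i "\<lambda>_. of_real (wt (a i) ^ l) * X n (a i)"]] by simp
    moreover have "cmod (\<Sum>j. t d (X (N i)) j) \<le> C * (\<Sum>j. cmod (d j))"
      by (rule C) (use sums_summable[OF d1] in simp)
    ultimately have "wt (a i) ^ l * cmod (X (N i) (a i)) \<le> C"
      using sums_unique[OF d1] by (simp add: norm_mult norm_power wt_pos less_imp_le)
    with Na[of i] show ?thesis by simp
  qed
  then show False using reals_Archimedean2[of C] by (meson less_asym)
qed

section \<open>Null sequences of convolutors\<close>

text \<open>The substitute for barrelledness: common bounds on every step make the supremum of the
  family a continuous seminorm that dominates each member.\<close>

lemma sup_seminorm:
  assumes Q: "\<And>i. i \<in> I \<Longrightarrow> seminorm_on oc_all (Q i)" and I: "I \<noteq> {}"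
    and equi: "\<And>k. 1 \<le> k \<Longrightarrow> \<exists>m c. \<forall>i\<in>I. \<forall>f\<in>oc_fun k. Q i f \<le> c * ocn m k f"
  shows "oc_seminorm (\<lambda>f. SUP i\<in>I. Q i f)"
    and "i \<in> I \<Longrightarrow> f \<in> oc_all \<Longrightarrow> Q i f \<le> (SUP i\<in>I. Q i f)"
proof -
  have bdd: "bdd_above ((\<lambda>i. Q i f) ` I)" if f: "f \<in> oc_all" for f
  proof -
    obtain k where k: "1 \<le> k" "f \<in> oc_fun k" using f by (rule oc_allE)
    obtain m c where "\<forall>i\<in>I. \<forall>f\<in>oc_fun k. Q i f \<le> c * ocn m k f" using equi[OF k(1)] by blast
    then show ?thesis using k(2) by (intro bdd_aboveI2[of _ _ "c * ocn m k f"]) auto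
  qed
  show up: "i \<in> I \<Longrightarrow> f \<in> oc_all \<Longrightarrow> Q i f \<le> (SUP i\<in>I. Q i f)" for i f
    by (rule cSUP_upper[OF _ bdd])
  obtain i0 where i0: "i0 \<in> I" using I by blast
  show "oc_seminorm (\<lambda>f. SUP i\<in>I. Q i f)"
    unfolding oc_seminorm_def
  proof (intro conjI allI impI)
    show "seminorm_on oc_all (\<lambda>f. SUP i\<in>I. Q i f)"
    proof (rule seminorm_onI[OF lin_subspace_oc_all])
      fix f assume f: "f \<in> oc_all"
      show "0 \<le> (SUP i\<in>I. Q i f)"
        using order_trans[OF seminorm_onD(1)[OF Q[OF i0] f] up[OF i0 f]] .
      show "(SUP i\<in>I. Q i (\<lambda>x. c * f x)) \<le> cmod c * (SUP i\<in>I. Q i f)" for c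
      proof (rule cSUP_least[OF I])
        fix i assume i: "i \<in> I"
        show "Q i (\<lambda>x. c * f x) \<le> cmod c * (SUP i\<in>I. Q i f)"
          unfolding seminorm_onD(3)[OF Q[OF i] f] by (intro mult_left_mono up i f) simp
      qed
    next
      fix f g assume fg: "f \<in> oc_all" "g \<in> oc_all"
      show "(SUP i\<in>I. Q i (f + g)) \<le> (SUP i\<in>I. Q i f) + (SUP i\<in>I. Q i g)"
      proof (rule cSUP_least[OF I])
        fix i assume i: "i \<in> I"
        show "Q i (f + g) \<le> (SUP i\<in>I. Q i f) + (SUP i\<in>I. Q i g)"
          by (rule order_trans[OF seminorm_onD(2)[OF Q[OF i] fg]]) (intro add_mono up i fg)
      qed
    qed
    fix k :: nat assume k: "1 \<le> k"
    obtain m c where "\<forall>i\<in>I. \<forall>f\<in>oc_fun k. Q i f \<le> c * ocn m k f" using equi[OF k] by blast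
    then have "(SUP i\<in>I. Q i f) \<le> c * ocn m k f" if "f \<in> oc_fun k" for f
      using that by (intro cSUP_least[OF I]) blast
    then show "\<exists>m c. \<forall>f\<in>oc_fun k. (SUP i\<in>I. Q i f) \<le> c * ocn m k f" by blast
  qed
qed

lemma seminorm_on_dual_oc:
  assumes "u \<in> dual oc_space"
  shows "seminorm_on oc_all (\<lambda>f. cmod (u f))"
  using assms unfolding dual_oc_iff seminorm_on_def by (auto simp: norm_mult norm_triangle_ineq)

text \<open>The easy direction of regularity, enough for the explicit sets of translates to which it
  is applied.\<close>

lemma step_bounded:
  assumes k: "1 \<le> k" and G: "G \<subseteq> oc_fun k" and bd: "\<And>m. \<exists>C. \<forall>g\<in>G. ocn m k g \<le> C"
  shows "G \<in> bounded_sets oc_space"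
  unfolding oc.bounded_sets_iff topspace_oc_space
proof (intro conjI ballI)
  show "G \<subseteq> oc_all" using G oc_fun_subset[OF k] by blast
  fix q assume "q \<in> Collect oc_seminorm"
  then have "oc_seminorm q" by simp
  then obtain m c where mc: "0 < c" "\<And>f. f \<in> oc_fun k \<Longrightarrow> q f \<le> c * ocn m k f" using oc_seminormE k by metis
  obtain C where C: "\<forall>g\<in>G. ocn m k g \<le> C" using bd by blast
  have "q g \<le> c * C" if "g \<in> G" for g
    by (rule order_trans[OF mc(2)]) (use that G C mc(1) in \<open>auto intro: mult_left_mono\<close>)
  then show "\<exists>C. \<forall>f\<in>G. q f \<le> C" by blast
qed

text \<open>Models the means minus their limit. Convergence is assumed only weakly; all uniformity
  is derived inside.\<close>

locale null_convolutors =
  fixes u :: "nat \<Rightarrow> (real \<Rightarrow> complex) \<Rightarrow> complex"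
  assumes dual: "u n \<in> dual oc_space"
    and null: "f \<in> oc_all \<Longrightarrow> (\<lambda>n. u n f) \<longlonglongrightarrow> 0"
begin

lemma equicontinuous:
  assumes k: "1 \<le> k"
  obtains m c where "0 \<le> c" "\<And>n f. f \<in> oc_fun k \<Longrightarrow> cmod (u n f) \<le> c * ocn m k f"
proof -
  have "\<exists>m c. \<forall>v\<in>range u. \<forall>f\<in>oc_fun k. cmod (v f) \<le> c * ocn m k f"
  proof (rule dual_oc_equicontinuous[OF _ _ k])
    show "range u \<subseteq> dual oc_space" using dual by auto
    fix f assume "f \<in> oc_all"
    then have "Bseq (\<lambda>n. u n f)" using null convergentI convergent_imp_Bseq by blast
    then obtain C where "\<forall>n. cmod (u n f) \<le> C" by (auto elim: BseqE)
    then show "\<exists>C. \<forall>v\<in>range u. cmod (v f) \<le> C" by auto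
  qed
  then obtain m c where mc: "\<And>n f. f \<in> oc_fun k \<Longrightarrow> cmod (u n f) \<le> c * ocn m k f" by blast
  have "cmod (u n f) \<le> \<bar>c\<bar> * ocn m k f" if "f \<in> oc_fun k" for n f
    using order_trans[OF mc[OF that] mult_right_mono[of c "\<bar>c\<bar>" "ocn m k f"]] ocn_nonneg[of m k f] by simp
  then show ?thesis by (rule that[OF abs_ge_zero])
qed

lemma null_bounded:
  assumes B: "B \<in> bounded_sets oc_space" and e: "0 < e"
  shows "\<forall>\<^sub>F n in sequentially. \<forall>f\<in>B. cmod (u n f) < e"
proof -
  have equi: "\<exists>m c. \<forall>n\<in>UNIV. \<forall>f\<in>oc_fun k. cmod (u n f) \<le> c * ocn m k f" if "1 \<le> k" for k
    using equicontinuous[OF that] by metis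
  note R = sup_seminorm[of UNIV "\<lambda>n f. cmod (u n f)", OF seminorm_on_dual_oc[OF dual] UNIV_not_empty equi]
  show ?thesis
  proof (rule uniform_null_on_bounded[OF seminorm_on_dual_oc[OF dual] R(1) _ _ B e])
    show "cmod (u n f) \<le> (SUP n\<in>UNIV. cmod (u n f))" if "f \<in> oc_all" for n f
      by (rule R(2)) (use that in auto)
    show "(\<lambda>n. cmod (u n f)) \<longlonglongrightarrow> 0" if "f \<in> oc_all" for f
      using null[OF that] by (rule tendsto_norm_zero)
  qed auto
qed

text \<open>Reflected translates of derivatives, divided by \<open>wt x ^ k\<close>, are bounded in
  step \<open>k\<close>. Uniform smallness of \<open>u n\<close> on them is smallness of the norm of
  the convolution.\<close>

lemma convolution_ocn_null:
  assumes k: "1 \<le> k" and f: "f \<in> oc_fun k" and e: "0 < e"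
  shows "\<forall>\<^sub>F n in sequentially. ocn j k (convolution (u n) f) \<le> e"
proof -
  have fo: "f \<in> oc_all" using f oc_fun_subset[OF k] by blast
  define G where "G = {\<lambda>y. of_real (1 / wt x ^ k) * iter_deriv i f (x - y) | x i. i \<le> j}"
  have "G \<in> bounded_sets oc_space"
  proof (rule step_bounded[OF k])
    have G: "(\<lambda>y. of_real (1 / wt x ^ k) * iter_deriv i f (x - y)) \<in> oc_fun k" for x i
      by (intro lin_subspaceD(3)[OF lin_subspace_oc_fun] reflect_oc_fun iter_deriv_oc_fun f)
    then show "G \<subseteq> oc_fun k" by (auto simp: G_def)
    fix m
    have "ocn m k (\<lambda>y. of_real (1 / wt x ^ k) * iter_deriv i f (x - y)) \<le> 2 ^ k * ocn (j + m) k f" if i: "i \<le> j" for x i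
    proof -
      have "ocn m k (\<lambda>y. of_real (1 / wt x ^ k) * iter_deriv i f (x - y)) = 1 / wt x ^ k * ocn m k (\<lambda>y. iter_deriv i f (x - y))"
        unfolding seminorm_onD(3)[OF seminorm_ocn reflect_oc_fun[OF iter_deriv_oc_fun[OF f]]]
        by (simp add: norm_divide norm_power wt_pos less_imp_le)
      also have "\<dots> \<le> 1 / wt x ^ k * (2 ^ k * wt x ^ k * ocn m k (iter_deriv i f))"
        by (intro mult_left_mono ocn_reflect iter_deriv_oc_fun f) (simp add: wt_pos less_imp_le)
      also have "\<dots> = 2 ^ k * ocn m k (iter_deriv i f)" using wt_pos[of x] by simp
      also have "\<dots> \<le> 2 ^ k * ocn (j + m) k f"
        by (intro mult_left_mono order_trans[OF ocn_iter_deriv[OF f] ocn_mono[OF f]]) (use i in auto)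
      finally show ?thesis .
    qed
    then show "\<exists>C. \<forall>g\<in>G. ocn m k g \<le> C" by (intro exI[of _ "2 ^ k * ocn (j + m) k f"]) (auto simp: G_def)
  qed
  from null_bounded[OF this e] show ?thesis
  proof eventually_elim
    case (elim n)
    show ?case
    proof (rule ocn_leI)
      fix x i assume i: "i \<le> j"
      have d: "(\<lambda>y. iter_deriv i f (x - y)) \<in> oc_all"
        by (intro reflect_oc_all iter_deriv_oc_all fo)
      have "cmod (u n (\<lambda>y. of_real (1 / wt x ^ k) * iter_deriv i f (x - y))) < e"
        using elim i by (auto simp: G_def)
      then have "1 / wt x ^ k * cmod (u n (\<lambda>y. iter_deriv i f (x - y))) < e"
        unfolding dual_ocD(2)[OF dual d] norm_mult using wt_pos[of x] by (simp add: norm_divide norm_power)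
      then have "cmod (u n (\<lambda>y. iter_deriv i f (x - y))) \<le> e * wt x ^ k"
        using wt_power_pos[of x k] by (simp add: field_simps)
      then show "cmod (iter_deriv i (convolution (u n) f) x) \<le> e * wt x ^ k"
        unfolding iter_deriv_convolution[OF dual fo] unfolding convolution_def .
    qed (use e in simp)
  qed
qed

text \<open>The constants of the equicontinuous sequence pass through the convolution estimate, so
  the supremum over \<open>n\<close> of the pulled back seminorms is continuous and dominates
  them.\<close>

lemma convolution_null_oc:
  assumes q: "oc_seminorm q" and B: "B \<in> bounded_sets oc_space" and e: "0 < e"
  shows "\<forall>\<^sub>F n in sequentially. \<forall>f\<in>B. q (convolution (u n) f) < e"
proof -
  have Q: "seminorm_on oc_all (\<lambda>f. q (convolution (u n) f))" for n
    using oc_seminorm_convolution[OF dual q, of n] by (simp add: oc_seminorm_def)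
  have equi: "\<exists>m c. \<forall>n\<in>UNIV. \<forall>f\<in>oc_fun k. q (convolution (u n) f) \<le> c * ocn m k f" if k: "1 \<le> k" for k
  proof -
    obtain m c where mc: "0 \<le> c" "\<And>n f. f \<in> oc_fun k \<Longrightarrow> cmod (u n f) \<le> c * ocn m k f"
      using equicontinuous[OF k] by metis
    obtain j d where jd: "0 < d" "\<And>f. f \<in> oc_fun k \<Longrightarrow> q f \<le> d * ocn j k f"
      using oc_seminormE[OF q k] by metis
    have "q (convolution (u n) f) \<le> d * (2 ^ k * c) * ocn (j + m) k f" if f: "f \<in> oc_fun k" for n f
    proof -
      have "q (convolution (u n) f) \<le> d * ocn j k (convolution (u n) f)"
        by (intro jd convolution_oc_fun[OF dual k mc(1) mc(2) f])
      also have "\<dots> \<le> d * (2 ^ k * c * ocn (j + m) k f)"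
        using jd(1) by (intro mult_left_mono ocn_convolution[OF dual k mc(1) mc(2) f]) auto
      finally show ?thesis by (simp add: mult.assoc)
    qed
    then show ?thesis by blast
  qed
  note R = sup_seminorm[of UNIV "\<lambda>n f. q (convolution (u n) f)", OF Q UNIV_not_empty equi]
  show ?thesis
  proof (rule uniform_null_on_bounded[OF Q R(1) _ _ B e])
    show "q (convolution (u n) f) \<le> (SUP n\<in>UNIV. q (convolution (u n) f))" if "f \<in> oc_all" for n f
      by (rule R(2)) (use that in auto)
    fix f assume f: "f \<in> oc_all"
    obtain k where k: "1 \<le> k" "f \<in> oc_fun k" using f by (rule oc_allE)
    obtain j d where jd: "0 < d" "\<And>f. f \<in> oc_fun k \<Longrightarrow> q f \<le> d * ocn j k f"
      using oc_seminormE[OF q k(1)] by metis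
    show "(\<lambda>n. q (convolution (u n) f)) \<longlonglongrightarrow> 0"
    proof (rule tendstoI)
      fix r :: real assume r: "0 < r"
      have "\<forall>\<^sub>F n in sequentially. ocn j k (convolution (u n) f) \<le> r / (2 * d)"
        by (rule convolution_ocn_null[OF k]) (use r jd(1) in simp)
      then show "\<forall>\<^sub>F n in sequentially. dist (q (convolution (u n) f)) 0 < r"
      proof eventually_elim
        case (elim n)
        obtain m c where mc: "0 \<le> c" "\<And>n f. f \<in> oc_fun k \<Longrightarrow> cmod (u n f) \<le> c * ocn m k f"
          using equicontinuous[OF k(1)] by metis
        have "q (convolution (u n) f) \<le> d * ocn j k (convolution (u n) f)"
          by (intro jd convolution_oc_fun[OF dual k(1) mc(1) mc(2) k(2)])
        also have "\<dots> \<le> d * (r / (2 * d))" using elim jd(1) by (intro mult_left_mono) auto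
        also have "\<dots> < r" using jd(1) r by simp
        finally show ?case using seminorm_onD(1)[OF Q f, of n] by simp
      qed
    qed
  qed auto
qed

text \<open>Decay of Schwartz functions allows the translates to be multiplied by
  \<open>wt x ^ k\<close> and to be taken over all \<open>f\<close> in \<open>B\<close> at once,
  still within a bounded set of one step; null convergence on that set is already uniform.\<close>

lemma convolution_null_schwartz:
  assumes B: "B \<in> bounded_sets schwartz_space" and e: "0 < e"
  shows "\<forall>\<^sub>F i in sequentially. \<forall>f\<in>B. sn n (convolution (u i) f) \<le> e"
proof -
  have Bs: "B \<subseteq> schwartz_fun" using B unfolding sw.bounded_sets_iff topspace_schwartz_space by blast
  define k where "k = Suc n"
  have k: "1 \<le> k" by (simp add: k_def)
  define G where "G = {\<lambda>y. of_real (wt x ^ k) * iter_deriv i f (x - y) | x i f. i \<le> k \<and> f \<in> B}"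
  have "G \<in> bounded_sets oc_space"
  proof (rule step_bounded[OF k])
    have G: "(\<lambda>y. of_real (wt x ^ k) * iter_deriv i f (x - y)) \<in> oc_fun k" if "f \<in> B" for x i f
      using that Bs schwartz_fun_subset by (intro lin_subspaceD(3)[OF lin_subspace_oc_fun] reflect_oc_fun iter_deriv_oc_fun) auto
    then show "G \<subseteq> oc_fun k" by (auto simp: G_def)
    fix m
    have "(\<lambda>f. 1 * sn (k + k + m) f) \<in> schwartz_seminorms"
      unfolding schwartz_seminorms_def by (intro CollectI exI[of _ 1] exI[of _ "k + k + m"]) simp
    then have "\<exists>C. \<forall>f\<in>B. 1 * sn (k + k + m) f \<le> C"
      by (rule bspec[OF conjunct2[OF B[unfolded sw.bounded_sets_iff]]])
    then obtain C where C: "\<And>f. f \<in> B \<Longrightarrow> sn (k + k + m) f \<le> C" by auto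
    have "ocn m k (\<lambda>y. of_real (wt x ^ k) * iter_deriv i f (x - y)) \<le> 2 ^ k * C" if i: "i \<le> k" and f: "f \<in> B" for x i f
    proof -
      have fs: "f \<in> schwartz_fun" using f Bs by blast
      have fk: "f \<in> oc_fun k" using fs schwartz_fun_subset by blast
      have "ocn m k (\<lambda>y. of_real (wt x ^ k) * iter_deriv i f (x - y)) = wt x ^ k * ocn m k (\<lambda>y. iter_deriv i f (x - y))"
        unfolding seminorm_onD(3)[OF seminorm_ocn reflect_oc_fun[OF iter_deriv_oc_fun[OF fk]]]
        using wt_pos[of x] by (simp add: norm_power)
      also have "\<dots> \<le> 2 ^ k * sn (k + i + m) f" by (rule ocn_reflect_schwartz[OF fs])
      also have "\<dots> \<le> 2 ^ k * C"
        by (intro mult_left_mono order_trans[OF sn_mono[OF fs] C[OF f]]) (use i in auto)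
      finally show ?thesis .
    qed
    then show "\<exists>C. \<forall>g\<in>G. ocn m k g \<le> C" by (intro exI[of _ "2 ^ k * C"]) (auto simp: G_def)
  qed
  from null_bounded[OF this e] show ?thesis
  proof eventually_elim
    case (elim j)
    show ?case
    proof
      fix f assume f: "f \<in> B"
      have fs: "f \<in> schwartz_fun" using f Bs by blast
      have fo: "f \<in> oc_all" using fs schwartz_fun_oc_all by blast
      have "sn n (convolution (u j) f) \<le> sn k (convolution (u j) f)"
        by (intro sn_mono convolution_schwartz_fun dual fs) (simp add: k_def)
      also have "\<dots> \<le> e"
      proof (rule sn_leI)
        fix x i assume i: "i \<le> k"
        have d: "(\<lambda>y. iter_deriv i f (x - y)) \<in> oc_all"
          by (intro reflect_oc_all iter_deriv_oc_all fo)
        have "(\<lambda>y. of_real (wt x ^ k) * iter_deriv i f (x - y)) \<in> G" using i f by (auto simp: G_def)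
        then have "cmod (u j (\<lambda>y. of_real (wt x ^ k) * iter_deriv i f (x - y))) < e" using elim by blast
        then have "wt x ^ k * cmod (u j (\<lambda>y. iter_deriv i f (x - y))) \<le> e"
          unfolding dual_ocD(2)[OF dual d] norm_mult using wt_pos[of x] by (simp add: norm_power)
        then show "wt x ^ k * cmod (iter_deriv i (convolution (u j) f) x) \<le> e"
          unfolding iter_deriv_convolution[OF dual fo] unfolding convolution_def .
      qed (use e in simp)
      finally show "sn n (convolution (u j) f) \<le> e" .
    qed
  qed
qed

text \<open>By contradiction. Violating convolutions can be picked so small that multiplying the
  \<open>i\<close>-th by \<open>i + 1\<close> still gives a bounded set of Schwartz functions; there
  the functionals of the bounded set stay bounded, yet take values of modulus at least
  \<open>(i + 1) * e\<close>.\<close>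

lemma convolution_null_schwartz_dual:
  assumes S: "\<S> \<in> bounded_sets (strong_dual schwartz_space)" and B: "B \<in> bounded_sets schwartz_space" and e: "0 < e"
  shows "\<forall>\<^sub>F n in sequentially. \<forall>S\<in>\<S>. \<forall>f\<in>B. cmod (S (convolution (u n) f)) < e"
proof (rule ccontr)
  assume "\<not> ?thesis"
  then have freq: "\<exists>\<^sub>F n in sequentially. \<exists>S\<in>\<S>. \<exists>f\<in>B. e \<le> cmod (S (convolution (u n) f))"
    by (simp add: not_eventually not_less)
  interpret sd: seminormed "strong_dual schwartz_space" "polar_seminorm ` bounded_sets schwartz_space"
    by (rule sw.seminormed_strong_dual)
  have Bs: "B \<subseteq> schwartz_fun" using B unfolding sw.bounded_sets_iff topspace_schwartz_space by blast
  have "\<exists>S f n. S \<in> \<S> \<and> f \<in> B \<and> e \<le> cmod (S (convolution (u n) f)) \<and> sn i (convolution (u n) f) \<le> 1 / (real i + 1)" for i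
  proof -
    have "\<forall>\<^sub>F n in sequentially. \<forall>f\<in>B. sn i (convolution (u n) f) \<le> 1 / (real i + 1)"
      by (rule convolution_null_schwartz[OF B]) simp
    then have "\<exists>\<^sub>F n in sequentially. (\<exists>S\<in>\<S>. \<exists>f\<in>B. e \<le> cmod (S (convolution (u n) f))) \<and> (\<forall>f\<in>B. sn i (convolution (u n) f) \<le> 1 / (real i + 1))"
      by (rule frequently_rev_mp[OF freq, OF eventually_mono]) blast
    then obtain n where "\<exists>S\<in>\<S>. \<exists>f\<in>B. e \<le> cmod (S (convolution (u n) f))" "\<forall>f\<in>B. sn i (convolution (u n) f) \<le> 1 / (real i + 1)"
      using frequently_ex by blast
    then show ?thesis by blast
  qed
  then obtain S f n where Sfn: "\<And>i. S i \<in> \<S>" "\<And>i. f i \<in> B" "\<And>i. e \<le> cmod (S i (convolution (u (n i)) (f i)))"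
    "\<And>i. sn i (convolution (u (n i)) (f i)) \<le> 1 / (real i + 1)" by metis
  define g where "g i = convolution (u (n i)) (f i)" for i
  define h where "h i = (\<lambda>x. of_real (real i + 1) * g i x)" for i
  have g: "g i \<in> schwartz_fun" for i
    unfolding g_def using Sfn(2)[of i] Bs by (intro convolution_schwartz_fun dual) auto
  have h: "h i \<in> schwartz_fun" for i unfolding h_def by (rule lin_subspaceD(3)[OF lin_subspace_schwartz_fun g])
  have snh: "sn k (h i) \<le> 1" if "k \<le> i" for k i
  proof -
    have "sn k (h i) = (real i + 1) * sn k (g i)"
      unfolding h_def using seminorm_onD(3)[OF seminorm_sn g, of k "of_real (real i + 1)" i] by (simp only: norm_of_real)
    also have "\<dots> \<le> (real i + 1) * (1 / (real i + 1))"
      using order_trans[OF sn_mono[OF g that] Sfn(4)[of i, folded g_def]] by (intro mult_left_mono) auto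
    finally show ?thesis by simp
  qed
  have "range h \<in> bounded_sets schwartz_space"
    unfolding sw.bounded_sets_iff topspace_schwartz_space
  proof (intro conjI ballI)
    show "range h \<subseteq> schwartz_fun" using h by auto
    fix q assume "q \<in> schwartz_seminorms"
    then obtain c k where ck: "0 < c" "q = (\<lambda>f. c * sn k f)" unfolding schwartz_seminorms_def by blast
    \<comment> \<open>\<open>sn k (h i) \<le> 1\<close> is known only from index \<open>k\<close>
      on; the finitely many earlier terms are added.\<close>
    have "sn k (h i) \<le> 1 + (\<Sum>j<k. sn k (h j))" for i
    proof (cases "k \<le> i")
      case True
      then show ?thesis using snh[OF True] by (intro add_increasing2 sum_nonneg sn_nonneg) auto
    next
      case False
      then have "sn k (h i) \<le> (\<Sum>j<k. sn k (h j))" by (intro member_le_sum sn_nonneg) auto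
      then show ?thesis by simp
    qed
    then have "\<forall>f\<in>range h. q f \<le> c * (1 + (\<Sum>j<k. sn k (h j)))"
      unfolding ck(2) using ck(1) by (auto intro!: mult_left_mono)
    then show "\<exists>C. \<forall>f\<in>range h. q f \<le> C" by blast
  qed
  then obtain C where C: "\<And>R. R \<in> \<S> \<Longrightarrow> polar_seminorm (range h) R \<le> C"
    using S unfolding sd.bounded_sets_iff by blast
  have big: "(real i + 1) * e \<le> C" for i
  proof -
    have Sd: "S i \<in> dual schwartz_space" using Sfn(1)[of i] S unfolding sd.bounded_sets_iff topspace_strong_dual by blast
    have "S i (h i) = of_real (real i + 1) * S i (g i)"
      unfolding h_def by (rule sw.in_dualD(2)[OF Sd]) (simp add: topspace_schwartz_space g)
    then have "cmod (S i (h i)) = (real i + 1) * cmod (S i (g i))" by (simp only: norm_mult norm_of_real)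
    moreover have "cmod (S i (h i)) \<le> polar_seminorm (range h) (S i)"
      by (rule sw.polar_seminorm_upper[OF Sd \<open>range h \<in> bounded_sets schwartz_space\<close>]) simp
    moreover have "(real i + 1) * e \<le> (real i + 1) * cmod (S i (g i))"
      using Sfn(3)[of i] by (intro mult_left_mono) (auto simp: g_def)
    ultimately show ?thesis using C[OF Sfn(1)[of i]] by linarith
  qed
  obtain i :: nat where "C / e < real i" using reals_Archimedean2 by blast
  then have "C < real i * e" using e by (simp add: pos_divide_less_eq)
  then show False using big[of i] e by (simp add: distrib_right)
qed

text \<open>Strongly bounded sets of functionals are pointwise bounded, hence equicontinuous on each
  step; their supremum is then one continuous seminorm to which the result on O_C applies.\<close>

lemma convolution_null_oc_dual:
  assumes S: "\<S> \<in> bounded_sets (strong_dual oc_space)" and B: "B \<in> bounded_sets oc_space" and e: "0 < e"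
  shows "\<forall>\<^sub>F n in sequentially. \<forall>S\<in>\<S>. \<forall>f\<in>B. cmod (S (convolution (u n) f)) < e"
proof -
  interpret sd: seminormed "strong_dual oc_space" "polar_seminorm ` bounded_sets oc_space"
    by (rule oc.seminormed_strong_dual)
  \<comment> \<open>Inserting 0 keeps the supremum over a nonempty set.\<close>
  define U where "U = insert 0 \<S>"
  have U: "U \<subseteq> dual oc_space"
    using S lin_subspaceD(1)[OF oc.lin_subspace_dual] unfolding U_def sd.bounded_sets_iff topspace_strong_dual by blast
  have pw: "\<exists>C. \<forall>v\<in>U. cmod (v f) \<le> C" if f: "f \<in> oc_all" for f
  proof -
    have fb: "{f} \<in> bounded_sets oc_space"
      using f by (intro oc.finite_subset_bounded) (simp add: finite_subsets_def topspace_oc_space)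
    then obtain C where C: "\<And>v. v \<in> \<S> \<Longrightarrow> polar_seminorm {f} v \<le> C"
      using S unfolding sd.bounded_sets_iff by blast
    have "cmod (v f) \<le> max 0 C" if v: "v \<in> U" for v
    proof (cases "v \<in> \<S>")
      case True
      then have "cmod (v f) \<le> polar_seminorm {f} v" using U by (intro oc.polar_seminorm_upper[OF _ fb]) (auto simp: U_def)
      then show ?thesis using C[OF True] by simp
    qed (use v in \<open>simp add: U_def\<close>)
    then show ?thesis by blast
  qed
  have equi: "\<exists>m c. \<forall>v\<in>U. \<forall>f\<in>oc_fun k. cmod (v f) \<le> c * ocn m k f" if "1 \<le> k" for k
    by (rule dual_oc_equicontinuous[OF U pw that])
  have Q: "seminorm_on oc_all (\<lambda>f. cmod (v f))" if "v \<in> U" for v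
    using that U by (intro seminorm_on_dual_oc) auto
  have ne: "U \<noteq> {}" by (simp add: U_def)
  have R1: "oc_seminorm (\<lambda>f. SUP v\<in>U. cmod (v f))" by (rule sup_seminorm(1)[OF Q ne equi])
  have R2: "cmod (v f) \<le> (SUP v\<in>U. cmod (v f))" if "v \<in> U" "f \<in> oc_all" for v f
    by (rule sup_seminorm(2)[OF Q ne equi that])
  have Bo: "B \<subseteq> oc_all" using B unfolding oc.bounded_sets_iff topspace_oc_space by blast
  show ?thesis
    using convolution_null_oc[OF R1 B e]
  proof eventually_elim
    case (elim n)
    have "cmod (v (convolution (u n) f)) < e" if v: "v \<in> \<S>" and f: "f \<in> B" for v f
    proof -
      have "convolution (u n) f \<in> oc_all" using f Bo by (intro convolution_oc_all dual) auto
      then have "cmod (v (convolution (u n) f)) \<le> (SUP v\<in>U. cmod (v (convolution (u n) f)))"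
        by (intro R2) (auto simp: U_def v)
      then show ?thesis using elim f by fastforce
    qed
    then show ?case by blast
  qed
qed

end

lemma null_convolutors_reflection:
  assumes "null_convolutors u"
  shows "null_convolutors (\<lambda>n. reflection (u n))"
proof -
  interpret null_convolutors u by fact
  show ?thesis
  proof
    show "reflection (u n) \<in> dual oc_space" for n by (rule reflection_dual[OF dual])
    show "(\<lambda>n. reflection (u n) f) \<longlonglongrightarrow> 0" if "f \<in> oc_all" for f
      unfolding reflection_def using null[OF reflect_oc_all[OF that, of 0]] by simp
  qed
qed

text \<open>The common bounds of a pointwise bounded sequence survive in the limit, so the limit is
  again a continuous functional.\<close>

lemma pointwise_limit:
  assumes u: "\<And>n. u n \<in> dual oc_space" and conv: "\<And>f. f \<in> oc_all \<Longrightarrow> convergent (\<lambda>n. u n f)"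
  obtains L where "L \<in> dual oc_space" "null_convolutors (\<lambda>n. u n - L)"
proof -
  define L where "L f = lim (\<lambda>n. u n f)" for f
  have lim: "(\<lambda>n. u n f) \<longlonglongrightarrow> L f" if "f \<in> oc_all" for f
    using conv[OF that] unfolding L_def convergent_LIMSEQ_iff .
  have "L \<in> dual oc_space"
    unfolding dual_oc_iff
  proof (intro conjI ballI allI impI)
    fix f g assume fg: "f \<in> oc_all" "g \<in> oc_all"
    have "(\<lambda>n. u n (f + g)) \<longlonglongrightarrow> L f + L g"
      unfolding dual_ocD(1)[OF u fg] by (intro tendsto_add lim fg)
    then show "L (f + g) = L f + L g"
      by (rule LIMSEQ_unique[OF lim[OF lin_subspaceD(2)[OF lin_subspace_oc_all fg]]])
  next
    fix c f assume f: "f \<in> oc_all"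
    have "(\<lambda>n. u n (\<lambda>x. c * f x)) \<longlonglongrightarrow> c * L f"
      unfolding dual_ocD(2)[OF u f] by (intro tendsto_mult_left lim f)
    then show "L (\<lambda>x. c * f x) = c * L f"
      by (rule LIMSEQ_unique[OF lim[OF lin_subspaceD(3)[OF lin_subspace_oc_all f]]])
  next
    fix f assume "f \<notin> oc_all"
    then have "(\<lambda>n. u n f) = (\<lambda>n. 0)" using dual_ocD(3)[OF u] by auto
    then show "L f = 0" by (simp add: L_def)
  next
    fix k :: nat assume k: "1 \<le> k"
    have "\<exists>m c. \<forall>v\<in>range u. \<forall>f\<in>oc_fun k. cmod (v f) \<le> c * ocn m k f"
    proof (rule dual_oc_equicontinuous[OF _ _ k])
      show "range u \<subseteq> dual oc_space" using u by auto
      fix f assume "f \<in> oc_all"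
      then have "Bseq (\<lambda>n. u n f)" using conv convergent_imp_Bseq by blast
      then obtain C where "\<forall>n. cmod (u n f) \<le> C" by (auto elim: BseqE)
      then show "\<exists>C. \<forall>v\<in>range u. cmod (v f) \<le> C" by auto
    qed
    then obtain m c where mc: "\<And>n f. f \<in> oc_fun k \<Longrightarrow> cmod (u n f) \<le> c * ocn m k f" by blast
    have "cmod (L f) \<le> c * ocn m k f" if f: "f \<in> oc_fun k" for f
    proof (rule LIMSEQ_le_const2)
      show "(\<lambda>n. cmod (u n f)) \<longlonglongrightarrow> cmod (L f)"
        using f oc_fun_subset[OF k] by (intro tendsto_norm lim) auto
      show "\<exists>N. \<forall>n\<ge>N. cmod (u n f) \<le> c * ocn m k f" using mc[OF f] by blast
    qed
    then show "\<exists>m c. \<forall>f\<in>oc_fun k. cmod (L f) \<le> c * ocn m k f" by blast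
  qed
  moreover have "null_convolutors (\<lambda>n. u n - L)"
  proof
    show "u n - L \<in> dual oc_space" for n
      by (rule lin_subspaceD(5)[OF oc.lin_subspace_dual u \<open>L \<in> dual oc_space\<close>])
    show "(\<lambda>n. (u n - L) f) \<longlonglongrightarrow> 0" if "f \<in> oc_all" for f
      using tendsto_diff[OF lim[OF that] tendsto_const[of "L f"]] by simp
  qed
  ultimately show ?thesis by (rule that)
qed

section \<open>The equivalences\<close>

lemma convolution_diff_left: "convolution (u - v) f = convolution u f - convolution v f"
  by (simp add: convolution_def fun_eq_iff)

lemma reflection_diff: "reflection (u - v) = reflection u - reflection v"
  by (simp add: reflection_def fun_eq_iff)

lemma strong_dual_tendsto:
  assumes E: "seminormed E Q" and lim: "limitin (strong_dual E) X L sequentially" and f: "f \<in> topspace E"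
  shows "(\<lambda>n. X n f) \<longlonglongrightarrow> L f"
proof -
  interpret seminormed E Q by fact
  interpret sd: seminormed "strong_dual E" "polar_seminorm ` bounded_sets E"
    by (rule seminormed_strong_dual)
  have fb: "{f} \<in> bounded_sets E"
    using f by (intro finite_subset_bounded) (simp add: finite_subsets_def)
  have L: "L \<in> dual E" and ev: "\<And>e. 0 < e \<Longrightarrow> \<forall>\<^sub>F n in sequentially. X n \<in> dual E \<and> polar_seminorm {f} (X n - L) < e"
    using lim fb unfolding sd.limitin_iff_seminorm topspace_strong_dual by blast+
  show ?thesis
  proof (rule tendstoI)
    fix e :: real assume "0 < e"
    from ev[OF this] show "\<forall>\<^sub>F n in sequentially. dist (X n f) (L f) < e"
    proof eventually_elim
      case (elim n)
      then have "X n - L \<in> dual E" using lin_subspaceD(5)[OF lin_subspace_dual _ L] by blast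
      then have "cmod ((X n - L) f) \<le> polar_seminorm {f} (X n - L)"
        by (rule polar_seminorm_upper[OF _ fb]) simp
      then show ?case using elim by (simp add: dist_norm)
    qed
  qed
qed

section \<open>From pointwise convergence of the means to all properties\<close>

context
  fixes T :: "(real \<Rightarrow> complex) \<Rightarrow> complex"
  assumes T: "T \<in> dual oc_space"
begin

abbreviation "pointwise_convergent \<equiv> \<forall>f\<in>oc_all. convergent (\<lambda>n. conv_mean T n f)"

lemma cesaro_oc: "cesaro_mean (conv_op oc_space T) n = conv_op oc_space (conv_mean T n)"
  by (rule cesaro_mean_conv_op[OF T]) (auto simp: topspace_oc_space lin_subspace_oc_all convolution_oc_all[OF T])

lemma cesaro_schwartz: "cesaro_mean (conv_op schwartz_space T) n = conv_op schwartz_space (conv_mean T n)"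
  by (rule cesaro_mean_conv_op[OF T])
    (use schwartz_fun_oc_all in \<open>auto simp: topspace_schwartz_space lin_subspace_schwartz_fun convolution_schwartz_fun[OF T]\<close>)

lemma cesaro_oc_dual: "cesaro_mean (dual_conv_op oc_space T) n = dual_conv_op oc_space (conv_mean T n)"
  by (rule cesaro_mean_dual_conv_op[OF T seminormed_oc_space])
    (auto simp: topspace_oc_space convolution_oc_all[OF reflection_dual[OF T]] dual_conv_op_dual[OF T])

lemma cesaro_schwartz_dual: "cesaro_mean (dual_conv_op schwartz_space T) n = dual_conv_op schwartz_space (conv_mean T n)"
  by (rule cesaro_mean_dual_conv_op[OF T seminormed_schwartz_space])
    (use schwartz_fun_oc_all in \<open>auto simp: topspace_schwartz_space convolution_schwartz_fun[OF reflection_dual[OF T]] dual_conv_op_dual[OF T]\<close>)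

lemma pointwise_convergent_imp:
  assumes pointwise_convergent
  shows "mean_ergodic oc_space (conv_op oc_space T) \<and> uniformly_mean_ergodic oc_space (conv_op oc_space T)"
    and "mean_ergodic schwartz_space (conv_op schwartz_space T) \<and> uniformly_mean_ergodic schwartz_space (conv_op schwartz_space T)"
    and "mean_ergodic (strong_dual oc_space) (dual_conv_op oc_space T) \<and>
      uniformly_mean_ergodic (strong_dual oc_space) (dual_conv_op oc_space T)"
    and "mean_ergodic (strong_dual schwartz_space) (dual_conv_op schwartz_space T) \<and>
      uniformly_mean_ergodic (strong_dual schwartz_space) (dual_conv_op schwartz_space T)"
    and "convergent_in (strong_dual oc_space) (conv_mean T)"
proof -
  note Tn = conv_mean_dual[OF T]
  obtain L where L: "L \<in> dual oc_space" and null: "null_convolutors (\<lambda>n. conv_mean T n - L)"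
    by (rule pointwise_limit[of "conv_mean T", OF Tn]) (use assms in auto)
  interpret u: null_convolutors "\<lambda>n. conv_mean T n - L" by (rule null)
  \<comment> \<open>The operators on the duals are transposes, which involve reflected
    convolutors.\<close>
  interpret ru: null_convolutors "\<lambda>n. reflection (conv_mean T n - L)" by (rule null_convolutors_reflection[OF null])
  interpret od: seminormed "strong_dual oc_space" "polar_seminorm ` bounded_sets oc_space"
    by (rule oc.seminormed_strong_dual)
  interpret sd: seminormed "strong_dual schwartz_space" "polar_seminorm ` bounded_sets schwartz_space"
    by (rule sw.seminormed_strong_dual)
  show "mean_ergodic oc_space (conv_op oc_space T) \<and> uniformly_mean_ergodic oc_space (conv_op oc_space T)"
  proof (rule oc.uniformly_mean_ergodicI[OF conv_op_oc_operators[OF T] conv_op_oc_operators[OF L]])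
    show "\<forall>\<^sub>F n in sequentially. cesaro_mean (conv_op oc_space T) n \<in> operators oc_space"
      unfolding cesaro_oc by (intro always_eventually allI conv_op_oc_operators Tn)
    fix B q and e :: real assume B: "B \<in> bounded_sets oc_space" and q: "q \<in> Collect oc_seminorm" and e: "0 < e"
    have Bo: "B \<subseteq> topspace oc_space" using B unfolding oc.bounded_sets_iff by blast
    have "oc_seminorm q" using q by simp
    from u.convolution_null_oc[OF this B e]
    show "\<forall>\<^sub>F n in sequentially. \<forall>f\<in>B. q (cesaro_mean (conv_op oc_space T) n f - conv_op oc_space L f) < e"
    proof eventually_elim
      case (elim n)
      then show ?case
        using Bo unfolding cesaro_oc convolution_diff_left by (auto simp: conv_op_def subset_iff)
    qed
  qed
  show "mean_ergodic schwartz_space (conv_op schwartz_space T) \<and> uniformly_mean_ergodic schwartz_space (conv_op schwartz_space T)"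
  proof (rule sw.uniformly_mean_ergodicI[OF conv_op_schwartz_operators[OF T] conv_op_schwartz_operators[OF L]])
    show "\<forall>\<^sub>F n in sequentially. cesaro_mean (conv_op schwartz_space T) n \<in> operators schwartz_space"
      unfolding cesaro_schwartz by (intro always_eventually allI conv_op_schwartz_operators Tn)
    fix B q and e :: real assume B: "B \<in> bounded_sets schwartz_space" and q: "q \<in> schwartz_seminorms" and e: "0 < e"
    have Bs: "B \<subseteq> topspace schwartz_space" using B unfolding sw.bounded_sets_iff by blast
    obtain c k where ck: "0 < c" "q = (\<lambda>f. c * sn k f)" using q unfolding schwartz_seminorms_def by blast
    \<comment> \<open>The factor 2 turns the non-strict estimate for \<open>sn k\<close> into a
      strict one.\<close>
    have "0 < e / (2 * c)" using e ck(1) by simp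
    from u.convolution_null_schwartz[OF B this, of k]
    show "\<forall>\<^sub>F n in sequentially. \<forall>f\<in>B. q (cesaro_mean (conv_op schwartz_space T) n f - conv_op schwartz_space L f) < e"
    proof eventually_elim
      case (elim n)
      show ?case
      proof
        fix f assume f: "f \<in> B"
        have "c * sn k (convolution (conv_mean T n - L) f) \<le> c * (e / (2 * c))"
          using elim f ck(1) by (intro mult_left_mono) auto
        also have "\<dots> < e" using ck(1) e by simp
        finally show "q (cesaro_mean (conv_op schwartz_space T) n f - conv_op schwartz_space L f) < e"
          using Bs f unfolding ck(2) cesaro_schwartz convolution_diff_left by (auto simp: conv_op_def subset_iff)
      qed
    qed
  qed
  \<comment> \<open>On the duals the difference of the operators is moved onto the test function,
    where the null sequence acts.\<close>
  have diff_apply: "(dual_conv_op E u S - dual_conv_op E v S) f = S (convolution (reflection (u - v)) f)"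
    if E: "seminormed E Q" and S: "S \<in> dual E" and f: "f \<in> topspace E"
      and uv: "convolution (reflection u) f \<in> topspace E" "convolution (reflection v) f \<in> topspace E" for E Q u v S f
    using seminormed.in_dualD(5)[OF E S uv] S f
    by (simp add: dual_conv_op_def reflection_diff convolution_diff_left)
  show "mean_ergodic (strong_dual oc_space) (dual_conv_op oc_space T) \<and>
      uniformly_mean_ergodic (strong_dual oc_space) (dual_conv_op oc_space T)"
  proof (rule od.uniformly_mean_ergodicI[OF dual_conv_op_operators(1)[OF T] dual_conv_op_operators(1)[OF L]])
    show "\<forall>\<^sub>F n in sequentially. cesaro_mean (dual_conv_op oc_space T) n \<in> operators (strong_dual oc_space)"
      unfolding cesaro_oc_dual by (intro always_eventually allI dual_conv_op_operators Tn)
    fix \<S> q and e :: real assume S: "\<S> \<in> bounded_sets (strong_dual oc_space)"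
      and q: "q \<in> polar_seminorm ` bounded_sets oc_space" and e: "0 < e"
    obtain B where B: "B \<in> bounded_sets oc_space" "q = polar_seminorm B" using q by blast
    have Bo: "B \<subseteq> oc_all" using B(1) unfolding oc.bounded_sets_iff topspace_oc_space by blast
    have Sd: "\<S> \<subseteq> dual oc_space" using S unfolding od.bounded_sets_iff topspace_strong_dual by blast
    have "0 < e / 2" using e by simp
    from ru.convolution_null_oc_dual[OF S B(1) this]
    show "\<forall>\<^sub>F n in sequentially. \<forall>S\<in>\<S>. q (cesaro_mean (dual_conv_op oc_space T) n S - dual_conv_op oc_space L S) < e"
    proof eventually_elim
      case (elim n)
      show ?case
      proof
        fix S assume S: "S \<in> \<S>"
        have d: "dual_conv_op oc_space (conv_mean T n) S - dual_conv_op oc_space L S \<in> dual oc_space"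
          using S Sd by (intro lin_subspaceD(5)[OF oc.lin_subspace_dual] dual_conv_op_dual Tn L) auto
        have "polar_seminorm B (dual_conv_op oc_space (conv_mean T n) S - dual_conv_op oc_space L S) \<le> e / 2"
        proof (subst oc.polar_seminorm_le_iff[OF d B(1)]; safe?)
          fix f assume f: "f \<in> B"
          have fo: "f \<in> oc_all" using f Bo by blast
          have "(dual_conv_op oc_space (conv_mean T n) S - dual_conv_op oc_space L S) f
              = S (convolution (reflection (conv_mean T n - L)) f)"
            by (rule diff_apply[OF seminormed_oc_space])
              (use S Sd fo convolution_oc_all[OF reflection_dual[OF Tn]] convolution_oc_all[OF reflection_dual[OF L]] in
                \<open>auto simp: topspace_oc_space\<close>)
          then show "cmod ((dual_conv_op oc_space (conv_mean T n) S - dual_conv_op oc_space L S) f) \<le> e / 2"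
            using elim S f by (simp add: less_imp_le)
        qed (use e in simp)
        then show "q (cesaro_mean (dual_conv_op oc_space T) n S - dual_conv_op oc_space L S) < e"
          unfolding B(2) cesaro_oc_dual using e by simp
      qed
    qed
  qed
  show "mean_ergodic (strong_dual schwartz_space) (dual_conv_op schwartz_space T) \<and>
      uniformly_mean_ergodic (strong_dual schwartz_space) (dual_conv_op schwartz_space T)"
  proof (rule sd.uniformly_mean_ergodicI[OF dual_conv_op_operators(2)[OF T] dual_conv_op_operators(2)[OF L]])
    show "\<forall>\<^sub>F n in sequentially. cesaro_mean (dual_conv_op schwartz_space T) n \<in> operators (strong_dual schwartz_space)"
      unfolding cesaro_schwartz_dual by (intro always_eventually allI dual_conv_op_operators Tn)
    fix \<S> q and e :: real assume S: "\<S> \<in> bounded_sets (strong_dual schwartz_space)"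
      and q: "q \<in> polar_seminorm ` bounded_sets schwartz_space" and e: "0 < e"
    obtain B where B: "B \<in> bounded_sets schwartz_space" "q = polar_seminorm B" using q by blast
    have Bs: "B \<subseteq> schwartz_fun" using B(1) unfolding sw.bounded_sets_iff topspace_schwartz_space by blast
    have Sd: "\<S> \<subseteq> dual schwartz_space" using S unfolding sd.bounded_sets_iff topspace_strong_dual by blast
    have "0 < e / 2" using e by simp
    from ru.convolution_null_schwartz_dual[OF S B(1) this]
    show "\<forall>\<^sub>F n in sequentially. \<forall>S\<in>\<S>. q (cesaro_mean (dual_conv_op schwartz_space T) n S - dual_conv_op schwartz_space L S) < e"
    proof eventually_elim
      case (elim n)
      show ?case
      proof
        fix S assume S: "S \<in> \<S>"
        have d: "dual_conv_op schwartz_space (conv_mean T n) S - dual_conv_op schwartz_space L S \<in> dual schwartz_space"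
          using S Sd by (intro lin_subspaceD(5)[OF sw.lin_subspace_dual] dual_conv_op_dual Tn L) auto
        have "polar_seminorm B (dual_conv_op schwartz_space (conv_mean T n) S - dual_conv_op schwartz_space L S) \<le> e / 2"
        proof (subst sw.polar_seminorm_le_iff[OF d B(1)]; safe?)
          fix f assume f: "f \<in> B"
          have fs: "f \<in> schwartz_fun" using f Bs by blast
          have "(dual_conv_op schwartz_space (conv_mean T n) S - dual_conv_op schwartz_space L S) f
              = S (convolution (reflection (conv_mean T n - L)) f)"
            by (rule diff_apply[OF seminormed_schwartz_space])
              (use S Sd fs convolution_schwartz_fun[OF reflection_dual[OF Tn]] convolution_schwartz_fun[OF reflection_dual[OF L]] in
                \<open>auto simp: topspace_schwartz_space\<close>)
          then show "cmod ((dual_conv_op schwartz_space (conv_mean T n) S - dual_conv_op schwartz_space L S) f) \<le> e / 2"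
            using elim S f by (simp add: less_imp_le)
        qed (use e in simp)
        then show "q (cesaro_mean (dual_conv_op schwartz_space T) n S - dual_conv_op schwartz_space L S) < e"
          unfolding B(2) cesaro_schwartz_dual using e by simp
      qed
    qed
  qed
  have "limitin (strong_dual oc_space) (conv_mean T) L sequentially"
    unfolding od.limitin_iff_seminorm topspace_strong_dual
  proof (intro conjI ballI allI impI L)
    fix q and e :: real assume q: "q \<in> polar_seminorm ` bounded_sets oc_space" and e: "0 < e"
    obtain B where B: "B \<in> bounded_sets oc_space" "q = polar_seminorm B" using q by blast
    have "0 < e / 2" using e by simp
    from u.null_bounded[OF B(1) this]
    show "\<forall>\<^sub>F n in sequentially. conv_mean T n \<in> dual oc_space \<and> q (conv_mean T n - L) < e"
    proof eventually_elim
      case (elim n)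
      have "polar_seminorm B (conv_mean T n - L) \<le> e / 2"
        using elim e by (subst oc.polar_seminorm_le_iff[OF u.dual B(1)]) (auto intro: less_imp_le)
      then show ?case using Tn e unfolding B(2) by simp
    qed
  qed
  then show "convergent_in (strong_dual oc_space) (conv_mean T)" unfolding convergent_in_def by blast
qed

section \<open>From each property back to pointwise convergence\<close>

lemma pointwise_convergent_if_strong:
  assumes "convergent_in (strong_dual oc_space) (conv_mean T)"
  shows pointwise_convergent
proof
  fix f assume "f \<in> oc_all"
  then have f: "f \<in> topspace oc_space" by (simp add: topspace_oc_space)
  obtain L where "limitin (strong_dual oc_space) (conv_mean T) L sequentially"
    using assms unfolding convergent_in_def by blast
  from strong_dual_tendsto[OF seminormed_oc_space this f] show "convergent (\<lambda>n. conv_mean T n f)"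
    by (rule convergentI)
qed

text \<open>Convolution with the reflection of \<open>f\<close>, evaluated at 0, returns the value
  of the functional at \<open>f\<close>, and evaluation at 0 is continuous.\<close>

lemma pointwise_convergent_if_oc:
  assumes "mean_ergodic oc_space (conv_op oc_space T) \<or> uniformly_mean_ergodic oc_space (conv_op oc_space T)"
  shows pointwise_convergent
proof
  fix f assume f: "f \<in> oc_all"
  let ?g = "\<lambda>y. f (0 - y)"
  have g: "?g \<in> oc_all" by (rule reflect_oc_all[OF f])
  then obtain l where l: "limitin oc_space (\<lambda>n. cesaro_mean (conv_op oc_space T) n ?g) l sequentially"
    using oc.mean_ergodic_pointwise[OF assms, of ?g] unfolding topspace_oc_space by blast
  have "oc_seminorm (\<lambda>f. cmod (f 0))"
    unfolding oc_seminorm_def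
  proof (intro conjI allI impI)
    show "seminorm_on oc_all (\<lambda>f. cmod (f 0))"
      unfolding seminorm_on_def by (auto simp: norm_mult norm_triangle_ineq)
    fix k :: nat
    have "cmod (f 0) \<le> 1 * ocn 0 k f" if "f \<in> oc_fun k" for f
      using ocn_upper[OF that, of 0 0 0] by simp
    then show "\<exists>m c. \<forall>f\<in>oc_fun k. cmod (f 0) \<le> c * ocn m k f" by blast
  qed
  from bspec[OF conjunct2[OF l[unfolded oc.limitin_iff_seminorm]] CollectI[of oc_seminorm, OF this]]
  have ev: "\<forall>\<^sub>F n in sequentially. cmod ((cesaro_mean (conv_op oc_space T) n ?g - l) 0) < e" if "0 < e" for e
    using that by (elim allE impE) (assumption, rule eventually_mono, assumption, erule conjunct2)
  have "cesaro_mean (conv_op oc_space T) n ?g 0 = conv_mean T n f" for n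
    unfolding cesaro_oc using g by (simp add: conv_op_def topspace_oc_space convolution_def)
  with ev have "(\<lambda>n. conv_mean T n f) \<longlonglongrightarrow> l 0"
    by (intro tendstoI) (simp add: dist_norm)
  then show "convergent (\<lambda>n. conv_mean T n f)" by (rule convergentI)
qed

text \<open>Evaluation at 0 is the unit of convolution, so its orbit under the Cesaro means consists
  of the means of \<open>T\<close>.\<close>

lemma pointwise_convergent_if_oc_dual:
  assumes "mean_ergodic (strong_dual oc_space) (dual_conv_op oc_space T) \<or>
    uniformly_mean_ergodic (strong_dual oc_space) (dual_conv_op oc_space T)"
  shows pointwise_convergent
proof
  fix f assume f: "f \<in> oc_all"
  interpret od: seminormed "strong_dual oc_space" "polar_seminorm ` bounded_sets oc_space"
    by (rule oc.seminormed_strong_dual)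
  define d where "d f = (if f \<in> oc_all then f 0 else 0)" for f :: "real \<Rightarrow> complex"
  have d: "d \<in> dual oc_space"
    unfolding dual_oc_iff
  proof (intro conjI ballI allI impI)
    fix k :: nat
    have "cmod (d f) \<le> 1 * ocn 0 k f" if "f \<in> oc_fun k" for f
      using ocn_upper[OF that, of 0 0 0] by (simp add: d_def ocn_nonneg)
    then show "\<exists>m c. \<forall>f\<in>oc_fun k. cmod (d f) \<le> c * ocn m k f" by blast
  qed (use lin_subspaceD[OF lin_subspace_oc_all] in \<open>auto simp: d_def\<close>)
  obtain l where "limitin (strong_dual oc_space) (\<lambda>n. cesaro_mean (dual_conv_op oc_space T) n d) l sequentially"
    using od.mean_ergodic_pointwise[OF assms, of d] d unfolding topspace_strong_dual by blast
  from strong_dual_tendsto[OF seminormed_oc_space this, of f] f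
  have "(\<lambda>n. dual_conv_op oc_space (conv_mean T n) d f) \<longlonglongrightarrow> l f"
    unfolding cesaro_oc_dual by (simp add: topspace_oc_space)
  moreover have "dual_conv_op oc_space (conv_mean T n) d f = conv_mean T n f" for n
    using d f convolution_oc_all[OF reflection_dual[OF conv_mean_dual[OF T]] f]
    by (simp add: dual_conv_op_def topspace_oc_space d_def convolution_reflection)
  ultimately show "convergent (\<lambda>n. conv_mean T n f)" by (simp add: convergentI)
qed

lemma pointwise_convergent_from_schwartz:
  assumes loc: "\<And>f l. f \<in> schwartz_fun \<Longrightarrow> \<exists>C. \<forall>n a. wt a ^ l * cmod (conv_mean T n (\<lambda>y. f (y - a))) \<le> C"
    and conv: "\<And>f. f \<in> schwartz_fun \<Longrightarrow> convergent (\<lambda>n. conv_mean T n f)"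
  shows pointwise_convergent
proof
  fix f assume f: "f \<in> oc_all"
  show "convergent (\<lambda>n. conv_mean T n f)"
  proof (rule convergent_from_schwartz[OF conv_mean_dual[OF T] _ conv f])
    fix k :: nat assume k: "1 \<le> k"
    show "\<exists>m c. \<forall>v\<in>range (conv_mean T). \<forall>f\<in>oc_fun k. cmod (v f) \<le> c * ocn m k f"
    proof (rule dual_oc_equicontinuous_local[OF _ _ k])
      show "range (conv_mean T) \<subseteq> dual oc_space" using conv_mean_dual[OF T] by auto
      fix f l assume "f \<in> test_fun"
      then have "f \<in> schwartz_fun"
        by (intro compact_support_schwartz[of f 1 1]) (auto simp: test_fun_def)
      from loc[OF this, of l] show "\<exists>C. \<forall>u\<in>range (conv_mean T). \<forall>a. wt a ^ l * cmod (u (\<lambda>y. f (y - a))) \<le> C" by auto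
    qed
  qed
qed

lemma reflect_schwartz_fun:
  assumes f: "f \<in> schwartz_fun"
  shows "(\<lambda>y. f (0 - y)) \<in> schwartz_fun"
proof (rule schwartz_funI)
  show "smooth (\<lambda>y. f (0 - y))" by (rule smooth_reflect[OF schwartz_fun_smooth[OF f]])
  fix n i
  have "wt x ^ n * cmod (iter_deriv i (\<lambda>y. f (0 - y)) x) \<le> sn (n + i) f" for x
    unfolding cmod_iter_deriv_reflect[OF schwartz_fun_smooth[OF f]]
    using schwartz_fun_decay[OF f, of i "n + i" n "0 - x"] by simp
  then show "\<exists>c. \<forall>x. wt x ^ n * cmod (iter_deriv i (\<lambda>y. f (0 - y)) x) \<le> c" by blast
qed

text \<open>The values on translates of \<open>f\<close> are the values of one convolution with the
  reflection of \<open>f\<close>; its convergence in \<open>sn k\<close> bounds them, weighted by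
  \<open>wt a ^ k\<close>, uniformly in \<open>n\<close>.\<close>

lemma pointwise_convergent_if_schwartz:
  assumes "mean_ergodic schwartz_space (conv_op schwartz_space T) \<or>
    uniformly_mean_ergodic schwartz_space (conv_op schwartz_space T)"
  shows pointwise_convergent
proof -
  have lim: "\<exists>l\<in>schwartz_fun. \<forall>k. (\<lambda>n. sn k (convolution (conv_mean T n) f - l)) \<longlonglongrightarrow> 0" if f: "f \<in> schwartz_fun" for f
  proof -
    obtain l where l: "limitin schwartz_space (\<lambda>n. cesaro_mean (conv_op schwartz_space T) n f) l sequentially"
      using sw.mean_ergodic_pointwise[OF assms, of f] f unfolding topspace_schwartz_space by blast
    have eq: "cesaro_mean (conv_op schwartz_space T) n f = convolution (conv_mean T n) f" for n
      unfolding cesaro_schwartz using f by (simp add: conv_op_def topspace_schwartz_space)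
    have "(\<lambda>n. sn k (convolution (conv_mean T n) f - l)) \<longlonglongrightarrow> 0" for k
    proof (rule tendstoI)
      fix e :: real assume e: "0 < e"
      have "(\<lambda>f. 1 * sn k f) \<in> schwartz_seminorms"
        unfolding schwartz_seminorms_def by (intro CollectI exI[of _ 1] exI[of _ k]) simp
      with l e have "\<forall>\<^sub>F n in sequentially. cesaro_mean (conv_op schwartz_space T) n f \<in> topspace schwartz_space \<and>
          1 * sn k (cesaro_mean (conv_op schwartz_space T) n f - l) < e"
        unfolding sw.limitin_iff_seminorm by (auto dest!: bspec)
      then show "\<forall>\<^sub>F n in sequentially. dist (sn k (convolution (conv_mean T n) f - l)) 0 < e"
        unfolding eq by (rule eventually_mono) (simp add: sn_nonneg)
    qed
    moreover have "l \<in> schwartz_fun" using l unfolding sw.limitin_iff_seminorm topspace_schwartz_space by blast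
    ultimately show ?thesis by blast
  qed
  show ?thesis
  proof (rule pointwise_convergent_from_schwartz)
    fix f k assume f: "f \<in> schwartz_fun"
    let ?g = "\<lambda>y. f (0 - y)"
    have g: "?g \<in> schwartz_fun" by (rule reflect_schwartz_fun[OF f])
    obtain l where l: "l \<in> schwartz_fun" "\<And>k. (\<lambda>n. sn k (convolution (conv_mean T n) ?g - l)) \<longlonglongrightarrow> 0"
      using lim[OF g] by blast
    have c: "convolution (conv_mean T n) ?g \<in> schwartz_fun" for n
      by (rule convolution_schwartz_fun[OF conv_mean_dual[OF T] g])
    have "Bseq (\<lambda>n. sn k (convolution (conv_mean T n) ?g - l))"
      using l(2) convergentI convergent_imp_Bseq by blast
    then obtain C where C: "\<forall>n. norm (sn k (convolution (conv_mean T n) ?g - l)) \<le> C" by (rule BseqE)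
    have "wt a ^ k * cmod (conv_mean T n (\<lambda>y. f (y - a))) \<le> C + sn k l" for n a
    proof -
      have "conv_mean T n (\<lambda>y. f (y - a)) = convolution (conv_mean T n) ?g a" by (simp add: convolution_def)
      then have "wt a ^ k * cmod (conv_mean T n (\<lambda>y. f (y - a))) \<le> sn k (convolution (conv_mean T n) ?g)"
        using sn_upper[OF c, of 0 k a n] by simp
      also have "\<dots> \<le> sn k (convolution (conv_mean T n) ?g - l) + sn k l"
        by (rule seminorm_on_triangle[OF seminorm_sn lin_subspace_schwartz_fun c l(1)])
      also have "\<dots> \<le> C + sn k l" using spec[OF C, of n] by simp
      finally show ?thesis .
    qed
    then show "\<exists>C. \<forall>n a. wt a ^ k * cmod (conv_mean T n (\<lambda>y. f (y - a))) \<le> C" by blast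
  next
    fix f assume f: "f \<in> schwartz_fun"
    let ?g = "\<lambda>y. f (0 - y)"
    have g: "?g \<in> schwartz_fun" by (rule reflect_schwartz_fun[OF f])
    obtain l where l: "l \<in> schwartz_fun" "\<And>k. (\<lambda>n. sn k (convolution (conv_mean T n) ?g - l)) \<longlonglongrightarrow> 0"
      using lim[OF g] by blast
    have "(\<lambda>n. conv_mean T n f - l 0) \<longlonglongrightarrow> 0"
    proof (rule Lim_null_comparison[OF _ l(2)[of 0]], intro always_eventually allI)
      fix n
      have "convolution (conv_mean T n) ?g - l \<in> schwartz_fun"
        by (intro lin_subspaceD(5)[OF lin_subspace_schwartz_fun] convolution_schwartz_fun conv_mean_dual T g l)
      from sn_upper[OF this, of 0 0 0]
      show "norm (conv_mean T n f - l 0) \<le> sn 0 (convolution (conv_mean T n) ?g - l)"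
        by (simp add: convolution_def)
    qed
    then have "(\<lambda>n. conv_mean T n f) \<longlonglongrightarrow> l 0" by (simp add: LIM_zero_iff)
    then show "convergent (\<lambda>n. conv_mean T n f)" by (rule convergentI)
  qed
qed

text \<open>Here the convolutions with \<open>f\<close> are known to converge only when tested by
  each fixed functional. That is weak boundedness, which \<open>weakly_bounded_decay\<close>
  upgrades to the uniform decay required.\<close>

lemma pointwise_convergent_if_schwartz_dual:
  assumes "mean_ergodic (strong_dual schwartz_space) (dual_conv_op schwartz_space T) \<or>
    uniformly_mean_ergodic (strong_dual schwartz_space) (dual_conv_op schwartz_space T)"
  shows pointwise_convergent
proof -
  interpret sd: seminormed "strong_dual schwartz_space" "polar_seminorm ` bounded_sets schwartz_space"
    by (rule sw.seminormed_strong_dual)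
  let ?X = "\<lambda>f n. convolution (reflection (conv_mean T n)) f"
  have X: "?X f n \<in> schwartz_fun" if "f \<in> schwartz_fun" for f n
    by (rule convolution_schwartz_fun[OF reflection_dual[OF conv_mean_dual[OF T]] that])
  have conv: "convergent (\<lambda>n. S (?X f n))" if S: "S \<in> dual schwartz_space" and f: "f \<in> schwartz_fun" for S f
  proof -
    obtain l where "limitin (strong_dual schwartz_space) (\<lambda>n. cesaro_mean (dual_conv_op schwartz_space T) n S) l sequentially"
      using sd.mean_ergodic_pointwise[OF assms, of S] S unfolding topspace_strong_dual by blast
    from strong_dual_tendsto[OF seminormed_schwartz_space this, of f] f
    have "(\<lambda>n. dual_conv_op schwartz_space (conv_mean T n) S f) \<longlonglongrightarrow> l f"
      unfolding cesaro_schwartz_dual by (simp add: topspace_schwartz_space)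
    moreover have "dual_conv_op schwartz_space (conv_mean T n) S f = S (?X f n)" for n
      using S f by (simp add: dual_conv_op_def topspace_schwartz_space)
    ultimately show ?thesis by (simp add: convergentI)
  qed
  show ?thesis
  proof (rule pointwise_convergent_from_schwartz)
    fix f k assume f: "f \<in> schwartz_fun"
    have "\<exists>C. \<forall>n a. wt a ^ k * cmod (?X f n a) \<le> C"
    proof (rule weakly_bounded_decay[OF X[OF f]])
      fix S assume "S \<in> dual schwartz_space"
      from conv[OF this f] have "Bseq (\<lambda>n. S (?X f n))" by (rule convergent_imp_Bseq)
      then show "\<exists>C. \<forall>n. cmod (S (?X f n)) \<le> C" by (rule BseqE) blast
    qed
    then obtain C where C: "\<And>n a. wt a ^ k * cmod (?X f n a) \<le> C" by blast
    have "wt a ^ k * cmod (conv_mean T n (\<lambda>y. f (y - a))) \<le> C" for n a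
    proof -
      \<comment> \<open>The reflected convolutor reverses the shift, which the even weight does not
        notice.\<close>
      have "conv_mean T n (\<lambda>y. f (y - a)) = ?X f n (- a)" by (simp add: convolution_reflection)
      then show ?thesis using C[of "- a" n] by simp
    qed
    then show "\<exists>C. \<forall>n a. wt a ^ k * cmod (conv_mean T n (\<lambda>y. f (y - a))) \<le> C" by blast
  next
    fix f assume f: "f \<in> schwartz_fun"
    define d where "d f = (if f \<in> schwartz_fun then f 0 else 0)" for f :: "real \<Rightarrow> complex"
    have "(\<lambda>f. 1 * sn 0 f) \<in> schwartz_seminorms"
      unfolding schwartz_seminorms_def by (intro CollectI exI[of _ 1] exI[of _ 0]) simp
    moreover have "cmod (d f) \<le> 1 * sn 0 f" if "f \<in> schwartz_fun" for f
      using sn_upper[OF that, of 0 0 0] that by (simp add: d_def)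
    ultimately have bd: "\<exists>q\<in>schwartz_seminorms. \<forall>f\<in>schwartz_fun. cmod (d f) \<le> q f"
      by - (rule bexI[of _ "\<lambda>f. 1 * sn 0 f"], rule ballI, assumption+)
    have "d \<in> dual schwartz_space"
      unfolding sw.in_dual_iff topspace_schwartz_space
      by (intro conjI bd) (use lin_subspaceD[OF lin_subspace_schwartz_fun] in \<open>auto simp: d_def\<close>)
    from conv[OF this f] show "convergent (\<lambda>n. conv_mean T n f)"
      using X[OF f] by (simp add: d_def convolution_reflection)
  qed
qed

end

theorem proposition4p7:
  fixes T :: "(real \<Rightarrow> complex) \<Rightarrow> complex"
  assumes "T \<in> dual oc_space"
  shows "(mean_ergodic schwartz_space (conv_op schwartz_space T) \<longleftrightarrow>
        convergent_in (strong_dual oc_space) (conv_mean T)) \<and>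
     (uniformly_mean_ergodic schwartz_space (conv_op schwartz_space T) \<longleftrightarrow>
        convergent_in (strong_dual oc_space) (conv_mean T)) \<and>
     (mean_ergodic (strong_dual schwartz_space) (dual_conv_op schwartz_space T) \<longleftrightarrow>
        convergent_in (strong_dual oc_space) (conv_mean T)) \<and>
     (uniformly_mean_ergodic (strong_dual schwartz_space) (dual_conv_op schwartz_space T) \<longleftrightarrow>
        convergent_in (strong_dual oc_space) (conv_mean T)) \<and>
     (mean_ergodic oc_space (conv_op oc_space T) \<longleftrightarrow>
        convergent_in (strong_dual oc_space) (conv_mean T)) \<and>
     (uniformly_mean_ergodic oc_space (conv_op oc_space T) \<longleftrightarrow>
        convergent_in (strong_dual oc_space) (conv_mean T)) \<and>
     (mean_ergodic (strong_dual oc_space) (dual_conv_op oc_space T) \<longleftrightarrow>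
        convergent_in (strong_dual oc_space) (conv_mean T)) \<and>
     (uniformly_mean_ergodic (strong_dual oc_space) (dual_conv_op oc_space T) \<longleftrightarrow>
        convergent_in (strong_dual oc_space) (conv_mean T))"
  using pointwise_convergent_imp[OF assms] pointwise_convergent_if_strong[OF assms]
    pointwise_convergent_if_oc[OF assms] pointwise_convergent_if_oc_dual[OF assms]
    pointwise_convergent_if_schwartz[OF assms] pointwise_convergent_if_schwartz_dual[OF assms]
  by (intro conjI iffI) argo+

end
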